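(* Let $\mathcal H=\mathcal H_1\otimes\dots\otimes\mathcal H_N$ be the Hilbert space of a quantum system with $N$ sites and finite-dimensional site Hilbert spaces $\mathcal H_i$. For a set $\mathcal M\subseteq\mathcal H$ of normalized states consider the problems: (I) for a given state $|\psi_0\rangle\in\mathcal H$, minimize the distance $\||\Psi\rangle-|\psi_0\rangle\|^2$ or, equivalently, maximize the overlap $|\langle\psi_0|\Psi\rangle|$ over $|\Psi\rangle\in\mathcal M$; (II) for a given self-adjoint operator (Hamiltonian) $\hat H:\mathcal H\to\mathcal H$, minimize $\langle\Psi|\hat H|\Psi\rangle$ over $|\Psi\rangle\in\mathcal M$. (a) Existence: Problems (I) and (II) possess an optimizer in $\mathcal M$ for any $|\psi_0\rangle\in\mathcal H$ and any self-adjoint $\hat H:\mathcal H\to\mathcal H$ when $\mathcal M$ is any of the following sets: $\mathrm{oMPS}(N,\{m_i\},d)$ with bond dimensions $m_i\ge1$, $m_0=m_N=1$; $\mathrm{TTNS}(\mathcal G)$ for any tree network $\mathcal G$; $\mathrm{MERA}(\mathcal G)$ for any MERA network $\mathcal G$. (b) Nonexistence: For each of the following sets $\mathcal M$, there exist states $|\psi_0\rangle\in\mathcal H$ and Hamiltonians $\hat H$ such that problems (I) and (II) do not possess an optimizer in $\mathcal M$: 1. $\mathrm{tiMPS}(N,m,d)$ with $m,d\ge2$ and $N$ prime, $N>N_c(m)$, for some $N_c(m)$ with $2\log_d m<N_c(m)\le12m^3(7+\log_2m)$; 2. $\mathrm{pMPS_n}(N,m,d)$ with $m>1$, $N\ge3$,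 $d\ge m^2$; 3. $\mathrm{pMPS_n}(N,m,\tilde d)$ with integers $\ell\ge 1$, $\tilde d\ge d>1$, $m=d^{\ell/2}$ an integer, and $N\ge3\ell$ a multiple of $\ell$; more generally, $\mathrm{pMPS_n}(N,m,\{\tilde d_{c,i}\})$ with $m>1$ where the ring of $N$ sites is divided into at least three clusters $c$ of $\ell_c\ge 1$ consecutive sites, $N=\sum_c\ell_c$, with site dimensions $\tilde d_{c,i}\ge d_{c,i}$ ($i=1,\dots,\ell_c$) in cluster $c$, where $d_{c,i}$ are positive integers with $m^2=d_{c,1}\cdots d_{c,\ell_c}$ for every $c$; 4. $\mathrm{PEPS}(\mathcal G)$ for a network $\mathcal G$ with all bond dimensions equal to $m\ge2$, containing at least one loop, and with site dimensions $d_i\ge m^{z_i}$, $z_i$ being the degree of vertex $i$; 5. $\mathrm{PEPS}(\mathcal G)$ for a cubic lattice $\mathcal G$ in $D$ dimensions with site dimensions $d_i\ge d\ge2$ such that, in the $x$ direction, $\mathcal G$ has periodic boundary conditions, bond dimension $m_x=d^{\ell_x}$ and length $L_x=2N_c\ell_x$ with $\ell_x\ge1$, $N_c\ge3$, and such that, in the other $D-1$ directions, lengths $L_y,L_z,\dots\ge1$, boundary conditions (open or periodic), and bond dimensions $m_y,m_z,\dots\ge2$ are arbitrary; 6. $\mathrm{PEPS}(\mathcal G')$ for a fine-grained version $\mathcal G'$ of a network $\mathcal G$ as in item 4 such that, for some family of two-domain loop states $|\psi_T(\varepsilon)\rangle\in\mathrm{PEPS}(\mathcal G)$, $\varepsilon>0$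 (defined in the context), there is for every $\varepsilon>0$ a fine-grained version $|\psi_T'\rangle\in\mathrm{PEPS}(\mathcal G')$ of $|\psi_T(\varepsilon)\rangle$, with a blocking scheme independent of $\varepsilon$.
   Context: All topological notions refer to the norm topology of $\mathcal H$; site Hilbert spaces $\mathbb C^{d_i}$ have orthonormal bases $\{|\sigma_i\rangle\}_{\sigma_i=1}^{d_i}$; an order-3 tensor $A\in\mathbb C^{d\times m\times m'}$ is a collection of $m\times m'$ matrices $A^1,\dots,A^d$. An optimizer is an element of $\mathcal M$ at which the infimum (supremum) over $\mathcal M$ is attained. **MPS.** $\mathrm{oMPS}(N,\{m_i\},d)$: states $\sum_{\boldsymbol\sigma}A_1^{\sigma_1}\cdots A_N^{\sigma_N}|\boldsymbol\sigma\rangle$ of norm $1$ with $A_i\in\mathbb C^{d\times m_{i-1}\times m_i}$. $\mathrm{tiMPS}(N,m,d)$: states $\sum_{\boldsymbol\sigma}\operatorname{Tr}(A^{\sigma_1}\cdots A^{\sigma_N})|\boldsymbol\sigma\rangle$ of norm $1$ with a single $A\in\mathbb C^{d\times m\times m}$. $\mathrm{pMPS_n}(N,m,\{\delta_j\})$: states $\sum_{\boldsymbol\sigma}\operatorname{Tr}(A_1^{\sigma_1}\cdots A_N^{\sigma_N})|\boldsymbol\sigma\rangle$ of norm $1$ with $A_j\in\mathbb C^{\delta_j\times m\times m}$, where $\delta_j$ are the site dimensions; written $\mathrm{pMPS_n}(N,m,d)$ if all $\delta_j=d$. **PEPS and TTNS.** A network $\mathcal G=(\mathcal E,\{m_e\},\{d_i\})$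 is a finite connected simple graph with vertices $1,\dots,N$, edge set $\mathcal E$, bond dimensions $m_e\ge1$ and site dimensions $d_i\ge1$. With $\partial i$ the set of edges incident to $i$, $\mathrm{PEPS}(\mathcal G)$ is the set of states $|\Psi\rangle=\sum_{\boldsymbol\sigma}\sum_{\{n_e\}}\prod_i[A_i^{\sigma_i}]_{(n_e)_{e\in\partial i}}|\boldsymbol\sigma\rangle$ of norm $1$, with $n_e\in\{1,\dots,m_e\}$ and tensors $A_i\in\mathbb C^{d_i\times\prod_{e\in\partial i}m_e}$. If the graph is a tree, this set is denoted $\mathrm{TTNS}(\mathcal G)$. For the cubic lattice, vertices are the points of $\{1,\dots,L_x\}\times\{1,\dots,L_y\}\times\cdots$, edges join sites differing by one unit in exactly one coordinate, and periodic boundary conditions in a direction of length $L\ge3$ add the edges joining coordinates $L$ and $1$ (for $L\le2$ they add nothing). **MERA.** A MERA network is a finite connected directed acyclic graph with bond dimensions $m_e\ge1$ and site dimensions $d_i\ge1$. Put $m_i'=\prod_{e\in\mathrm{in}(i)}m_e$ and $m_i=\prod_{e\in\mathrm{out}(i)}m_e$ for the incoming and outgoing edges of vertex $i$ (empty products are $1$); it is assumed that $m_i\le d_im_i'$. $\mathrm{MERA}(\mathcal G)$ is the set of norm-$1$ states obtained by contracting (summing over all bond indices) tensors $A_i\in\mathbb C^{d_i\times m_i\times m_i'}$ satisfying $\sum_{\sigma=1}^{d_i}A_i^\sigma A_i^{\sigma\dagger}=\mathbb 1_{m_i}$, where rows of $A_i^\sigma$ are labelled by the bond indices of outgoing edges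 and columns by those of incoming edges. **The states $|\psi_T\rangle$.** Let $\mathcal G$ be as in item 4. For $e\in\partial i$ let $\mathcal V_{i,e}\simeq\mathbb C^m$ with orthonormal basis $\{|n\rangle\}_{n=1}^m$, and regard $\bigotimes_{e\in\partial i}\mathcal V_{i,e}$ as a subspace of $\mathcal H_i$. Let $|\mu\rangle=\bigotimes_{e\in\mathcal E}(\sum_{n=1}^m|n,n\rangle_e)$ with $\sum_n|n,n\rangle_e\in\mathcal V_{i,e}\otimes\mathcal V_{j,e}$ for $e$ joining $i$ and $j$. On $\mathbb C^m\otimes\mathbb C^m$ let $\hat P_d=\sum_n|n,n\rangle\langle n,n|$, $\hat P_o=\mathbb 1-\hat P_d$, $\hat A=\hat P_d+\varepsilon\hat P_o$, $\hat B=\frac1\varepsilon(\hat P_o+\varepsilon\hat P_d)$. Choose a loop $(i_1,\dots,i_L)$ of distinct vertices. If it enters $i_k$ through edge $e$ and leaves through $e'$, apply $\hat A$ (for $k<L$), resp. $\hat B$ (for $k=L$), to the factor $\mathcal V_{i_k,e}\otimes\mathcal V_{i_k,e'}$ of $|\mu\rangle$, and the identity everywhere else; $|\psi_T(\varepsilon)\rangle$ is the resulting state normalized to norm $1$. **Fine-graining.** $\mathcal G'=(\mathcal E',\{m'_e\},\{d'_j\})$ is a fine-grained version of $\mathcal G=(\mathcal E,\{m_e\},\{d_i\})$ if there is a blocking scheme: the graph of $\mathcal G'$ is partitioned into clusters, each cluster $C_i$ corresponding to exactly one vertex $i$ of $\mathcal G$ with $d_i=\prod_{j\in C_i}d'_j$;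 the edge $e$ of $\mathcal G$ joining $i$ and $j$ corresponds to all edges of $\mathcal G'$ joining $C_i$ and $C_j$, the product of whose bond dimensions equals $m_e$ (clusters of non-adjacent vertices are not joined). $|\Psi'\rangle\in\mathrm{PEPS}(\mathcal G')$ is a fine-grained version of $|\Psi\rangle\in\mathrm{PEPS}(\mathcal G)$ if, for such a blocking scheme, the PEPS tensor $A_i$ of $|\Psi\rangle$ is obtained by contracting the PEPS tensors of $|\Psi'\rangle$ in $C_i$ and grouping indices of outgoing edges into one multi-index for each connected cluster, where $\mathcal H_i$ is identified with $\bigotimes_{j\in C_i}\mathcal H_j'$ by an identification of orthonormal product bases. *)

theory Defs
  imports "HOL-Analysis.L2_Norm" "Jordan_Normal_Form.Matrix" "HOL-Computational_Algebra.Primes"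
begin

section \<open>Hilbert spaces with finitely many sites, and the two optimization problems\<close>

text \<open>A vector of the tensor product of the spaces \<open>\<complex>^(d i)\<close>, \<open>i \<in> V\<close>, is given by its coefficients
  in the product basis. The basis is labelled by the functions \<open>\<sigma>\<close> with \<open>\<sigma> i \<in> {1..d i}\<close> for
  \<open>i \<in> V\<close>; coefficients at any other argument are \<open>0\<close>.\<close>

type_synonym 'v state = "('v \<Rightarrow> nat) \<Rightarrow> complex"

definition configs :: "'v set \<Rightarrow> ('v \<Rightarrow> nat) \<Rightarrow> ('v \<Rightarrow> nat) set" where
  "configs V d = PiE V (\<lambda>i. {1..d i})"

definition hilb :: "'v set \<Rightarrow> ('v \<Rightarrow> nat) \<Rightarrow> 'v state set" where
  "hilb V d = {\<psi>. \<forall>\<sigma>. \<sigma> \<notin> configs V d \<longrightarrow> \<psi> \<sigma> = 0}"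

definition vec_of :: "'v set \<Rightarrow> ('v \<Rightarrow> nat) \<Rightarrow> 'v state \<Rightarrow> 'v state" where
  "vec_of V d f = (\<lambda>\<sigma>. if \<sigma> \<in> configs V d then f \<sigma> else 0)"

definition braket :: "'v set \<Rightarrow> ('v \<Rightarrow> nat) \<Rightarrow> 'v state \<Rightarrow> 'v state \<Rightarrow> complex" where
  "braket V d \<phi> \<psi> = (\<Sum>\<sigma>\<in>configs V d. cnj (\<phi> \<sigma>) * \<psi> \<sigma>)"

definition hnorm :: "'v set \<Rightarrow> ('v \<Rightarrow> nat) \<Rightarrow> 'v state \<Rightarrow> real" where
  "hnorm V d \<psi> = L2_set (\<lambda>\<sigma>. cmod (\<psi> \<sigma>)) (configs V d)"

definition normalized :: "'v set \<Rightarrow> ('v \<Rightarrow> nat) \<Rightarrow> 'v state \<Rightarrow> 'v state" where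
  "normalized V d \<psi> = (\<lambda>\<sigma>. \<psi> \<sigma> / complex_of_real (hnorm V d \<psi>))"

definition self_adjoint :: "'v set \<Rightarrow> ('v \<Rightarrow> nat) \<Rightarrow> ('v state \<Rightarrow> 'v state) \<Rightarrow> bool" where
  "self_adjoint V d H \<longleftrightarrow>
     (\<forall>\<psi>\<in>hilb V d. H \<psi> \<in> hilb V d) \<and>
     (\<forall>\<phi>\<in>hilb V d. \<forall>\<psi>\<in>hilb V d. \<forall>a b.
        H (\<lambda>\<sigma>. a * \<phi> \<sigma> + b * \<psi> \<sigma>) = (\<lambda>\<sigma>. a * H \<phi> \<sigma> + b * H \<psi> \<sigma>)) \<and>
     (\<forall>\<phi>\<in>hilb V d. \<forall>\<psi>\<in>hilb V d. braket V d \<phi> (H \<psi>) = braket V d (H \<phi>) \<psi>)"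

text \<open>Problem (I) is kept in both of its forms, because minimizers of the distance and maximizers of
  the overlap agree only up to a phase.\<close>

definition distance_optimizer ::
    "'v set \<Rightarrow> ('v \<Rightarrow> nat) \<Rightarrow> 'v state set \<Rightarrow> 'v state \<Rightarrow> 'v state \<Rightarrow> bool" where
  "distance_optimizer V d M \<psi>0 \<Psi> \<longleftrightarrow>
     is_arg_min (\<lambda>\<Psi>. (hnorm V d (\<lambda>\<sigma>. \<Psi> \<sigma> - \<psi>0 \<sigma>))\<^sup>2) (\<lambda>\<Psi>. \<Psi> \<in> M) \<Psi>"

definition overlap_optimizer ::
    "'v set \<Rightarrow> ('v \<Rightarrow> nat) \<Rightarrow> 'v state set \<Rightarrow> 'v state \<Rightarrow> 'v state \<Rightarrow> bool" where
  "overlap_optimizer V d M \<psi>0 \<Psi> \<longleftrightarrow>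
     is_arg_max (\<lambda>\<Psi>. cmod (braket V d \<psi>0 \<Psi>)) (\<lambda>\<Psi>. \<Psi> \<in> M) \<Psi>"

definition energy_optimizer ::
    "'v set \<Rightarrow> ('v \<Rightarrow> nat) \<Rightarrow> 'v state set \<Rightarrow> ('v state \<Rightarrow> 'v state) \<Rightarrow> 'v state \<Rightarrow> bool" where
  "energy_optimizer V d M H \<Psi> \<longleftrightarrow>
     is_arg_min (\<lambda>\<Psi>. Re (braket V d \<Psi> (H \<Psi>))) (\<lambda>\<Psi>. \<Psi> \<in> M) \<Psi>"

definition always_optimizers :: "'v set \<Rightarrow> ('v \<Rightarrow> nat) \<Rightarrow> 'v state set \<Rightarrow> bool" where
  "always_optimizers V d M \<longleftrightarrow>
     (\<forall>\<psi>0\<in>hilb V d. (\<exists>\<Psi>. distance_optimizer V d M \<psi>0 \<Psi>) \<and> (\<exists>\<Psi>. overlap_optimizer V d M \<psi>0 \<Psi>)) \<and>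
     (\<forall>H. self_adjoint V d H \<longrightarrow> (\<exists>\<Psi>. energy_optimizer V d M H \<Psi>))"

definition lacks_optimizers :: "'v set \<Rightarrow> ('v \<Rightarrow> nat) \<Rightarrow> 'v state set \<Rightarrow> bool" where
  "lacks_optimizers V d M \<longleftrightarrow>
     (\<exists>\<psi>0\<in>hilb V d. hnorm V d \<psi>0 = 1 \<and>
        \<not> (\<exists>\<Psi>. distance_optimizer V d M \<psi>0 \<Psi>) \<and> \<not> (\<exists>\<Psi>. overlap_optimizer V d M \<psi>0 \<Psi>)) \<and>
     (\<exists>H. self_adjoint V d H \<and> \<not> (\<exists>\<Psi>. energy_optimizer V d M H \<Psi>))"

section \<open>Matrix product states\<close>

text \<open>The sites are \<open>1, \<dots>, N\<close>. The product \<open>A_1^(\<sigma> 1) \<cdots> A_N^(\<sigma> N)\<close> is formed by multiplying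
  onto the identity matrix of size \<open>r\<close>, the number of columns of the last factor.\<close>

definition mps_prod :: "nat \<Rightarrow> nat \<Rightarrow> (nat \<Rightarrow> nat \<Rightarrow> complex mat) \<Rightarrow> (nat \<Rightarrow> nat) \<Rightarrow> complex mat" where
  "mps_prod N r A \<sigma> = foldr (\<lambda>i M. A i (\<sigma> i) * M) [1..<Suc N] (1\<^sub>m r)"

definition mat_trace :: "complex mat \<Rightarrow> complex" where
  "mat_trace M = (\<Sum>i<dim_row M. M $$ (i, i))"

definition oMPS :: "nat \<Rightarrow> (nat \<Rightarrow> nat) \<Rightarrow> nat \<Rightarrow> nat state set" where
  "oMPS N m d = {\<Psi>. hnorm {1..N} (\<lambda>_. d) \<Psi> = 1 \<and>
     (\<exists>A. (\<forall>i\<in>{1..N}. \<forall>s\<in>{1..d}. A i s \<in> carrier_mat (m (i - 1)) (m i)) \<and>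
          \<Psi> = vec_of {1..N} (\<lambda>_. d) (\<lambda>\<sigma>. mps_prod N (m N) A \<sigma> $$ (0, 0)))}"

definition tiMPS :: "nat \<Rightarrow> nat \<Rightarrow> nat \<Rightarrow> nat state set" where
  "tiMPS N m d = {\<Psi>. hnorm {1..N} (\<lambda>_. d) \<Psi> = 1 \<and>
     (\<exists>A. (\<forall>s\<in>{1..d}. A s \<in> carrier_mat m m) \<and>
          \<Psi> = vec_of {1..N} (\<lambda>_. d) (\<lambda>\<sigma>. mat_trace (mps_prod N m (\<lambda>_. A) \<sigma>)))}"

definition pMPSn :: "nat \<Rightarrow> nat \<Rightarrow> (nat \<Rightarrow> nat) \<Rightarrow> nat state set" where
  "pMPSn N m \<delta> = {\<Psi>. hnorm {1..N} \<delta> \<Psi> = 1 \<and>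
     (\<exists>A. (\<forall>j\<in>{1..N}. \<forall>s\<in>{1..\<delta> j}. A j s \<in> carrier_mat m m) \<and>
          \<Psi> = vec_of {1..N} \<delta> (\<lambda>\<sigma>. mat_trace (mps_prod N m A \<sigma>)))}"

text \<open>The site of the ring \<open>1, \<dots>, N\<close> that is the \<open>i\<close>-th one (\<open>i < l c\<close>) of cluster \<open>c\<close>, when the
  clusters \<open>0, 1, \<dots>\<close> have lengths \<open>l 0, l 1, \<dots>\<close> and are laid out consecutively around the ring,
  starting after \<open>s\<close> sites (so that a cluster may contain both \<open>N\<close> and \<open>1\<close>).\<close>

definition ring_site :: "nat \<Rightarrow> nat \<Rightarrow> (nat \<Rightarrow> nat) \<Rightarrow> nat \<Rightarrow> nat \<Rightarrow> nat" where
  "ring_site N s l c i = Suc ((s + (\<Sum>c'<c. l c') + i) mod N)"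

section \<open>Networks, PEPS and TTNS\<close>

text \<open>An edge is the two-element set of its endpoints.\<close>

record 'v network =
  verts :: "'v set"
  edges :: "'v set set"
  bdim :: "'v set \<Rightarrow> nat"
  sdim :: "'v \<Rightarrow> nat"

definition network :: "'v network \<Rightarrow> bool" where
  "network G \<longleftrightarrow>
     finite (verts G) \<and> verts G \<noteq> {} \<and>
     (\<forall>e\<in>edges G. e \<subseteq> verts G \<and> card e = 2) \<and>
     (\<forall>u\<in>verts G. \<forall>v\<in>verts G. (u, v) \<in> {(x, y). {x, y} \<in> edges G}\<^sup>*) \<and>
     (\<forall>e\<in>edges G. bdim G e \<ge> 1) \<and> (\<forall>i\<in>verts G. sdim G i \<ge> 1)"

definition inc :: "'v network \<Rightarrow> 'v \<Rightarrow> 'v set set" where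
  "inc G i = {e \<in> edges G. i \<in> e}"

definition is_loop :: "'v network \<Rightarrow> 'v list \<Rightarrow> bool" where
  "is_loop G vs \<longleftrightarrow> length vs \<ge> 3 \<and> distinct vs \<and> set vs \<subseteq> verts G \<and>
     (\<forall>k<length vs. {vs ! k, vs ! (Suc k mod length vs)} \<in> edges G)"

definition tree_network :: "'v network \<Rightarrow> bool" where
  "tree_network G \<longleftrightarrow> network G \<and> \<not> (\<exists>vs. is_loop G vs)"

definition peps_vec :: "'v network \<Rightarrow> ('v \<Rightarrow> nat \<Rightarrow> ('v set \<Rightarrow> nat) \<Rightarrow> complex) \<Rightarrow> 'v state" where
  "peps_vec G A = vec_of (verts G) (sdim G)
     (\<lambda>\<sigma>. \<Sum>n\<in>PiE (edges G) (\<lambda>e. {1..bdim G e}). \<Prod>i\<in>verts G. A i (\<sigma> i) (restrict n (inc G i)))"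

definition PEPS :: "'v network \<Rightarrow> 'v state set" where
  "PEPS G = {\<Psi>. hnorm (verts G) (sdim G) \<Psi> = 1 \<and> (\<exists>A. \<Psi> = peps_vec G A)}"

definition TTNS :: "'v network \<Rightarrow> 'v state set" where
  "TTNS G = PEPS G"

text \<open>Sites of the cubic lattice are lists of \<open>D\<close> coordinates; direction \<open>0\<close> is the \<open>x\<close> direction.
  \<open>per k\<close> says that direction \<open>k\<close> has periodic boundary conditions.\<close>

definition lattice_sites :: "nat \<Rightarrow> (nat \<Rightarrow> nat) \<Rightarrow> nat list set" where
  "lattice_sites D L = {v. length v = D \<and> (\<forall>k<D. v ! k \<in> {1..L k})}"

definition lattice_edges :: "nat \<Rightarrow> (nat \<Rightarrow> nat) \<Rightarrow> (nat \<Rightarrow> bool) \<Rightarrow> nat \<Rightarrow> nat list set set" where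
  "lattice_edges D L per k =
     {{v, v[k := v ! k + 1]} |v. v \<in> lattice_sites D L \<and> v ! k < L k} \<union>
     {{v, v[k := 1]} |v. v \<in> lattice_sites D L \<and> v ! k = L k \<and> per k \<and> L k \<ge> 3}"

definition cubic_lattice ::
    "nat \<Rightarrow> (nat \<Rightarrow> nat) \<Rightarrow> (nat \<Rightarrow> bool) \<Rightarrow> (nat \<Rightarrow> nat) \<Rightarrow> nat list network \<Rightarrow> bool" where
  "cubic_lattice D L per m G \<longleftrightarrow>
     verts G = lattice_sites D L \<and> edges G = (\<Union>k<D. lattice_edges D L per k) \<and>
     (\<forall>k<D. \<forall>e\<in>lattice_edges D L per k. bdim G e = m k)"

section \<open>MERA\<close>

record 'v mera_network =
  mverts :: "'v set"
  marcs :: "('v \<times> 'v) set"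
  mbdim :: "'v \<times> 'v \<Rightarrow> nat"
  msdim :: "'v \<Rightarrow> nat"

definition arcs_in :: "'v mera_network \<Rightarrow> 'v \<Rightarrow> ('v \<times> 'v) set" where
  "arcs_in G i = {e \<in> marcs G. snd e = i}"

definition arcs_out :: "'v mera_network \<Rightarrow> 'v \<Rightarrow> ('v \<times> 'v) set" where
  "arcs_out G i = {e \<in> marcs G. fst e = i}"

definition mera_network :: "'v mera_network \<Rightarrow> bool" where
  "mera_network G \<longleftrightarrow>
     finite (mverts G) \<and> mverts G \<noteq> {} \<and> marcs G \<subseteq> mverts G \<times> mverts G \<and> acyclic (marcs G) \<and>
     (\<forall>u\<in>mverts G. \<forall>v\<in>mverts G. (u, v) \<in> (marcs G \<union> (marcs G)\<inverse>)\<^sup>*) \<and>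
     (\<forall>e\<in>marcs G. mbdim G e \<ge> 1) \<and> (\<forall>i\<in>mverts G. msdim G i \<ge> 1) \<and>
     (\<forall>i\<in>mverts G. (\<Prod>e\<in>arcs_out G i. mbdim G e) \<le> msdim G i * (\<Prod>e\<in>arcs_in G i. mbdim G e))"

definition bonds :: "'v mera_network \<Rightarrow> ('v \<times> 'v) set \<Rightarrow> ('v \<times> 'v \<Rightarrow> nat) set" where
  "bonds G X = PiE X (\<lambda>e. {1..mbdim G e})"

text \<open>\<open>A i s r c\<close> is the entry of the matrix \<open>A_i^s\<close> in row \<open>r\<close> (indices of outgoing arcs) and
  column \<open>c\<close> (indices of incoming arcs).\<close>

definition mera_isometric ::
    "'v mera_network \<Rightarrow> ('v \<Rightarrow> nat \<Rightarrow> ('v \<times> 'v \<Rightarrow> nat) \<Rightarrow> ('v \<times> 'v \<Rightarrow> nat) \<Rightarrow> complex) \<Rightarrow> bool" where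
  "mera_isometric G A \<longleftrightarrow>
     (\<forall>i\<in>mverts G. \<forall>r\<in>bonds G (arcs_out G i). \<forall>r'\<in>bonds G (arcs_out G i).
        (\<Sum>s\<in>{1..msdim G i}. \<Sum>c\<in>bonds G (arcs_in G i). A i s r c * cnj (A i s r' c)) =
        (if r = r' then 1 else 0))"

definition mera_vec ::
    "'v mera_network \<Rightarrow> ('v \<Rightarrow> nat \<Rightarrow> ('v \<times> 'v \<Rightarrow> nat) \<Rightarrow> ('v \<times> 'v \<Rightarrow> nat) \<Rightarrow> complex) \<Rightarrow> 'v state" where
  "mera_vec G A = vec_of (mverts G) (msdim G)
     (\<lambda>\<sigma>. \<Sum>n\<in>bonds G (marcs G).
        \<Prod>i\<in>mverts G. A i (\<sigma> i) (restrict n (arcs_out G i)) (restrict n (arcs_in G i)))"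

definition MERA :: "'v mera_network \<Rightarrow> 'v state set" where
  "MERA G = {\<Psi>. hnorm (mverts G) (msdim G) \<Psi> = 1 \<and> (\<exists>A. mera_isometric G A \<and> \<Psi> = mera_vec G A)}"

section \<open>The two-domain loop states\<close>

text \<open>The factors \<open>\<V>_(i,e)\<close> are labelled by the pairs \<open>(i, e)\<close> with \<open>e\<close> incident to \<open>i\<close>; a vector of
  their tensor product is again a state over this set of labels, with all dimensions equal to \<open>m\<close>.\<close>

definition half_edges :: "'v network \<Rightarrow> ('v \<times> 'v set) set" where
  "half_edges G = Sigma (verts G) (inc G)"

definition mu_vec :: "'v network \<Rightarrow> nat \<Rightarrow> ('v \<times> 'v set) state" where
  "mu_vec G m = vec_of (half_edges G) (\<lambda>_. m)
     (\<lambda>\<nu>. \<Prod>e\<in>edges G. \<Sum>n\<in>{1..m}. \<Prod>i\<in>e. if \<nu> (i, e) = n then 1 else 0)"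

text \<open>Operators on \<open>\<complex>^m \<otimes> \<complex>^m\<close> are given by their matrix elements \<open>T x y = \<langle>x|T|y\<rangle>\<close>, where
  \<open>x\<close> and \<open>y\<close> are pairs of basis labels in \<open>{1..m}\<close>.\<close>

type_synonym pair_op = "nat \<times> nat \<Rightarrow> nat \<times> nat \<Rightarrow> complex"

definition op_Pd :: pair_op where
  "op_Pd x y = (if x = y \<and> fst x = snd x then 1 else 0)"

definition op_Po :: pair_op where
  "op_Po x y = (if x = y then 1 else 0) - op_Pd x y"

definition op_A :: "real \<Rightarrow> pair_op" where
  "op_A \<epsilon> x y = op_Pd x y + complex_of_real \<epsilon> * op_Po x y"

definition op_B :: "real \<Rightarrow> pair_op" where
  "op_B \<epsilon> x y = (1 / complex_of_real \<epsilon>) * (op_Po x y + complex_of_real \<epsilon> * op_Pd x y)"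

text \<open>Application of \<open>T\<close> to the factors \<open>p \<noteq> q\<close> of a state over the set \<open>S\<close> of labels.\<close>

definition apply_pair :: "'k set \<Rightarrow> nat \<Rightarrow> pair_op \<Rightarrow> 'k \<Rightarrow> 'k \<Rightarrow> 'k state \<Rightarrow> 'k state" where
  "apply_pair S m T p q \<phi> = vec_of S (\<lambda>_. m)
     (\<lambda>\<nu>. \<Sum>y\<in>{1..m} \<times> {1..m}. T (\<nu> p, \<nu> q) y * \<phi> (\<nu>(p := fst y, q := snd y)))"

text \<open>The loop enters \<open>vs ! k\<close> from its cyclic predecessor and leaves to its cyclic successor.\<close>

definition loop_vec :: "'v network \<Rightarrow> nat \<Rightarrow> 'v list \<Rightarrow> real \<Rightarrow> ('v \<times> 'v set) state" where
  "loop_vec G m vs \<epsilon> = (let L = length vs in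
     foldr (\<lambda>k. apply_pair (half_edges G) m (if Suc k < L then op_A \<epsilon> else op_B \<epsilon>)
                  (vs ! k, {vs ! ((k + L - 1) mod L), vs ! k})
                  (vs ! k, {vs ! k, vs ! (Suc k mod L)}))
       [0..<L] (mu_vec G m))"

text \<open>An embedding of \<open>\<Otimes>_(e \<in> \<partial>i) \<V>_(i,e)\<close> into \<open>\<H>_i\<close> for every vertex \<open>i\<close>: the basis vector
  with label \<open>n\<close> is sent to the vector with coefficients \<open>W i s n\<close>, \<open>s \<in> {1..d_i}\<close>.\<close>

definition site_embedding ::
    "'v network \<Rightarrow> nat \<Rightarrow> ('v \<Rightarrow> nat \<Rightarrow> ('v set \<Rightarrow> nat) \<Rightarrow> complex) \<Rightarrow> bool" where
  "site_embedding G m W \<longleftrightarrow>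
     (\<forall>i\<in>verts G. \<forall>n\<in>PiE (inc G i) (\<lambda>_. {1..m}). \<forall>n'\<in>PiE (inc G i) (\<lambda>_. {1..m}).
        (\<Sum>s\<in>{1..sdim G i}. cnj (W i s n) * W i s n') = (if n = n' then 1 else 0))"

definition psi_T ::
    "'v network \<Rightarrow> nat \<Rightarrow> ('v \<Rightarrow> nat \<Rightarrow> ('v set \<Rightarrow> nat) \<Rightarrow> complex) \<Rightarrow> 'v list \<Rightarrow> real \<Rightarrow> 'v state" where
  "psi_T G m W vs \<epsilon> = normalized (verts G) (sdim G) (vec_of (verts G) (sdim G)
     (\<lambda>\<sigma>. \<Sum>\<nu>\<in>configs (half_edges G) (\<lambda>_. m).
        (\<Prod>i\<in>verts G. W i (\<sigma> i) (\<lambda>e\<in>inc G i. \<nu> (i, e))) * loop_vec G m vs \<epsilon> \<nu>))"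

definition loop_network :: "'v network \<Rightarrow> nat \<Rightarrow> bool" where
  "loop_network G m \<longleftrightarrow> network G \<and> m \<ge> 2 \<and> (\<forall>e\<in>edges G. bdim G e = m) \<and>
     (\<exists>vs. is_loop G vs) \<and> (\<forall>i\<in>verts G. sdim G i \<ge> m ^ card (inc G i))"

section \<open>Fine-graining\<close>

text \<open>A blocking scheme is given by the map \<open>p\<close> sending a vertex of the fine network \<open>G'\<close> to the
  vertex of \<open>G\<close> whose cluster contains it. The edge \<open>{i, j}\<close> of \<open>G\<close> then corresponds to the edges
  \<open>e'\<close> of \<open>G'\<close> with \<open>p ` e' = {i, j}\<close>, and the edges inside the cluster of \<open>i\<close> are those
  with \<open>p ` e' = {i}\<close>.\<close>

definition edges_over :: "'w network \<Rightarrow> ('w \<Rightarrow> 'v) \<Rightarrow> 'v set \<Rightarrow> 'w set set" where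
  "edges_over G' p X = {e' \<in> edges G'. p ` e' = X}"

definition cluster :: "'w network \<Rightarrow> ('w \<Rightarrow> 'v) \<Rightarrow> 'v \<Rightarrow> 'w set" where
  "cluster G' p i = {j \<in> verts G'. p j = i}"

definition blocking_scheme :: "'v network \<Rightarrow> 'w network \<Rightarrow> ('w \<Rightarrow> 'v) \<Rightarrow> bool" where
  "blocking_scheme G G' p \<longleftrightarrow>
     p ` verts G' = verts G \<and>
     (\<forall>i\<in>verts G. sdim G i = (\<Prod>j\<in>cluster G' p i. sdim G' j)) \<and>
     (\<forall>e'\<in>edges G'. card (p ` e') = 2 \<longrightarrow> p ` e' \<in> edges G) \<and>
     (\<forall>e\<in>edges G. edges_over G' p e \<noteq> {} \<and> (\<Prod>e'\<in>edges_over G' p e. bdim G' e') = bdim G e)"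

text \<open>Contraction of the tensors \<open>A'\<close> in the cluster of \<open>i\<close>. The bijections \<open>\<gamma> e\<close> group the indices
  of the edges over \<open>e\<close> into one multi-index, and \<open>\<beta> i\<close> identifies the product basis of the cluster
  with the basis of \<open>\<H>_i\<close>.\<close>

definition contract_cluster ::
    "'w network \<Rightarrow> ('w \<Rightarrow> 'v) \<Rightarrow> ('v \<Rightarrow> nat \<Rightarrow> 'w \<Rightarrow> nat) \<Rightarrow> ('v set \<Rightarrow> nat \<Rightarrow> 'w set \<Rightarrow> nat) \<Rightarrow>
     ('w \<Rightarrow> nat \<Rightarrow> ('w set \<Rightarrow> nat) \<Rightarrow> complex) \<Rightarrow> 'v \<Rightarrow> nat \<Rightarrow> ('v set \<Rightarrow> nat) \<Rightarrow> complex" where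
  "contract_cluster G' p \<beta> \<gamma> A' i s n =
     (\<Sum>k\<in>PiE (edges_over G' p {i}) (\<lambda>e'. {1..bdim G' e'}).
        \<Prod>j\<in>cluster G' p i. A' j (\<beta> i s j)
          (\<lambda>e'\<in>inc G' j. if p ` e' = {i} then k e' else \<gamma> (p ` e') (n (p ` e')) e'))"

definition fine_grained_state ::
    "'v network \<Rightarrow> 'w network \<Rightarrow> ('w \<Rightarrow> 'v) \<Rightarrow> 'v state \<Rightarrow> 'w state \<Rightarrow> bool" where
  "fine_grained_state G G' p \<Psi> \<Psi>' \<longleftrightarrow> \<Psi> \<in> PEPS G \<and> \<Psi>' \<in> PEPS G' \<and>
     (\<exists>A A' \<beta> \<gamma>. \<Psi> = peps_vec G A \<and> \<Psi>' = peps_vec G' A' \<and>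
        (\<forall>i\<in>verts G. bij_betw (\<beta> i) {1..sdim G i} (configs (cluster G' p i) (sdim G'))) \<and>
        (\<forall>e\<in>edges G. bij_betw (\<gamma> e) {1..bdim G e}
                        (PiE (edges_over G' p e) (\<lambda>e'. {1..bdim G' e'}))) \<and>
        (\<forall>i\<in>verts G. \<forall>s\<in>{1..sdim G i}. \<forall>n\<in>PiE (inc G i) (\<lambda>e. {1..bdim G e}).
           A i s n = contract_cluster G' p \<beta> \<gamma> A' i s n))"

end

theory Submission
 imports Defs "HOL-Analysis.Topology_Euclidean_Space" "HOL-Number_Theory.Cong" "HOL-Computational_Algebra.Polynomial"
begin

text \<open>Every set of states in question is the unit sphere of a set closed under scaling, so
 optimizers always exist if that set is closed under limits, and they fail to exist (for a limit
 \<open>\<psi>\<^sub>0\<close> of elements and for \<open>H = - |\<psi>\<^sub>0\<rangle>\<langle>\<psi>\<^sub>0|\<close>) if a normalizable limit escapes from it.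

 Trees are closed by removing a leaf: the leaf tensor expresses a limit of matrices of rank at most
 \<open>m\<close>, and rows of the limit matrix serve as the second factor. MERA tensors are bounded.

 For nonexistence, contracting the tensors in three classes of sites turns a network state into a
 triangle \<open>\<Sum>x y z. T\<^sub>0 x y * T\<^sub>1 y z * T\<^sub>2 z x\<close> with bond spaces of known dimensions. A limit state,
 pulled back along suitable functionals, is the indicator of \<open>x = x', y = y', z = z'\<close> and of a
 relation \<open>P\<close> between labels of \<open>x, y, z\<close>. Counting dimensions of the spaces annihilated by the
 factors shows that no triangle with these bond dimensions represents such a tensor. For rings \<open>P\<close>
 says that the steps made in the three clusters add up to \<open>m - 1\<close>; for loops it says that the number
 of domain walls in the first two classes agrees with that in the third.\<close>


section \<open>The triangle obstruction\<close>

text \<open>The bond dimensions alone do not exclude the limit: the bonds of a candidate triangle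
  are exactly as large as the label sets. This tightness is what is used. The slices of each factor
  are independent and as many as the entries of a matrix between two bond spaces, hence a basis, so
  a trace that vanishes against all slices of the third factor makes a product of two slices vanish
  as a matrix. The relation \<open>P\<close> forbids so many pairs of labels that too many slices of
  one factor would have large annihilators on both sides. Where \<open>P\<close> comes from: on a
  ring, closing up modulo \<open>m\<close> fixes the total weighted step to \<open>- 1\<close>
  modulo \<open>m\<close>, so the power \<open>m - 1\<close> of \<open>\<epsilon>\<close> is the
  lowest one and survives after division. The offset that has to be closed sits at a distinguished
  site. With equal tensors at all sites there is none, and the length \<open>N\<close>, coprime to
  \<open>m\<close>, takes its place. On the loop of \<open>psi_T\<close> a domain wall costs
  \<open>\<epsilon>\<close> except at one vertex, which refunds it; since a closed loop cannot have
  a single wall, no negative power occurs.\<close>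

definition indep :: "'i set \<Rightarrow> 'j set \<Rightarrow> ('i \<Rightarrow> 'j \<Rightarrow> complex) \<Rightarrow> bool" where
 "indep I J K \<longleftrightarrow> (\<forall>f. (\<forall>j\<in>J. (\<Sum>i\<in>I. f i * K i j) = 0) \<longrightarrow> (\<forall>i\<in>I. f i = 0))"

text \<open>Gaussian elimination: one equation is removed in each step by solving it for the unknown
  \<open>i0\<close>; \<open>K'\<close> is the Schur complement left for the other unknowns.\<close>

lemma underdetermined:
 fixes K :: "'i \<Rightarrow> 'j \<Rightarrow> complex"
 assumes "finite J" "finite I" "card J < card I"
 shows "\<exists>f. (\<exists>i\<in>I. f i \<noteq> 0) \<and> (\<forall>j\<in>J. (\<Sum>i\<in>I. f i * K i j) = 0)"
 using assms
proof (induction J arbitrary: I K rule: finite_induct)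
 case empty
 hence "I \<noteq> {}" by auto
 thus ?case by (intro exI[of _ "\<lambda>_. 1"]) auto
next
 case (insert j J)
 show ?case
 proof (cases "\<forall>i\<in>I. K i j = 0")
  case True
  have "card J < card I" using insert.hyps insert.prems by simp
  then obtain f where f: "\<exists>i\<in>I. f i \<noteq> 0" "\<forall>j\<in>J. (\<Sum>i\<in>I. f i * K i j) = 0"
   using insert.IH[of I K] insert.prems by blast
  thus ?thesis using True by (intro exI[of _ f]) auto
 next
  case False
  then obtain i0 where i0: "i0 \<in> I" "K i0 j \<noteq> 0" by auto
  define I' where "I' = I - {i0}"
  have I': "finite I'" "card J < card I'" "I = insert i0 I'" "i0 \<notin> I'"
   using insert.hyps insert.prems i0 by (auto simp: I'_def)
  define K' where "K' = (\<lambda>i l. K i l - K i j / K i0 j * K i0 l)"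
  obtain f where f: "\<exists>i\<in>I'. f i \<noteq> 0" "\<forall>l\<in>J. (\<Sum>i\<in>I'. f i * K' i l) = 0"
   using insert.IH[of I' K'] I' by auto
  define c where "c = - (\<Sum>i\<in>I'. f i * K i j) / K i0 j"
  define g where "g = f(i0 := c)"
  have gsum: "(\<Sum>i\<in>I. g i * K i l) = c * K i0 l + (\<Sum>i\<in>I'. f i * K i l)" for l
  proof -
   have "(\<Sum>i\<in>I'. g i * K i l) = (\<Sum>i\<in>I'. f i * K i l)"
    by (rule sum.cong) (use I' in \<open>auto simp: g_def\<close>)
   thus ?thesis using I' by (simp add: g_def)
  qed
  have "(\<Sum>i\<in>I. g i * K i l) = 0" if "l \<in> insert j J" for l
  proof (cases "l = j")
   case True
   thus ?thesis using i0 by (simp add: gsum c_def)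
  next
   case False
   hence "(\<Sum>i\<in>I'. f i * K' i l) = 0" using f that by auto
   moreover have "(\<Sum>i\<in>I'. f i * K' i l) =
     (\<Sum>i\<in>I'. f i * K i l) - (\<Sum>i\<in>I'. f i * K i j) / K i0 j * K i0 l"
   proof -
    have "f i * K' i l = f i * K i l - f i * K i j * (K i0 l / K i0 j)" for i
     by (simp add: K'_def right_diff_distrib)
    thus ?thesis by (simp add: sum_subtractf sum_distrib_right sum_divide_distrib)
   qed
   ultimately have "(\<Sum>i\<in>I'. f i * K i l) = (\<Sum>i\<in>I'. f i * K i j) / K i0 j * K i0 l"
    by simp
   thus ?thesis by (simp add: gsum c_def)
  qed
  moreover have "\<exists>i\<in>I. g i \<noteq> 0" using f(1) I' by (auto simp: g_def)
  ultimately show ?thesis by auto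
 qed
qed

lemma indep_card_le:
 assumes "indep I J K" "finite I" "finite J"
 shows "card I \<le> card J"
proof (rule ccontr)
 assume "\<not> card I \<le> card J"
 then obtain f where "\<exists>i\<in>I. f i \<noteq> 0" "\<forall>j\<in>J. (\<Sum>i\<in>I. f i * K i j) = 0"
  using underdetermined[OF assms(3,2), of K] by auto
 thus False using assms(1) unfolding indep_def by blast
qed

lemma indep_subset:
 assumes "indep I J K" "I' \<subseteq> I" "finite I"
 shows "indep I' J K"
 unfolding indep_def
proof (intro allI impI)
 fix f assume f: "\<forall>j\<in>J. (\<Sum>i\<in>I'. f i * K i j) = 0"
 have "\<forall>j\<in>J. (\<Sum>i\<in>I. (if i \<in> I' then f i else 0) * K i j) = 0"
 proof
  fix j assume "j \<in> J"
  have "(\<Sum>i\<in>I. (if i \<in> I' then f i else 0) * K i j) = (\<Sum>i\<in>I'. f i * K i j)"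
   by (rule sum.mono_neutral_cong_right) (use assms in auto)
  thus "(\<Sum>i\<in>I. (if i \<in> I' then f i else 0) * K i j) = 0" using f \<open>j \<in> J\<close> by simp
 qed
 hence "\<forall>i\<in>I. (if i \<in> I' then f i else 0) = 0"
  using assms(1) unfolding indep_def by (elim allE[of _ "\<lambda>i. if i \<in> I' then f i else 0"]) blast
 thus "\<forall>i\<in>I'. f i = 0" using assms(2) by (auto split: if_splits)
qed

text \<open>Deleting column \<open>j0\<close> leaves fewer equations than unknowns, so some
  combination \<open>f\<close> of the rows vanishes off \<open>j0\<close>. Independence makes its
  entry at \<open>j0\<close> nonzero, and pairing it with \<open>G\<close> isolates
  \<open>G j0\<close>.\<close>

lemma indep_square_right:
 assumes "indep I J K" "finite I" "finite J" "card I = card J"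
  and G: "\<forall>i\<in>I. (\<Sum>j\<in>J. K i j * G j) = 0" and "j0 \<in> J"
 shows "G j0 = 0"
proof (rule ccontr)
 assume "G j0 \<noteq> 0"
 have "card (J - {j0}) < card I"
  using card_Diff1_less[OF assms(3,6)] assms(4) by simp
 then obtain f where f: "\<exists>i\<in>I. f i \<noteq> 0" "\<forall>j\<in>J - {j0}. (\<Sum>i\<in>I. f i * K i j) = 0"
  using underdetermined[of "J - {j0}" I K] assms by auto
 have "(\<Sum>i\<in>I. f i * K i j0) \<noteq> 0"
 proof
  assume "(\<Sum>i\<in>I. f i * K i j0) = 0"
  hence "\<forall>j\<in>J. (\<Sum>i\<in>I. f i * K i j) = 0" using f by blast
  thus False using assms(1) f(1) unfolding indep_def by blast
 qed
 moreover have "(\<Sum>i\<in>I. f i * K i j0) * G j0 = 0"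
 proof -
  have "0 = (\<Sum>i\<in>I. f i * (\<Sum>j\<in>J. K i j * G j))" using G by simp
  also have "\<dots> = (\<Sum>j\<in>J. (\<Sum>i\<in>I. f i * K i j) * G j)"
   by (simp add: sum_distrib_left sum_distrib_right mult.assoc) (rule sum.swap)
  also have "\<dots> = (\<Sum>j\<in>{j0}. (\<Sum>i\<in>I. f i * K i j) * G j)"
   by (rule sum.mono_neutral_right) (use f assms in auto)
  finally show ?thesis by simp
 qed
 ultimately show False using \<open>G j0 \<noteq> 0\<close> by simp
qed

text \<open>A smallest set of coordinates on which no nonzero vector of \<open>V\<close> vanishes
  stands in for a basis: its size plays the role of the dimension of \<open>V\<close>, and by
  minimality each of its points carries a dual vector, normalized by scaling.\<close>

lemma pivot_set:
 fixes V :: "('y \<Rightarrow> complex) set"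
 assumes "finite Y" and scale: "\<forall>u\<in>V. \<forall>c. (\<lambda>y. c * u y) \<in> V"
 shows "\<exists>P\<subseteq>Y. (\<forall>u\<in>V. (\<forall>y\<in>P. u y = 0) \<longrightarrow> (\<forall>y\<in>Y. u y = 0)) \<and>
  (\<forall>y\<in>P. \<exists>u\<in>V. u y = 1 \<and> (\<forall>y'\<in>P - {y}. u y' = 0))"
proof -
 define good where "good P \<longleftrightarrow> P \<subseteq> Y \<and> (\<forall>u\<in>V. (\<forall>y\<in>P. u y = 0) \<longrightarrow> (\<forall>y\<in>Y. u y = 0))" for P
 have "good Y" by (auto simp: good_def)
 then obtain P where P: "good P" "\<And>Q. good Q \<Longrightarrow> card P \<le> card Q"
  using ex_has_least_nat[of good Y card] by blast
 have PY: "P \<subseteq> Y" and P0: "\<And>u. u \<in> V \<Longrightarrow> \<forall>y\<in>P. u y = 0 \<Longrightarrow> \<forall>y\<in>Y. u y = 0"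
  using P(1) unfolding good_def by blast+
 have fin: "finite P" using PY assms(1) by (rule finite_subset)
 have P1: "\<exists>u\<in>V. u y = 1 \<and> (\<forall>y'\<in>P - {y}. u y' = 0)" if "y \<in> P" for y
 proof -
  have "card (P - {y}) < card P" using fin that by (rule card_Diff1_less)
  hence "\<not> good (P - {y})" using P(2) not_le by blast
  then obtain u where u: "u \<in> V" "\<forall>y'\<in>P - {y}. u y' = 0" "\<not> (\<forall>y\<in>Y. u y = 0)"
   using PY unfolding good_def by blast
  have "u y \<noteq> 0"
  proof
   assume "u y = 0"
   hence "\<forall>y'\<in>P. u y' = 0" using u(2) by blast
   thus False using P0[OF u(1)] u(3) by blast
  qed
  thus ?thesis using u(2) by (intro bexI[OF _ scale[rule_format, OF u(1), of "1 / u y"]]) simp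
 qed
 show ?thesis
  by (rule exI[of _ P], intro conjI ballI impI) (rule PY, rule bspec[OF P0], assumption+, rule P1)
qed

text \<open>\<open>v\<close> and \<open>w\<close> are the dimensions of the common right and left
  annihilators of the matrices \<open>M n\<close>. The columns of all combinations of the
  \<open>B p\<close> lie in the former, the rows of all combinations of the \<open>C q\<close> in
  the latter, and the \<open>M n\<close> descend to the two quotients. Each independent family is
  bounded by the dimension of the space in which it lives.\<close>

lemma annihilator_count:
 fixes M :: "'n \<Rightarrow> 'a \<times> 'b \<Rightarrow> complex" and B :: "'p \<Rightarrow> 'b \<times> 'c \<Rightarrow> complex" and C :: "'q \<Rightarrow> 'c \<times> 'a \<Rightarrow> complex"
 assumes fin: "finite X" "finite Y" "finite Z" "finite N1" "finite N2" "finite N3"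
  and iM: "indep N1 (X \<times> Y) M" and iB: "indep N2 (Y \<times> Z) B" and iC: "indep N3 (Z \<times> X) C"
  and MB: "\<And>n p a c. n \<in> N1 \<Longrightarrow> p \<in> N2 \<Longrightarrow> a \<in> X \<Longrightarrow> c \<in> Z \<Longrightarrow> (\<Sum>b\<in>Y. M n (a, b) * B p (b, c)) = 0"
  and CM: "\<And>n q b c. n \<in> N1 \<Longrightarrow> q \<in> N3 \<Longrightarrow> b \<in> Y \<Longrightarrow> c \<in> Z \<Longrightarrow> (\<Sum>a\<in>X. C q (c, a) * M n (a, b)) = 0"
 shows "\<exists>v w. v \<le> card Y \<and> w \<le> card X \<and> card N2 \<le> v * card Z \<and> card N3 \<le> w * card Z \<and>
   card N1 \<le> (card X - w) * (card Y - v)"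
proof -
 define V where "V = {u. \<forall>n\<in>N1. \<forall>a\<in>X. (\<Sum>b\<in>Y. M n (a, b) * u b) = 0}"
 define W where "W = {u. \<forall>n\<in>N1. \<forall>b\<in>Y. (\<Sum>a\<in>X. u a * M n (a, b)) = 0}"
 have scV: "\<forall>u\<in>V. \<forall>k. (\<lambda>y. k * u y) \<in> V"
 proof (intro ballI allI)
  fix u k assume that: "u \<in> V"
  have "(\<Sum>b\<in>Y. M n (a, b) * (k * u b)) = k * (\<Sum>b\<in>Y. M n (a, b) * u b)" for n a
   by (simp add: sum_distrib_left mult_ac)
  thus "(\<lambda>y. k * u y) \<in> V" using that by (auto simp: V_def)
 qed
 obtain P where P: "P \<subseteq> Y" "\<forall>u\<in>V. (\<forall>y\<in>P. u y = 0) \<longrightarrow> (\<forall>y\<in>Y. u y = 0)"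
  "\<forall>y\<in>P. \<exists>u\<in>V. u y = 1 \<and> (\<forall>y'\<in>P - {y}. u y' = 0)"
  using pivot_set[OF fin(2) scV] by (elim exE conjE) (rule that)
 have scW: "\<forall>u\<in>W. \<forall>k. (\<lambda>y. k * u y) \<in> W"
 proof (intro ballI allI)
  fix u k assume that: "u \<in> W"
  have "(\<Sum>a\<in>X. (k * u a) * M n (a, b)) = k * (\<Sum>a\<in>X. u a * M n (a, b))" for n b
   by (simp add: sum_distrib_left mult_ac)
  thus "(\<lambda>y. k * u y) \<in> W" using that by (auto simp: W_def)
 qed
 obtain Q where Q: "Q \<subseteq> X" "\<forall>u\<in>W. (\<forall>y\<in>Q. u y = 0) \<longrightarrow> (\<forall>y\<in>X. u y = 0)"
  "\<forall>y\<in>Q. \<exists>u\<in>W. u y = 1 \<and> (\<forall>y'\<in>Q - {y}. u y' = 0)"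
  using pivot_set[OF fin(1) scW] by (elim exE conjE) (rule that)
 have finPQ: "finite P" "finite Q" using P(1) Q(1) fin by (auto intro: finite_subset)
 have "indep N2 (P \<times> Z) B"
  unfolding indep_def
 proof (intro allI impI)
  fix f assume f: "\<forall>j\<in>P \<times> Z. (\<Sum>i\<in>N2. f i * B i j) = 0"
  have "(\<Sum>i\<in>N2. f i * B i (b, c)) = 0" if "b \<in> Y" "c \<in> Z" for b c
  proof -
   have "(\<Sum>b\<in>Y. M n (a, b) * (\<Sum>i\<in>N2. f i * B i (b, c))) = 0" if "n \<in> N1" "a \<in> X" for n a
   proof -
    have "(\<Sum>b\<in>Y. M n (a, b) * (\<Sum>i\<in>N2. f i * B i (b, c)))
      = (\<Sum>i\<in>N2. f i * (\<Sum>b\<in>Y. M n (a, b) * B i (b, c)))"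
     by (simp add: sum_distrib_left sum.swap[of _ N2] mult_ac)
    thus ?thesis using MB that \<open>c \<in> Z\<close> by simp
   qed
   hence "(\<lambda>b. \<Sum>i\<in>N2. f i * B i (b, c)) \<in> V" by (auto simp: V_def)
   from bspec[OF P(2) this] show ?thesis using f that by auto
  qed
  thus "\<forall>i\<in>N2. f i = 0" using iB unfolding indep_def by auto
 qed
 hence 1: "card N2 \<le> card P * card Z"
  using indep_card_le fin finPQ by (metis card_cartesian_product finite_cartesian_product)
 have "indep N3 (Z \<times> Q) C"
  unfolding indep_def
 proof (intro allI impI)
  fix f assume f: "\<forall>j\<in>Z \<times> Q. (\<Sum>i\<in>N3. f i * C i j) = 0"
  have "(\<Sum>i\<in>N3. f i * C i (c, a)) = 0" if "a \<in> X" "c \<in> Z" for a c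
  proof -
   have "(\<Sum>a\<in>X. (\<Sum>i\<in>N3. f i * C i (c, a)) * M n (a, b)) = 0" if "n \<in> N1" "b \<in> Y" for n b
   proof -
    have "(\<Sum>a\<in>X. (\<Sum>i\<in>N3. f i * C i (c, a)) * M n (a, b))
      = (\<Sum>i\<in>N3. f i * (\<Sum>a\<in>X. C i (c, a) * M n (a, b)))"
     by (simp add: sum_distrib_left sum_distrib_right sum.swap[of _ N3] mult_ac)
    thus ?thesis using CM that \<open>c \<in> Z\<close> by simp
   qed
   hence "(\<lambda>a. \<Sum>i\<in>N3. f i * C i (c, a)) \<in> W" by (auto simp: W_def)
   from bspec[OF Q(2) this] show ?thesis using f that by auto
  qed
  thus "\<forall>i\<in>N3. f i = 0" using iC unfolding indep_def by auto
 qed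
 hence 2: "card N3 \<le> card Q * card Z"
  using indep_card_le fin finPQ by (metis card_cartesian_product finite_cartesian_product mult.commute)
 have "indep N1 ((X - Q) \<times> (Y - P)) M"
  unfolding indep_def
 proof (intro allI impI)
  fix f assume f: "\<forall>j\<in>(X - Q) \<times> (Y - P). (\<Sum>i\<in>N1. f i * M i j) = 0"
  define S where "S a b = (\<Sum>i\<in>N1. f i * M i (a, b))" for a b
  have SV: "(\<Sum>b\<in>Y. S a b * u b) = 0" if "u \<in> V" "a \<in> X" for u a
  proof -
   have "(\<Sum>b\<in>Y. S a b * u b) = (\<Sum>i\<in>N1. f i * (\<Sum>b\<in>Y. M i (a, b) * u b))"
    by (simp add: S_def sum_distrib_left sum_distrib_right sum.swap[of _ N1] mult_ac)
   thus ?thesis using that by (simp add: V_def)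
  qed
  have SW: "(\<Sum>a\<in>X. u a * S a b) = 0" if "u \<in> W" "b \<in> Y" for u b
  proof -
   have "(\<Sum>a\<in>X. u a * S a b) = (\<Sum>i\<in>N1. f i * (\<Sum>a\<in>X. u a * M i (a, b)))"
    by (simp add: S_def sum_distrib_left sum_distrib_right sum.swap[of _ N1] mult_ac)
   thus ?thesis using that by (simp add: W_def)
  qed
  \<comment> \<open>Entries in pivot columns are recovered from the dual vectors: pairing a row of
    \<open>S\<close> with the vector dual to \<open>b\<close> leaves \<open>S a b\<close> alone.
    \<open>S2\<close> repeats this for the pivot rows.\<close>
  have S1: "S a b = 0" if "a \<in> X - Q" "b \<in> Y" for a b
  proof (cases "b \<in> P")
   case False thus ?thesis using f that by (auto simp: S_def)
  next
   case True
   then obtain u where u: "u \<in> V" "u b = 1" "\<forall>y'\<in>P - {b}. u y' = 0" using P(3) by blast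
   have "0 = (\<Sum>b'\<in>Y. S a b' * u b')" using SV u(1) that by auto
   also have "\<dots> = (\<Sum>b'\<in>{b}. S a b' * u b')"
    by (rule sum.mono_neutral_right) (use fin f that u in \<open>auto simp: S_def\<close>)
   finally show ?thesis using u(2) by simp
  qed
  have S2: "S a b = 0" if "a \<in> X" "b \<in> Y" for a b
  proof (cases "a \<in> Q")
   case False thus ?thesis using S1 that by auto
  next
   case True
   then obtain u where u: "u \<in> W" "u a = 1" "\<forall>y'\<in>Q - {a}. u y' = 0" using Q(3) by blast
   have "0 = (\<Sum>a'\<in>X. u a' * S a' b)" using SW u(1) that by auto
   also have "\<dots> = (\<Sum>a'\<in>{a}. u a' * S a' b)"
    by (rule sum.mono_neutral_right) (use fin that u S1 in auto)
   finally show ?thesis using u(2) by simp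
  qed
  thus "\<forall>i\<in>N1. f i = 0" using iM unfolding indep_def S_def by auto
 qed
 hence "card N1 \<le> card ((X - Q) \<times> (Y - P))"
  using indep_card_le fin by (metis finite_Diff finite_cartesian_product)
 hence "card N1 \<le> (card X - card Q) * (card Y - card P)"
  using P(1) Q(1) finPQ by (simp add: card_cartesian_product card_Diff_subset)
 moreover have "card P \<le> card Y" "card Q \<le> card X" using P(1) Q(1) fin card_mono by auto
 ultimately show ?thesis using 1 2 by blast
qed

lemma sum_swap_out3:
 "(\<Sum>a\<in>A. \<Sum>b\<in>B. \<Sum>c\<in>C. \<Sum>p\<in>P. g a b c p) = (\<Sum>p\<in>P. \<Sum>a\<in>A. \<Sum>b\<in>B. \<Sum>c\<in>C. g a b c p)"
 by (simp add: sum.swap[of _ P])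

lemma sum_rotate3:
 "(\<Sum>a\<in>A. \<Sum>b\<in>B. \<Sum>c\<in>C. g a b c) = (\<Sum>b\<in>B. \<Sum>c\<in>C. \<Sum>a\<in>A. g a b c)"
proof -
 have "(\<Sum>a\<in>A. \<Sum>b\<in>B. \<Sum>c\<in>C. g a b c) = (\<Sum>b\<in>B. \<Sum>a\<in>A. \<Sum>c\<in>C. g a b c)"
  by (rule sum.swap)
 also have "\<dots> = (\<Sum>b\<in>B. \<Sum>c\<in>C. \<Sum>a\<in>A. g a b c)"
  by (rule sum.cong[OF refl]) (rule sum.swap)
 finally show ?thesis .
qed

text \<open>Freezing the other two factors at a label \<open>z0\<close> with
  \<open>P x0 y0 z0\<close> gives a functional on the slices of \<open>A\<close> that is 1 at
  \<open>(x0, y0)\<close> and 0 at all other labels. Hence no nontrivial combination of slices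
  vanishes.\<close>

lemma triangle_indep:
 fixes A :: "'x \<Rightarrow> 'y \<Rightarrow> 'a \<Rightarrow> 'b \<Rightarrow> complex"
 assumes fin: "finite X" "finite Y"
  and t: "\<And>x y y' z z' x'. x \<in> X \<Longrightarrow> y \<in> Y \<Longrightarrow> y' \<in> Y \<Longrightarrow> z \<in> Z \<Longrightarrow> z' \<in> Z \<Longrightarrow> x' \<in> X \<Longrightarrow>
   (\<Sum>a\<in>X'. \<Sum>b\<in>Y'. \<Sum>c\<in>Z'. A x y a b * B y' z b c * C z' x' c a) =
   (if x = x' \<and> y = y' \<and> z = z' \<and> P x y z then 1 else 0)"
  and ext: "\<And>x y. x \<in> X \<Longrightarrow> y \<in> Y \<Longrightarrow> \<exists>z\<in>Z. P x y z"
 shows "indep (X \<times> Y) (X' \<times> Y') (\<lambda>p q. A (fst p) (snd p) (fst q) (snd q))"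
 unfolding indep_def
proof (intro allI impI)
 fix f :: "'x \<times> 'y \<Rightarrow> complex"
 assume f: "\<forall>q\<in>X' \<times> Y'. (\<Sum>p\<in>X \<times> Y. f p * A (fst p) (snd p) (fst q) (snd q)) = 0"
 show "\<forall>p\<in>X \<times> Y. f p = 0"
 proof
  fix p0 assume p0: "p0 \<in> X \<times> Y"
  obtain x0 y0 where xy: "p0 = (x0, y0)" "x0 \<in> X" "y0 \<in> Y" using p0 by auto
  obtain z0 where z0: "z0 \<in> Z" "P x0 y0 z0" using ext xy by blast
  have f0: "(\<Sum>p\<in>X \<times> Y. f p * A (fst p) (snd p) a b) = 0" if "a \<in> X'" "b \<in> Y'" for a b
   using bspec[OF f, of "(a, b)"] that by simp
  have "0 = (\<Sum>a\<in>X'. \<Sum>b\<in>Y'. \<Sum>c\<in>Z'. (\<Sum>p\<in>X \<times> Y. f p * A (fst p) (snd p) a b) * (B y0 z0 b c * C z0 x0 c a))"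
   by (rule sym, intro sum.neutral ballI) (simp only: f0 mult_zero_left)
  also have "\<dots> = (\<Sum>a\<in>X'. \<Sum>b\<in>Y'. \<Sum>c\<in>Z'. \<Sum>p\<in>X \<times> Y. f p * (A (fst p) (snd p) a b * B y0 z0 b c * C z0 x0 c a))"
   by (simp only: sum_distrib_right mult.assoc)
  also have "\<dots> = (\<Sum>p\<in>X \<times> Y. f p * (\<Sum>a\<in>X'. \<Sum>b\<in>Y'. \<Sum>c\<in>Z'. A (fst p) (snd p) a b * B y0 z0 b c * C z0 x0 c a))"
   by (subst sum_swap_out3) (simp only: sum_distrib_left)
  also have "\<dots> = (\<Sum>p\<in>X \<times> Y. if p = p0 then f p else 0)"
  proof (rule sum.cong[OF refl])
   fix p assume "p \<in> X \<times> Y"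
   then obtain x y where p: "p = (x, y)" "x \<in> X" "y \<in> Y" by auto
   show "f p * (\<Sum>a\<in>X'. \<Sum>b\<in>Y'. \<Sum>c\<in>Z'. A (fst p) (snd p) a b * B y0 z0 b c * C z0 x0 c a) =
     (if p = p0 then f p else 0)"
    using t[of x y y0 z0 z0 x0] p xy z0 by auto
  qed
  also have "\<dots> = f p0" using p0 fin by simp
  finally show "f p0 = 0" by simp
 qed
qed

text \<open>Transfers counts of pairs of numbers below \<open>m\<close> to the larger sets of bond
  configurations, on which each label is equidistributed.\<close>

lemma fibre_count:
 fixes g :: "'x \<Rightarrow> nat" and h :: "'y \<Rightarrow> nat"
 assumes fin: "finite X" "finite Y" and sub: "n \<subseteq> {..<m} \<times> {..<m}"
  and gX: "\<And>i. i < m \<Longrightarrow> m * card {x\<in>X. g x = i} = card X"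
  and hY: "\<And>i. i < m \<Longrightarrow> m * card {y\<in>Y. h y = i} = card Y"
 shows "m * m * card {p\<in>X \<times> Y. (g (fst p), h (snd p)) \<in> n} = card n * (card X * card Y)"
proof -
 have fn: "finite n" using sub by (rule finite_subset) simp
 have "{p\<in>X \<times> Y. (g (fst p), h (snd p)) \<in> n} = (\<Union>q\<in>n. {x\<in>X. g x = fst q} \<times> {y\<in>Y. h y = snd q})"
  by auto
 also have "card \<dots> = (\<Sum>q\<in>n. card ({x\<in>X. g x = fst q} \<times> {y\<in>Y. h y = snd q}))"
  by (rule card_UN_disjoint) (use fn fin in auto)
 also have "m * m * \<dots> = (\<Sum>q\<in>n. (m * card {x\<in>X. g x = fst q}) * (m * card {y\<in>Y. h y = snd q}))"
  by (simp add: sum_distrib_left card_cartesian_product mult_ac)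
 also have "\<dots> = (\<Sum>q\<in>n. card X * card Y)"
  by (rule sum.cong[OF refl]) (use sub gX hY in auto)
 finally show ?thesis by simp
qed

text \<open>A triangle-shaped contraction \<open>A B C\<close> with the bond sets \<open>X'\<close>, \<open>Y'\<close>, \<open>Z'\<close> cannot reproduce
 the degenerate matrix multiplication tensor supported on \<open>P\<close>: the slices labelled by \<open>n1\<close> would
 be matrices annihilated from the right by those of \<open>n2\<close> and from the left by those of \<open>n3\<close>, and
 there are too many of them.\<close>

theorem triangle_obstruction:
 fixes A :: "'x \<Rightarrow> 'y \<Rightarrow> 'a \<Rightarrow> 'b \<Rightarrow> complex" and B :: "'y \<Rightarrow> 'z \<Rightarrow> 'b \<Rightarrow> 'c \<Rightarrow> complex"
  and C :: "'z \<Rightarrow> 'x \<Rightarrow> 'c \<Rightarrow> 'a \<Rightarrow> complex" and P :: "nat \<Rightarrow> nat \<Rightarrow> nat \<Rightarrow> bool" and m :: nat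
 assumes fin: "finite X" "finite Y" "finite Z" and fin': "finite X'" "finite Y'" "finite Z'"
  and card: "card X' = card X" "card Y' = card Y" "card Z' = card Z"
  and ne: "X \<noteq> {}" "Y \<noteq> {}" "Z \<noteq> {}"
  and t: "\<And>x y y' z z' x'. x \<in> X \<Longrightarrow> y \<in> Y \<Longrightarrow> y' \<in> Y \<Longrightarrow> z \<in> Z \<Longrightarrow> z' \<in> Z \<Longrightarrow> x' \<in> X \<Longrightarrow>
   (\<Sum>a\<in>X'. \<Sum>b\<in>Y'. \<Sum>c\<in>Z'. A x y a b * B y' z b c * C z' x' c a) =
   (if x = x' \<and> y = y' \<and> z = z' \<and> P (gX x) (gY y) (gZ z) then 1 else 0)"
  and m: "m \<ge> 2"
  and gX: "\<And>x. x \<in> X \<Longrightarrow> gX x < m" "\<And>i. i < m \<Longrightarrow> m * card {x\<in>X. gX x = i} = card X"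
  and gY: "\<And>x. x \<in> Y \<Longrightarrow> gY x < m" "\<And>i. i < m \<Longrightarrow> m * card {x\<in>Y. gY x = i} = card Y"
  and gZ: "\<And>x. x \<in> Z \<Longrightarrow> gZ x < m" "\<And>i. i < m \<Longrightarrow> m * card {x\<in>Z. gZ x = i} = card Z"
  and ext: "\<And>i j. i < m \<Longrightarrow> j < m \<Longrightarrow> \<exists>l<m. P i j l" "\<And>j l. j < m \<Longrightarrow> l < m \<Longrightarrow> \<exists>i<m. P i j l"
   "\<And>l i. l < m \<Longrightarrow> i < m \<Longrightarrow> \<exists>j<m. P i j l"
  and sub: "n1 \<subseteq> {..<m} \<times> {..<m}" "n2 \<subseteq> {..<m} \<times> {..<m}" "n3 \<subseteq> {..<m} \<times> {..<m}"
  and ex12: "\<And>i j l. (i, j) \<in> n1 \<Longrightarrow> (j, l) \<in> n2 \<Longrightarrow> \<not> P i j l"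
  and ex13: "\<And>i j l. (i, j) \<in> n1 \<Longrightarrow> (l, i) \<in> n3 \<Longrightarrow> \<not> P i j l"
  and cn: "card n1 \<ge> m * (m - 1)" "card n2 \<ge> m" "card n3 \<ge> m"
 shows False
proof -
 have surj: "\<exists>w\<in>W. g w = i" if "W \<noteq> {}" "finite W" "\<And>i. i < m \<Longrightarrow> m * card {x\<in>W. g x = i} = card W" "i < m"
  for W :: "'w set" and g i
 proof (rule ccontr)
  assume "\<not> ?thesis"
  hence "{x\<in>W. g x = i} = {}" by auto
  hence "m * card ({} :: 'w set) = card W" using that(3)[OF that(4)] by (simp only:)
  hence "card W = 0" by simp
  thus False using that by simp
 qed
 have eX: "\<exists>x\<in>X. P (gX x) (gY y) (gZ z)" if "y \<in> Y" "z \<in> Z" for y z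
  using ext(2)[OF gY(1)[OF that(1)] gZ(1)[OF that(2)]] surj[OF ne(1) fin(1) gX(2)] by blast
 have eY: "\<exists>y\<in>Y. P (gX x) (gY y) (gZ z)" if "z \<in> Z" "x \<in> X" for x z
  using ext(3)[OF gZ(1)[OF that(1)] gX(1)[OF that(2)]] surj[OF ne(2) fin(2) gY(2)] by blast
 have eZ: "\<exists>z\<in>Z. P (gX x) (gY y) (gZ z)" if "x \<in> X" "y \<in> Y" for x y
  using ext(1)[OF gX(1)[OF that(1)] gY(1)[OF that(2)]] surj[OF ne(3) fin(3) gZ(2)] by blast
 define A' where "A' = (\<lambda>p q. A (fst p) (snd p) (fst q) (snd q))"
 define B' where "B' = (\<lambda>p q. B (fst p) (snd p) (fst q) (snd q))"
 define C' where "C' = (\<lambda>p q. C (fst p) (snd p) (fst q) (snd q))"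
 have tB: "(\<Sum>b\<in>Y'. \<Sum>c\<in>Z'. \<Sum>a\<in>X'. B y' z b c * C z' x' c a * A x y a b) =
   (if y' = y \<and> z = z' \<and> x' = x \<and> P (gX x') (gY y') (gZ z) then 1 else 0)"
  if "x \<in> X" "y \<in> Y" "y' \<in> Y" "z \<in> Z" "z' \<in> Z" "x' \<in> X" for x y y' z z' x'
 proof -
  have "(\<Sum>b\<in>Y'. \<Sum>c\<in>Z'. \<Sum>a\<in>X'. B y' z b c * C z' x' c a * A x y a b)
    = (\<Sum>b\<in>Y'. \<Sum>c\<in>Z'. \<Sum>a\<in>X'. A x y a b * B y' z b c * C z' x' c a)"
   by (simp only: mult_ac)
  also have "\<dots> = (\<Sum>a\<in>X'. \<Sum>b\<in>Y'. \<Sum>c\<in>Z'. A x y a b * B y' z b c * C z' x' c a)"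
   by (rule sum_rotate3[symmetric])
  finally show ?thesis using t[OF that] by auto
 qed
 have tC: "(\<Sum>c\<in>Z'. \<Sum>a\<in>X'. \<Sum>b\<in>Y'. C z' x' c a * A x y a b * B y' z b c) =
   (if z' = z \<and> x' = x \<and> y = y' \<and> P (gX x') (gY y) (gZ z') then 1 else 0)"
  if "x \<in> X" "y \<in> Y" "y' \<in> Y" "z \<in> Z" "z' \<in> Z" "x' \<in> X" for x y y' z z' x'
 proof -
  have "(\<Sum>c\<in>Z'. \<Sum>a\<in>X'. \<Sum>b\<in>Y'. C z' x' c a * A x y a b * B y' z b c)
    = (\<Sum>c\<in>Z'. \<Sum>a\<in>X'. \<Sum>b\<in>Y'. A x y a b * B y' z b c * C z' x' c a)"
   by (simp only: mult_ac)
  also have "\<dots> = (\<Sum>a\<in>X'. \<Sum>b\<in>Y'. \<Sum>c\<in>Z'. A x y a b * B y' z b c * C z' x' c a)"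
   by (rule sum_rotate3)
  finally show ?thesis using t[OF that] by auto
 qed
 have iA: "indep (X \<times> Y) (X' \<times> Y') A'"
  unfolding A'_def by (rule triangle_indep[OF fin(1,2) t eZ])
 have iB: "indep (Y \<times> Z) (Y' \<times> Z') B'"
  unfolding B'_def by (rule triangle_indep[where P = "\<lambda>y z x. P (gX x) (gY y) (gZ z)", OF fin(2,3) tB eX])
 have iC: "indep (Z \<times> X) (Z' \<times> X') C'"
  unfolding C'_def by (rule triangle_indep[where P = "\<lambda>z x y. P (gX x) (gY y) (gZ z)", OF fin(3,1) tC eY])
 define N1 where "N1 = {p\<in>X \<times> Y. (gX (fst p), gY (snd p)) \<in> n1}"
 define N2 where "N2 = {p\<in>Y \<times> Z. (gY (fst p), gZ (snd p)) \<in> n2}"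
 define N3 where "N3 = {p\<in>Z \<times> X. (gZ (fst p), gX (snd p)) \<in> n3}"
 have sN: "N1 \<subseteq> X \<times> Y" "N2 \<subseteq> Y \<times> Z" "N3 \<subseteq> Z \<times> X" by (auto simp: N1_def N2_def N3_def)
 have fP: "finite (X \<times> Y)" "finite (Y \<times> Z)" "finite (Z \<times> X)" using fin by auto
 have fN: "finite N1" "finite N2" "finite N3" using sN fP finite_subset by blast+
 \<comment> \<open>Being independent and of the right number, the slices of \<open>C\<close> span
   all functions on \<open>Z' \<times> X'\<close>. For \<open>n\<close> in \<open>N1\<close> and
   \<open>p\<close> in \<open>N2\<close> the relation fails by \<open>ex12\<close>, so the product
   of the two slices is orthogonal to all of them.\<close>
 have MB: "(\<Sum>b\<in>Y'. A' n (a, b) * B' p (b, c)) = 0"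
  if n: "n \<in> N1" and p: "p \<in> N2" and ac: "a \<in> X'" "c \<in> Z'" for n p a c
 proof -
  define G where "G = (\<lambda>q. \<Sum>b\<in>Y'. A' n (snd q, b) * B' p (b, fst q))"
  have "(\<Sum>j\<in>Z' \<times> X'. C' i j * G j) = 0" if i: "i \<in> Z \<times> X" for i
  proof -
   have "(\<Sum>j\<in>Z' \<times> X'. C' i j * G j) = (\<Sum>c\<in>Z'. \<Sum>a\<in>X'. C' i (c, a) * G (c, a))"
    by (simp add: sum.cartesian_product)
   also have "\<dots> = (\<Sum>c\<in>Z'. \<Sum>a\<in>X'. \<Sum>b\<in>Y'. C (fst i) (snd i) c a * A (fst n) (snd n) a b * B (fst p) (snd p) b c)"
    by (simp add: G_def A'_def B'_def C'_def sum_distrib_left mult.assoc)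
   also have "\<dots> = 0"
    using tC[of "fst n" "snd n" "fst p" "snd p" "fst i" "snd i"] n p i ex12[of "gX (fst n)" "gY (snd n)" "gZ (snd p)"]
    by (auto simp: N1_def N2_def)
   finally show ?thesis .
  qed
  hence "G (c, a) = 0"
   using indep_square_right[OF iC fP(3), of G "(c, a)"] fin' card ac by (simp add: card_cartesian_product)
  thus ?thesis by (simp add: G_def)
 qed
 \<comment> \<open>The same with the slices of \<open>B\<close> as the spanning family and with
   \<open>ex13\<close>.\<close>
 have CM: "(\<Sum>a\<in>X'. C' q (c, a) * A' n (a, b)) = 0"
  if n: "n \<in> N1" and q: "q \<in> N3" and bc: "b \<in> Y'" "c \<in> Z'" for n q b c
 proof -
  define G where "G = (\<lambda>r. \<Sum>a\<in>X'. C' q (snd r, a) * A' n (a, fst r))"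
  have "(\<Sum>j\<in>Y' \<times> Z'. B' i j * G j) = 0" if i: "i \<in> Y \<times> Z" for i
  proof -
   have "(\<Sum>j\<in>Y' \<times> Z'. B' i j * G j) = (\<Sum>b\<in>Y'. \<Sum>c\<in>Z'. B' i (b, c) * G (b, c))"
    by (simp add: sum.cartesian_product)
   also have "\<dots> = (\<Sum>b\<in>Y'. \<Sum>c\<in>Z'. \<Sum>a\<in>X'. B (fst i) (snd i) b c * C (fst q) (snd q) c a * A (fst n) (snd n) a b)"
    by (simp add: G_def A'_def B'_def C'_def sum_distrib_left mult.assoc)
   also have "\<dots> = 0"
    using tB[of "fst n" "snd n" "fst i" "snd i" "fst q" "snd q"] n q i ex13[of "gX (fst n)" "gY (snd n)" "gZ (fst q)"]
    by (auto simp: N1_def N3_def)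
   finally show ?thesis .
  qed
  hence "G (b, c) = 0"
   using indep_square_right[OF iB fP(2), of G "(b, c)"] fin' card bc by (simp add: card_cartesian_product)
  thus ?thesis by (simp add: G_def)
 qed
 have "\<exists>v w. v \<le> card Y' \<and> w \<le> card X' \<and> card N2 \<le> v * card Z' \<and> card N3 \<le> w * card Z' \<and>
   card N1 \<le> (card X' - w) * (card Y' - v)"
  by (rule annihilator_count[OF fin' fN indep_subset[OF iA sN(1) fP(1)] indep_subset[OF iB sN(2) fP(2)]
   indep_subset[OF iC sN(3) fP(3)]]) (erule (3) MB, erule (3) CM)
 then obtain v w where vw: "card N2 \<le> v * card Z'" "card N3 \<le> w * card Z'"
   "card N1 \<le> (card X' - w) * (card Y' - v)" by auto
 have c1: "m * m * card N1 = card n1 * (card X * card Y)"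
  unfolding N1_def by (rule fibre_count[OF fin(1,2) sub(1) gX(2) gY(2)])
 have c2: "m * m * card N2 = card n2 * (card Y * card Z)"
  unfolding N2_def by (rule fibre_count[OF fin(2,3) sub(2) gY(2) gZ(2)])
 have c3: "m * m * card N3 = card n3 * (card Z * card X)"
  unfolding N3_def by (rule fibre_count[OF fin(3,1) sub(3) gZ(2) gX(2)])
 have pos: "card X > 0" "card Y > 0" "card Z > 0" using ne fin by (auto simp: card_gt_0_iff)
 \<comment> \<open>The sizes of \<open>n2\<close> and \<open>n3\<close> give
   \<open>v \<ge> card Y / m\<close> and \<open>w \<ge> card X / m\<close>, so
   \<open>card N1\<close> is at most \<open>(1 - 1/m)^2\<close> times
   \<open>card X * card Y\<close>; the size of \<open>n1\<close> demands the factor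
   \<open>1 - 1/m\<close>. Multiplying by \<open>m * m\<close> avoids fractions.\<close>
 have "m * (card Y * card Z) \<le> card n2 * (card Y * card Z)" using cn(2) by (rule mult_le_mono1)
 also have "\<dots> = m * (m * card N2)" using c2 by simp
 also have "\<dots> \<le> m * (m * (v * card Z))" using vw(1) card by simp
 finally have "card Y * card Z \<le> (m * v) * card Z" using m by simp
 hence v: "card Y \<le> m * v" using pos by simp
 have "m * (card Z * card X) \<le> card n3 * (card Z * card X)" using cn(3) by (rule mult_le_mono1)
 also have "\<dots> = m * (m * card N3)" using c3 by simp
 also have "\<dots> \<le> m * (m * (w * card Z))" using vw(2) card by simp
 finally have "card X * card Z \<le> (m * w) * card Z" using m by (simp add: mult.commute)
 hence w: "card X \<le> m * w" using pos by simp
 have "m * (m - 1) * (card X * card Y) \<le> card n1 * (card X * card Y)" using cn(1) by (rule mult_le_mono1)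
 also have "\<dots> = m * m * card N1" using c1 by simp
 also have "\<dots> \<le> m * m * ((card X - w) * (card Y - v))" using vw(3) card by simp
 also have "\<dots> = (m * card X - m * w) * (m * card Y - m * v)" by (simp add: diff_mult_distrib2[symmetric] mult_ac)
 also have "\<dots> \<le> (m * card X - card X) * (m * card Y - card Y)"
  by (rule mult_le_mono) (use v w in auto)
 also have "\<dots> = ((m - 1) * card X) * ((m - 1) * card Y)"
  by (simp only: diff_mult_distrib mult_1)
 also have "\<dots> = (m - 1) * (m - 1) * (card X * card Y)" by (simp only: mult_ac)
 finally have "m * (m - 1) \<le> (m - 1) * (m - 1)" using pos by simp
 thus False using m by simp
qed

section \<open>Closed sets and scale-invariant sets of states\<close>

text \<open>Bolzano-Weierstrass, one coordinate at a time. States are plain functions, so limits are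
  taken coordinatewise throughout; on a finite basis this agrees with convergence in norm.\<close>

lemma pointwise_convergent_subseq:
 fixes f :: "nat \<Rightarrow> 'i \<Rightarrow> complex"
 assumes "finite I" and "\<And>k i. i \<in> I \<Longrightarrow> cmod (f k i) \<le> B i"
 shows "\<exists>\<phi> g. strict_mono \<phi> \<and> (\<forall>i\<in>I. (\<lambda>k. f (\<phi> k) i) \<longlonglongrightarrow> g i)"
 using assms
proof (induction I rule: finite_induct)
 case empty
 show ?case by (intro exI[of _ id]) (auto simp: strict_mono_def)
next
 case (insert i I)
 have "\<And>k i. i \<in> I \<Longrightarrow> cmod (f k i) \<le> B i" using insert.prems by blast
 from insert.IH[OF this] obtain \<phi> g where \<phi>: "strict_mono \<phi>" "\<forall>i\<in>I. (\<lambda>k. f (\<phi> k) i) \<longlonglongrightarrow> g i"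
  by blast
 have "bounded (range (\<lambda>k. f (\<phi> k) i))"
  unfolding bounded_iff by (rule exI[of _ "B i"]) (use insert.prems in blast)
 then obtain l r where r: "strict_mono (r :: nat \<Rightarrow> nat)" "((\<lambda>k. f (\<phi> k) i) \<circ> r) \<longlonglongrightarrow> l"
  using bounded_imp_convergent_subsequence by blast
 have "strict_mono (\<phi> \<circ> r)" using \<phi>(1) r(1) by (rule strict_mono_o)
 moreover have "(\<lambda>k. f ((\<phi> \<circ> r) k) j) \<longlonglongrightarrow> (g(i := l)) j" if j: "j \<in> insert i I" for j
 proof (cases "j = i")
  case True
  thus ?thesis using r(2) by (simp add: o_def)
 next
  case False
  hence "(\<lambda>k. f (\<phi> k) j) \<longlonglongrightarrow> g j" using \<phi>(2) j by blast
  from LIMSEQ_subseq_LIMSEQ[OF this r(1)] show ?thesis using False by (simp add: o_def)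
 qed
 ultimately show ?case by blast
qed

lemma finite_configs: "finite V \<Longrightarrow> finite (configs V d)"
 by (simp add: configs_def finite_PiE)

lemma braket_self: "braket V d \<psi> \<psi> = complex_of_real ((hnorm V d \<psi>)\<^sup>2)"
proof -
 have "cnj z * z = complex_of_real ((cmod z)\<^sup>2)" for z
  by (metis complex_norm_square mult.commute)
 thus ?thesis
  by (simp add: braket_def hnorm_def L2_set_def sum_nonneg)
qed

lemma hnorm_eq_0:
 assumes "finite V"
 shows "hnorm V d \<psi> = 0 \<longleftrightarrow> (\<forall>\<sigma>\<in>configs V d. \<psi> \<sigma> = 0)"
 by (simp add: hnorm_def L2_set_eq_0_iff finite_configs assms)

lemma hnorm_nonneg: "hnorm V d \<psi> \<ge> 0"
 by (simp add: hnorm_def)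

lemma hnorm_scale: "hnorm V d (\<lambda>\<sigma>. c * \<psi> \<sigma>) = cmod c * hnorm V d \<psi>"
 by (simp add: hnorm_def norm_mult L2_set_right_distrib)

lemma hnorm_tendsto:
 assumes "\<And>\<sigma>. (\<lambda>k. f k \<sigma>) \<longlonglongrightarrow> \<psi> \<sigma>"
 shows "(\<lambda>k. hnorm V d (f k)) \<longlonglongrightarrow> hnorm V d \<psi>"
 unfolding hnorm_def L2_set_def by (intro tendsto_intros assms)

lemma braket_tendsto:
 assumes "\<And>\<sigma>. (\<lambda>k. f k \<sigma>) \<longlonglongrightarrow> \<psi> \<sigma>" "\<And>\<sigma>. (\<lambda>k. g k \<sigma>) \<longlonglongrightarrow> \<phi> \<sigma>"
 shows "(\<lambda>k. braket V d (f k) (g k)) \<longlonglongrightarrow> braket V d \<psi> \<phi>"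
 unfolding braket_def by (intro tendsto_intros assms)

lemma norm_le_hnorm:
 assumes "finite V" "\<sigma> \<in> configs V d"
 shows "cmod (\<psi> \<sigma>) \<le> hnorm V d \<psi>"
 unfolding hnorm_def by (rule member_le_L2_set) (use assms finite_configs in auto)

lemma self_adjoint_linear:
 assumes "self_adjoint V d H" "\<phi> \<in> hilb V d" "\<psi> \<in> hilb V d"
 shows "H (\<lambda>\<sigma>. a * \<phi> \<sigma> + b * \<psi> \<sigma>) = (\<lambda>\<sigma>. a * H \<phi> \<sigma> + b * H \<psi> \<sigma>)"
 using assms unfolding self_adjoint_def by blast

text \<open>An operator is given as a linear map on a set of functions. Its expansion in matrix
  elements is what makes it continuous under coordinatewise limits.\<close>

lemma self_adjoint_matrix:
 assumes sa: "self_adjoint V d H" and fin: "finite V" and \<psi>: "\<psi> \<in> hilb V d"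
 shows "H \<psi> \<tau> = (\<Sum>\<rho>\<in>configs V d. \<psi> \<rho> * H (\<lambda>\<sigma>. if \<sigma> = \<rho> then 1 else 0) \<tau>)"
proof -
 let ?e = "\<lambda>\<rho> \<sigma>. if \<sigma> = \<rho> then 1 else (0::complex)"
 have e: "?e \<rho> \<in> hilb V d" if "\<rho> \<in> configs V d" for \<rho>
  using that by (auto simp: hilb_def)
 have *: "(\<lambda>\<sigma>. \<Sum>\<rho>\<in>A. \<psi> \<rho> * ?e \<rho> \<sigma>) \<in> hilb V d \<and>
   H (\<lambda>\<sigma>. \<Sum>\<rho>\<in>A. \<psi> \<rho> * ?e \<rho> \<sigma>) = (\<lambda>\<tau>. \<Sum>\<rho>\<in>A. \<psi> \<rho> * H (?e \<rho>) \<tau>)"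
  if "A \<subseteq> configs V d" for A
 proof -
  have "finite A" using that finite_configs[OF fin] by (rule finite_subset)
  thus ?thesis using that
  proof (induction A rule: finite_induct)
   case empty
   have "H (\<lambda>\<sigma>. 0 * \<psi> \<sigma> + 0 * \<psi> \<sigma>) = (\<lambda>\<sigma>. 0 * H \<psi> \<sigma> + 0 * H \<psi> \<sigma>)"
    using self_adjoint_linear[OF sa \<psi> \<psi>] .
   thus ?case by (simp add: hilb_def)
  next
   case (insert \<rho> A)
   hence r: "\<rho> \<in> configs V d" and ih: "(\<lambda>\<sigma>. \<Sum>\<rho>\<in>A. \<psi> \<rho> * ?e \<rho> \<sigma>) \<in> hilb V d"
     "H (\<lambda>\<sigma>. \<Sum>\<rho>\<in>A. \<psi> \<rho> * ?e \<rho> \<sigma>) = (\<lambda>\<tau>. \<Sum>\<rho>\<in>A. \<psi> \<rho> * H (?e \<rho>) \<tau>)"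
    by blast+
   have eq: "(\<lambda>\<sigma>. \<Sum>\<rho>\<in>insert \<rho> A. \<psi> \<rho> * ?e \<rho> \<sigma>)
     = (\<lambda>\<sigma>. \<psi> \<rho> * ?e \<rho> \<sigma> + 1 * (\<Sum>\<rho>\<in>A. \<psi> \<rho> * ?e \<rho> \<sigma>))"
    by (rule ext) (simp add: insert.hyps)
   have "H (\<lambda>\<sigma>. \<Sum>\<rho>\<in>insert \<rho> A. \<psi> \<rho> * ?e \<rho> \<sigma>) = (\<lambda>\<tau>. \<Sum>\<rho>\<in>insert \<rho> A. \<psi> \<rho> * H (?e \<rho>) \<tau>)"
    unfolding eq self_adjoint_linear[OF sa e[OF r] ih(1)] ih(2)
    by (rule ext) (simp add: insert.hyps)
   moreover have "(\<lambda>\<sigma>. \<Sum>\<rho>\<in>insert \<rho> A. \<psi> \<rho> * ?e \<rho> \<sigma>) \<in> hilb V d"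
    unfolding eq using e[OF r] ih(1) by (simp add: hilb_def)
   ultimately show ?case by blast
  qed
 qed
 have "(\<lambda>\<sigma>. \<Sum>\<rho>\<in>configs V d. \<psi> \<rho> * ?e \<rho> \<sigma>) = \<psi>"
 proof
  fix \<sigma>
  have "(\<Sum>\<rho>\<in>configs V d. \<psi> \<rho> * ?e \<rho> \<sigma>) = (\<Sum>\<rho>\<in>configs V d. if \<sigma> = \<rho> then \<psi> \<rho> else 0)"
   by (rule sum.cong) auto
  also have "\<dots> = (if \<sigma> \<in> configs V d then \<psi> \<sigma> else 0)"
   using finite_configs[OF fin] by simp
  also have "\<dots> = \<psi> \<sigma>" using \<psi> by (auto simp: hilb_def)
  finally show "(\<Sum>\<rho>\<in>configs V d. \<psi> \<rho> * ?e \<rho> \<sigma>) = \<psi> \<sigma>" .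
 qed
 thus ?thesis using conjunct2[OF *[OF order_refl]] by (simp add: fun_eq_iff)
qed

text \<open>Compactness of a closed part of the unit sphere, phrased with sequences: a minimizing
  sequence has a convergent subsequence whose limit stays in \<open>M\<close>.\<close>

lemma attains_minimum:
 fixes g :: "'v state \<Rightarrow> real"
 assumes fin: "finite V" and ne: "M \<noteq> {}"
  and sub: "\<And>\<Psi>. \<Psi> \<in> M \<Longrightarrow> \<Psi> \<in> hilb V d" and nrm: "\<And>\<Psi>. \<Psi> \<in> M \<Longrightarrow> hnorm V d \<Psi> = 1"
  and cl: "\<And>f \<psi>. (\<And>k::nat. f k \<in> M) \<Longrightarrow> (\<And>\<sigma>. (\<lambda>k. f k \<sigma>) \<longlonglongrightarrow> \<psi> \<sigma>) \<Longrightarrow> \<psi> \<in> M"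
  and cont: "\<And>f \<psi>. (\<And>k::nat. f k \<in> M) \<Longrightarrow> \<psi> \<in> M \<Longrightarrow> (\<And>\<sigma>. (\<lambda>k. f k \<sigma>) \<longlonglongrightarrow> \<psi> \<sigma>) \<Longrightarrow> (\<lambda>k. g (f k)) \<longlonglongrightarrow> g \<psi>"
 shows "\<exists>\<Psi>. is_arg_min g (\<lambda>\<Psi>. \<Psi> \<in> M) \<Psi>"
proof -
 \<comment> \<open>No lower bound for \<open>g\<close> is known in advance. The function
   \<open>arctan\<close> is bounded and strictly increasing, so it supplies an infimum and leaves
   the minimizers unchanged.\<close>
 define S where "S = (\<lambda>\<Psi>. arctan (g \<Psi>)) ` M"
 have S: "S \<noteq> {}" "bdd_below S"
  using ne unfolding S_def by (auto intro!: bdd_belowI2[where m = "- (pi / 2)"] less_imp_le[OF arctan_lbound])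
 have "\<exists>\<Psi>\<in>M. arctan (g \<Psi>) < Inf S + inverse (real (Suc k))" for k
  using cInf_lessD[OF S(1), of "Inf S + inverse (real (Suc k))"] by (auto simp: S_def)
 then obtain f where f: "\<And>k. f k \<in> M" "\<And>k. arctan (g (f k)) < Inf S + inverse (real (Suc k))"
  by metis
 have "cmod (f k \<sigma>) \<le> 1" if "\<sigma> \<in> configs V d" for k \<sigma>
  using norm_le_hnorm[OF fin that, of "f k"] nrm[OF f(1)] by simp
 then obtain \<phi> h where \<phi>: "strict_mono (\<phi> :: nat \<Rightarrow> nat)" "\<forall>\<sigma>\<in>configs V d. (\<lambda>k. f (\<phi> k) \<sigma>) \<longlonglongrightarrow> h \<sigma>"
  using pointwise_convergent_subseq[OF finite_configs[OF fin, of d], of f "\<lambda>_. 1"] by blast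
 define \<psi> where "\<psi> = (\<lambda>\<sigma>. if \<sigma> \<in> configs V d then h \<sigma> else 0)"
 have lim: "(\<lambda>k. f (\<phi> k) \<sigma>) \<longlonglongrightarrow> \<psi> \<sigma>" for \<sigma>
 proof (cases "\<sigma> \<in> configs V d")
  case True thus ?thesis using \<phi>(2) by (simp add: \<psi>_def)
 next
  case False
  hence "f k \<sigma> = 0" for k using sub[OF f(1)] by (simp add: hilb_def)
  thus ?thesis using False by (simp add: \<psi>_def)
 qed
 have \<psi>: "\<psi> \<in> M" by (rule cl[of "\<lambda>k. f (\<phi> k)"]) (rule f(1), rule lim)
 have "(\<lambda>k. g (f (\<phi> k))) \<longlonglongrightarrow> g \<psi>" by (rule cont) (rule f(1), rule \<psi>, rule lim)
 hence 1: "(\<lambda>k. arctan (g (f (\<phi> k)))) \<longlonglongrightarrow> arctan (g \<psi>)" by (rule tendsto_arctan)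
 have "(\<lambda>k. Inf S + inverse (real (Suc k))) \<longlonglongrightarrow> Inf S + 0"
  by (intro tendsto_intros LIMSEQ_inverse_real_of_nat)
 from LIMSEQ_subseq_LIMSEQ[OF this \<phi>(1)]
 have 2: "(\<lambda>k. Inf S + inverse (real (Suc (\<phi> k)))) \<longlonglongrightarrow> Inf S" by (simp add: o_def)
 have "arctan (g \<psi>) \<le> Inf S"
  by (rule LIMSEQ_le[OF 1 2]) (use f(2) less_imp_le in blast)
 moreover have "Inf S \<le> arctan (g \<Phi>)" if "\<Phi> \<in> M" for \<Phi>
  by (rule cInf_lower[OF _ S(2)]) (use that in \<open>simp add: S_def\<close>)
 ultimately have "g \<psi> \<le> g \<Phi>" if "\<Phi> \<in> M" for \<Phi>
  using that arctan_le_iff[of "g \<psi>" "g \<Phi>"] order_trans by blast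
 thus ?thesis using \<psi> unfolding is_arg_min_def by (intro exI[of _ \<psi>]) (auto simp: not_less)
qed

lemma always_optimizersI:
 assumes fin: "finite V" and ne: "M \<noteq> {}"
  and sub: "\<And>\<Psi>. \<Psi> \<in> M \<Longrightarrow> \<Psi> \<in> hilb V d" and nrm: "\<And>\<Psi>. \<Psi> \<in> M \<Longrightarrow> hnorm V d \<Psi> = 1"
  and cl: "\<And>f \<psi>. (\<And>k::nat. f k \<in> M) \<Longrightarrow> (\<And>\<sigma>. (\<lambda>k. f k \<sigma>) \<longlonglongrightarrow> \<psi> \<sigma>) \<Longrightarrow> \<psi> \<in> M"
 shows "always_optimizers V d M"
 unfolding always_optimizers_def
proof (intro conjI ballI allI impI)
 fix \<psi>0 assume "\<psi>0 \<in> hilb V d"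
 show "\<exists>\<Psi>. distance_optimizer V d M \<psi>0 \<Psi>"
  unfolding distance_optimizer_def
  by (rule attains_minimum[OF fin ne sub nrm cl]) (assumption | intro tendsto_intros hnorm_tendsto | rule refl)+
 have "\<exists>\<Psi>. is_arg_min (\<lambda>\<Psi>. - cmod (braket V d \<psi>0 \<Psi>)) (\<lambda>\<Psi>. \<Psi> \<in> M) \<Psi>"
  by (rule attains_minimum[OF fin ne sub nrm cl]) (assumption | intro tendsto_intros braket_tendsto | rule refl)+
 thus "\<exists>\<Psi>. overlap_optimizer V d M \<psi>0 \<Psi>"
  by (simp add: overlap_optimizer_def is_arg_min_def is_arg_max_def)
next
 fix H assume H: "self_adjoint V d H"
 have lim: "(\<lambda>k. H (f k) \<sigma>) \<longlonglongrightarrow> H \<psi> \<sigma>"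
  if "\<And>k::nat. f k \<in> M" "\<psi> \<in> M" "\<And>\<sigma>. (\<lambda>k. f k \<sigma>) \<longlonglongrightarrow> \<psi> \<sigma>" for f \<psi> \<sigma>
  unfolding self_adjoint_matrix[OF H fin sub[OF that(1)]] self_adjoint_matrix[OF H fin sub[OF that(2)]]
  by (intro tendsto_intros that)
 show "\<exists>\<Psi>. energy_optimizer V d M H \<Psi>"
  unfolding energy_optimizer_def
  by (rule attains_minimum[OF fin ne sub nrm cl]) (assumption | intro tendsto_intros braket_tendsto lim | rule refl)+
qed

lemma braket_scale: "braket V d \<phi> (\<lambda>\<sigma>. c * \<psi> \<sigma>) = c * braket V d \<phi> \<psi>"
 by (simp add: braket_def sum_distrib_left mult_ac)

lemma braket_cnj: "cnj (braket V d \<phi> \<psi>) = braket V d \<psi> \<phi>"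
 by (simp add: braket_def mult.commute)

lemma braket_diff: "braket V d \<phi> (\<lambda>\<sigma>. \<psi> \<sigma> - \<xi> \<sigma>) = braket V d \<phi> \<psi> - braket V d \<phi> \<xi>"
 by (simp add: braket_def right_diff_distrib sum_subtractf)

lemma braket_add: "braket V d \<phi> (\<lambda>\<sigma>. \<psi> \<sigma> + \<xi> \<sigma>) = braket V d \<phi> \<psi> + braket V d \<phi> \<xi>"
 by (simp add: braket_def distrib_left sum.distrib)

text \<open>The equality case of Cauchy-Schwarz: the part \<open>\<phi>\<close> of
  \<open>\<Psi>\<close> orthogonal to \<open>\<psi>0\<close> has squared norm
  \<open>1 - |c|^2\<close> for the overlap \<open>c\<close>, so it vanishes once \<open>c\<close>
  has modulus at least 1.\<close>

lemma overlap_ge_1: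
 assumes fin: "finite V" and h: "\<psi>0 \<in> hilb V d" "\<Psi> \<in> hilb V d" and n: "hnorm V d \<psi>0 = 1" "hnorm V d \<Psi> = 1"
  and c: "cmod (braket V d \<psi>0 \<Psi>) \<ge> 1"
 shows "\<psi>0 = (\<lambda>\<sigma>. (1 / braket V d \<psi>0 \<Psi>) * \<Psi> \<sigma>)"
proof -
 let ?c = "braket V d \<psi>0 \<Psi>"
 define \<phi> where "\<phi> = (\<lambda>\<sigma>. \<Psi> \<sigma> - ?c * \<psi>0 \<sigma>)"
 have 0: "braket V d \<xi> \<phi> = braket V d \<xi> \<Psi> - ?c * braket V d \<xi> \<psi>0" for \<xi>
  by (simp add: \<phi>_def braket_diff braket_scale)
 have z: "braket V d \<phi> \<psi>0 = 0"
  using 0[of \<psi>0] braket_cnj[of V d \<psi>0 \<phi>] by (simp add: braket_self n)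
 have "braket V d \<phi> \<phi> = cnj (braket V d \<Psi> \<phi>)"
  using 0[of \<phi>] z by (simp add: braket_cnj)
 also have "\<dots> = 1 - ?c * cnj ?c"
  using 0[of \<Psi>] by (simp add: braket_self n braket_cnj mult.commute)
 finally have "complex_of_real ((hnorm V d \<phi>)\<^sup>2) = complex_of_real (1 - (cmod ?c)\<^sup>2)"
  by (simp add: braket_self flip: complex_norm_square)
 hence "(hnorm V d \<phi>)\<^sup>2 = 1 - (cmod ?c)\<^sup>2" by (simp only: of_real_eq_iff)
 also have "\<dots> \<le> 0" using c by (simp add: one_le_power)
 finally have "hnorm V d \<phi> = 0" by simp
 hence 0: "\<forall>\<sigma>\<in>configs V d. \<phi> \<sigma> = 0" by (simp add: hnorm_eq_0[OF fin])
 have "?c \<noteq> 0" using c by auto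
 show ?thesis
 proof
  fix \<sigma>
  show "\<psi>0 \<sigma> = (1 / ?c) * \<Psi> \<sigma>"
  proof (cases "\<sigma> \<in> configs V d")
   case True thus ?thesis using 0 \<open>?c \<noteq> 0\<close> by (simp add: \<phi>_def)
  next
   case False thus ?thesis using h by (simp add: hilb_def)
  qed
 qed
qed

text \<open>The best possible values, distance 0 and overlap 1, are approached along
  \<open>f\<close>, while an element attaining either would have \<open>\<psi>0\<close> as a
  multiple. The energy of minus the projector onto \<open>\<psi>0\<close> is minus the squared
  overlap, which carries the conclusion over to problem (II).\<close>

lemma lacks_optimizersI:
 assumes fin: "finite V" and sub: "\<And>\<Psi>. \<Psi> \<in> M \<Longrightarrow> \<Psi> \<in> hilb V d" and nrm: "\<And>\<Psi>. \<Psi> \<in> M \<Longrightarrow> hnorm V d \<Psi> = 1"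
  and \<psi>0: "\<psi>0 \<in> hilb V d" "hnorm V d \<psi>0 = 1"
  and notin: "\<And>\<Psi> c. \<Psi> \<in> M \<Longrightarrow> \<psi>0 \<noteq> (\<lambda>\<sigma>. c * \<Psi> \<sigma>)"
  and f: "\<And>k::nat. f k \<in> M" "\<And>\<sigma>. (\<lambda>k. f k \<sigma>) \<longlonglongrightarrow> \<psi>0 \<sigma>"
 shows "lacks_optimizers V d M"
proof -
 have lt: "\<not> 1 \<le> cmod (braket V d \<psi>0 \<Psi>)" if "\<Psi> \<in> M" for \<Psi>
  using overlap_ge_1[OF fin \<psi>0(1) sub[OF that] \<psi>0(2) nrm[OF that]] notin[OF that] by blast
 have lim: "(\<lambda>k. cmod (braket V d \<psi>0 (f k))) \<longlonglongrightarrow> cmod (braket V d \<psi>0 \<psi>0)"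
  by (intro tendsto_intros braket_tendsto f)
 have one: "cmod (braket V d \<psi>0 \<psi>0) = 1" by (simp add: braket_self \<psi>0)
 have dist: "\<not> distance_optimizer V d M \<psi>0 \<Psi>" for \<Psi>
 proof
  assume "distance_optimizer V d M \<psi>0 \<Psi>"
  hence P: "\<Psi> \<in> M" "\<And>\<Phi>. \<Phi> \<in> M \<Longrightarrow> (hnorm V d (\<lambda>\<sigma>. \<Psi> \<sigma> - \<psi>0 \<sigma>))\<^sup>2 \<le> (hnorm V d (\<lambda>\<sigma>. \<Phi> \<sigma> - \<psi>0 \<sigma>))\<^sup>2"
   by (auto simp: distance_optimizer_def is_arg_min_def not_less)
  have "(\<lambda>k. (hnorm V d (\<lambda>\<sigma>. f k \<sigma> - \<psi>0 \<sigma>))\<^sup>2) \<longlonglongrightarrow> (hnorm V d (\<lambda>\<sigma>. \<psi>0 \<sigma> - \<psi>0 \<sigma>))\<^sup>2"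
   by (intro tendsto_intros hnorm_tendsto f)
  hence "(hnorm V d (\<lambda>\<sigma>. \<Psi> \<sigma> - \<psi>0 \<sigma>))\<^sup>2 \<le> (hnorm V d (\<lambda>\<sigma>. \<psi>0 \<sigma> - \<psi>0 \<sigma>))\<^sup>2"
   by (rule LIMSEQ_le_const) (use P(2)[OF f(1)] in blast)
  also have "\<dots> = 0" by (simp add: hnorm_def L2_set_def)
  finally have "hnorm V d (\<lambda>\<sigma>. \<Psi> \<sigma> - \<psi>0 \<sigma>) = 0" by simp
  hence "\<forall>\<sigma>\<in>configs V d. \<Psi> \<sigma> - \<psi>0 \<sigma> = 0" by (simp add: hnorm_eq_0[OF fin])
  hence "\<psi>0 \<sigma> = 1 * \<Psi> \<sigma>" for \<sigma>
   using \<psi>0(1) sub[OF P(1)] by (cases "\<sigma> \<in> configs V d") (auto simp: hilb_def)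
  thus False using notin[OF P(1), of 1] by (simp add: fun_eq_iff)
 qed
 have ov: "\<not> overlap_optimizer V d M \<psi>0 \<Psi>" for \<Psi>
 proof
  assume "overlap_optimizer V d M \<psi>0 \<Psi>"
  hence P: "\<Psi> \<in> M" "\<And>\<Phi>. \<Phi> \<in> M \<Longrightarrow> cmod (braket V d \<psi>0 \<Phi>) \<le> cmod (braket V d \<psi>0 \<Psi>)"
   by (auto simp: overlap_optimizer_def is_arg_max_def not_less)
  have "cmod (braket V d \<psi>0 \<psi>0) \<le> cmod (braket V d \<psi>0 \<Psi>)"
   by (rule LIMSEQ_le_const2[OF lim]) (use P(2)[OF f(1)] in blast)
  thus False using lt[OF P(1)] one by simp
 qed
 define H where "H = (\<lambda>\<phi> \<sigma>. - braket V d \<psi>0 \<phi> * \<psi>0 \<sigma>)"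
 have HH: "braket V d \<phi> (H \<psi>) = - braket V d \<psi>0 \<psi> * cnj (braket V d \<psi>0 \<phi>)" for \<phi> \<psi>
  by (simp only: H_def braket_scale braket_cnj)
 have "self_adjoint V d H"
  unfolding self_adjoint_def
 proof (intro conjI ballI allI)
  show "H \<psi> \<in> hilb V d" for \<psi> using \<psi>0(1) by (simp add: H_def hilb_def)
  show "H (\<lambda>\<sigma>. a * \<phi> \<sigma> + b * \<psi> \<sigma>) = (\<lambda>\<sigma>. a * H \<phi> \<sigma> + b * H \<psi> \<sigma>)" for a b \<phi> \<psi>
  proof -
   have "braket V d \<psi>0 (\<lambda>\<sigma>. a * \<phi> \<sigma> + b * \<psi> \<sigma>) = a * braket V d \<psi>0 \<phi> + b * braket V d \<psi>0 \<psi>"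
    by (simp only: braket_add braket_scale)
   thus ?thesis by (simp add: H_def algebra_simps)
  qed
  show "braket V d \<phi> (H \<psi>) = braket V d (H \<phi>) \<psi>" for \<phi> \<psi>
  proof -
   have "braket V d (H \<phi>) \<psi> = cnj (braket V d \<psi> (H \<phi>))" by (simp only: braket_cnj)
   thus ?thesis by (simp add: HH)
  qed
 qed
 moreover have "\<not> energy_optimizer V d M H \<Psi>" for \<Psi>
 proof
  have E: "Re (braket V d \<Phi> (H \<Phi>)) = - (cmod (braket V d \<psi>0 \<Phi>))\<^sup>2" for \<Phi>
   by (simp add: HH cmod_power2 flip: power2_eq_square)
  assume "energy_optimizer V d M H \<Psi>"
  hence P: "\<Psi> \<in> M" "\<And>\<Phi>. \<Phi> \<in> M \<Longrightarrow> (cmod (braket V d \<psi>0 \<Phi>))\<^sup>2 \<le> (cmod (braket V d \<psi>0 \<Psi>))\<^sup>2"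
   by (auto simp: energy_optimizer_def is_arg_min_def not_less E)
  have "cmod (braket V d \<psi>0 \<Phi>) \<le> cmod (braket V d \<psi>0 \<Psi>)" if "\<Phi> \<in> M" for \<Phi>
   using P(2)[OF that] by (rule power2_le_imp_le) simp
  hence "cmod (braket V d \<psi>0 \<psi>0) \<le> cmod (braket V d \<psi>0 \<Psi>)"
   by (intro LIMSEQ_le_const2[OF lim]) (use f(1) in blast)
  thus False using lt[OF P(1)] one by simp
 qed
 ultimately show ?thesis unfolding lacks_optimizers_def using \<psi>0 dist ov by blast
qed

text \<open>Network states before normalization form a cone \<open>C\<close>, in which limits are
  easier to handle. The norms converge to the positive norm of \<open>\<Phi>0\<close>, so from an
  index \<open>K\<close> on the approximants can be normalized.\<close>

lemma lacks_optimizers_cone: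
 fixes C :: "'v state \<Rightarrow> bool"
 assumes fin: "finite V" and M: "M = {\<Psi>. hnorm V d \<Psi> = 1 \<and> C \<Psi>}"
  and C: "\<And>\<Psi>. C \<Psi> \<Longrightarrow> \<Psi> \<in> hilb V d" "\<And>\<Psi> c. C \<Psi> \<Longrightarrow> C (\<lambda>\<sigma>. c * \<Psi> \<sigma>)"
  and \<Phi>: "\<And>k::nat. C (\<Phi> k)" "\<And>\<sigma>. (\<lambda>k. \<Phi> k \<sigma>) \<longlonglongrightarrow> \<Phi>0 \<sigma>"
  and nz: "\<Phi>0 \<rho> \<noteq> 0" and notin: "\<not> C \<Phi>0"
 shows "lacks_optimizers V d M"
proof -
 have h0: "\<Phi>0 \<in> hilb V d"
 proof -
  have "\<Phi>0 \<sigma> = 0" if "\<sigma> \<notin> configs V d" for \<sigma>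
  proof -
   have "\<Phi> k \<sigma> = 0" for k using C(1)[OF \<Phi>(1)] that by (simp add: hilb_def)
   thus ?thesis using \<Phi>(2)[of \<sigma>] by (simp add: LIMSEQ_const_iff)
  qed
  thus ?thesis by (simp add: hilb_def)
 qed
 have "\<rho> \<in> configs V d" using h0 nz by (auto simp: hilb_def)
 hence pos: "hnorm V d \<Phi>0 > 0"
  using nz hnorm_eq_0[OF fin, of d \<Phi>0] hnorm_nonneg[of V d \<Phi>0] by fastforce
 have lim: "(\<lambda>k. hnorm V d (\<Phi> k)) \<longlonglongrightarrow> hnorm V d \<Phi>0" by (rule hnorm_tendsto[OF \<Phi>(2)])
 obtain K where K: "\<And>k. k \<ge> K \<Longrightarrow> hnorm V d (\<Phi> k) > 0"
  using order_tendstoD(1)[OF lim pos] unfolding eventually_sequentially by blast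
 define f where "f = (\<lambda>k \<sigma>. complex_of_real (1 / hnorm V d (\<Phi> (k + K))) * \<Phi> (k + K) \<sigma>)"
 define \<psi>0 where "\<psi>0 = (\<lambda>\<sigma>. complex_of_real (1 / hnorm V d \<Phi>0) * \<Phi>0 \<sigma>)"
 show ?thesis
 proof (rule lacks_optimizersI[OF fin])
  show "\<Psi> \<in> hilb V d" "hnorm V d \<Psi> = 1" if "\<Psi> \<in> M" for \<Psi>
   using that C(1) unfolding M by auto
  show "\<psi>0 \<in> hilb V d" using h0 by (simp add: \<psi>0_def hilb_def)
  show "hnorm V d \<psi>0 = 1" unfolding \<psi>0_def hnorm_scale using pos by (simp add: norm_divide)
  show "f k \<in> M" for k
  proof -
   have "hnorm V d (f k) = 1" unfolding f_def hnorm_scale using K[of "k + K"] by (simp add: norm_divide)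
   moreover have "C (f k)" unfolding f_def by (rule C(2)[OF \<Phi>(1)])
   ultimately show ?thesis unfolding M by blast
  qed
  show "(\<lambda>k. f k \<sigma>) \<longlonglongrightarrow> \<psi>0 \<sigma>" for \<sigma>
   unfolding f_def \<psi>0_def
   by (intro tendsto_intros LIMSEQ_ignore_initial_segment[OF lim] LIMSEQ_ignore_initial_segment[OF \<Phi>(2)])
    (use pos in simp)
  show "\<psi>0 \<noteq> (\<lambda>\<sigma>. c * \<Psi> \<sigma>)" if "\<Psi> \<in> M" for \<Psi> c
  proof
   assume e: "\<psi>0 = (\<lambda>\<sigma>. c * \<Psi> \<sigma>)"
   have "C (\<lambda>\<sigma>. (complex_of_real (hnorm V d \<Phi>0) * c) * \<Psi> \<sigma>)" using that unfolding M by (intro C(2)) blast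
   moreover have "(\<lambda>\<sigma>. (complex_of_real (hnorm V d \<Phi>0) * c) * \<Psi> \<sigma>) = \<Phi>0"
   proof
    fix \<sigma>
    have "c * \<Psi> \<sigma> = complex_of_real (1 / hnorm V d \<Phi>0) * \<Phi>0 \<sigma>"
     using fun_cong[OF e, of \<sigma>] by (simp add: \<psi>0_def)
    thus "(complex_of_real (hnorm V d \<Phi>0) * c) * \<Psi> \<sigma> = \<Phi>0 \<sigma>" using pos by (simp add: mult.assoc)
   qed
   ultimately show False using notin by simp
  qed
 qed
qed

section \<open>Contraction to a triangle\<close>

lemma sum_PiE_Un:
 assumes "A \<inter> B = {}"
 shows "(\<Sum>n\<in>PiE (A \<union> B) F. f n) = (\<Sum>a\<in>PiE A F. \<Sum>b\<in>PiE B F. f (\<lambda>i. if i \<in> A then a i else b i))"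
proof -
 have "(\<Sum>a\<in>PiE A F. \<Sum>b\<in>PiE B F. f (\<lambda>i. if i \<in> A then a i else b i))
   = (\<Sum>p\<in>PiE A F \<times> PiE B F. f (\<lambda>i. if i \<in> A then fst p i else snd p i))"
  by (simp add: sum.cartesian_product case_prod_unfold)
 also have "\<dots> = (\<Sum>n\<in>PiE (A \<union> B) F. f n)"
 proof (rule sum.reindex_bij_witness[of _ "\<lambda>n. (restrict n A, restrict n B)" "\<lambda>p i. if i \<in> A then fst p i else snd p i"])
  fix p assume "p \<in> PiE A F \<times> PiE B F"
  then obtain a b where p: "p = (a, b)" "a \<in> PiE A F" "b \<in> PiE B F" by auto
  show "(restrict (\<lambda>i. if i \<in> A then fst p i else snd p i) A, restrict (\<lambda>i. if i \<in> A then fst p i else snd p i) B) = p"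
  proof -
   have "restrict (\<lambda>i. if i \<in> A then a i else b i) A = a"
    using p(2) by (auto simp: fun_eq_iff restrict_def PiE_def extensional_def)
   moreover have "restrict (\<lambda>i. if i \<in> A then a i else b i) B = b"
    using p(3) assms by (auto simp: fun_eq_iff restrict_def PiE_def extensional_def)
   ultimately show ?thesis by (simp only: p(1) fst_conv snd_conv)
  qed
  show "(\<lambda>i. if i \<in> A then fst p i else snd p i) \<in> PiE (A \<union> B) F"
   using p by (auto simp: PiE_def Pi_def extensional_def)
 next
  fix n assume n: "n \<in> PiE (A \<union> B) F"
  show "(\<lambda>i. if i \<in> A then fst (restrict n A, restrict n B) i else snd (restrict n A, restrict n B) i) = n"
   using n by (auto simp: fun_eq_iff restrict_def PiE_def extensional_def)
  show "(restrict n A, restrict n B) \<in> PiE A F \<times> PiE B F" using n by auto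
 qed auto
 finally show ?thesis by simp
qed

definition graph_edges :: "'v set \<Rightarrow> 'v set set \<Rightarrow> bool" where
 "graph_edges V E \<longleftrightarrow> finite V \<and> (\<forall>e\<in>E. e \<subseteq> V \<and> card e = 2)"

lemma graph_edges_finite: "graph_edges V E \<Longrightarrow> finite E"
 unfolding graph_edges_def by (rule finite_subset[of _ "Pow V"]) auto

lemma edge_two:
 assumes "graph_edges V E" "e \<in> E"
 shows "\<exists>u v. e = {u, v} \<and> u \<noteq> v \<and> u \<in> V \<and> v \<in> V"
proof -
 have "e \<subseteq> V" "card e = 2" using assms by (auto simp: graph_edges_def)
 then obtain u v where "e = {u, v}" "u \<noteq> v" unfolding card_2_iff by blast
 with \<open>e \<subseteq> V\<close> show ?thesis by (intro exI[of _ u] exI[of _ v]) simp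
qed

lemma sum_product3:
 "(\<Sum>a\<in>A. \<Sum>b\<in>B. \<Sum>c\<in>C. f a * g b * h c) = (\<Sum>a\<in>A. f a) * (\<Sum>b\<in>B. g b) * (\<Sum>c\<in>C. h c :: complex)"
 by (simp only: sum_distrib_left[symmetric] sum_distrib_right[symmetric])

lemma network_graph: "network G \<Longrightarrow> graph_edges (verts G) (edges G)"
 by (simp add: network_def graph_edges_def)

definition peps_cone :: "'v network \<Rightarrow> 'v state \<Rightarrow> bool" where
 "peps_cone G \<Psi> \<longleftrightarrow> (\<exists>A. \<Psi> = peps_vec G A)"

lemma PEPS_cone: "PEPS G = {\<Psi>. hnorm (verts G) (sdim G) \<Psi> = 1 \<and> peps_cone G \<Psi>}"
 by (simp add: PEPS_def peps_cone_def)

lemma vec_of_hilb: "vec_of V d f \<in> hilb V d"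
 by (simp add: vec_of_def hilb_def)

lemma peps_cone_hilb: "peps_cone G \<Psi> \<Longrightarrow> \<Psi> \<in> hilb (verts G) (sdim G)"
 by (auto simp: peps_cone_def peps_vec_def vec_of_hilb)

lemma peps_cone_scale:
 assumes "finite (verts G)" "verts G \<noteq> {}" "peps_cone G \<Psi>"
 shows "peps_cone G (\<lambda>\<sigma>. c * \<Psi> \<sigma>)"
proof -
 obtain A where A: "\<Psi> = peps_vec G A" using assms(3) by (auto simp: peps_cone_def)
 obtain v where v: "v \<in> verts G" using assms(2) by blast
 define A' where "A' = (\<lambda>i s n. (if i = v then c else 1) * A i s n)"
 have "(\<Prod>i\<in>verts G. A' i (\<sigma> i) (restrict n (inc G i))) = c * (\<Prod>i\<in>verts G. A i (\<sigma> i) (restrict n (inc G i)))" for \<sigma> n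
  using assms(1) v by (simp add: A'_def prod.distrib)
 hence "(\<lambda>\<sigma>. c * \<Psi> \<sigma>) = peps_vec G A'"
  by (simp add: A peps_vec_def vec_of_def fun_eq_iff sum_distrib_left)
 thus ?thesis by (auto simp: peps_cone_def)
qed

definition class_edges :: "'v network \<Rightarrow> ('v \<Rightarrow> nat) \<Rightarrow> nat \<Rightarrow> nat \<Rightarrow> 'v set set" where
 "class_edges G cl i j = {e \<in> edges G. cl ` e = {i, j}}"

definition bond_configs :: "'v network \<Rightarrow> 'v set set \<Rightarrow> ('v set \<Rightarrow> nat) set" where
 "bond_configs G E = PiE E (\<lambda>e. {1..bdim G e})"

definition class_verts :: "'v network \<Rightarrow> ('v \<Rightarrow> nat) \<Rightarrow> nat \<Rightarrow> 'v set" where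
 "class_verts G cl i = {v \<in> verts G. cl v = i}"

text \<open>Summing over the bonds inside each class of sites leaves three tensors joined by the
  bonds between classes. With three classes every bond between different classes lies on one of the
  three sides.\<close>

lemma peps_triangle:
 assumes G: "graph_edges (verts G) (edges G)" and cl: "\<And>v. v \<in> verts G \<Longrightarrow> cl v < 3"
 shows "\<exists>T0 T1 T2. \<forall>\<sigma>\<in>configs (verts G) (sdim G). peps_vec G A \<sigma> =
  (\<Sum>x\<in>bond_configs G (class_edges G cl 2 0). \<Sum>y\<in>bond_configs G (class_edges G cl 0 1). \<Sum>z\<in>bond_configs G (class_edges G cl 1 2).
   T0 (restrict \<sigma> (class_verts G cl 0)) x y * T1 (restrict \<sigma> (class_verts G cl 1)) y z * (T2 (restrict \<sigma> (class_verts G cl 2)) z x :: complex))"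
proof -
 define E where "E i j = class_edges G cl i j" for i j
 define V where "V i = class_verts G cl i" for i
 define F where "F = (\<lambda>e. {1..bdim G e})"
 have fV: "finite (verts G)" using G by (simp add: graph_edges_def)
 have VU: "verts G = V 0 \<union> V 1 \<union> V 2"
 proof -
  have "v \<in> V 0 \<union> V 1 \<union> V 2" if "v \<in> verts G" for v
   using cl[OF that] that by (cases "cl v = 0"; cases "cl v = 1") (auto simp: V_def class_verts_def)
  thus ?thesis by (auto simp: V_def class_verts_def)
 qed
 have Vd: "V 0 \<inter> V 1 = {}" "(V 0 \<union> V 1) \<inter> V 2 = {}" by (auto simp: V_def class_verts_def)
 have Vf: "finite (V i)" for i using fV by (simp add: V_def class_verts_def)
 have Edge: "\<exists>i<3. \<exists>j<3. cl ` e = {i, j}" if e: "e \<in> edges G" for e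
 proof -
  obtain u v where "e = {u, v}" "u \<in> verts G" "v \<in> verts G" using edge_two[OF G e] by blast
  thus ?thesis using cl by (intro exI[of _ "cl u"] exI[of _ "cl v"] conjI) simp_all
 qed
 have EU: "edges G = E 2 0 \<union> (E 0 1 \<union> (E 1 2 \<union> (E 0 0 \<union> (E 1 1 \<union> E 2 2))))"
 proof -
  have "e \<in> E 2 0 \<union> (E 0 1 \<union> (E 1 2 \<union> (E 0 0 \<union> (E 1 1 \<union> E 2 2))))" if e: "e \<in> edges G" for e
  proof -
   obtain i j where ij: "i < 3" "j < 3" "cl ` e = {i, j}" using Edge[OF e] by blast
   have "i = 0 \<or> i = 1 \<or> i = 2" "j = 0 \<or> j = 1 \<or> j = 2" using ij by auto
   moreover have "e \<in> E i j" "e \<in> E j i" using e ij(3) by (simp_all add: E_def class_edges_def insert_commute)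
   ultimately show ?thesis by (elim disjE) simp_all
  qed
  moreover have "E i j \<subseteq> edges G" for i j by (auto simp: E_def class_edges_def)
  ultimately show ?thesis by (intro equalityI subsetI) blast+
 qed
 have disj: "E i j \<inter> E k l = {}" if "{i, j} \<noteq> {k, l}" for i j k l
  using that by (auto simp: E_def class_edges_def)
 have Ed: "E 2 0 \<inter> (E 0 1 \<union> (E 1 2 \<union> (E 0 0 \<union> (E 1 1 \<union> E 2 2)))) = {}"
  "E 0 1 \<inter> (E 1 2 \<union> (E 0 0 \<union> (E 1 1 \<union> E 2 2))) = {}" "E 1 2 \<inter> (E 0 0 \<union> (E 1 1 \<union> E 2 2)) = {}"
  "E 0 0 \<inter> (E 1 1 \<union> E 2 2) = {}" "E 1 1 \<inter> E 2 2 = {}"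
  by (simp_all add: Int_Un_distrib disj doubleton_eq_iff)
 have incE: "e \<in> inc G v \<Longrightarrow> v \<in> V i \<Longrightarrow> e \<in> E j k \<Longrightarrow> i = j \<or> i = k" for e v i j k
  by (auto simp: inc_def V_def class_verts_def E_def class_edges_def)
 define mg where "mg x y k = (\<lambda>e. if e \<in> x then y e else k e)" for x :: "'a set set" and y k :: "'a set \<Rightarrow> nat"
 \<comment> \<open>The tensor of class 0 gets the bonds to classes 2 and 1 and sums over its inner
   bonds. All other bonds are left out of its arguments, since no site of class 0 is incident to
   them.\<close>
 define T0 where "T0 s x y = (\<Sum>k\<in>PiE (E 0 0) F. \<Prod>v\<in>V 0. A v (s v) (restrict (mg (E 2 0) x (mg (E 0 1) y k)) (inc G v)))" for s x y
 define T1 where "T1 s y z = (\<Sum>k\<in>PiE (E 1 1) F. \<Prod>v\<in>V 1. A v (s v) (restrict (mg (E 0 1) y (mg (E 1 2) z k)) (inc G v)))" for s y z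
 define T2 where "T2 s z x = (\<Sum>k\<in>PiE (E 2 2) F. \<Prod>v\<in>V 2. A v (s v) (restrict (mg (E 2 0) x (mg (E 1 2) z k)) (inc G v)))" for s z x
 have main: "peps_vec G A \<sigma> = (\<Sum>x\<in>PiE (E 2 0) F. \<Sum>y\<in>PiE (E 0 1) F. \<Sum>z\<in>PiE (E 1 2) F.
   T0 (restrict \<sigma> (V 0)) x y * T1 (restrict \<sigma> (V 1)) y z * T2 (restrict \<sigma> (V 2)) z x)"
  if \<sigma>: "\<sigma> \<in> configs (verts G) (sdim G)" for \<sigma>
 proof -
  define w where "w v n = A v (\<sigma> v) (restrict n (inc G v))" for v n
  have wc: "w v n = w v n'" if "\<And>e. e \<in> inc G v \<Longrightarrow> n e = n' e" for v n n'
  proof -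
   have "restrict n (inc G v) = restrict n' (inc G v)" using that by (auto simp: restrict_def)
   thus ?thesis by (simp add: w_def)
  qed
  have "peps_vec G A \<sigma> = (\<Sum>n\<in>PiE (edges G) F. \<Prod>v\<in>verts G. w v n)"
   using \<sigma> by (simp add: peps_vec_def vec_of_def F_def w_def)
  also have "\<dots> = (\<Sum>x\<in>PiE (E 2 0) F. \<Sum>y\<in>PiE (E 0 1) F. \<Sum>z\<in>PiE (E 1 2) F.
    \<Sum>k0\<in>PiE (E 0 0) F. \<Sum>k1\<in>PiE (E 1 1) F. \<Sum>k2\<in>PiE (E 2 2) F.
     \<Prod>v\<in>verts G. w v (mg (E 2 0) x (mg (E 0 1) y (mg (E 1 2) z (mg (E 0 0) k0 (mg (E 1 1) k1 k2))))))"
   unfolding EU sum_PiE_Un[OF Ed(1)] sum_PiE_Un[OF Ed(2)] sum_PiE_Un[OF Ed(3)] sum_PiE_Un[OF Ed(4)] sum_PiE_Un[OF Ed(5)] mg_def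
   by (rule refl)
  also have "\<dots> = (\<Sum>x\<in>PiE (E 2 0) F. \<Sum>y\<in>PiE (E 0 1) F. \<Sum>z\<in>PiE (E 1 2) F.
    \<Sum>k0\<in>PiE (E 0 0) F. \<Sum>k1\<in>PiE (E 1 1) F. \<Sum>k2\<in>PiE (E 2 2) F.
     (\<Prod>v\<in>V 0. w v (mg (E 2 0) x (mg (E 0 1) y k0))) * (\<Prod>v\<in>V 1. w v (mg (E 0 1) y (mg (E 1 2) z k1))) *
     (\<Prod>v\<in>V 2. w v (mg (E 2 0) x (mg (E 1 2) z k2))))"
  proof (intro sum.cong refl)
   fix x y z k0 k1 k2
   let ?n = "mg (E 2 0) x (mg (E 0 1) y (mg (E 1 2) z (mg (E 0 0) k0 (mg (E 1 1) k1 k2))))"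
   have "(\<Prod>v\<in>verts G. w v ?n) = (\<Prod>v\<in>V 0. w v ?n) * (\<Prod>v\<in>V 1. w v ?n) * (\<Prod>v\<in>V 2. w v ?n)"
    unfolding VU prod.union_disjoint[OF finite_UnI[OF Vf Vf] Vf Vd(2)] prod.union_disjoint[OF Vf Vf Vd(1)]
    by (rule refl)
   moreover have "(\<Prod>v\<in>V 0. w v ?n) = (\<Prod>v\<in>V 0. w v (mg (E 2 0) x (mg (E 0 1) y k0)))"
   proof (intro prod.cong refl wc)
    fix v e assume ve: "v \<in> V 0" "e \<in> inc G v"
    have "e \<notin> E 1 2" "e \<notin> E 1 1" "e \<notin> E 2 2" using incE[OF ve(2,1)] by fastforce+
    moreover have "e \<in> edges G" using ve by (simp add: inc_def)
    ultimately show "?n e = mg (E 2 0) x (mg (E 0 1) y k0) e" using EU by (auto simp: mg_def)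
   qed
   moreover have "(\<Prod>v\<in>V 1. w v ?n) = (\<Prod>v\<in>V 1. w v (mg (E 0 1) y (mg (E 1 2) z k1)))"
   proof (intro prod.cong refl wc)
    fix v e assume ve: "v \<in> V 1" "e \<in> inc G v"
    have "e \<notin> E 2 0" "e \<notin> E 0 0" "e \<notin> E 2 2" using incE[OF ve(2,1)] by fastforce+
    moreover have "e \<in> edges G" using ve by (simp add: inc_def)
    ultimately show "?n e = mg (E 0 1) y (mg (E 1 2) z k1) e" using EU by (auto simp: mg_def)
   qed
   moreover have "(\<Prod>v\<in>V 2. w v ?n) = (\<Prod>v\<in>V 2. w v (mg (E 2 0) x (mg (E 1 2) z k2)))"
   proof (intro prod.cong refl wc)
    fix v e assume ve: "v \<in> V 2" "e \<in> inc G v"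
    have "e \<notin> E 0 1" "e \<notin> E 0 0" "e \<notin> E 1 1" using incE[OF ve(2,1)] by fastforce+
    moreover have "e \<in> edges G" using ve by (simp add: inc_def)
    ultimately show "?n e = mg (E 2 0) x (mg (E 1 2) z k2) e" using EU by (auto simp: mg_def)
   qed
   ultimately show "(\<Prod>v\<in>verts G. w v ?n) = (\<Prod>v\<in>V 0. w v (mg (E 2 0) x (mg (E 0 1) y k0))) *
     (\<Prod>v\<in>V 1. w v (mg (E 0 1) y (mg (E 1 2) z k1))) * (\<Prod>v\<in>V 2. w v (mg (E 2 0) x (mg (E 1 2) z k2)))"
    by (simp only:)
  qed
  also have "\<dots> = (\<Sum>x\<in>PiE (E 2 0) F. \<Sum>y\<in>PiE (E 0 1) F. \<Sum>z\<in>PiE (E 1 2) F.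
   T0 (restrict \<sigma> (V 0)) x y * T1 (restrict \<sigma> (V 1)) y z * T2 (restrict \<sigma> (V 2)) z x)"
  proof (intro sum.cong refl)
   fix x y z
   have t0: "T0 (restrict \<sigma> (V 0)) x y = (\<Sum>k\<in>PiE (E 0 0) F. \<Prod>v\<in>V 0. w v (mg (E 2 0) x (mg (E 0 1) y k)))"
    unfolding T0_def w_def by (intro sum.cong prod.cong refl) simp
   have t1: "T1 (restrict \<sigma> (V 1)) y z = (\<Sum>k\<in>PiE (E 1 1) F. \<Prod>v\<in>V 1. w v (mg (E 0 1) y (mg (E 1 2) z k)))"
    unfolding T1_def w_def by (intro sum.cong prod.cong refl) simp
   have t2: "T2 (restrict \<sigma> (V 2)) z x = (\<Sum>k\<in>PiE (E 2 2) F. \<Prod>v\<in>V 2. w v (mg (E 2 0) x (mg (E 1 2) z k)))"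
    unfolding T2_def w_def by (intro sum.cong prod.cong refl) simp
   show "(\<Sum>k0\<in>PiE (E 0 0) F. \<Sum>k1\<in>PiE (E 1 1) F. \<Sum>k2\<in>PiE (E 2 2) F.
     (\<Prod>v\<in>V 0. w v (mg (E 2 0) x (mg (E 0 1) y k0))) * (\<Prod>v\<in>V 1. w v (mg (E 0 1) y (mg (E 1 2) z k1))) *
     (\<Prod>v\<in>V 2. w v (mg (E 2 0) x (mg (E 1 2) z k2)))) =
     T0 (restrict \<sigma> (V 0)) x y * T1 (restrict \<sigma> (V 1)) y z * T2 (restrict \<sigma> (V 2)) z x"
    unfolding t0 t1 t2 by (rule sum_product3)
  qed
  finally show ?thesis .
 qed
 show ?thesis
  by (intro exI[of _ T0] exI[of _ T1] exI[of _ T2] ballI)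
   (use main in \<open>simp add: E_def V_def F_def bond_configs_def\<close>)
qed

lemma card_bond_configs:
 assumes "finite E" shows "card (bond_configs G E) = (\<Prod>e\<in>E. bdim G e)"
 using assms by (simp add: bond_configs_def card_PiE)

lemma finite_bond_configs: "finite E \<Longrightarrow> finite (bond_configs G E)"
 by (simp add: bond_configs_def finite_PiE)

text \<open>Functionals on the three classes, applied to a triangle, give a triangle with the same
  bond sets. A candidate state is therefore excluded as soon as suitable functionals turn it into
  the forbidden tensor, whatever the dimensions of the sites.\<close>

theorem triangle_pullback_obstruction:
 fixes \<Phi> :: "'s \<Rightarrow> 't \<Rightarrow> 'u \<Rightarrow> complex" and P :: "nat \<Rightarrow> nat \<Rightarrow> nat \<Rightarrow> bool" and m :: nat
 assumes tri: "\<And>s0 s1 s2. s0 \<in> S0 \<Longrightarrow> s1 \<in> S1 \<Longrightarrow> s2 \<in> S2 \<Longrightarrow>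
   \<Phi> s0 s1 s2 = (\<Sum>a\<in>X'. \<Sum>b\<in>Y'. \<Sum>c\<in>Z'. T0 s0 a b * T1 s1 b c * T2 s2 c a)"
  and fin: "finite X" "finite Y" "finite Z" and fin': "finite X'" "finite Y'" "finite Z'"
  and card: "card X' = card X" "card Y' = card Y" "card Z' = card Z"
  and ne: "X \<noteq> {}" "Y \<noteq> {}" "Z \<noteq> {}"
  and t: "\<And>x y y' z z' x'. x \<in> X \<Longrightarrow> y \<in> Y \<Longrightarrow> y' \<in> Y \<Longrightarrow> z \<in> Z \<Longrightarrow> z' \<in> Z \<Longrightarrow> x' \<in> X \<Longrightarrow>
   (\<Sum>s0\<in>S0. \<Sum>s1\<in>S1. \<Sum>s2\<in>S2. f0 x y s0 * f1 y' z s1 * f2 z' x' s2 * \<Phi> s0 s1 s2) =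
   (if x = x' \<and> y = y' \<and> z = z' \<and> P (gX x) (gY y) (gZ z) then 1 else 0)"
  and m: "m \<ge> 2"
  and gX: "\<And>x. x \<in> X \<Longrightarrow> gX x < m" "\<And>i. i < m \<Longrightarrow> m * card {x\<in>X. gX x = i} = card X"
  and gY: "\<And>x. x \<in> Y \<Longrightarrow> gY x < m" "\<And>i. i < m \<Longrightarrow> m * card {x\<in>Y. gY x = i} = card Y"
  and gZ: "\<And>x. x \<in> Z \<Longrightarrow> gZ x < m" "\<And>i. i < m \<Longrightarrow> m * card {x\<in>Z. gZ x = i} = card Z"
  and ext: "\<And>i j. i < m \<Longrightarrow> j < m \<Longrightarrow> \<exists>l<m. P i j l" "\<And>j l. j < m \<Longrightarrow> l < m \<Longrightarrow> \<exists>i<m. P i j l"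
   "\<And>l i. l < m \<Longrightarrow> i < m \<Longrightarrow> \<exists>j<m. P i j l"
  and sub: "n1 \<subseteq> {..<m} \<times> {..<m}" "n2 \<subseteq> {..<m} \<times> {..<m}" "n3 \<subseteq> {..<m} \<times> {..<m}"
  and ex12: "\<And>i j l. (i, j) \<in> n1 \<Longrightarrow> (j, l) \<in> n2 \<Longrightarrow> \<not> P i j l"
  and ex13: "\<And>i j l. (i, j) \<in> n1 \<Longrightarrow> (l, i) \<in> n3 \<Longrightarrow> \<not> P i j l"
  and cn: "card n1 \<ge> m * (m - 1)" "card n2 \<ge> m" "card n3 \<ge> m"
 shows False
proof -
 define A where "A x y a b = (\<Sum>s\<in>S0. f0 x y s * T0 s a b)" for x y a b
 define B where "B y z b c = (\<Sum>s\<in>S1. f1 y z s * T1 s b c)" for y z b c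
 define C where "C z x c a = (\<Sum>s\<in>S2. f2 z x s * T2 s c a)" for z x c a
 have tABC: "(\<Sum>a\<in>X'. \<Sum>b\<in>Y'. \<Sum>c\<in>Z'. A x y a b * B y' z b c * C z' x' c a) =
   (if x = x' \<and> y = y' \<and> z = z' \<and> P (gX x) (gY y) (gZ z) then 1 else 0)"
  if xyz: "x \<in> X" "y \<in> Y" "y' \<in> Y" "z \<in> Z" "z' \<in> Z" "x' \<in> X" for x y y' z z' x'
 proof -
  have "(\<Sum>a\<in>X'. \<Sum>b\<in>Y'. \<Sum>c\<in>Z'. A x y a b * B y' z b c * C z' x' c a) =
   (\<Sum>a\<in>X'. \<Sum>b\<in>Y'. \<Sum>c\<in>Z'. \<Sum>s0\<in>S0. \<Sum>s1\<in>S1. \<Sum>s2\<in>S2.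
    (f0 x y s0 * T0 s0 a b) * (f1 y' z s1 * T1 s1 b c) * (f2 z' x' s2 * T2 s2 c a))"
   unfolding A_def B_def C_def by (simp only: sum_product3)
  also have "\<dots> = (\<Sum>s0\<in>S0. \<Sum>s1\<in>S1. \<Sum>s2\<in>S2. \<Sum>a\<in>X'. \<Sum>b\<in>Y'. \<Sum>c\<in>Z'.
    (f0 x y s0 * T0 s0 a b) * (f1 y' z s1 * T1 s1 b c) * (f2 z' x' s2 * T2 s2 c a))"
   by (subst sum_swap_out3, rule sum.cong[OF refl], subst sum_swap_out3, rule sum.cong[OF refl], rule sum_swap_out3)
  also have "\<dots> = (\<Sum>s0\<in>S0. \<Sum>s1\<in>S1. \<Sum>s2\<in>S2. f0 x y s0 * f1 y' z s1 * f2 z' x' s2 * \<Phi> s0 s1 s2)"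
  proof (intro sum.cong refl)
   fix s0 s1 s2 assume s: "s0 \<in> S0" "s1 \<in> S1" "s2 \<in> S2"
   show "(\<Sum>a\<in>X'. \<Sum>b\<in>Y'. \<Sum>c\<in>Z'. (f0 x y s0 * T0 s0 a b) * (f1 y' z s1 * T1 s1 b c) * (f2 z' x' s2 * T2 s2 c a)) =
     f0 x y s0 * f1 y' z s1 * f2 z' x' s2 * \<Phi> s0 s1 s2"
    unfolding tri[OF s] sum_distrib_left by (intro sum.cong refl) (simp only: mult_ac)
  qed
  also have "\<dots> = (if x = x' \<and> y = y' \<and> z = z' \<and> P (gX x) (gY y) (gZ z) then 1 else 0)"
   by (rule t[OF xyz])
  finally show ?thesis .
 qed
 show False
  by (rule triangle_obstruction[OF fin fin' card ne tABC m gX gY gZ ext sub ex12 ex13 cn])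
qed

text \<open>The exponent of \<open>\<epsilon>\<close> belonging to a segment from position
  \<open>i\<close> to position \<open>j\<close> modulo \<open>m\<close>, if the segment advances by
  \<open>c\<close> anyway and by \<open>q\<close> for every factor
  \<open>\<epsilon>\<close>.\<close>

definition wt :: "nat \<Rightarrow> nat \<Rightarrow> nat \<Rightarrow> nat \<Rightarrow> nat \<Rightarrow> nat" where
 "wt m q c i j = (THE k. k < m \<and> [i + c + q * k = j] (mod m))"

context
 fixes m q :: nat
 assumes m: "m \<ge> 2" and q: "coprime q m"
begin

lemma wt_ex1: "\<exists>!k. k < m \<and> [i + c + q * k = j] (mod m)"
proof -
 obtain x where x: "[q * x = Suc 0] (mod m)" using cong_solve_coprime_nat[OF q] by blast
 define r where "r = j + (m - 1) * (i + c)"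
 have r: "[i + c + r = j] (mod m)"
 proof -
  have "i + c + r = j + m * (i + c)" using m by (cases m) (simp_all add: r_def algebra_simps)
  thus ?thesis by (simp add: cong_def)
 qed
 define k where "k = (x * r) mod m"
 have "[q * k = q * (x * r)] (mod m)" unfolding k_def by (intro cong_scalar_left) simp
 also have "q * (x * r) = (q * x) * r" by simp
 also have "[(q * x) * r = Suc 0 * r] (mod m)" by (intro cong_scalar_right x)
 finally have "[q * k = r] (mod m)" by simp
 hence "[i + c + q * k = i + c + r] (mod m)" by (simp add: cong_add_lcancel_nat)
 hence k: "[i + c + q * k = j] (mod m)" using r by (rule cong_trans)
 show ?thesis
 proof (rule ex1I[of _ k])
  show "k < m \<and> [i + c + q * k = j] (mod m)" using k m by (simp add: k_def)
  fix k' assume k': "k' < m \<and> [i + c + q * k' = j] (mod m)"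
  hence "[i + c + q * k' = i + c + q * k] (mod m)" using k cong_sym cong_trans by blast
  hence "[k' = k] (mod m)" using q by (simp add: cong_add_lcancel_nat cong_mult_lcancel_nat)
  thus "k' = k" using k' m by (intro cong_less_modulus_unique_nat[of k' k m]) (auto simp: k_def)
 qed
qed

lemma wt_less: "wt m q c i j < m" and wt_cong: "[i + c + q * wt m q c i j = j] (mod m)"
 using theI'[OF wt_ex1[of i c j]] by (simp_all add: wt_def)

lemma wt_unique: "k < m \<Longrightarrow> [i + c + q * k = j] (mod m) \<Longrightarrow> wt m q c i j = k"
 unfolding wt_def by (rule the1_equality[OF wt_ex1]) (rule conjI)

text \<open>Adding the three congruences shows that the weights around a closed triangle sum to
  \<open>- 1\<close> modulo \<open>m\<close>, so \<open>m - 1\<close> is the least possible total.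
  It is reached by choosing \<open>l\<close> such that the second weight completes the first to
  \<open>m - 1\<close>; the third is then 0.\<close>

lemma wt_extend:
 assumes c: "[c1 + c2 + c3 = q] (mod m)"
 shows "\<exists>l<m. wt m q c1 i j + wt m q c2 j l + wt m q c3 l i = m - 1"
proof -
 define k where "k = wt m q c1 i j"
 define l where "l = (j + c2 + q * (m - 1 - k)) mod m"
 have km: "k < m" using wt_less by (simp add: k_def)
 have w2: "wt m q c2 j l = m - 1 - k" by (rule wt_unique) (use m in \<open>simp_all add: l_def cong_def\<close>)
 have "[l + c3 + q * 0 = j + c2 + q * (m - 1 - k) + c3] (mod m)"
  by (simp add: l_def cong_def mod_add_left_eq)
 also have "[j + c2 + q * (m - 1 - k) + c3 = (i + c1 + q * k) + c2 + q * (m - 1 - k) + c3] (mod m)"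
  unfolding k_def by (intro cong_add cong_refl cong_sym[OF wt_cong])
 also have "(i + c1 + q * k) + c2 + q * (m - 1 - k) + c3 = i + (c1 + c2 + c3) + q * (m - 1)"
 proof -
  have "q * k + q * (m - 1 - k) = q * (m - 1)"
   using km by (simp flip: add_mult_distrib2)
  thus ?thesis by linarith
 qed
 also have "[i + (c1 + c2 + c3) + q * (m - 1) = i + q + q * (m - 1)] (mod m)"
  by (intro cong_add cong_refl c)
 also have "i + q + q * (m - 1) = i + q * m" using m by (cases m) simp_all
 also have "[i + q * m = i] (mod m)" by (simp add: cong_def)
 finally have "wt m q c3 l i = 0" by (intro wt_unique) (use m in auto)
 thus ?thesis using w2 km m by (intro exI[of _ l]) (simp add: l_def k_def)
qed

lemma card_wt:
 assumes "k < m"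
 shows "card {(i, j). i < m \<and> j < m \<and> wt m q c i j = k} = m"
proof -
 have "{(i, j). i < m \<and> j < m \<and> wt m q c i j = k} = (\<lambda>i. (i, (i + c + q * k) mod m)) ` {..<m}"
 proof (intro equalityI subsetI)
  fix p assume "p \<in> {(i, j). i < m \<and> j < m \<and> wt m q c i j = k}"
  then obtain i j where p: "p = (i, j)" "i < m" "j < m" "wt m q c i j = k" by auto
  have "(i + c + q * k) mod m = j" using wt_cong[of i c j] p by (simp add: cong_def)
  thus "p \<in> (\<lambda>i. (i, (i + c + q * k) mod m)) ` {..<m}" using p by auto
 next
  fix p assume "p \<in> (\<lambda>i. (i, (i + c + q * k) mod m)) ` {..<m}"
  then obtain i where i: "i < m" "p = (i, (i + c + q * k) mod m)" by auto
  have "wt m q c i ((i + c + q * k) mod m) = k" by (rule wt_unique) (use assms in \<open>simp_all add: cong_def\<close>)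
  thus "p \<in> {(i, j). i < m \<and> j < m \<and> wt m q c i j = k}" using i m by simp
 qed
 moreover have "inj_on (\<lambda>i. (i, (i + c + q * k) mod m)) {..<m}" by (auto simp: inj_on_def)
 ultimately show ?thesis by (simp add: card_image)
qed

text \<open>A nonzero first weight and a second or third weight of \<open>m - 1\<close> exceed the
  total \<open>m - 1\<close>; these are the forbidden pairs. By \<open>card_wt\<close> there are
  \<open>m * (m - 1)\<close> pairs of the former kind and \<open>m\<close> of each of the latter,
  just what the obstruction asks for.\<close>

theorem cyclic_triangle_obstruction:
 fixes \<Phi> :: "'s \<Rightarrow> 't \<Rightarrow> 'u \<Rightarrow> complex"
 assumes c: "[c1 + c2 + c3 = q] (mod m)"
  and tri: "\<And>s0 s1 s2. s0 \<in> S0 \<Longrightarrow> s1 \<in> S1 \<Longrightarrow> s2 \<in> S2 \<Longrightarrow>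
   \<Phi> s0 s1 s2 = (\<Sum>a\<in>X'. \<Sum>b\<in>Y'. \<Sum>c\<in>Z'. T0 s0 a b * T1 s1 b c * T2 s2 c a)"
  and fin: "finite X" and fin': "finite X'" "finite Y'" "finite Z'"
  and card: "card X' = card X" "card Y' = card X" "card Z' = card X"
  and ne: "X \<noteq> {}"
  and t: "\<And>x y y' z z' x'. x \<in> X \<Longrightarrow> y \<in> X \<Longrightarrow> y' \<in> X \<Longrightarrow> z \<in> X \<Longrightarrow> z' \<in> X \<Longrightarrow> x' \<in> X \<Longrightarrow>
   (\<Sum>s0\<in>S0. \<Sum>s1\<in>S1. \<Sum>s2\<in>S2. f0 x y s0 * f1 y' z s1 * f2 z' x' s2 * \<Phi> s0 s1 s2) =
   (if x = x' \<and> y = y' \<and> z = z' \<and>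
     wt m q c1 (g x) (g y) + wt m q c2 (g y) (g z) + wt m q c3 (g z) (g x) = m - 1 then 1 else 0)"
  and g: "\<And>x. x \<in> X \<Longrightarrow> g x < m" "\<And>i. i < m \<Longrightarrow> m * card {x\<in>X. g x = i} = card X"
 shows False
proof -
 define n1 where "n1 = {(i, j). i < m \<and> j < m \<and> wt m q c1 i j \<noteq> 0}"
 define n2 where "n2 = {(i, j). i < m \<and> j < m \<and> wt m q c2 i j = m - 1}"
 define n3 where "n3 = {(i, j). i < m \<and> j < m \<and> wt m q c3 i j = m - 1}"
 have s: "n1 \<subseteq> {..<m} \<times> {..<m}" "n2 \<subseteq> {..<m} \<times> {..<m}" "n3 \<subseteq> {..<m} \<times> {..<m}"
  by (auto simp: n1_def n2_def n3_def)
 have c2: "card n2 \<ge> m" and c3: "card n3 \<ge> m"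
  unfolding n2_def n3_def by (subst card_wt, use m in simp, simp)+
 define n0 where "n0 = {(i, j). i < m \<and> j < m \<and> wt m q c1 i j = 0}"
 have n0: "n0 \<subseteq> {..<m} \<times> {..<m}" "card n0 = m"
  using m card_wt[of 0 c1] by (auto simp: n0_def)
 have "n1 = {..<m} \<times> {..<m} - n0" by (auto simp: n1_def n0_def)
 hence "card n1 = m * m - m"
  using n0 by (simp add: card_Diff_subset finite_subset[OF n0(1)] card_cartesian_product)
 hence c1: "card n1 \<ge> m * (m - 1)" by (simp add: diff_mult_distrib2)
 have e1: "\<exists>l<m. wt m q c1 i j + wt m q c2 j l + wt m q c3 l i = m - 1" for i j
  by (rule wt_extend[OF c])
 have e2: "\<exists>i<m. wt m q c1 i j + wt m q c2 j l + wt m q c3 l i = m - 1" for j l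
  using wt_extend[of c2 c3 c1 j l] c by (simp add: ac_simps)
 have e3: "\<exists>j<m. wt m q c1 i j + wt m q c2 j l + wt m q c3 l i = m - 1" for l i
  using wt_extend[of c3 c1 c2 l i] c by (simp add: ac_simps)
 show False
  by (rule triangle_pullback_obstruction[where P = "\<lambda>i j l. wt m q c1 i j + wt m q c2 j l + wt m q c3 l i = m - 1",
    OF tri fin fin fin fin' card ne ne ne t m g g g e1 e2 e3 s _ _ c1 c2 c3])
   (auto simp: n1_def n2_def n3_def)
qed

end

section \<open>Rings of lines\<close>

lemma digit_expansion:
 fixes u :: "nat \<Rightarrow> nat"
 assumes "s \<le> t"
 shows "(\<Sum>i\<in>{s..<t}. (a div (\<Prod>j\<in>{s..<i}. u j) mod u i) * (\<Prod>j\<in>{s..<i}. u j)) = a mod (\<Prod>j\<in>{s..<t}. u j)"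
 using assms
proof (induction t rule: dec_induct)
 case base thus ?case by simp
next
 case (step n)
 have "(\<Prod>j\<in>{s..<Suc n}. u j) = (\<Prod>j\<in>{s..<n}. u j) * u n" using step.hyps by simp
 thus ?case
  using step.hyps step.IH mod_mult2_eq[of a "\<Prod>j\<in>{s..<n}. u j" "u n"] by (simp add: mult.commute)
qed

lemma root_power_cong:
 fixes \<omega> :: complex
 assumes "\<omega> ^ m = 1" "[x = y] (mod m)"
 shows "\<omega> ^ x = \<omega> ^ y"
proof -
 have "\<omega> ^ x = \<omega> ^ (x mod m)" for x
 proof -
  have "\<omega> ^ x = \<omega> ^ (m * (x div m) + x mod m)" by simp
  also have "\<dots> = \<omega> ^ (x mod m)" by (simp only: power_add power_mult assms(1) power_one mult_1)
  finally show ?thesis .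
 qed
 thus ?thesis using assms(2) unfolding cong_def by metis
qed

text \<open>Site \<open>i\<close> raises the bond index by \<open>\<delta> i\<close>, so the index
  in front of site 0 determines all others, and they close up exactly if \<open>m\<close> divides
  the total. What remains is a sum over that one index \<open>k\<close>.\<close>

lemma ring_sum:
 fixes \<omega> :: complex and \<delta> b :: "nat \<Rightarrow> nat"
 assumes N: "N > 0" and m: "m > 0" and om: "\<omega> ^ m = 1"
 shows "(\<Sum>\<kappa>\<in>PiE {..<N} (\<lambda>_. {1..m}). \<Prod>i<N.
   if [\<kappa> i = \<kappa> ((i + N - 1) mod N) + \<delta> i] (mod m) then \<omega> ^ (b i * \<kappa> ((i + N - 1) mod N)) else 0) =
  (if m dvd (\<Sum>i<N. \<delta> i) then \<Sum>k<m. \<omega> ^ (\<Sum>i<N. b i * (k + (\<Sum>j<i. \<delta> j))) else 0)"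
proof -
 define pd where "pd i = (i + N - 1) mod N" for i
 define D where "D i = (\<Sum>j<i. \<delta> j)" for i
 define S where "S = {\<kappa>\<in>PiE {..<N} (\<lambda>_. {1..m}). \<forall>i<N. [\<kappa> i = \<kappa> (pd i) + \<delta> i] (mod m)}"
 have fS: "finite (PiE {..<N} (\<lambda>_. {1..m}))" by (simp add: finite_PiE)
 have pd0: "pd 0 = N - 1" using N by (simp add: pd_def)
 have pdS: "pd (Suc i) = i" if "Suc i < N" for i using that by (simp add: pd_def)
 have pdS': "pd (Suc i) = i" if "i < N" for i using that by (simp add: pd_def)
 have path: "[\<kappa> (pd i) = \<kappa> (N - 1) + D i] (mod m)" if "\<kappa> \<in> S" "i \<le> N" for \<kappa> i
  using that(2)
 proof (induction i)
  case 0 thus ?case by (simp add: pd0 D_def)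
 next
  case (Suc i)
  have "[\<kappa> i = \<kappa> (pd i) + \<delta> i] (mod m)" using that(1) Suc.prems by (simp add: S_def)
  also have "[\<kappa> (pd i) + \<delta> i = \<kappa> (N - 1) + D i + \<delta> i] (mod m)"
   using Suc by (intro cong_add cong_refl) simp
  finally show ?case using Suc.prems by (simp add: pdS' D_def add.assoc)
 qed
 have "(\<Sum>\<kappa>\<in>PiE {..<N} (\<lambda>_. {1..m}). \<Prod>i<N. if [\<kappa> i = \<kappa> (pd i) + \<delta> i] (mod m) then \<omega> ^ (b i * \<kappa> (pd i)) else 0)
   = (\<Sum>\<kappa>\<in>S. \<omega> ^ (\<Sum>i<N. b i * \<kappa> (pd i)))"
 proof (rule sum.mono_neutral_cong_right[OF fS])
  show "S \<subseteq> PiE {..<N} (\<lambda>_. {1..m})" by (auto simp: S_def)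
  show "\<forall>\<kappa>\<in>PiE {..<N} (\<lambda>_. {1..m}) - S. (\<Prod>i<N. if [\<kappa> i = \<kappa> (pd i) + \<delta> i] (mod m) then \<omega> ^ (b i * \<kappa> (pd i)) else 0) = 0"
  proof
   fix \<kappa> assume "\<kappa> \<in> PiE {..<N} (\<lambda>_. {1..m}) - S"
   then obtain i where "i < N" "\<not> [\<kappa> i = \<kappa> (pd i) + \<delta> i] (mod m)" by (auto simp: S_def)
   thus "(\<Prod>i<N. if [\<kappa> i = \<kappa> (pd i) + \<delta> i] (mod m) then \<omega> ^ (b i * \<kappa> (pd i)) else 0) = 0"
    by (intro prod_zero bexI[of _ i]) auto
  qed
  show "(\<Prod>i<N. if [\<kappa> i = \<kappa> (pd i) + \<delta> i] (mod m) then \<omega> ^ (b i * \<kappa> (pd i)) else 0) = \<omega> ^ (\<Sum>i<N. b i * \<kappa> (pd i))"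
   if "\<kappa> \<in> S" for \<kappa>
  proof -
   have "(\<Prod>i<N. if [\<kappa> i = \<kappa> (pd i) + \<delta> i] (mod m) then \<omega> ^ (b i * \<kappa> (pd i)) else 0) = (\<Prod>i<N. \<omega> ^ (b i * \<kappa> (pd i)))"
    by (rule prod.cong[OF refl]) (use that in \<open>simp add: S_def\<close>)
   thus ?thesis by (simp add: power_sum)
  qed
 qed
 also have "\<dots> = (if m dvd D N then \<Sum>k<m. \<omega> ^ (\<Sum>i<N. b i * (k + D i)) else 0)"
 proof (cases "m dvd D N")
  case False
  have "\<kappa> \<notin> S" for \<kappa>
  proof
   assume "\<kappa> \<in> S"
   from path[OF this order_refl] have "[\<kappa> (pd N) = \<kappa> (N - 1) + D N] (mod m)" .
   moreover have "pd N = N - 1" using N pdS'[of "N - 1"] by simp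
   ultimately have "[\<kappa> (N - 1) + 0 = \<kappa> (N - 1) + D N] (mod m)" by simp
   hence "[0 = D N] (mod m)" by (simp only: cong_add_lcancel_nat)
   thus False using False by (simp add: cong_def mod_eq_0_iff_dvd)
  qed
  hence "S = {}" by auto
  thus ?thesis using False by simp
 next
  case True
  \<comment> \<open>Bond indices run from 1 to \<open>m\<close>, so the residue 0 is represented by
    \<open>m\<close>.\<close>
  define rp where "rp x = (if x mod m = 0 then m else x mod m)" for x
  have rp: "rp x \<in> {1..m}" "[rp x = x] (mod m)" for x using m by (auto simp: rp_def cong_def less_imp_le)
  have rpu: "rp x = y" if "y \<in> {1..m}" "[x = y] (mod m)" for x y
  proof (cases "y = m")
   case True thus ?thesis using that by (simp add: rp_def cong_def)
  next
   case False
   hence "y < m" "y \<noteq> 0" using that by auto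
   thus ?thesis using that by (simp add: rp_def cong_def)
  qed
  have "(\<Sum>\<kappa>\<in>S. \<omega> ^ (\<Sum>i<N. b i * \<kappa> (pd i))) = (\<Sum>k<m. \<omega> ^ (\<Sum>i<N. b i * (k + D i)))"
  proof (rule sum.reindex_bij_witness[of _ "\<lambda>k. restrict (\<lambda>i. rp (k + D (Suc i))) {..<N}" "\<lambda>\<kappa>. \<kappa> (N - 1) mod m"])
   fix \<kappa> assume \<kappa>: "\<kappa> \<in> S"
   show "restrict (\<lambda>i. rp (\<kappa> (N - 1) mod m + D (Suc i))) {..<N} = \<kappa>"
   proof
    fix i show "restrict (\<lambda>i. rp (\<kappa> (N - 1) mod m + D (Suc i))) {..<N} i = \<kappa> i"
    proof (cases "i < N")
     case True
     have "[\<kappa> (N - 1) mod m + D (Suc i) = \<kappa> (N - 1) + D (Suc i)] (mod m)" by (simp add: cong_def mod_add_left_eq)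
     also have "[\<kappa> (N - 1) + D (Suc i) = \<kappa> i] (mod m)"
      using path[OF \<kappa>, of "Suc i"] True pdS'[OF True] cong_sym by simp
     finally have "[\<kappa> (N - 1) mod m + D (Suc i) = \<kappa> i] (mod m)" .
     moreover have "\<kappa> i \<in> {1..m}" using \<kappa> True by (auto simp: S_def)
     ultimately show ?thesis using True rpu by simp
    next
     case False thus ?thesis using \<kappa> by (auto simp: S_def PiE_def extensional_def)
    qed
   qed
   show "\<kappa> (N - 1) mod m \<in> {..<m}" using m by simp
   show "\<omega> ^ (\<Sum>i<N. b i * (\<kappa> (N - 1) mod m + D i)) = \<omega> ^ (\<Sum>i<N. b i * \<kappa> (pd i))"
   proof (rule root_power_cong[OF om], rule cong_sum, rule cong_scalar_left)
    fix i assume "i \<in> {..<N}"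
    have "[\<kappa> (N - 1) mod m + D i = \<kappa> (N - 1) + D i] (mod m)" by (simp add: cong_def mod_add_left_eq)
    also have "[\<kappa> (N - 1) + D i = \<kappa> (pd i)] (mod m)"
     using path[OF \<kappa>, of i] \<open>i \<in> {..<N}\<close> by (simp add: cong_sym)
    finally show "[\<kappa> (N - 1) mod m + D i = \<kappa> (pd i)] (mod m)" .
   qed
  next
   fix k assume k: "k \<in> {..<m}"
   let ?\<kappa> = "restrict (\<lambda>i. rp (k + D (Suc i))) {..<N}"
   have last: "[?\<kappa> (N - 1) = k] (mod m)"
   proof -
    have "?\<kappa> (N - 1) = rp (k + D N)" using N by simp
    moreover have "[rp (k + D N) = k + D N] (mod m)" by (rule rp)
    moreover have "[k + D N = k] (mod m)" using True by (simp add: cong_def mod_add_right_eq[symmetric, of k "D N"] dvd_imp_mod_0)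
    ultimately show ?thesis using cong_trans by auto
   qed
   thus "?\<kappa> (N - 1) mod m = k" using k by (simp add: cong_def)
   have pdk: "[?\<kappa> (pd i) = k + D i] (mod m)" if "i < N" for i
   proof (cases i)
    case 0 thus ?thesis using last by (simp add: pd0 D_def)
   next
    case (Suc j)
    thus ?thesis using that rp(2)[of "k + D (Suc j)"] by (simp add: pdS)
   qed
   show "?\<kappa> \<in> S"
    unfolding S_def
   proof (intro CollectI conjI allI impI)
    show "?\<kappa> \<in> PiE {..<N} (\<lambda>_. {1..m})" using rp(1) by auto
    fix i assume i: "i < N"
    have "[?\<kappa> i = k + D (Suc i)] (mod m)" using i rp(2)[of "k + D (Suc i)"] by simp
    also have "k + D (Suc i) = k + D i + \<delta> i" by (simp add: D_def)
    also have "[k + D i + \<delta> i = ?\<kappa> (pd i) + \<delta> i] (mod m)" using pdk[OF i] by (intro cong_add cong_refl) (rule cong_sym)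
    finally show "[?\<kappa> i = ?\<kappa> (pd i) + \<delta> i] (mod m)" .
   qed
  qed
  thus ?thesis using True by simp
 qed
 finally show ?thesis by (simp only: pd_def D_def)
qed

definition root_of_unity :: "nat \<Rightarrow> complex" where
 "root_of_unity m = cis (2 * pi / real m)"

lemma root_of_unity_power: "m > 0 \<Longrightarrow> root_of_unity m ^ m = 1"
 by (simp add: root_of_unity_def DeMoivre)

lemma root_of_unity_norm: "root_of_unity m ^ k * cnj (root_of_unity m ^ k) = 1"
 by (simp add: root_of_unity_def DeMoivre complex_norm_square[symmetric])

lemma root_of_unity_orth:
 assumes m: "m > 0"
 shows "(\<Sum>b<m. root_of_unity m ^ (p * b) * cnj (root_of_unity m ^ (q * b))) = (if [p = q] (mod m) then of_nat m else 0)"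
proof -
 let ?w = "root_of_unity m"
 define z where "z = ?w ^ p * cnj (?w ^ q)"
 have zb: "?w ^ (p * b) * cnj (?w ^ (q * b)) = z ^ b" for b
  by (simp add: z_def power_mult_distrib power_mult)
 show ?thesis
 proof (cases "[p = q] (mod m)")
  case True
  hence "?w ^ p = ?w ^ q" using root_power_cong root_of_unity_power[OF m] by blast
  hence "z = 1" by (simp add: z_def root_of_unity_norm del: complex_cnj_power)
  thus ?thesis using True by (simp only: zb) simp
 next
  case False
  have zm: "z ^ m = 1"
  proof -
   have "z ^ m = (?w ^ m) ^ p * cnj ((?w ^ m) ^ q)"
    by (simp add: z_def power_mult_distrib flip: power_mult) (simp add: mult.commute)
   thus ?thesis by (simp add: root_of_unity_power[OF m])
  qed
  have "z \<noteq> 1"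
  proof
   assume "z = 1"
   hence "?w ^ p * (cnj (?w ^ q) * ?w ^ q) = ?w ^ q" by (simp add: z_def mult.assoc[symmetric])
   hence e: "?w ^ p = ?w ^ q" using root_of_unity_norm[of m q] by (simp add: mult.commute del: complex_cnj_power)
   have "?w ^ (p mod m) = ?w ^ (q mod m)"
    using e root_power_cong[OF root_of_unity_power[OF m], of "p mod m" p] root_power_cong[OF root_of_unity_power[OF m], of "q mod m" q]
    by (simp add: cong_def)
   hence "cis (2 * pi * real (p mod m) / real m) = cis (2 * pi * real (q mod m) / real m)"
    by (simp add: root_of_unity_def DeMoivre mult_ac)
   moreover have "inj_on (\<lambda>k. cis (2 * pi * real k / real m)) {..<m}"
    using bij_betw_roots_unity[OF m] by (rule bij_betw_imp_inj_on)
   ultimately have "p mod m = q mod m" using m by (auto dest: inj_onD)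
   thus False using False by (simp add: cong_def)
  qed
  hence "(\<Sum>b<m. z ^ b) = 0" using zm by (simp add: geometric_sum)
  thus ?thesis using False by (simp only: zb if_False)
 qed
qed

lemma sum_triple_delta:
 fixes A B C m :: nat
 assumes "A < m" "B < m" "C < m"
 shows "(\<Sum>a0<m. \<Sum>a1<m. \<Sum>a2<m. if a0 = A \<and> a1 = B \<and> a2 = C then r else (0::complex)) = r"
proof -
 have "(\<Sum>a2<m. if a1 = B \<and> a2 = C then r else 0) = (if a1 = B then r else 0)" for a1
  using assms by (cases "a1 = B") simp_all
 hence "(\<Sum>a1<m. \<Sum>a2<m. if a0 = A \<and> a1 = B \<and> a2 = C then r else 0) = (if a0 = A then r else 0)" for a0
  using assms by (cases "a0 = A") simp_all
 thus ?thesis using assms by simp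
qed

text \<open>A cluster is described by a step \<open>a\<close> and a dual phase index
  \<open>b\<close>. Summing over \<open>b\<close> against conjugate characters fixes the position at
  which the cluster starts, the congruence in \<open>g\<close> fixes where it ends, and comparing
  ends with starts yields the three equalities. The phases \<open>Q\<close> involve one cluster each
  and are cancelled by the functional of that cluster; \<open>J\<close> is an arbitrary further
  condition on the steps.\<close>

lemma line_orthogonality:
 fixes Q0 Q1 Q2 :: "nat \<Rightarrow> nat \<Rightarrow> nat"
 assumes m: "m \<ge> 2" and lt: "x < m" "x' < m" "y < m" "y' < m" "z < m" "z' < m"
 defines "\<omega> \<equiv> root_of_unity m"
 defines "g \<equiv> (\<lambda>c Q i j a b. (if [j = i + c + a] (mod m) then cnj (\<omega> ^ (i * b)) * cnj (\<omega> ^ Q a b) / of_nat m else 0))"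
 shows "(\<Sum>a0<m. \<Sum>b0<m. \<Sum>a1<m. \<Sum>b1<m. \<Sum>a2<m. \<Sum>b2<m.
   g 1 Q0 x y a0 b0 * g 0 Q1 y' z a1 b1 * g 0 Q2 z' x' a2 b2 *
   (if m dvd (1 + a0 + a1 + a2) \<and> J a0 a1 a2 then
     \<Sum>k<m. \<omega> ^ (k * b0 + (k + 1 + a0) * b1 + (k + 1 + a0 + a1) * b2 + (Q0 a0 b0 + Q1 a1 b1 + Q2 a2 b2)) else 0)) =
  (if x = x' \<and> y = y' \<and> z = z' \<and> J (wt m 1 1 x y) (wt m 1 0 y z) (wt m 1 0 z x) then 1 else 0)"
 (is "?L = ?R")
proof -
 have cop: "coprime (1::nat) m" by simp
 have eqm: "[i = j] (mod m) \<longleftrightarrow> i = j" if "i < m" "j < m" for i j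
  using that by (simp add: cong_def)
 have nrm: "\<omega> ^ k * cnj (\<omega> ^ k) = 1" for k unfolding \<omega>_def by (rule root_of_unity_norm)
 have orth: "(\<Sum>b<m. \<omega> ^ (p * b) * cnj (\<omega> ^ (q * b))) = (if [p = q] (mod m) then of_nat m else 0)" for p q
  unfolding \<omega>_def by (rule root_of_unity_orth) (use m in simp)
 define I where "I a0 a1 a2 \<longleftrightarrow> [y = x + 1 + a0] (mod m) \<and> [z = y' + 0 + a1] (mod m) \<and> [x' = z' + 0 + a2] (mod m) \<and>
   m dvd (1 + a0 + a1 + a2) \<and> J a0 a1 a2" for a0 a1 a2
 define T where "T k a0 a1 a2 b0 b1 b2 = (\<omega> ^ (k * b0) * cnj (\<omega> ^ (x * b0))) * (\<omega> ^ ((k + 1 + a0) * b1) * cnj (\<omega> ^ (y' * b1))) *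
   (\<omega> ^ ((k + 1 + a0 + a1) * b2) * cnj (\<omega> ^ (z' * b2)))" for k a0 a1 a2 b0 b1 b2 :: nat
 have summand: "g 1 Q0 x y a0 b0 * g 0 Q1 y' z a1 b1 * g 0 Q2 z' x' a2 b2 *
   (if m dvd (1 + a0 + a1 + a2) \<and> J a0 a1 a2 then
     \<Sum>k<m. \<omega> ^ (k * b0 + (k + 1 + a0) * b1 + (k + 1 + a0 + a1) * b2 + (Q0 a0 b0 + Q1 a1 b1 + Q2 a2 b2)) else 0)
   = (if I a0 a1 a2 then (\<Sum>k<m. T k a0 a1 a2 b0 b1 b2) / of_nat m ^ 3 else 0)" for a0 b0 a1 b1 a2 b2
 proof (cases "I a0 a1 a2")
  case True
  have "\<omega> ^ (k * b0 + (k + 1 + a0) * b1 + (k + 1 + a0 + a1) * b2 + (Q0 a0 b0 + Q1 a1 b1 + Q2 a2 b2)) =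
   \<omega> ^ (k * b0) * \<omega> ^ ((k + 1 + a0) * b1) * \<omega> ^ ((k + 1 + a0 + a1) * b2) * (\<omega> ^ Q0 a0 b0 * \<omega> ^ Q1 a1 b1 * \<omega> ^ Q2 a2 b2)" for k
   by (simp only: power_add mult.assoc)
  moreover have "g 1 Q0 x y a0 b0 * g 0 Q1 y' z a1 b1 * g 0 Q2 z' x' a2 b2 *
    (e * e1 * e2 * (\<omega> ^ Q0 a0 b0 * \<omega> ^ Q1 a1 b1 * \<omega> ^ Q2 a2 b2)) =
    (e * cnj (\<omega> ^ (x * b0))) * (e1 * cnj (\<omega> ^ (y' * b1))) * (e2 * cnj (\<omega> ^ (z' * b2))) / of_nat m ^ 3" for e e1 e2
  proof -
   have "g 1 Q0 x y a0 b0 * g 0 Q1 y' z a1 b1 * g 0 Q2 z' x' a2 b2 *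
    (e * e1 * e2 * (\<omega> ^ Q0 a0 b0 * \<omega> ^ Q1 a1 b1 * \<omega> ^ Q2 a2 b2)) =
    (e * cnj (\<omega> ^ (x * b0))) * (e1 * cnj (\<omega> ^ (y' * b1))) * (e2 * cnj (\<omega> ^ (z' * b2))) / of_nat m ^ 3 *
    ((\<omega> ^ Q0 a0 b0 * cnj (\<omega> ^ Q0 a0 b0)) * (\<omega> ^ Q1 a1 b1 * cnj (\<omega> ^ Q1 a1 b1)) * (\<omega> ^ Q2 a2 b2 * cnj (\<omega> ^ Q2 a2 b2)))"
    using True unfolding g_def I_def by (simp add: power3_eq_cube del: complex_cnj_power)
   thus ?thesis by (simp only: nrm mult_1_right)
  qed
  ultimately show ?thesis using True by (simp add: I_def T_def sum_distrib_left sum_divide_distrib)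
 next
  case False
  thus ?thesis unfolding I_def g_def by auto
 qed
 have "?L = (\<Sum>a0<m. \<Sum>b0<m. \<Sum>a1<m. \<Sum>b1<m. \<Sum>a2<m. \<Sum>b2<m.
   if I a0 a1 a2 then (\<Sum>k<m. T k a0 a1 a2 b0 b1 b2) / of_nat m ^ 3 else 0)"
  by (simp only: summand)
 also have "\<dots> = (\<Sum>a0<m. \<Sum>a1<m. \<Sum>a2<m. \<Sum>b0<m. \<Sum>b1<m. \<Sum>b2<m.
   if I a0 a1 a2 then (\<Sum>k<m. T k a0 a1 a2 b0 b1 b2) / of_nat m ^ 3 else 0)"
 proof (rule sum.cong[OF refl])
  fix a0
  have "(\<Sum>b0<m. \<Sum>a1<m. \<Sum>b1<m. \<Sum>a2<m. \<Sum>b2<m. h a1 a2 b0 b1 b2) = (\<Sum>a1<m. \<Sum>a2<m. \<Sum>b0<m. \<Sum>b1<m. \<Sum>b2<m. h a1 a2 b0 b1 b2)"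
   for h :: "nat \<Rightarrow> nat \<Rightarrow> nat \<Rightarrow> nat \<Rightarrow> nat \<Rightarrow> complex"
  proof -
   have "(\<Sum>b0<m. \<Sum>a1<m. \<Sum>b1<m. \<Sum>a2<m. \<Sum>b2<m. h a1 a2 b0 b1 b2) = (\<Sum>a1<m. \<Sum>b0<m. \<Sum>b1<m. \<Sum>a2<m. \<Sum>b2<m. h a1 a2 b0 b1 b2)"
    by (rule sum.swap)
   also have "\<dots> = (\<Sum>a1<m. \<Sum>b0<m. \<Sum>a2<m. \<Sum>b1<m. \<Sum>b2<m. h a1 a2 b0 b1 b2)"
    by (rule sum.cong[OF refl], rule sum.cong[OF refl], rule sum.swap)
   also have "\<dots> = (\<Sum>a1<m. \<Sum>a2<m. \<Sum>b0<m. \<Sum>b1<m. \<Sum>b2<m. h a1 a2 b0 b1 b2)"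
    by (rule sum.cong[OF refl], rule sum.swap)
   finally show ?thesis .
  qed
  thus "(\<Sum>b0<m. \<Sum>a1<m. \<Sum>b1<m. \<Sum>a2<m. \<Sum>b2<m. if I a0 a1 a2 then (\<Sum>k<m. T k a0 a1 a2 b0 b1 b2) / of_nat m ^ 3 else 0) =
    (\<Sum>a1<m. \<Sum>a2<m. \<Sum>b0<m. \<Sum>b1<m. \<Sum>b2<m. if I a0 a1 a2 then (\<Sum>k<m. T k a0 a1 a2 b0 b1 b2) / of_nat m ^ 3 else 0)" .
 qed
 also have "\<dots> = (\<Sum>a0<m. \<Sum>a1<m. \<Sum>a2<m. if I a0 a1 a2 \<and> [x + 1 + a0 = y'] (mod m) \<and> [x + 1 + a0 + a1 = z'] (mod m) then 1 else 0)"
 proof (intro sum.cong refl)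
  fix a0 a1 a2
  have "(\<Sum>b0<m. \<Sum>b1<m. \<Sum>b2<m. (\<Sum>k<m. T k a0 a1 a2 b0 b1 b2) / of_nat m ^ 3) =
    (\<Sum>k<m. \<Sum>b0<m. \<Sum>b1<m. \<Sum>b2<m. T k a0 a1 a2 b0 b1 b2) / of_nat m ^ 3"
   by (subst sum_swap_out3[symmetric]) (simp only: sum_divide_distrib)
  also have "(\<Sum>k<m. \<Sum>b0<m. \<Sum>b1<m. \<Sum>b2<m. T k a0 a1 a2 b0 b1 b2) =
    (\<Sum>k<m. (if k = x then of_nat m else 0) * (if [k + 1 + a0 = y'] (mod m) then of_nat m else 0) *
     (if [k + 1 + a0 + a1 = z'] (mod m) then of_nat m else 0))"
   unfolding T_def sum_product3 orth by (intro sum.cong refl) (use lt eqm in simp)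
  also have "\<dots> = (\<Sum>k<m. if k = x then of_nat m * (if [x + 1 + a0 = y'] (mod m) then of_nat m else 0) *
     (if [x + 1 + a0 + a1 = z'] (mod m) then of_nat m else 0) else 0)"
   by (intro sum.cong refl) simp
  also have "\<dots> = of_nat m * (if [x + 1 + a0 = y'] (mod m) then of_nat m else 0) *
     (if [x + 1 + a0 + a1 = z'] (mod m) then of_nat m else 0)"
   using lt by simp
  finally have val: "(\<Sum>b0<m. \<Sum>b1<m. \<Sum>b2<m. (\<Sum>k<m. T k a0 a1 a2 b0 b1 b2) / of_nat m ^ 3) =
    of_nat m * (if [x + 1 + a0 = y'] (mod m) then of_nat m else 0) *
     (if [x + 1 + a0 + a1 = z'] (mod m) then of_nat m else 0) / of_nat m ^ 3" .
  have "of_nat m * (if A then of_nat m else 0) * (if B then of_nat m else 0) / of_nat m ^ 3 = (if A \<and> B then 1 else 0 :: complex)" for A B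
   using m by (auto simp: power3_eq_cube)
  note val = val[unfolded this]
  show "(\<Sum>b0<m. \<Sum>b1<m. \<Sum>b2<m. if I a0 a1 a2 then (\<Sum>k<m. T k a0 a1 a2 b0 b1 b2) / of_nat m ^ 3 else 0) =
    (if I a0 a1 a2 \<and> [x + 1 + a0 = y'] (mod m) \<and> [x + 1 + a0 + a1 = z'] (mod m) then 1 else 0)"
  proof (cases "I a0 a1 a2")
   case True show ?thesis by (simp only: True if_True val simp_thms)
  next
   case False show ?thesis by (simp only: False if_False sum.neutral_const simp_thms)
  qed
 qed
 also have "\<dots> = (\<Sum>a0<m. \<Sum>a1<m. \<Sum>a2<m. if a0 = wt m 1 1 x y \<and> a1 = wt m 1 0 y' z \<and> a2 = wt m 1 0 z' x' then ?R else 0)"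
 proof (intro sum.cong refl)
  fix a0 a1 a2 assume a: "a0 \<in> {..<m}" "a1 \<in> {..<m}" "a2 \<in> {..<m}"
  have w: "[j = i + c + a] (mod m) \<longleftrightarrow> a = wt m 1 c i j" if "a < m" for i j c a
   using wt_unique[OF m cop that, of i c j] wt_cong[OF m cop, of i c j] by (auto simp: cong_sym_eq)
  have I_iff: "I a0 a1 a2 \<longleftrightarrow> a0 = wt m 1 1 x y \<and> a1 = wt m 1 0 y' z \<and> a2 = wt m 1 0 z' x' \<and> m dvd (1 + a0 + a1 + a2) \<and> J a0 a1 a2"
  proof -
   have e: "[y = x + 1 + a0] (mod m) \<longleftrightarrow> a0 = wt m 1 1 x y" "[z = y' + 0 + a1] (mod m) \<longleftrightarrow> a1 = wt m 1 0 y' z"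
    "[x' = z' + 0 + a2] (mod m) \<longleftrightarrow> a2 = wt m 1 0 z' x'"
    by (rule w, use a in simp)+
   show ?thesis unfolding I_def e by (rule refl)
  qed
  show "(if I a0 a1 a2 \<and> [x + 1 + a0 = y'] (mod m) \<and> [x + 1 + a0 + a1 = z'] (mod m) then 1 else 0) =
    (if a0 = wt m 1 1 x y \<and> a1 = wt m 1 0 y' z \<and> a2 = wt m 1 0 z' x' then ?R else 0)"
  proof (cases "a0 = wt m 1 1 x y \<and> a1 = wt m 1 0 y' z \<and> a2 = wt m 1 0 z' x'")
   case True
   hence c: "[y = x + 1 + a0] (mod m)" "[z = y' + a1] (mod m)" "[x' = z' + a2] (mod m)"
    using w[of a0 y x 1] w[of a1 z y' 0] w[of a2 x' z' 0] a by auto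
   have 1: "[x + 1 + a0 = y'] (mod m) \<longleftrightarrow> y = y'"
    using c(1) eqm[OF lt(3,4)] by (metis cong_sym cong_trans)
   have 2: "[x + 1 + a0 + a1 = z'] (mod m) \<longleftrightarrow> z = z'" if "y = y'"
   proof -
    have "[z = x + 1 + a0 + a1] (mod m)"
     using c(2) cong_add[OF c(1) cong_refl[of a1]] that cong_trans by blast
    thus ?thesis using eqm[OF lt(5,6)] by (metis cong_sym cong_trans)
   qed
   have 3: "m dvd (1 + a0 + a1 + a2) \<longleftrightarrow> x = x'" if "y = y'" "z = z'"
   proof -
    have "[x' = x + 1 + a0 + a1 + a2] (mod m)"
     using c that by (metis cong_add cong_refl cong_trans)
    hence "[x + (1 + a0 + a1 + a2) = x'] (mod m)" by (simp add: cong_sym_eq add.assoc)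
    hence "[x + (1 + a0 + a1 + a2) = x + 0] (mod m) \<longleftrightarrow> x = x'"
     using eqm[OF lt(1,2)] by (metis add_0_right cong_sym cong_trans)
    thus ?thesis by (simp only: cong_add_lcancel_nat cong_0_iff)
   qed
   have "I a0 a1 a2 \<longleftrightarrow> m dvd (1 + a0 + a1 + a2) \<and> J a0 a1 a2" using True I_iff by blast
   thus ?thesis using 1 2 3 True by auto
  next
   case False thus ?thesis using I_iff by auto
  qed
 qed
 also have "\<dots> = ?R" by (rule sum_triple_delta) (rule wt_less[OF m cop])+
 finally show ?thesis .
qed

lemma prod_sum_PiE_UN:
 fixes f :: "'r \<Rightarrow> ('i \<Rightarrow> 'a) \<Rightarrow> complex"
 assumes "finite R" "\<And>r r'. r \<in> R \<Longrightarrow> r' \<in> R \<Longrightarrow> r \<noteq> r' \<Longrightarrow> I r \<inter> I r' = {}"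
 shows "(\<Sum>n\<in>PiE (\<Union>r\<in>R. I r) F. \<Prod>r\<in>R. f r (restrict n (I r))) = (\<Prod>r\<in>R. \<Sum>n\<in>PiE (I r) F. f r n)"
 using assms
proof (induction R rule: finite_induct)
 case empty thus ?case by simp
next
 case (insert r R)
 have dj: "I r \<inter> (\<Union>r\<in>R. I r) = {}"
 proof -
  have "I r \<inter> I r' = {}" if "r' \<in> R" for r' using insert.prems[of r r'] insert.hyps that by auto
  thus ?thesis by blast
 qed
 have ih: "(\<Sum>n\<in>PiE (\<Union>r\<in>R. I r) F. \<Prod>r\<in>R. f r (restrict n (I r))) = (\<Prod>r\<in>R. \<Sum>n\<in>PiE (I r) F. f r n)"
  by (rule insert.IH) (use insert.prems in blast)
 have "(\<Sum>n\<in>PiE (\<Union>r\<in>insert r R. I r) F. \<Prod>r\<in>insert r R. f r (restrict n (I r)))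
   = (\<Sum>a\<in>PiE (I r) F. \<Sum>b\<in>PiE (\<Union>r\<in>R. I r) F. \<Prod>r'\<in>insert r R. f r' (restrict (\<lambda>i. if i \<in> I r then a i else b i) (I r')))"
  using sum_PiE_Un[OF dj] by simp
 also have "\<dots> = (\<Sum>a\<in>PiE (I r) F. \<Sum>b\<in>PiE (\<Union>r\<in>R. I r) F. f r a * (\<Prod>r'\<in>R. f r' (restrict b (I r'))))"
 proof (intro sum.cong refl)
  fix a b assume a: "a \<in> PiE (I r) F"
  have 1: "restrict (\<lambda>i. if i \<in> I r then a i else b i) (I r) = a"
   using a by (auto simp: fun_eq_iff restrict_def PiE_def extensional_def)
  have 2: "restrict (\<lambda>i. if i \<in> I r then a i else b i) (I r') = restrict b (I r')" if "r' \<in> R" for r'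
   using dj that by (auto simp: fun_eq_iff restrict_def)
  show "(\<Prod>r'\<in>insert r R. f r' (restrict (\<lambda>i. if i \<in> I r then a i else b i) (I r'))) =
    f r a * (\<Prod>r'\<in>R. f r' (restrict b (I r')))"
   using insert.hyps by (simp add: 1 2 cong: prod.cong)
 qed
 also have "\<dots> = (\<Sum>a\<in>PiE (I r) F. f r a) * (\<Prod>r\<in>R. \<Sum>n\<in>PiE (I r) F. f r n)"
  by (simp only: sum_distrib_left[symmetric] sum_distrib_right[symmetric] ih)
 also have "\<dots> = (\<Prod>r\<in>insert r R. \<Sum>n\<in>PiE (I r) F. f r n)" using insert.hyps by simp
 finally show ?case .
qed

lemma sum_PiE_reindex:
 assumes "inj_on h I"
 shows "(\<Sum>n\<in>PiE (h ` I) F. g n) = (\<Sum>k\<in>PiE I (\<lambda>i. F (h i)). g (restrict (\<lambda>j. k (the_inv_into I h j)) (h ` I)))"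
proof (rule sum.reindex_bij_witness[of _ "\<lambda>k. restrict (\<lambda>j. k (the_inv_into I h j)) (h ` I)" "\<lambda>n. restrict (\<lambda>i. n (h i)) I"])
 fix n assume n: "n \<in> PiE (h ` I) F"
 show *: "restrict (\<lambda>j. (restrict (\<lambda>i. n (h i)) I) (the_inv_into I h j)) (h ` I) = n"
 proof
  fix j show "restrict (\<lambda>j. (restrict (\<lambda>i. n (h i)) I) (the_inv_into I h j)) (h ` I) j = n j"
  proof (cases "j \<in> h ` I")
   case True
   then obtain i where i: "i \<in> I" "j = h i" by auto
   thus ?thesis using the_inv_into_f_f[OF assms i(1)] by simp
  next
   case False thus ?thesis using n by (simp add: PiE_def extensional_def)
  qed
 qed
 show "restrict (\<lambda>i. n (h i)) I \<in> PiE I (\<lambda>i. F (h i))" using n by auto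
 show "g (restrict (\<lambda>j. (restrict (\<lambda>i. n (h i)) I) (the_inv_into I h j)) (h ` I)) = g n" by (simp only: *)
next
 fix k assume k: "k \<in> PiE I (\<lambda>i. F (h i))"
 have inv: "the_inv_into I h (h i) = i" if "i \<in> I" for i using the_inv_into_f_f[OF assms that] .
 show "restrict (\<lambda>i. (restrict (\<lambda>j. k (the_inv_into I h j)) (h ` I)) (h i)) I = k"
  using k inv by (auto simp: fun_eq_iff restrict_def PiE_def extensional_def)
 show "restrict (\<lambda>j. k (the_inv_into I h j)) (h ` I) \<in> PiE (h ` I) F" using k inv by auto
qed

lemma sum_prod3_PiE:
 fixes h :: "'r \<Rightarrow> 'a \<Rightarrow> 'b \<Rightarrow> 'c \<Rightarrow> complex"
 assumes "finite R" "finite A" "finite B" "finite C"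
 shows "(\<Sum>s0\<in>PiE R (\<lambda>_. A). \<Sum>s1\<in>PiE R (\<lambda>_. B). \<Sum>s2\<in>PiE R (\<lambda>_. C). \<Prod>r\<in>R. h r (s0 r) (s1 r) (s2 r))
   = (\<Prod>r\<in>R. \<Sum>a\<in>A. \<Sum>b\<in>B. \<Sum>c\<in>C. h r a b c)"
proof -
 have "(\<Prod>r\<in>R. \<Sum>a\<in>A. \<Sum>b\<in>B. \<Sum>c\<in>C. h r a b c) = (\<Sum>s0\<in>PiE R (\<lambda>_. A). \<Prod>r\<in>R. \<Sum>b\<in>B. \<Sum>c\<in>C. h r (s0 r) b c)"
  by (rule prod_sum_PiE) (use assms in auto)
 also have "\<dots> = (\<Sum>s0\<in>PiE R (\<lambda>_. A). \<Sum>s1\<in>PiE R (\<lambda>_. B). \<Prod>r\<in>R. \<Sum>c\<in>C. h r (s0 r) (s1 r) c)"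
  by (rule sum.cong[OF refl], rule prod_sum_PiE) (use assms in auto)
 also have "\<dots> = (\<Sum>s0\<in>PiE R (\<lambda>_. A). \<Sum>s1\<in>PiE R (\<lambda>_. B). \<Sum>s2\<in>PiE R (\<lambda>_. C). \<Prod>r\<in>R. h r (s0 r) (s1 r) (s2 r))"
  by (rule sum.cong[OF refl], rule sum.cong[OF refl], rule prod_sum_PiE) (use assms in auto)
 finally show ?thesis by simp
qed

lemma sum_Times: "(\<Sum>p\<in>A \<times> B. f p) = (\<Sum>a\<in>A. \<Sum>b\<in>B. f (a, b))"
 by (simp add: sum.cartesian_product)

lemma prod_indicator:
 "finite R \<Longrightarrow> (\<Prod>r\<in>R. if Q r then 1 else 0) = (if \<forall>r\<in>R. Q r then 1 else (0::complex))"
 by (induction R rule: finite_induct) auto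

lemma card_PiE_fibre:
 assumes "finite R" "r0 \<in> R" "i < m"
 shows "m * card {x\<in>PiE R (\<lambda>_. {..<m}). x r0 = i} = card (PiE R (\<lambda>_. {..<m}))"
proof -
 have "{x\<in>PiE R (\<lambda>_. {..<m}). x r0 = i} = PiE R (\<lambda>r. if r = r0 then {i} else {..<m})"
  using assms by (auto simp: PiE_iff extensional_def split: if_splits)
 hence "card {x\<in>PiE R (\<lambda>_. {..<m}). x r0 = i} = (\<Prod>r\<in>R. if r = r0 then 1 else m)"
  using assms(1) by (simp add: card_PiE) (rule prod.cong, auto)
 also have "\<dots> = m ^ card (R - {r0})"
 proof -
  have "(\<Prod>r\<in>R. if r = r0 then 1 else m) = (\<Prod>r\<in>R - {r0}. m)"
   by (rule prod.mono_neutral_cong_right) (use assms in auto)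
  thus ?thesis by simp
 qed
 finally have c: "card {x\<in>PiE R (\<lambda>_. {..<m}). x r0 = i} = m ^ card (R - {r0})" .
 have "card R = Suc (card (R - {r0}))" by (rule card.remove[OF assms(1,2)])
 thus ?thesis using assms(1) by (simp add: c card_PiE)
qed

text \<open>Parallel rings of \<open>N\<close> sites, one for each \<open>r\<close> in
  \<open>R\<close>; all other edges join sites at the same position, so they never connect different
  clusters. The boundaries \<open>p1\<close>, \<open>p2\<close>, \<open>p3\<close> cut out three
  clusters. In each of them the step digits of sizes \<open>u\<close> and the phase digits of sizes
  \<open>w\<close> combine to \<open>m\<close> values, and every site has room for one digit of
  either kind. A chain is the case of a single line.\<close>

locale ring_lines =
 fixes G :: "'v network" and R :: "'r set" and r0 :: 'r and N m p1 p2 p3 :: nat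
  and loc :: "'r \<Rightarrow> nat \<Rightarrow> 'v" and u w :: "nat \<Rightarrow> nat"
 assumes graph: "graph_edges (verts G) (edges G)"
  and finR: "finite R" and r0: "r0 \<in> R"
  and bij: "bij_betw (\<lambda>p. loc (fst p) (snd p)) (R \<times> {..<N}) (verts G)"
  and line_edge: "\<And>r i. r \<in> R \<Longrightarrow> i < N \<Longrightarrow> {loc r i, loc r (Suc i mod N)} \<in> edges G"
  and line_dim: "\<And>r i. r \<in> R \<Longrightarrow> i < N \<Longrightarrow> bdim G {loc r i, loc r (Suc i mod N)} = m"
  and other_edge: "\<And>e. e \<in> edges G \<Longrightarrow> (\<exists>r\<in>R. \<exists>i<N. e = {loc r i, loc r (Suc i mod N)}) \<or>
    (\<exists>i<N. \<exists>r\<in>R. \<exists>r'\<in>R. e = {loc r i, loc r' i})"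
  and dim_pos: "\<And>e. e \<in> edges G \<Longrightarrow> bdim G e \<ge> 1"
  and m: "m \<ge> 2" and p: "0 < p1" "p1 < p2" "p2 < p3" "p3 \<le> N"
  and uw: "\<And>r i. r \<in> R \<Longrightarrow> i < N \<Longrightarrow> u i * w i \<le> sdim G (loc r i)"
  and uw_pos: "\<And>i. i < N \<Longrightarrow> u i \<ge> 1" "\<And>i. i < N \<Longrightarrow> w i \<ge> 1"
  and pu: "(\<Prod>i\<in>{0..<p1}. u i) = m" "(\<Prod>i\<in>{p1..<p2}. u i) = m" "(\<Prod>i\<in>{p2..<p3}. u i) = m"
  and pw: "(\<Prod>i\<in>{0..<p1}. w i) = m" "(\<Prod>i\<in>{p1..<p2}. w i) = m" "(\<Prod>i\<in>{p2..<p3}. w i) = m"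
begin

definition "coord v = the_inv_into (R \<times> {..<N}) (\<lambda>p. loc (fst p) (snd p)) v"
definition "line v = fst (coord v)"
definition "pos v = snd (coord v)"
definition "bond r i = {loc r i, loc r (Suc i mod N)}"
definition "pred i = (i + N - 1) mod N"
definition "start i = (if i < p1 then 0 else if i < p2 then p1 else p2)"
text \<open>\<open>U\<close> and \<open>W\<close> are the place values of the digits inside a
  cluster. The value 0 from \<open>p3\<close> on makes the remaining sites pass the bond index on
  without weight.\<close>

definition "U i = (if i < p3 then \<Prod>j\<in>{start i..<i}. u j else 0)"
definition "W i = (if i < p3 then \<Prod>j\<in>{start i..<i}. w j else 0)"
definition "al i s = (s - 1) mod u i" for s :: nat
definition "be i s = (s - 1) div u i" for s :: nat
text \<open>The extra 1 at site 0 is the offset that the weighted steps of a line have to close: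
  they must add up to \<open>- 1\<close> modulo \<open>m\<close>.\<close>

definition "dl i s = al i s * U i + (if i = 0 then 1 else 0)" for s :: nat
definition "cl i = (if i < p1 then 0 else if i < p2 then 1 else 2 :: nat)"
definition "om = root_of_unity m"

lemma N3: "N \<ge> 3" using p by simp

lemma coord_loc: "r \<in> R \<Longrightarrow> i < N \<Longrightarrow> coord (loc r i) = (r, i)"
 unfolding coord_def using the_inv_into_f_f[OF bij_betw_imp_inj_on[OF bij], of "(r, i)"] by simp

lemma line_loc: "r \<in> R \<Longrightarrow> i < N \<Longrightarrow> line (loc r i) = r"
 and pos_loc: "r \<in> R \<Longrightarrow> i < N \<Longrightarrow> pos (loc r i) = i"
 by (simp_all add: line_def pos_def coord_loc)

lemma loc_vert: "r \<in> R \<Longrightarrow> i < N \<Longrightarrow> loc r i \<in> verts G"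
 using bij unfolding bij_betw_def by force

lemma vert_loc: "v \<in> verts G \<Longrightarrow> \<exists>r\<in>R. \<exists>i<N. v = loc r i"
 using bij unfolding bij_betw_def by force

lemma loc_inj: "r \<in> R \<Longrightarrow> i < N \<Longrightarrow> r' \<in> R \<Longrightarrow> i' < N \<Longrightarrow> loc r i = loc r' i' \<Longrightarrow> r = r' \<and> i = i'"
 by (metis line_loc pos_loc)

lemma suc_lt: "Suc i mod N < N" using N3 by simp

lemma pred_lt: "pred i < N" using N3 by (simp add: pred_def)

lemma suc_pred: "i < N \<Longrightarrow> Suc (pred i) mod N = i"
 using N3 by (cases i) (simp_all add: pred_def)

lemma suc_eq_pred: "i < N \<Longrightarrow> j < N \<Longrightarrow> Suc j mod N = i \<Longrightarrow> j = pred i"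
 using N3 by (cases "Suc j = N") (auto simp: pred_def)

lemma suc_suc: "i < N \<Longrightarrow> Suc (Suc i mod N) mod N \<noteq> i"
proof -
 assume i: "i < N"
 consider "Suc (Suc i) < N" | "Suc (Suc i) = N" | "Suc i = N" using i by linarith
 thus ?thesis using N3 by cases auto
qed

text \<open>Different bonds of one line could coincide only with their ends exchanged, which a ring
  of at least three sites excludes by \<open>suc_suc\<close>.\<close>

lemma bond_inj:
 assumes "r \<in> R" "i < N" "r' \<in> R" "i' < N" "bond r i = bond r' i'"
 shows "r = r' \<and> i = i'"
proof -
 consider "loc r i = loc r' i'" | "loc r i = loc r' (Suc i' mod N)" "loc r (Suc i mod N) = loc r' i'"
  using assms(5) unfolding bond_def doubleton_eq_iff by blast
 thus ?thesis
 proof cases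
  case 1 thus ?thesis using loc_inj[OF assms(1-4)] by blast
 next
  case 2
  have "i = Suc i' mod N" using loc_inj[OF assms(1,2,3) suc_lt 2(1)] by blast
  moreover have "Suc i mod N = i'" using loc_inj[OF assms(1) suc_lt assms(3,4) 2(2)] by blast
  ultimately show ?thesis using suc_suc[OF assms(4)] by simp
 qed
qed

lemma bond_at:
 assumes "r \<in> R" "i < N" "r' \<in> R" "j < N" "loc r i \<in> bond r' j"
 shows "r' = r \<and> (j = i \<or> j = pred i)"
proof -
 consider "loc r i = loc r' j" | "loc r i = loc r' (Suc j mod N)" using assms(5) unfolding bond_def by blast
 thus ?thesis
 proof cases
  case 1 thus ?thesis using loc_inj[OF assms(1-4)] by blast
 next
  case 2
  hence "r = r'" "i = Suc j mod N" using loc_inj[OF assms(1,2,3) suc_lt] by blast+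
  thus ?thesis using suc_eq_pred[OF assms(2,4)] by simp
 qed
qed

lemma finV: "finite (verts G)" using graph by (simp add: graph_edges_def)

definition "fits i s h h' = ([h = h' + dl i s] (mod m))" for i s h h' :: nat

text \<open>The physical index \<open>s - 1 = al i s + u i * be i s\<close> carries a digit of the step made along the line
 and a digit of the dual phase; only the steps on the line \<open>r0\<close> are weighted with \<open>\<epsilon>\<close>.\<close>

definition "tens \<epsilon> v s n = (let r = line v; i = pos v in
  if fits i s (n (bond r i)) (n (bond r (pred i))) \<and>
   (\<forall>e\<in>inc G v. e = bond r i \<or> e = bond r (pred i) \<or> n e = 1)
  then om ^ (be i s * W i * n (bond r (pred i))) * (if r = r0 then \<epsilon> ^ (al i s * U i) else 1) else 0)"
 for \<epsilon> :: complex and n :: "'v set \<Rightarrow> nat"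

definition "core i s h h' = (if fits i s h h' then om ^ (be i s * W i * h') else 0)"

text \<open>The ring sum of one line in closed form, with \<open>k\<close> the bond index in front
  of site 0.\<close>

definition "Lv \<tau> = (if m dvd (\<Sum>i<N. dl i (\<tau> i)) then
  \<Sum>k<m. om ^ (\<Sum>i<N. (be i (\<tau> i) * W i) * (k + (\<Sum>j<i. dl j (\<tau> j)))) else 0)"

definition "hh \<sigma> = (\<Sum>i<N. al i (\<sigma> (loc r0 i)) * U i)"

lemma line_sum:
 assumes r: "r \<in> R"
 shows "(\<Sum>n\<in>PiE (bond r ` {..<N}) (\<lambda>e. {1..bdim G e}). \<Prod>i<N. core i (\<tau> i) (n (bond r i)) (n (bond r (pred i)))) = Lv \<tau>"
proof -
 have inj: "inj_on (bond r) {..<N}" using bond_inj r by (auto simp: inj_on_def)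
 have "(\<Sum>n\<in>PiE (bond r ` {..<N}) (\<lambda>e. {1..bdim G e}). \<Prod>i<N. core i (\<tau> i) (n (bond r i)) (n (bond r (pred i))))
   = (\<Sum>\<kappa>\<in>PiE {..<N} (\<lambda>i. {1..bdim G (bond r i)}). \<Prod>i<N. core i (\<tau> i) (\<kappa> i) (\<kappa> (pred i)))"
  unfolding sum_PiE_reindex[OF inj]
  by (intro sum.cong refl prod.cong) (simp add: the_inv_into_f_f[OF inj] pred_lt)
 also have "PiE {..<N} (\<lambda>i. {1..bdim G (bond r i)}) = PiE {..<N} (\<lambda>_. {1..m})"
  by (rule PiE_cong) (use line_dim[OF r] in \<open>simp add: bond_def\<close>)
 also have "(\<Sum>\<kappa>\<in>PiE {..<N} (\<lambda>_. {1..m}). \<Prod>i<N. core i (\<tau> i) (\<kappa> i) (\<kappa> (pred i))) = Lv \<tau>"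
  unfolding core_def fits_def Lv_def pred_def
  by (rule ring_sum) (use N3 m root_of_unity_power in \<open>auto simp: om_def\<close>)
 finally show ?thesis .
qed

text \<open>The tensors freeze all bonds outside the lines at index 1, so the contraction splits
  into the ring sums of the lines; the weights along \<open>r0\<close> collect into one power of
  \<open>\<epsilon>\<close>.\<close>

lemma peps_tens:
 assumes \<sigma>: "\<sigma> \<in> configs (verts G) (sdim G)"
 shows "peps_vec G (tens \<epsilon>) \<sigma> = \<epsilon> ^ hh \<sigma> * (\<Prod>r\<in>R. Lv (\<lambda>i. \<sigma> (loc r i)))"
proof -
 let ?l = "\<lambda>r n. \<Prod>i<N. core i (\<sigma> (loc r i)) (n (bond r i)) (n (bond r (pred i)))"
 let ?C = "\<lambda>a. \<Prod>r\<in>R. \<Prod>i<N. core i (\<sigma> (loc r i)) (a (bond r i)) (a (bond r (pred i)))"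
 define F where "F = (\<lambda>e. {1..bdim G e})"
 define LL where "LL = (\<Union>r\<in>R. bond r ` {..<N})"
 define RE where "RE = edges G - LL"
 have LLE: "LL \<subseteq> edges G" using line_edge by (auto simp: LL_def bond_def)
 hence E: "edges G = LL \<union> RE" by (auto simp: RE_def)
 have dj: "LL \<inter> RE = {}" by (auto simp: RE_def)
 define one where "one = restrict (\<lambda>_::'v set. 1::nat) RE"
 have oneF: "one \<in> PiE RE F" using dim_pos by (auto simp: one_def F_def RE_def)
 have finE: "finite (edges G)" using graph by (rule graph_edges_finite)
 have finRE: "finite (PiE RE F)" using finE by (auto simp: RE_def F_def intro!: finite_PiE)
 define mg where "mg a b = (\<lambda>e. if e \<in> LL then a e else b e)" for a b :: "'v set \<Rightarrow> nat"
 let ?T = "\<lambda>a b. \<Prod>v\<in>verts G. tens \<epsilon> v (\<sigma> v) (restrict (mg a b) (inc G v))"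
 have bl: "bond r i \<in> LL" if "r \<in> R" "i < N" for r i using that by (auto simp: LL_def)
 have site: "tens \<epsilon> (loc r i) (\<sigma> (loc r i)) (restrict (mg a b) (inc G (loc r i))) =
   (if \<forall>e\<in>inc G (loc r i) \<inter> RE. b e = 1 then core i (\<sigma> (loc r i)) (a (bond r i)) (a (bond r (pred i))) *
     (if r = r0 then \<epsilon> ^ (al i (\<sigma> (loc r i)) * U i) else 1) else 0)"
  if ri: "r \<in> R" "i < N" for r i a b
 proof -
  have i1: "bond r i \<in> inc G (loc r i)" "bond r (pred i) \<in> inc G (loc r i)"
   using line_edge[OF ri] line_edge[OF ri(1) pred_lt[of i]] suc_pred[OF ri(2)] by (simp_all add: inc_def bond_def)
  have "(\<forall>e\<in>inc G (loc r i). e = bond r i \<or> e = bond r (pred i) \<or> restrict (mg a b) (inc G (loc r i)) e = 1)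
    \<longleftrightarrow> (\<forall>e\<in>inc G (loc r i) \<inter> RE. b e = 1)"
  proof
   assume L: "\<forall>e\<in>inc G (loc r i). e = bond r i \<or> e = bond r (pred i) \<or> restrict (mg a b) (inc G (loc r i)) e = 1"
   show "\<forall>e\<in>inc G (loc r i) \<inter> RE. b e = 1"
   proof
    fix e assume e: "e \<in> inc G (loc r i) \<inter> RE"
    hence "e \<notin> LL" using dj by blast
    hence "e \<noteq> bond r i" "e \<noteq> bond r (pred i)" using bl[OF ri(1)] ri(2) pred_lt by blast+
    hence "mg a b e = 1" using L e by auto
    thus "b e = 1" using \<open>e \<notin> LL\<close> by (simp add: mg_def)
   qed
  next
   assume Rr: "\<forall>e\<in>inc G (loc r i) \<inter> RE. b e = 1"
   show "\<forall>e\<in>inc G (loc r i). e = bond r i \<or> e = bond r (pred i) \<or> restrict (mg a b) (inc G (loc r i)) e = 1"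
   proof
    fix e assume e: "e \<in> inc G (loc r i)"
    show "e = bond r i \<or> e = bond r (pred i) \<or> restrict (mg a b) (inc G (loc r i)) e = 1"
    proof (cases "e \<in> LL")
     case True
     then obtain r' j where rj: "r' \<in> R" "j < N" "e = bond r' j" by (auto simp: LL_def)
     have "loc r i \<in> bond r' j" using e rj(3) by (simp add: inc_def)
     hence "r' = r \<and> (j = i \<or> j = pred i)" by (rule bond_at[OF ri rj(1,2)])
     thus ?thesis using rj(3) by blast
    next
     case False
     hence "e \<in> RE" using e by (simp add: RE_def inc_def)
     thus ?thesis using Rr e False by (simp add: mg_def)
    qed
   qed
  qed
  thus ?thesis
   unfolding tens_def Let_def line_loc[OF ri] pos_loc[OF ri] core_def
   using i1 bl[OF ri] bl[OF ri(1) pred_lt[of i]] by (simp add: mg_def)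
 qed
 have prod_sites: "(\<Prod>v\<in>verts G. t v) = (\<Prod>r\<in>R. \<Prod>i<N. t (loc r i))" for t :: "'v \<Rightarrow> complex"
 proof -
  have "(\<Prod>v\<in>verts G. t v) = (\<Prod>q\<in>R \<times> {..<N}. t (loc (fst q) (snd q)))"
   using prod.reindex_bij_betw[OF bij, of t] by simp
  thus ?thesis by (simp add: prod.cartesian_product case_prod_unfold)
 qed
 have val: "?T a b =
   (if b = one then \<epsilon> ^ hh \<sigma> * ?C a else 0)"
  if b: "b \<in> PiE RE F" for a b
 proof (cases "b = one")
  case True
  have "?T a b =
   (\<Prod>r\<in>R. \<Prod>i<N. core i (\<sigma> (loc r i)) (a (bond r i)) (a (bond r (pred i))) *
     (if r = r0 then \<epsilon> ^ (al i (\<sigma> (loc r i)) * U i) else 1))"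
   unfolding prod_sites by (intro prod.cong refl) (subst site, simp_all add: True one_def)
  also have "\<dots> = (?C a) *
    (\<Prod>r\<in>R. \<Prod>i<N. (if r = r0 then \<epsilon> ^ (al i (\<sigma> (loc r i)) * U i) else 1))"
   by (simp only: prod.distrib)
  also have "(\<Prod>r\<in>R. \<Prod>i<N. (if r = r0 then \<epsilon> ^ (al i (\<sigma> (loc r i)) * U i) else 1)) =
    (\<Prod>r\<in>R. if r = r0 then \<epsilon> ^ hh \<sigma> else 1)"
   by (intro prod.cong refl) (simp add: hh_def power_sum)
  also have "\<dots> = \<epsilon> ^ hh \<sigma>" using finR r0 by simp
  finally show ?thesis by (simp only: True if_True simp_thms mult.commute)
 next
  case False
  then obtain e where e: "b e \<noteq> one e" by blast
  hence eR: "e \<in> RE" using b by (cases "e \<in> RE") (auto simp: one_def PiE_def extensional_def)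
  hence be: "b e \<noteq> 1" using e by (simp add: one_def)
  have "e \<in> edges G" using eR by (simp add: RE_def)
  then obtain v where v: "v \<in> e" "v \<in> verts G" using edge_two[OF graph] by blast
  obtain r i where ri: "r \<in> R" "i < N" "v = loc r i" using vert_loc[OF v(2)] by blast
  have "e \<in> inc G (loc r i) \<inter> RE" using \<open>e \<in> edges G\<close> v(1) ri(3) eR by (simp add: inc_def)
  hence "tens \<epsilon> v (\<sigma> v) (restrict (mg a b) (inc G v)) = 0"
   unfolding ri(3) site[OF ri(1,2)] using be by (intro if_not_P) blast
  hence "?T a b = 0"
   using finV v(2) by (intro prod_zero bexI[of _ v])
  thus ?thesis using False by simp
 qed
 have "peps_vec G (tens \<epsilon>) \<sigma> = (\<Sum>n\<in>PiE (edges G) F. \<Prod>v\<in>verts G. tens \<epsilon> v (\<sigma> v) (restrict n (inc G v)))"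
  using \<sigma> by (simp add: peps_vec_def vec_of_def F_def)
 also have "\<dots> = (\<Sum>a\<in>PiE LL F. \<Sum>b\<in>PiE RE F. ?T a b)"
  unfolding mg_def by (subst E) (rule sum_PiE_Un[OF dj])
 also have "\<dots> = (\<Sum>a\<in>PiE LL F. \<epsilon> ^ hh \<sigma> * ?C a)"
 proof (intro sum.cong refl)
  fix a
  have "(\<Sum>b\<in>PiE RE F. ?T a b) =
   (\<Sum>b\<in>PiE RE F. if b = one then \<epsilon> ^ hh \<sigma> * ?C a else 0)"
   by (rule sum.cong[OF refl]) (rule val)
  thus "(\<Sum>b\<in>PiE RE F. ?T a b) =
   \<epsilon> ^ hh \<sigma> * ?C a"
   using oneF finRE by simp
 qed
 also have "\<dots> = \<epsilon> ^ hh \<sigma> * (\<Sum>a\<in>PiE LL F. \<Prod>r\<in>R. (\<lambda>n. ?l r n) (restrict a (bond r ` {..<N})))"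
  unfolding sum_distrib_left by (intro sum.cong arg_cong2[of _ _ _ _ "(*)"] prod.cong refl) (simp add: pred_lt)
 also have "(\<Sum>a\<in>PiE LL F. \<Prod>r\<in>R. (\<lambda>n. ?l r n) (restrict a (bond r ` {..<N}))) =
   (\<Prod>r\<in>R. \<Sum>n\<in>PiE (bond r ` {..<N}) F. ?l r n)"
  unfolding LL_def
 proof (rule prod_sum_PiE_UN[OF finR])
  show "bond r ` {..<N} \<inter> bond r' ` {..<N} = {}" if "r \<in> R" "r' \<in> R" "r \<noteq> r'" for r r'
   using bond_inj that by blast
 qed
 also have "\<dots> = (\<Prod>r\<in>R. Lv (\<lambda>i. \<sigma> (loc r i)))"
  unfolding F_def by (intro prod.cong refl) (rule line_sum)
 finally show ?thesis .
qed

text \<open>The coefficient of \<open>\<epsilon> ^ (m - 1)\<close>, the lowest power that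
  occurs.\<close>

definition "\<Phi>0 = vec_of (verts G) (sdim G) (\<lambda>\<sigma>. if hh \<sigma> = m - 1 then \<Prod>r\<in>R. Lv (\<lambda>i. \<sigma> (loc r i)) else 0)"

text \<open>The steps along \<open>r0\<close>, including the offset at site 0, add up to
  \<open>hh \<sigma> + 1\<close>, which is a positive multiple of \<open>m\<close> wherever the
  amplitude is nonzero.\<close>

lemma hh_ge:
 assumes "(\<Prod>r\<in>R. Lv (\<lambda>i. \<sigma> (loc r i))) \<noteq> 0"
 shows "hh \<sigma> \<ge> m - 1"
proof -
 have "Lv (\<lambda>i. \<sigma> (loc r0 i)) \<noteq> 0" using assms r0 finR by auto
 hence "m dvd (\<Sum>i<N. dl i (\<sigma> (loc r0 i)))" by (auto simp: Lv_def split: if_splits)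
 moreover have "(\<Sum>i<N. dl i (\<sigma> (loc r0 i))) = hh \<sigma> + 1"
  using N3 by (simp add: dl_def hh_def sum.distrib)
 ultimately have "m \<le> hh \<sigma> + 1" by (intro dvd_imp_le) auto
 thus ?thesis by simp
qed

definition "\<Phi> k = (\<lambda>\<sigma>. (1 / (1 / of_nat (Suc k)) ^ (m - 1)) * peps_vec G (tens (1 / of_nat (Suc k))) \<sigma>)" for k :: nat

lemma \<Phi>_cone: "peps_cone G (\<Phi> k)"
proof -
 have "verts G \<noteq> {}" using loc_vert[OF r0, of 0] N3 by auto
 thus ?thesis unfolding \<Phi>_def by (intro peps_cone_scale[OF finV]) (auto simp: peps_cone_def)
qed

lemma \<Phi>_lim: "(\<lambda>k. \<Phi> k \<sigma>) \<longlonglongrightarrow> \<Phi>0 \<sigma>"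
proof (cases "\<sigma> \<in> configs (verts G) (sdim G)")
 case False
 thus ?thesis by (simp add: \<Phi>_def \<Phi>0_def peps_vec_def vec_of_def)
next
 case True
 define L where "L = (\<Prod>r\<in>R. Lv (\<lambda>i. \<sigma> (loc r i)))"
 have inv: "(\<lambda>k. 1 / complex_of_nat (Suc k)) \<longlonglongrightarrow> 0"
  using LIMSEQ_inverse_real_of_nat[THEN tendsto_of_real, where 'a = complex] by (simp add: inverse_eq_divide)
 have e: "\<Phi> k \<sigma> = (1 / of_nat (Suc k)) ^ (hh \<sigma> - (m - 1)) * L" for k
 proof (cases "L = 0")
  case True thus ?thesis using peps_tens[OF \<open>\<sigma> \<in> _\<close>] by (simp add: \<Phi>_def L_def)
 next
  case False
  hence "hh \<sigma> = (hh \<sigma> - (m - 1)) + (m - 1)" using hh_ge[of \<sigma>] by (simp add: L_def)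
  hence "(1 / complex_of_nat (Suc k)) ^ hh \<sigma> = (1 / of_nat (Suc k)) ^ (hh \<sigma> - (m - 1)) * (1 / of_nat (Suc k)) ^ (m - 1)"
   by (metis power_add)
  moreover have "(1 / complex_of_nat (Suc k)) ^ (m - 1) \<noteq> 0"
   by (metis divide_eq_0_iff of_nat_neq_0 one_neq_zero power_not_zero)
  moreover have "(1 / q) * ((a * q) * l) = a * l" if "q \<noteq> 0" for q a l :: complex
   using that by simp
  ultimately show ?thesis unfolding \<Phi>_def peps_tens[OF True] L_def[symmetric] by (simp only:) blast
 qed
 have "(\<lambda>k. (1 / complex_of_nat (Suc k)) ^ (hh \<sigma> - (m - 1)) * L) \<longlonglongrightarrow> 0 ^ (hh \<sigma> - (m - 1)) * L"
  by (intro tendsto_intros inv)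
 moreover have "0 ^ (hh \<sigma> - (m - 1)) * L = \<Phi>0 \<sigma>"
 proof (cases "L = 0")
  case True thus ?thesis using \<open>\<sigma> \<in> _\<close> by (simp add: \<Phi>0_def vec_of_def L_def)
 next
  case False
  thus ?thesis using True hh_ge[of \<sigma>] by (simp add: \<Phi>0_def vec_of_def L_def power_0_left)
 qed
 ultimately show ?thesis by (simp only: e)
qed

text \<open>The index at position \<open>i\<close> that holds the digits of the step and phase
  labels assigned to its cluster. Idle sites get index 1, which stands for digits 0.\<close>

definition "sv t i = (if i < p3 then 1 + (fst (t (cl i)) div U i mod u i) + u i * (snd (t (cl i)) div W i mod w i) else 1)"
 for t :: "nat \<Rightarrow> nat \<times> nat"

text \<open>Phases caused by the partial steps made inside a cluster before each of its sites. They
  depend on the labels of this cluster alone, so its functional can undo them. In \<open>ph0\<close>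
  the offset counts from the second site on, because a site reads the bond in front of it.\<close>

definition "ph0 a b = (\<Sum>i\<in>{0..<p1}. ((b div W i mod w i) * W i) * ((if i = 0 then 0 else 1) + (\<Sum>j<i. (a div U j mod u j) * U j)))" for a b :: nat
definition "ph1 a b = (\<Sum>i\<in>{p1..<p2}. ((b div W i mod w i) * W i) * (\<Sum>j\<in>{p1..<i}. (a div U j mod u j) * U j))" for a b :: nat
definition "ph2 a b = (\<Sum>i\<in>{p2..<p3}. ((b div W i mod w i) * W i) * (\<Sum>j\<in>{p2..<i}. (a div U j mod u j) * U j))" for a b :: nat

lemma al_sv: "i < N \<Longrightarrow> al i (sv t i) * U i = (if i < p3 then (fst (t (cl i)) div U i mod u i) * U i else 0)"
 using uw_pos(1)[of i] by (auto simp: al_def sv_def U_def)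

lemma be_sv: "i < N \<Longrightarrow> be i (sv t i) * W i = (if i < p3 then (snd (t (cl i)) div W i mod w i) * W i else 0)"
 using uw_pos(1)[of i] by (auto simp: be_def sv_def W_def)

lemma UW_cluster:
 shows "i < p1 \<Longrightarrow> U i = (\<Prod>j\<in>{0..<i}. u j)" "p1 \<le> i \<Longrightarrow> i < p2 \<Longrightarrow> U i = (\<Prod>j\<in>{p1..<i}. u j)"
  "p2 \<le> i \<Longrightarrow> i < p3 \<Longrightarrow> U i = (\<Prod>j\<in>{p2..<i}. u j)"
  "i < p1 \<Longrightarrow> W i = (\<Prod>j\<in>{0..<i}. w j)" "p1 \<le> i \<Longrightarrow> i < p2 \<Longrightarrow> W i = (\<Prod>j\<in>{p1..<i}. w j)"
  "p2 \<le> i \<Longrightarrow> i < p3 \<Longrightarrow> W i = (\<Prod>j\<in>{p2..<i}. w j)"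
 using p by (auto simp: U_def W_def start_def)

lemma digit_sums:
 assumes "a < m"
 shows "(\<Sum>i\<in>{0..<p1}. (a div U i mod u i) * U i) = a" "(\<Sum>i\<in>{p1..<p2}. (a div U i mod u i) * U i) = a"
  "(\<Sum>i\<in>{p2..<p3}. (a div U i mod u i) * U i) = a"
  "(\<Sum>i\<in>{0..<p1}. (a div W i mod w i) * W i) = a" "(\<Sum>i\<in>{p1..<p2}. (a div W i mod w i) * W i) = a"
  "(\<Sum>i\<in>{p2..<p3}. (a div W i mod w i) * W i) = a"
proof -
 have aux: "(\<Sum>i\<in>{s..<t}. (a div X i mod f i) * X i) = a"
  if "s \<le> t" "\<And>i. i \<in> {s..<t} \<Longrightarrow> X i = (\<Prod>j\<in>{s..<i}. f j)" "(\<Prod>j\<in>{s..<t}. f j) = m" for s t and X f :: "nat \<Rightarrow> nat"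
 proof -
  have "(\<Sum>i\<in>{s..<t}. (a div X i mod f i) * X i) = (\<Sum>i\<in>{s..<t}. (a div (\<Prod>j\<in>{s..<i}. f j) mod f i) * (\<Prod>j\<in>{s..<i}. f j))"
   by (rule sum.cong[OF refl]) (simp only: that(2))
  also have "\<dots> = a mod m" using digit_expansion[OF that(1), of a f] by (simp only: that(3))
  finally show ?thesis using assms by simp
 qed
 show "(\<Sum>i\<in>{0..<p1}. (a div U i mod u i) * U i) = a" by (rule aux) (use p pu UW_cluster in auto)
 show "(\<Sum>i\<in>{p1..<p2}. (a div U i mod u i) * U i) = a" by (rule aux) (use p pu UW_cluster in auto)
 show "(\<Sum>i\<in>{p2..<p3}. (a div U i mod u i) * U i) = a" by (rule aux) (use p pu UW_cluster in auto)
 show "(\<Sum>i\<in>{0..<p1}. (a div W i mod w i) * W i) = a" by (rule aux) (use p pw UW_cluster in auto)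
 show "(\<Sum>i\<in>{p1..<p2}. (a div W i mod w i) * W i) = a" by (rule aux) (use p pw UW_cluster in auto)
 show "(\<Sum>i\<in>{p2..<p3}. (a div W i mod w i) * W i) = a" by (rule aux) (use p pw UW_cluster in auto)
qed

lemma sum_split: "(\<Sum>i<N. f i) = (\<Sum>i\<in>{0..<p1}. f i) + (\<Sum>i\<in>{p1..<p2}. f i) + (\<Sum>i\<in>{p2..<p3}. f i) + (\<Sum>i\<in>{p3..<N}. f i :: nat)"
 using p by (simp add: lessThan_atLeast0 sum.atLeastLessThan_concat)

text \<open>The three clusters are entered at the positions \<open>k\<close>,
  \<open>k + 1 + a0\<close> and \<open>k + 1 + a0 + a1\<close>. Since the phase digits of a cluster
  add up to its phase label, the exponent is label times entry position, plus the phases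
  \<open>ph0\<close>, \<open>ph1\<close>, \<open>ph2\<close>.\<close>

lemma line_value:
 assumes "fst (t 0) < m" "snd (t 0) < m" "fst (t 1) < m" "snd (t 1) < m" "fst (t 2) < m" "snd (t 2) < m"
 shows "Lv (sv t) = (if m dvd (1 + fst (t 0) + fst (t 1) + fst (t 2)) then
   \<Sum>k<m. om ^ (k * snd (t 0) + (k + 1 + fst (t 0)) * snd (t 1) + (k + 1 + fst (t 0) + fst (t 1)) * snd (t 2) +
    (ph0 (fst (t 0)) (snd (t 0)) + ph1 (fst (t 1)) (snd (t 1)) + ph2 (fst (t 2)) (snd (t 2)))) else 0)"
proof -
 obtain a0 b0 where t0: "t 0 = (a0, b0)" by fastforce
 obtain a1 b1 where t1: "t 1 = (a1, b1)" by fastforce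
 obtain a2 b2 where t2: "t 2 = (a2, b2)" by fastforce
 have lt: "a0 < m" "b0 < m" "a1 < m" "b1 < m" "a2 < m" "b2 < m" using assms t0 t1 t2 by simp_all
 define da where "da i = al i (sv t i) * U i" for i
 define db where "db i = be i (sv t i) * W i" for i
 define D where "D i = (\<Sum>j<i. dl j (sv t j))" for i
 have da0: "da i = (a0 div U i mod u i) * U i" and db0: "db i = (b0 div W i mod w i) * W i" if "i \<in> {0..<p1}" for i
  using that p al_sv[of i t] be_sv[of i t] by (simp_all add: da_def db_def cl_def t0)
 have da1: "da i = (a1 div U i mod u i) * U i" and db1: "db i = (b1 div W i mod w i) * W i" if "i \<in> {p1..<p2}" for i
  using that p al_sv[of i t] be_sv[of i t] t1 by (simp_all add: da_def db_def cl_def)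
 have da2: "da i = (a2 div U i mod u i) * U i" and db2: "db i = (b2 div W i mod w i) * W i" if "i \<in> {p2..<p3}" for i
  using that p al_sv[of i t] be_sv[of i t] by (simp_all add: da_def db_def cl_def t2)
 have da3: "da i = 0" and db3: "db i = 0" if "i \<in> {p3..<N}" for i
  using that p al_sv[of i t] be_sv[of i t] by (simp_all add: da_def db_def)
 have sa: "(\<Sum>i\<in>{0..<p1}. da i) = a0" "(\<Sum>i\<in>{p1..<p2}. da i) = a1" "(\<Sum>i\<in>{p2..<p3}. da i) = a2"
  by (rule trans[OF sum.cong[OF refl da0] digit_sums(1)[OF lt(1)]], assumption,
    rule trans[OF sum.cong[OF refl da1] digit_sums(2)[OF lt(3)]], assumption,
    rule trans[OF sum.cong[OF refl da2] digit_sums(3)[OF lt(5)]], assumption)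
 have sb: "(\<Sum>i\<in>{0..<p1}. db i) = b0" "(\<Sum>i\<in>{p1..<p2}. db i) = b1" "(\<Sum>i\<in>{p2..<p3}. db i) = b2"
  by (rule trans[OF sum.cong[OF refl db0] digit_sums(4)[OF lt(2)]], assumption,
    rule trans[OF sum.cong[OF refl db1] digit_sums(5)[OF lt(4)]], assumption,
    rule trans[OF sum.cong[OF refl db2] digit_sums(6)[OF lt(6)]], assumption)
 have De: "D i = (if i = 0 then 0 else 1) + (\<Sum>j<i. da j)" for i
  by (induction i) (auto simp: D_def dl_def da_def)
 have tot: "(\<Sum>i<N. dl i (sv t i)) = 1 + a0 + a1 + a2"
  using De[of N] N3 sum_split[of da] da3 by (simp add: D_def sa)
 have D1: "D i = 1 + a0 + (\<Sum>j\<in>{p1..<i}. (a1 div U j mod u j) * U j)" if "i \<in> {p1..<p2}" for i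
 proof -
  have "(\<Sum>j<i. da j) = (\<Sum>j\<in>{0..<p1}. da j) + (\<Sum>j\<in>{p1..<i}. da j)"
   using that by (simp add: lessThan_atLeast0 sum.atLeastLessThan_concat)
  also have "(\<Sum>j\<in>{p1..<i}. da j) = (\<Sum>j\<in>{p1..<i}. (a1 div U j mod u j) * U j)"
   by (rule sum.cong[OF refl], rule da1) (use that in auto)
  finally show ?thesis using that p by (simp add: De sa)
 qed
 have D2: "D i = 1 + a0 + a1 + (\<Sum>j\<in>{p2..<i}. (a2 div U j mod u j) * U j)" if "i \<in> {p2..<p3}" for i
 proof -
  have "(\<Sum>j<i. da j) = (\<Sum>j\<in>{0..<p1}. da j) + (\<Sum>j\<in>{p1..<p2}. da j) + (\<Sum>j\<in>{p2..<i}. da j)"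
   using that p by (simp add: lessThan_atLeast0 sum.atLeastLessThan_concat)
  also have "(\<Sum>j\<in>{p2..<i}. da j) = (\<Sum>j\<in>{p2..<i}. (a2 div U j mod u j) * U j)"
   by (rule sum.cong[OF refl], rule da2) (use that in auto)
  finally show ?thesis using that p by (simp add: De sa)
 qed
 have D0: "D i = (if i = 0 then 0 else 1) + (\<Sum>j<i. (a0 div U j mod u j) * U j)" if "i \<in> {0..<p1}" for i
 proof -
  have "(\<Sum>j<i. da j) = (\<Sum>j<i. (a0 div U j mod u j) * U j)"
   by (rule sum.cong[OF refl], rule da0) (use that in auto)
  thus ?thesis by (simp add: De)
 qed
 have ex: "(\<Sum>i<N. db i * (k + D i)) = k * b0 + (k + 1 + a0) * b1 + (k + 1 + a0 + a1) * b2 +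
    (ph0 a0 b0 + ph1 a1 b1 + ph2 a2 b2)" for k
 proof -
  have e0: "(\<Sum>i\<in>{0..<p1}. db i * (k + D i)) = k * b0 + ph0 a0 b0"
  proof -
   have "(\<Sum>i\<in>{0..<p1}. db i * (k + D i)) = k * (\<Sum>i\<in>{0..<p1}. db i) + (\<Sum>i\<in>{0..<p1}. db i * D i)"
    by (simp add: distrib_left sum.distrib sum_distrib_left mult.commute)
   also have "(\<Sum>i\<in>{0..<p1}. db i * D i) = ph0 a0 b0"
    unfolding ph0_def by (rule sum.cong[OF refl]) (simp only: db0 D0)
   finally show ?thesis by (simp only: sb)
  qed
  have e1: "(\<Sum>i\<in>{p1..<p2}. db i * (k + D i)) = (k + 1 + a0) * b1 + ph1 a1 b1"
  proof -
   have "(\<Sum>i\<in>{p1..<p2}. db i * (k + D i)) = (\<Sum>i\<in>{p1..<p2}. (k + 1 + a0) * db i + db i * (\<Sum>j\<in>{p1..<i}. (a1 div U j mod u j) * U j))"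
    by (rule sum.cong[OF refl]) (simp add: D1 algebra_simps)
   also have "\<dots> = (k + 1 + a0) * (\<Sum>i\<in>{p1..<p2}. db i) + (\<Sum>i\<in>{p1..<p2}. db i * (\<Sum>j\<in>{p1..<i}. (a1 div U j mod u j) * U j))"
    by (simp only: sum.distrib sum_distrib_left)
   also have "(\<Sum>i\<in>{p1..<p2}. db i * (\<Sum>j\<in>{p1..<i}. (a1 div U j mod u j) * U j)) = ph1 a1 b1"
    unfolding ph1_def by (rule sum.cong[OF refl]) (simp only: db1)
   finally show ?thesis by (simp only: sb)
  qed
  have e2: "(\<Sum>i\<in>{p2..<p3}. db i * (k + D i)) = (k + 1 + a0 + a1) * b2 + ph2 a2 b2"
  proof -
   have "(\<Sum>i\<in>{p2..<p3}. db i * (k + D i)) = (\<Sum>i\<in>{p2..<p3}. (k + 1 + a0 + a1) * db i + db i * (\<Sum>j\<in>{p2..<i}. (a2 div U j mod u j) * U j))"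
    by (rule sum.cong[OF refl]) (simp add: D2 algebra_simps)
   also have "\<dots> = (k + 1 + a0 + a1) * (\<Sum>i\<in>{p2..<p3}. db i) + (\<Sum>i\<in>{p2..<p3}. db i * (\<Sum>j\<in>{p2..<i}. (a2 div U j mod u j) * U j))"
    by (simp only: sum.distrib sum_distrib_left)
   also have "(\<Sum>i\<in>{p2..<p3}. db i * (\<Sum>j\<in>{p2..<i}. (a2 div U j mod u j) * U j)) = ph2 a2 b2"
    unfolding ph2_def by (rule sum.cong[OF refl]) (simp only: db2)
   finally show ?thesis by (simp only: sb)
  qed
  have e3: "(\<Sum>i\<in>{p3..<N}. db i * (k + D i)) = 0" by (rule sum.neutral) (simp add: db3)
  show ?thesis unfolding sum_split e0 e1 e2 e3 by simp
 qed
 show ?thesis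
  unfolding Lv_def tot t0 t1 t2 fst_conv snd_conv ex[symmetric] db_def D_def by (rule refl)
qed

section \<open>Cluster labels and the pull back of the limit state\<close>

definition "trip s0 s1 s2 c = (if c = 0 then s0 else if c = 1 then s1 else s2)" for c :: nat and s0 s1 s2 :: "'r \<Rightarrow> nat \<times> nat"

definition "cfg t = restrict (\<lambda>v. sv (\<lambda>c. t c (line v)) (pos v)) (verts G)" for t :: "nat \<Rightarrow> 'r \<Rightarrow> nat \<times> nat"

lemma cfg_configs: "cfg t \<in> configs (verts G) (sdim G)"
 unfolding configs_def
proof (rule PiE_I)
 fix v assume v: "v \<in> verts G"
 then obtain r i where ri: "r \<in> R" "i < N" "v = loc r i" using vert_loc by blast
 have le: "u i * w i \<le> sdim G (loc r i)" "1 \<le> u i" "1 \<le> w i" using uw[OF ri(1,2)] uw_pos ri by auto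
 have "x + u i * y \<le> u i * w i - 1" if "x < u i" "y < w i" for x y
 proof -
  have "x + u i * y + 1 \<le> u i * (y + 1)" using that by simp
  also have "\<dots> \<le> u i * w i" using that by (intro mult_le_mono2) simp
  finally show ?thesis by simp
 qed
 note * = this[of "a mod u i" "b mod w i" for a b]
 have "sv t' i \<in> {1..sdim G (loc r i)}" for t'
 proof (cases "i < p3")
  case True
  have "fst (t' (cl i)) div U i mod u i + u i * (snd (t' (cl i)) div W i mod w i) \<le> u i * w i - 1"
   by (rule *) (use le in auto)
  moreover have "u i * w i \<ge> 1" using le by simp
  ultimately have "1 + (fst (t' (cl i)) div U i mod u i + u i * (snd (t' (cl i)) div W i mod w i)) \<le> u i * w i" by linarith
  thus ?thesis using True le(1) by (simp add: sv_def)
 next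
  case False
  have "u i * w i \<ge> 1" using le by simp
  hence "1 \<le> sdim G (loc r i)" using le(1) by linarith
  thus ?thesis using False by (simp add: sv_def)
 qed
 thus "cfg t v \<in> {1..sdim G v}" using v ri by (simp add: cfg_def line_loc pos_loc)
qed (simp add: cfg_def)

lemma cfg_loc: "r \<in> R \<Longrightarrow> i < N \<Longrightarrow> cfg t (loc r i) = sv (\<lambda>c. t c r) i"
 by (simp add: cfg_def loc_vert line_loc pos_loc)

definition "S = PiE R (\<lambda>_. {..<m} \<times> {..<m})"

definition "amp J q0 q1 q2 = (if m dvd (1 + fst q0 + fst q1 + fst q2) \<and> J (fst q0) (fst q1) (fst q2) then
   \<Sum>k<m. om ^ (k * snd q0 + (k + 1 + fst q0) * snd q1 + (k + 1 + fst q0 + fst q1) * snd q2 +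
    (ph0 (fst q0) (snd q0) + ph1 (fst q1) (snd q1) + ph2 (fst q2) (snd q2))) else 0)"
 for J :: "nat \<Rightarrow> nat \<Rightarrow> nat \<Rightarrow> bool" and q0 q1 q2 :: "nat \<times> nat"

text \<open>The limit constrains the steps of \<open>r0\<close> alone; the other lines merely close
  up modulo \<open>m\<close>.\<close>

definition "JJ r a b c = (r = r0 \<longrightarrow> a + b + c = m - 1)" for a b c :: nat

lemma \<Phi>0_cfg:
 assumes s: "s0 \<in> S" "s1 \<in> S" "s2 \<in> S"
 shows "\<Phi>0 (cfg (trip s0 s1 s2)) = (\<Prod>r\<in>R. amp (JJ r) (s0 r) (s1 r) (s2 r))"
proof -
 let ?t = "trip s0 s1 s2"
 have tr: "?t 0 = s0" "?t 1 = s1" "?t 2 = s2" by (simp_all add: trip_def)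
 have lt: "fst (s r) < m" "snd (s r) < m" if "r \<in> R" "s \<in> S" for r s
  using that by (auto simp: S_def PiE_iff mem_Times_iff)
 have Lc: "Lv (\<lambda>i. cfg ?t (loc r i)) = Lv (sv (\<lambda>c. ?t c r))" if "r \<in> R" for r
 proof -
  have "(\<Sum>i<N. dl i (cfg ?t (loc r i))) = (\<Sum>i<N. dl i (sv (\<lambda>c. ?t c r) i))"
   by (intro sum.cong refl) (simp add: cfg_loc[OF that])
  moreover have "(\<Sum>i<N. (be i (cfg ?t (loc r i)) * W i) * (k + (\<Sum>j<i. dl j (cfg ?t (loc r j))))) =
   (\<Sum>i<N. (be i (sv (\<lambda>c. ?t c r) i) * W i) * (k + (\<Sum>j<i. dl j (sv (\<lambda>c. ?t c r) j))))" for k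
   by (intro sum.cong refl arg_cong2[of _ _ _ _ "(*)"] arg_cong2[of _ _ _ _ "(+)"]) (simp_all add: cfg_loc[OF that])
  ultimately show ?thesis unfolding Lv_def by (simp only:)
 qed
 have Lr: "Lv (\<lambda>i. cfg ?t (loc r i)) = amp (\<lambda>_ _ _. True) (s0 r) (s1 r) (s2 r)" if "r \<in> R" for r
  unfolding Lc[OF that] amp_def
  by (subst line_value) (use lt[OF that] s in \<open>simp_all add: tr tr(2)[unfolded One_nat_def]\<close>)
 have h: "hh (cfg ?t) = fst (s0 r0) + fst (s1 r0) + fst (s2 r0)"
 proof -
  define da where "da i = (if i < p3 then (fst (?t (cl i) r0) div U i mod u i) * U i else 0)" for i
  have "hh (cfg ?t) = (\<Sum>i<N. da i)"
   unfolding hh_def by (intro sum.cong refl) (simp add: cfg_loc[OF r0] al_sv da_def)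
  also have "\<dots> = (\<Sum>i\<in>{0..<p1}. da i) + (\<Sum>i\<in>{p1..<p2}. da i) + (\<Sum>i\<in>{p2..<p3}. da i) + (\<Sum>i\<in>{p3..<N}. da i)"
   by (rule sum_split)
  also have "(\<Sum>i\<in>{0..<p1}. da i) = (\<Sum>i\<in>{0..<p1}. (fst (s0 r0) div U i mod u i) * U i)"
   by (intro sum.cong refl) (use p in \<open>simp add: da_def cl_def tr\<close>)
  also have "(\<Sum>i\<in>{p1..<p2}. da i) = (\<Sum>i\<in>{p1..<p2}. (fst (s1 r0) div U i mod u i) * U i)"
   by (intro sum.cong refl) (use p tr(2) in \<open>simp add: da_def cl_def\<close>)
  also have "(\<Sum>i\<in>{p2..<p3}. da i) = (\<Sum>i\<in>{p2..<p3}. (fst (s2 r0) div U i mod u i) * U i)"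
   by (intro sum.cong refl) (use p in \<open>simp add: da_def cl_def tr\<close>)
  also have "(\<Sum>i\<in>{p3..<N}. da i) = 0" by (rule sum.neutral) (simp add: da_def)
  finally show ?thesis using digit_sums(1-3) lt[OF r0] s by simp
 qed
 show ?thesis
 proof (cases "hh (cfg ?t) = m - 1")
  case True
  have "(\<Prod>r\<in>R. Lv (\<lambda>i. cfg ?t (loc r i))) = (\<Prod>r\<in>R. amp (JJ r) (s0 r) (s1 r) (s2 r))"
  proof (rule prod.cong[OF refl])
   fix r assume r: "r \<in> R"
   have "JJ r (fst (s0 r)) (fst (s1 r)) (fst (s2 r))" using True h by (simp add: JJ_def)
   thus "Lv (\<lambda>i. cfg ?t (loc r i)) = amp (JJ r) (s0 r) (s1 r) (s2 r)"
    unfolding Lr[OF r] amp_def by (simp only: simp_thms)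
  qed
  thus ?thesis using True cfg_configs by (simp add: \<Phi>0_def vec_of_def)
 next
  case False
  have "amp (JJ r0) (s0 r0) (s1 r0) (s2 r0) = 0" using False h by (simp add: amp_def JJ_def)
  hence "(\<Prod>r\<in>R. amp (JJ r) (s0 r) (s1 r) (s2 r)) = 0" using r0 finR by (intro prod_zero) auto
  thus ?thesis using False by (simp add: \<Phi>0_def vec_of_def)
 qed
qed

definition "gg c Q i j q = (if [j = i + c + fst q] (mod m) then cnj (om ^ (i * snd q)) * cnj (om ^ Q (fst q) (snd q)) / of_nat m else 0)"
 for c i j :: nat and Q :: "nat \<Rightarrow> nat \<Rightarrow> nat" and q :: "nat \<times> nat"

definition "ff c Q x y s = (\<Prod>r\<in>R. gg c Q (x r) (y r) (s r))" for c :: nat and Q x y s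

definition "XX = PiE R (\<lambda>_. {..<m})"

text \<open>Functionals and amplitude are products over the lines, so
  \<open>line_orthogonality\<close> evaluates one line at a time. Equality of all components is
  equality of the labels in \<open>XX\<close>, and the constraint on the weights remains for
  \<open>r0\<close>.\<close>

lemma pullback:
 assumes xx: "x \<in> XX" "y \<in> XX" "y' \<in> XX" "z \<in> XX" "z' \<in> XX" "x' \<in> XX"
 shows "(\<Sum>s0\<in>S. \<Sum>s1\<in>S. \<Sum>s2\<in>S. ff 1 ph0 x y s0 * ff 0 ph1 y' z s1 * ff 0 ph2 z' x' s2 * \<Phi>0 (cfg (trip s0 s1 s2))) =
  (if x = x' \<and> y = y' \<and> z = z' \<and> wt m 1 1 (x r0) (y r0) + wt m 1 0 (y r0) (z r0) + wt m 1 0 (z r0) (x r0) = m - 1 then 1 else 0)"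
proof -
 define h where "h r q0 q1 q2 = gg 1 ph0 (x r) (y r) q0 * gg 0 ph1 (y' r) (z r) q1 * gg 0 ph2 (z' r) (x' r) q2 * amp (JJ r) q0 q1 q2" for r q0 q1 q2
 have lt: "f r < m" if "f \<in> XX" "r \<in> R" for f r using that by (auto simp: XX_def)
 have "(\<Sum>s0\<in>S. \<Sum>s1\<in>S. \<Sum>s2\<in>S. ff 1 ph0 x y s0 * ff 0 ph1 y' z s1 * ff 0 ph2 z' x' s2 * \<Phi>0 (cfg (trip s0 s1 s2))) =
   (\<Sum>s0\<in>S. \<Sum>s1\<in>S. \<Sum>s2\<in>S. \<Prod>r\<in>R. h r (s0 r) (s1 r) (s2 r))"
  by (intro sum.cong refl) (simp add: \<Phi>0_cfg ff_def h_def prod.distrib)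
 also have "\<dots> = (\<Prod>r\<in>R. \<Sum>q0\<in>{..<m} \<times> {..<m}. \<Sum>q1\<in>{..<m} \<times> {..<m}. \<Sum>q2\<in>{..<m} \<times> {..<m}. h r q0 q1 q2)"
  unfolding S_def by (rule sum_prod3_PiE) (use finR in auto)
 also have "\<dots> = (\<Prod>r\<in>R. if x r = x' r \<and> y r = y' r \<and> z r = z' r \<and> JJ r (wt m 1 1 (x r) (y r)) (wt m 1 0 (y r) (z r)) (wt m 1 0 (z r) (x r)) then 1 else 0)"
 proof (rule prod.cong[OF refl])
  fix r assume r: "r \<in> R"
  have "(\<Sum>q0\<in>{..<m} \<times> {..<m}. \<Sum>q1\<in>{..<m} \<times> {..<m}. \<Sum>q2\<in>{..<m} \<times> {..<m}. h r q0 q1 q2) =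
   (\<Sum>a0<m. \<Sum>b0<m. \<Sum>a1<m. \<Sum>b1<m. \<Sum>a2<m. \<Sum>b2<m. h r (a0, b0) (a1, b1) (a2, b2))"
   by (simp only: sum_Times)
  also have "\<dots> = (if x r = x' r \<and> y r = y' r \<and> z r = z' r \<and> JJ r (wt m 1 1 (x r) (y r)) (wt m 1 0 (y r) (z r)) (wt m 1 0 (z r) (x r)) then 1 else 0)"
   unfolding h_def gg_def amp_def fst_conv snd_conv om_def
   by (rule line_orthogonality[OF m]) (use lt r xx in auto)
  finally show "(\<Sum>q0\<in>{..<m} \<times> {..<m}. \<Sum>q1\<in>{..<m} \<times> {..<m}. \<Sum>q2\<in>{..<m} \<times> {..<m}. h r q0 q1 q2) =
   (if x r = x' r \<and> y r = y' r \<and> z r = z' r \<and> JJ r (wt m 1 1 (x r) (y r)) (wt m 1 0 (y r) (z r)) (wt m 1 0 (z r) (x r)) then 1 else 0)" .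
 qed
 also have "\<dots> = (if \<forall>r\<in>R. x r = x' r \<and> y r = y' r \<and> z r = z' r \<and> JJ r (wt m 1 1 (x r) (y r)) (wt m 1 0 (y r) (z r)) (wt m 1 0 (z r) (x r)) then 1 else 0)"
  by (rule prod_indicator[OF finR])
 also have "(\<forall>r\<in>R. x r = x' r \<and> y r = y' r \<and> z r = z' r \<and> JJ r (wt m 1 1 (x r) (y r)) (wt m 1 0 (y r) (z r)) (wt m 1 0 (z r) (x r))) \<longleftrightarrow>
   x = x' \<and> y = y' \<and> z = z' \<and> wt m 1 1 (x r0) (y r0) + wt m 1 0 (y r0) (z r0) + wt m 1 0 (z r0) (x r0) = m - 1"
 proof -
  have ext: "(\<forall>r\<in>R. f r = g r) \<longleftrightarrow> f = g" if "f \<in> XX" "g \<in> XX" for f g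
   using that unfolding XX_def by (metis PiE_ext)
  show ?thesis using r0 unfolding JJ_def ext[OF xx(1,6), symmetric] ext[OF xx(2,3), symmetric] ext[OF xx(4,5), symmetric]
   by auto
 qed
 finally show ?thesis .
qed

lemma finS: "finite S" using finR by (simp add: S_def finite_PiE)
lemma finX: "finite XX" using finR by (simp add: XX_def finite_PiE)

text \<open>The pull back takes the value 1 at constant labels furnished by
  \<open>wt_extend\<close>.\<close>

lemma \<Phi>0_nonzero: "\<exists>\<rho>. \<Phi>0 \<rho> \<noteq> 0"
proof (rule ccontr)
 assume "\<not> ?thesis"
 hence z: "\<Phi>0 \<rho> = 0" for \<rho> by blast
 obtain l where l: "l < m" "wt m 1 1 0 0 + wt m 1 0 0 l + wt m 1 0 l 0 = m - 1"
  using wt_extend[OF m, of 1 1 0 0 0 0] by auto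
 define c where "c k = restrict (\<lambda>_. k) R" for k :: nat
 have "c k \<in> XX" if "k < m" for k using that by (auto simp: c_def XX_def)
 hence cX: "c 0 \<in> XX" "c l \<in> XX" using l m by auto
 have c0: "c k r0 = k" for k using r0 by (simp add: c_def)
 have "(\<Sum>s0\<in>S. \<Sum>s1\<in>S. \<Sum>s2\<in>S. ff 1 ph0 (c 0) (c 0) s0 * ff 0 ph1 (c 0) (c l) s1 * ff 0 ph2 (c l) (c 0) s2 * \<Phi>0 (cfg (trip s0 s1 s2))) = 1"
  by (subst pullback) (use cX l in \<open>simp_all only: c0 simp_thms if_True\<close>)
 thus False by (simp add: z)
qed

text \<open>Edges between lines join equal positions and stay inside a class. Two classes are thus
  joined by the line bonds across their common boundary, one for each line.\<close>

lemma class_edges_lines: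
 assumes ij: "i \<noteq> j" and k: "k < N" and uniq: "\<And>l. l < N \<Longrightarrow> {cl l, cl (Suc l mod N)} = {i, j} \<longleftrightarrow> l = k"
 shows "class_edges G (\<lambda>v. cl (pos v)) i j = (\<lambda>r. bond r k) ` R"
proof (intro equalityI subsetI)
 have im: "(\<lambda>v. cl (pos v)) ` bond r l = {cl l, cl (Suc l mod N)}" if "r \<in> R" "l < N" for r l
  using that suc_lt by (simp add: bond_def pos_loc)
 fix e
 {
  assume "e \<in> class_edges G (\<lambda>v. cl (pos v)) i j"
  hence e: "e \<in> edges G" "(\<lambda>v. cl (pos v)) ` e = {i, j}" by (auto simp: class_edges_def)
  from other_edge[OF e(1)] show "e \<in> (\<lambda>r. bond r k) ` R"
  proof
   assume "\<exists>r\<in>R. \<exists>l<N. e = {loc r l, loc r (Suc l mod N)}"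
   then obtain r l where rl: "r \<in> R" "l < N" "e = bond r l" by (auto simp: bond_def)
   hence "l = k" using uniq[OF rl(2)] im[OF rl(1,2)] e(2) by simp
   thus ?thesis using rl by blast
  next
   assume "\<exists>l<N. \<exists>r\<in>R. \<exists>r'\<in>R. e = {loc r l, loc r' l}"
   hence "\<exists>c. (\<lambda>v. cl (pos v)) ` e = {c}" using pos_loc by auto
   thus ?thesis using e(2) ij by (auto simp: doubleton_eq_iff)
  qed
 }
 {
  assume "e \<in> (\<lambda>r. bond r k) ` R"
  then obtain r where r: "r \<in> R" "e = bond r k" by blast
  show "e \<in> class_edges G (\<lambda>v. cl (pos v)) i j"
   unfolding class_edges_def using line_edge[OF r(1) k] im[OF r(1) k] uniq[OF k] r(2) by (simp add: bond_def)
 }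
qed

lemma card_lines:
 assumes k: "k < N"
 shows "card (bond_configs G ((\<lambda>r. bond r k) ` R)) = card XX" "finite (bond_configs G ((\<lambda>r. bond r k) ` R))"
proof -
 have inj: "inj_on (\<lambda>r. bond r k) R" using bond_inj k by (auto simp: inj_on_def)
 have "card (bond_configs G ((\<lambda>r. bond r k) ` R)) = (\<Prod>r\<in>R. bdim G (bond r k))"
  using finR by (simp add: card_bond_configs prod.reindex[OF inj])
 also have "\<dots> = (\<Prod>r\<in>R. m)" by (rule prod.cong[OF refl]) (use line_dim k in \<open>simp add: bond_def\<close>)
 finally show "card (bond_configs G ((\<lambda>r. bond r k) ` R)) = card XX" using finR by (simp add: XX_def card_PiE)
 show "finite (bond_configs G ((\<lambda>r. bond r k) ` R))" using finR by (intro finite_bond_configs) simp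
qed

text \<open>Every line crosses each of the three class boundaries once, at the bonds
  \<open>p1 - 1\<close>, \<open>p2 - 1\<close> and \<open>N - 1\<close>, so the bond sets have the
  size of the label set \<open>XX\<close>. The offset at site 0 lies in the first cluster, which
  gives \<open>c1 = 1\<close>, \<open>c2 = c3 = 0\<close> and \<open>q = 1\<close>.\<close>

lemma \<Phi>0_not_cone: "\<not> peps_cone G \<Phi>0"
proof
 assume "peps_cone G \<Phi>0"
 then obtain A where A: "\<Phi>0 = peps_vec G A" by (auto simp: peps_cone_def)
 let ?c = "\<lambda>v. cl (pos v)"
 have "cl i < 3" for i by (simp add: cl_def)
 then obtain T0 T1 T2 where T: "\<forall>\<sigma>\<in>configs (verts G) (sdim G). peps_vec G A \<sigma> =
  (\<Sum>x\<in>bond_configs G (class_edges G ?c 2 0). \<Sum>y\<in>bond_configs G (class_edges G ?c 0 1). \<Sum>z\<in>bond_configs G (class_edges G ?c 1 2).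
   T0 (restrict \<sigma> (class_verts G ?c 0)) x y * T1 (restrict \<sigma> (class_verts G ?c 1)) y z * T2 (restrict \<sigma> (class_verts G ?c 2)) z x)"
  using peps_triangle[OF graph, of ?c A] by blast
 have N3': "N \<ge> 3" by (rule N3)
 have sc: "Suc l mod N = (if Suc l = N then 0 else Suc l)" if "l < N" for l using that by auto
 have c20: "class_edges G ?c 2 0 = (\<lambda>r. bond r (N - 1)) ` R"
  by (rule class_edges_lines) (use p N3' in \<open>auto simp: sc cl_def doubleton_eq_iff split: if_splits\<close>)
 have c01: "class_edges G ?c 0 1 = (\<lambda>r. bond r (p1 - 1)) ` R"
  by (rule class_edges_lines) (use p N3' in \<open>auto simp: sc cl_def doubleton_eq_iff split: if_splits\<close>)
 have c12: "class_edges G ?c 1 2 = (\<lambda>r. bond r (p2 - 1)) ` R"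
  by (rule class_edges_lines) (use p N3' in \<open>auto simp: sc cl_def doubleton_eq_iff split: if_splits\<close>)
 have lts: "N - 1 < N" "p1 - 1 < N" "p2 - 1 < N" using p by auto
 have part: "restrict (cfg t) (class_verts G ?c c) = restrict (cfg (\<lambda>_. t c)) (class_verts G ?c c)" if "c < 3" for t c
 proof
  fix v show "restrict (cfg t) (class_verts G ?c c) v = restrict (cfg (\<lambda>_. t c)) (class_verts G ?c c) v"
   by (auto simp: restrict_def class_verts_def cfg_def sv_def)
 qed
 have tri: "\<Phi>0 (cfg (trip s0 s1 s2)) = (\<Sum>a\<in>bond_configs G (class_edges G ?c 2 0). \<Sum>b\<in>bond_configs G (class_edges G ?c 0 1). \<Sum>c\<in>bond_configs G (class_edges G ?c 1 2).
   T0 (restrict (cfg (\<lambda>_. s0)) (class_verts G ?c 0)) a b * T1 (restrict (cfg (\<lambda>_. s1)) (class_verts G ?c 1)) b c *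
   T2 (restrict (cfg (\<lambda>_. s2)) (class_verts G ?c 2)) c a)" for s0 s1 s2
 proof -
  have e: "restrict (cfg (trip s0 s1 s2)) (class_verts G ?c 0) = restrict (cfg (\<lambda>_. s0)) (class_verts G ?c 0)"
   "restrict (cfg (trip s0 s1 s2)) (class_verts G ?c 1) = restrict (cfg (\<lambda>_. s1)) (class_verts G ?c 1)"
   "restrict (cfg (trip s0 s1 s2)) (class_verts G ?c 2) = restrict (cfg (\<lambda>_. s2)) (class_verts G ?c 2)"
   using part[of 0 "trip s0 s1 s2"] part[of 1 "trip s0 s1 s2"] part[of 2 "trip s0 s1 s2"] by (simp_all add: trip_def)
  show ?thesis unfolding A bspec[OF T cfg_configs] e by (rule refl)
 qed
 have ne: "XX \<noteq> {}" using m by (auto simp: XX_def PiE_eq_empty_iff lessThan_empty_iff)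
 define F where "F s0 s1 s2 = \<Phi>0 (cfg (trip s0 s1 s2))" for s0 s1 s2
 define T0' where "T0' s = T0 (restrict (cfg (\<lambda>_. s)) (class_verts G ?c 0))" for s
 define T1' where "T1' s = T1 (restrict (cfg (\<lambda>_. s)) (class_verts G ?c 1))" for s
 define T2' where "T2' s = T2 (restrict (cfg (\<lambda>_. s)) (class_verts G ?c 2))" for s
 define g where "g x = x r0" for x :: "'r \<Rightarrow> nat"
 have q: "coprime 1 m" "[1 + 0 + 0 = 1] (mod m)" by simp_all
 have triF: "F s0 s1 s2 = (\<Sum>a\<in>bond_configs G ((\<lambda>r. bond r (N - 1)) ` R). \<Sum>b\<in>bond_configs G ((\<lambda>r. bond r (p1 - 1)) ` R).
   \<Sum>c\<in>bond_configs G ((\<lambda>r. bond r (p2 - 1)) ` R). T0' s0 a b * T1' s1 b c * T2' s2 c a)"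
  if "s0 \<in> S" "s1 \<in> S" "s2 \<in> S" for s0 s1 s2
  unfolding F_def tri c20 c01 c12 T0'_def T1'_def T2'_def by (rule refl)
 have pbF: "(\<Sum>s0\<in>S. \<Sum>s1\<in>S. \<Sum>s2\<in>S. ff 1 ph0 x y s0 * ff 0 ph1 y' z s1 * ff 0 ph2 z' x' s2 * F s0 s1 s2) =
  (if x = x' \<and> y = y' \<and> z = z' \<and> wt m 1 1 (g x) (g y) + wt m 1 0 (g y) (g z) + wt m 1 0 (g z) (g x) = m - 1 then 1 else 0)"
  if "x \<in> XX" "y \<in> XX" "y' \<in> XX" "z \<in> XX" "z' \<in> XX" "x' \<in> XX" for x y y' z z' x'
  unfolding F_def g_def by (rule pullback[OF that])
 have gX: "g x < m" if "x \<in> XX" for x using that r0 by (auto simp: XX_def g_def)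
 have gf: "m * card {x \<in> XX. g x = i} = card XX" if "i < m" for i
  unfolding XX_def g_def by (rule card_PiE_fibre[OF finR r0 that])
 show False
  by (rule cyclic_triangle_obstruction[OF m q triF finX card_lines(2)[OF lts(1)] card_lines(2)[OF lts(2)] card_lines(2)[OF lts(3)]
    card_lines(1)[OF lts(1)] card_lines(1)[OF lts(2)] card_lines(1)[OF lts(3)] ne pbF gX gf])
qed

theorem PEPS_lacks_optimizers: "lacks_optimizers (verts G) (sdim G) (PEPS G)"
proof -
 have ne: "verts G \<noteq> {}" using loc_vert[OF r0, of 0] N3 by auto
 obtain \<rho> where \<rho>: "\<Phi>0 \<rho> \<noteq> 0" using \<Phi>0_nonzero by blast
 show ?thesis
  by (rule lacks_optimizers_cone[where C = "peps_cone G", OF finV PEPS_cone peps_cone_hilb peps_cone_scale[OF finV ne] \<Phi>_cone \<Phi>_lim \<rho> \<Phi>0_not_cone])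
qed

end

section \<open>Matrix product states as PEPS\<close>

lemma sum_PiE_insert:
 assumes "j \<notin> I"
 shows "(\<Sum>k\<in>PiE (insert j I) F. g k) = (\<Sum>a\<in>F j. \<Sum>k\<in>PiE I F. g (k(j := a)))"
proof -
 have "(\<Sum>k\<in>PiE (insert j I) F. g k) = (\<Sum>p\<in>F j \<times> PiE I F. g ((snd p)(fst p' := fst p)))"
  if "p' = (j, undefined :: unit)" for p' :: "'a \<times> unit"
 proof (rule sum.reindex_bij_witness[of _ "\<lambda>p. (snd p)(j := fst p)" "\<lambda>k. (k j, k(j := undefined))"])
  fix k assume k: "k \<in> PiE (insert j I) F"
  show "(snd (k j, k(j := undefined)))(j := fst (k j, k(j := undefined))) = k" by auto
  show "(k j, k(j := undefined)) \<in> F j \<times> PiE I F"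
   using k assms by (auto simp: PiE_iff extensional_def)
  show "g ((snd (k j, k(j := undefined)))(fst p' := fst (k j, k(j := undefined)))) = g k" by (simp add: that)
 next
  fix p assume p: "p \<in> F j \<times> PiE I F"
  show "((snd p)(j := fst p)) \<in> PiE (insert j I) F" using p by (auto simp: PiE_iff extensional_def)
  show "(((snd p)(j := fst p)) j, ((snd p)(j := fst p))(j := undefined)) = p"
   using p assms by (cases p) (auto simp: fun_eq_iff PiE_iff extensional_def)
 qed
 thus ?thesis by (simp add: sum_Times)
qed

text \<open>Partial products from the right end as sums over paths of bond indices. Both end indices
  are kept free, which serves the trace and the open chain alike.\<close>

lemma mps_segment:
 assumes A: "\<And>i. i \<in> {1..N} \<Longrightarrow> B i \<in> carrier_mat (mm (i - 1)) (mm i)" and "j \<le> N"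
 shows "foldr (\<lambda>i M. B i * M) [Suc j..<Suc N] (1\<^sub>m (mm N)) \<in> carrier_mat (mm j) (mm N) \<and>
  (\<forall>x<mm j. \<forall>y<mm N. foldr (\<lambda>i M. B i * M) [Suc j..<Suc N] (1\<^sub>m (mm N)) $$ (x, y) =
   (\<Sum>\<kappa>\<in>PiE {j..N} (\<lambda>i. {..<mm i}). if \<kappa> j = x \<and> \<kappa> N = y then \<Prod>i\<in>{Suc j..N}. B i $$ (\<kappa> (i - 1), \<kappa> i) else (0::complex)))"
 using assms(2)
proof (induction j rule: inc_induct)
 case base
 have "(\<Sum>\<kappa>\<in>PiE {N} (\<lambda>i. {..<mm i}). if \<kappa> N = x \<and> \<kappa> N = y then 1 else 0) = (if x = y then 1 else (0::complex))" if "x < mm N" for x y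
 proof -
  have "(\<Sum>\<kappa>\<in>PiE (insert N {}) (\<lambda>i. {..<mm i}). if \<kappa> N = x \<and> \<kappa> N = y then 1 else (0::complex)) =
    (\<Sum>a<mm N. if a = x then (if x = y then 1 else 0) else 0)"
   by (subst sum_PiE_insert, simp, intro sum.cong refl) auto
  thus ?thesis using that by simp
 qed
 moreover have "(\<Prod>i\<in>{Suc N..N}. B i $$ (\<kappa> (i - 1), \<kappa> i)) = 1" for \<kappa> by simp
 ultimately have S: "(\<Sum>\<kappa>\<in>PiE {N..N} (\<lambda>i. {..<mm i}). if \<kappa> N = x \<and> \<kappa> N = y then \<Prod>i\<in>{Suc N..N}. B i $$ (\<kappa> (i - 1), \<kappa> i) else 0) =
   (if x = y then 1 else 0)" if "x < mm N" for x y
  using that by (simp only: atLeastAtMost_singleton)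
 have L: "foldr (\<lambda>i M. B i * M) [Suc N..<Suc N] (1\<^sub>m (mm N)) = 1\<^sub>m (mm N)" by simp
 show ?case unfolding L by (intro conjI allI impI) (simp_all only: S one_carrier_mat index_one_mat)
next
 case (step j)
 let ?B = "\<lambda>a \<kappa> i. B i $$ ((\<kappa>(j := a)) (i - 1), (\<kappa>(j := a)) i)"
 let ?Q = "\<lambda>x y \<kappa>. if \<kappa> N = y then B (Suc j) $$ (x, \<kappa> (Suc j)) * (\<Prod>i\<in>{Suc (Suc j)..N}. B i $$ (\<kappa> (i - 1), \<kappa> i)) else 0"
 define M where "M = foldr (\<lambda>i M. B i * M) [Suc (Suc j)..<Suc N] (1\<^sub>m (mm N))"
 have M: "M \<in> carrier_mat (mm (Suc j)) (mm N)"
  "\<And>x y. x < mm (Suc j) \<Longrightarrow> y < mm N \<Longrightarrow> M $$ (x, y) = (\<Sum>\<kappa>\<in>PiE {Suc j..N} (\<lambda>i. {..<mm i}).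
    if \<kappa> (Suc j) = x \<and> \<kappa> N = y then \<Prod>i\<in>{Suc (Suc j)..N}. B i $$ (\<kappa> (i - 1), \<kappa> i) else 0)"
  using step.IH unfolding M_def by blast+
 have Bj: "B (Suc j) \<in> carrier_mat (mm j) (mm (Suc j))" using A[of "Suc j"] step.hyps by simp
 have e: "foldr (\<lambda>i M. B i * M) [Suc j..<Suc N] (1\<^sub>m (mm N)) = B (Suc j) * M"
  using step.hyps by (simp add: M_def upt_conv_Cons del: upt_Suc)
 have "(B (Suc j) * M) $$ (x, y) = (\<Sum>\<kappa>\<in>PiE {j..N} (\<lambda>i. {..<mm i}). if \<kappa> j = x \<and> \<kappa> N = y then \<Prod>i\<in>{Suc j..N}. B i $$ (\<kappa> (i - 1), \<kappa> i) else 0)"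
  if xy: "x < mm j" "y < mm N" for x y
 proof -
  have "(B (Suc j) * M) $$ (x, y) = (\<Sum>l<mm (Suc j). B (Suc j) $$ (x, l) * M $$ (l, y))"
   using Bj M(1) xy by (simp add: times_mat_def scalar_prod_def lessThan_atLeast0)
  also have "\<dots> = (\<Sum>l<mm (Suc j). \<Sum>\<kappa>\<in>PiE {Suc j..N} (\<lambda>i. {..<mm i}). if \<kappa> (Suc j) = l then
     (?Q x y \<kappa>) else 0)"
   by (intro sum.cong refl) (use xy M(2) in \<open>auto simp: sum_distrib_left intro!: sum.cong\<close>)
  also have "\<dots> = (\<Sum>\<kappa>\<in>PiE {Suc j..N} (\<lambda>i. {..<mm i}). \<Sum>l<mm (Suc j). if \<kappa> (Suc j) = l then
     (?Q x y \<kappa>) else 0)"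
   by (rule sum.swap)
  also have "\<dots> = (\<Sum>\<kappa>\<in>PiE {Suc j..N} (\<lambda>i. {..<mm i}).
     ?Q x y \<kappa>)"
  proof (intro sum.cong refl)
   fix \<kappa> assume "\<kappa> \<in> PiE {Suc j..N} (\<lambda>i. {..<mm i})"
   hence "\<kappa> (Suc j) < mm (Suc j)" using step.hyps by (auto simp: PiE_iff)
   thus "(\<Sum>l<mm (Suc j). if \<kappa> (Suc j) = l then
     (?Q x y \<kappa>) else 0) =
     (?Q x y \<kappa>)"
    by simp
  qed
  also have "\<dots> = (\<Sum>a<mm j. if a = x then (\<Sum>\<kappa>\<in>PiE {Suc j..N} (\<lambda>i. {..<mm i}).
     ?Q x y \<kappa>) else 0)"
   using xy by simp
  also have "\<dots> = (\<Sum>a<mm j. \<Sum>\<kappa>\<in>PiE {Suc j..N} (\<lambda>i. {..<mm i}).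
    if (\<kappa>(j := a)) j = x \<and> (\<kappa>(j := a)) N = y then \<Prod>i\<in>{Suc j..N}. ?B a \<kappa> i else 0)"
  proof (intro sum.cong refl)
   fix a
   have "(\<Prod>i\<in>{Suc j..N}. ?B a \<kappa> i) =
     B (Suc j) $$ (a, \<kappa> (Suc j)) * (\<Prod>i\<in>{Suc (Suc j)..N}. B i $$ (\<kappa> (i - 1), \<kappa> i))" for \<kappa>
   proof -
    have "{Suc j..N} = insert (Suc j) {Suc (Suc j)..N}" using step.hyps by auto
    hence "(\<Prod>i\<in>{Suc j..N}. ?B a \<kappa> i) =
     B (Suc j) $$ (a, \<kappa> (Suc j)) * (\<Prod>i\<in>{Suc (Suc j)..N}. ?B a \<kappa> i)" by simp
    also have "(\<Prod>i\<in>{Suc (Suc j)..N}. ?B a \<kappa> i) =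
      (\<Prod>i\<in>{Suc (Suc j)..N}. B i $$ (\<kappa> (i - 1), \<kappa> i))" by (rule prod.cong) auto
    finally show ?thesis .
   qed
   note * = this
   show "(if a = x then (\<Sum>\<kappa>\<in>PiE {Suc j..N} (\<lambda>i. {..<mm i}).
     ?Q x y \<kappa>) else 0) =
    (\<Sum>\<kappa>\<in>PiE {Suc j..N} (\<lambda>i. {..<mm i}).
    if (\<kappa>(j := a)) j = x \<and> (\<kappa>(j := a)) N = y then \<Prod>i\<in>{Suc j..N}. ?B a \<kappa> i else 0)"
    unfolding * using step.hyps by (cases "a = x") auto
  qed
  also have "\<dots> = (\<Sum>\<kappa>\<in>PiE {j..N} (\<lambda>i. {..<mm i}). if \<kappa> j = x \<and> \<kappa> N = y then \<Prod>i\<in>{Suc j..N}. B i $$ (\<kappa> (i - 1), \<kappa> i) else 0)"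
  proof -
   have "{j..N} = insert j {Suc j..N}" using step.hyps by auto
   thus ?thesis by (simp only:) (subst sum_PiE_insert, simp_all)
  qed
  finally show ?thesis .
 qed
 thus ?case unfolding e using Bj M(1) by auto
qed

definition prev_site :: "nat \<Rightarrow> nat \<Rightarrow> nat" where
 "prev_site N i = (if i = 1 then N else i - 1)"

text \<open>The trace equates the path index at 0 with the one at \<open>N\<close>, so only the
  indices \<open>1..N\<close> remain and \<open>prev_site\<close> closes the ring.\<close>

lemma mps_trace:
 assumes N: "N \<ge> 1" and A: "\<And>i. i \<in> {1..N} \<Longrightarrow> A i (\<sigma> i) \<in> carrier_mat m m"
 shows "mat_trace (mps_prod N m A \<sigma>) =
  (\<Sum>\<kappa>\<in>PiE {1..N} (\<lambda>_. {..<m}). \<Prod>i\<in>{1..N}. A i (\<sigma> i) $$ (\<kappa> (prev_site N i), \<kappa> i))"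
proof -
 define B where "B i = A i (\<sigma> i)" for i
 let ?R = "\<lambda>a \<kappa>. \<Prod>i\<in>{1..N}. B i $$ ((\<kappa>(0 := a)) (i - 1), \<kappa> i)"
 let ?P = "\<lambda>\<kappa>. \<Prod>i\<in>{1..N}. B i $$ (\<kappa> (i - 1), \<kappa> i)"
 have seg: "mps_prod N m A \<sigma> \<in> carrier_mat m m"
  "\<And>x y. x < m \<Longrightarrow> y < m \<Longrightarrow> mps_prod N m A \<sigma> $$ (x, y) =
   (\<Sum>\<kappa>\<in>PiE {0..N} (\<lambda>_. {..<m}). if \<kappa> 0 = x \<and> \<kappa> N = y then ?P \<kappa> else 0)"
 proof -
  have e: "mps_prod N m A \<sigma> = foldr (\<lambda>i M. B i * M) [Suc 0..<Suc N] (1\<^sub>m m)"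
   by (simp only: mps_prod_def B_def One_nat_def)
  have "B i \<in> carrier_mat m m" if "i \<in> {1..N}" for i using A[OF that] by (simp add: B_def)
  note seg0 = mps_segment[of N B "\<lambda>_. m" 0, OF this le0, folded e]
  show "mps_prod N m A \<sigma> \<in> carrier_mat m m" by (rule conjunct1[OF seg0])
  show "mps_prod N m A \<sigma> $$ (x, y) =
   (\<Sum>\<kappa>\<in>PiE {0..N} (\<lambda>_. {..<m}). if \<kappa> 0 = x \<and> \<kappa> N = y then ?P \<kappa> else 0)"
   if "x < m" "y < m" for x y
   using conjunct2[OF seg0, rule_format, OF _ that] by (simp only: One_nat_def)
 qed
 have "mat_trace (mps_prod N m A \<sigma>) = (\<Sum>x<m. \<Sum>\<kappa>\<in>PiE {0..N} (\<lambda>_. {..<m}). if \<kappa> 0 = x \<and> \<kappa> N = x then ?P \<kappa> else 0)"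
  using seg by (simp add: mat_trace_def)
 also have "\<dots> = (\<Sum>\<kappa>\<in>PiE {0..N} (\<lambda>_. {..<m}). \<Sum>x<m. if \<kappa> 0 = x \<and> \<kappa> N = x then ?P \<kappa> else 0)"
  by (rule sum.swap)
 also have "\<dots> = (\<Sum>\<kappa>\<in>PiE (insert 0 {1..N}) (\<lambda>_. {..<m}). if \<kappa> 0 = \<kappa> N then ?P \<kappa> else 0)"
 proof (rule sum.cong)
  show "PiE {0..N} (\<lambda>_. {..<m}) = PiE (insert 0 {1..N}) (\<lambda>_. {..<m})"
   by (rule arg_cong2[of _ _ _ _ PiE]) auto
  fix \<kappa> assume "\<kappa> \<in> PiE (insert 0 {1..N}) (\<lambda>_. {..<m})"
  hence "\<kappa> 0 < m" by (auto simp: PiE_iff)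
  have "(\<Sum>x<m. if \<kappa> 0 = x \<and> \<kappa> N = x then ?P \<kappa> else 0) =
   (\<Sum>x<m. if \<kappa> 0 = x then (if \<kappa> 0 = \<kappa> N then ?P \<kappa> else 0) else 0)"
   by (intro sum.cong refl) auto
  thus "(\<Sum>x<m. if \<kappa> 0 = x \<and> \<kappa> N = x then ?P \<kappa> else 0) =
   (if \<kappa> 0 = \<kappa> N then ?P \<kappa> else 0)"
   using \<open>\<kappa> 0 < m\<close> by simp
 qed
 also have "\<dots> = (\<Sum>a<m. \<Sum>\<kappa>\<in>PiE {1..N} (\<lambda>_. {..<m}). if a = \<kappa> N then ?R a \<kappa> else 0)"
 proof (subst sum_PiE_insert, simp, intro sum.cong refl, rule if_cong)
  fix a :: nat and \<kappa> :: "nat \<Rightarrow> nat"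
  show "((\<kappa>(0 := a)) 0 = (\<kappa>(0 := a)) N) = (a = \<kappa> N)" using N by simp
  show "(\<Prod>i\<in>{1..N}. B i $$ ((\<kappa>(0 := a)) (i - 1), (\<kappa>(0 := a)) i)) = (?R a \<kappa>)"
   by (rule prod.cong) auto
 qed (rule refl)
 also have "\<dots> = (\<Sum>\<kappa>\<in>PiE {1..N} (\<lambda>_. {..<m}). \<Sum>a<m. if a = \<kappa> N then ?R a \<kappa> else 0)"
  by (rule sum.swap)
 also have "\<dots> = (\<Sum>\<kappa>\<in>PiE {1..N} (\<lambda>_. {..<m}). \<Prod>i\<in>{1..N}. B i $$ (\<kappa> (prev_site N i), \<kappa> i))"
 proof (intro sum.cong refl)
  fix \<kappa> assume "\<kappa> \<in> PiE {1..N} (\<lambda>_. {..<m})"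
  hence "\<kappa> N < m" using N by (auto simp: PiE_iff)
  hence "(\<Sum>a<m. if a = \<kappa> N then ?R a \<kappa> else 0) =
    (\<Prod>i\<in>{1..N}. B i $$ ((\<kappa>(0 := \<kappa> N)) (i - 1), \<kappa> i))" by simp
  also have "\<dots> = (\<Prod>i\<in>{1..N}. B i $$ (\<kappa> (prev_site N i), \<kappa> i))"
   by (rule prod.cong[OF refl]) (auto simp: prev_site_def)
  finally show "(\<Sum>a<m. if a = \<kappa> N then ?R a \<kappa> else 0) =
    (\<Prod>i\<in>{1..N}. B i $$ (\<kappa> (prev_site N i), \<kappa> i))" .
 qed
 finally show ?thesis by (simp add: B_def)
qed

text \<open>Positions outside \<open>J\<close> stand for bonds of dimension 1, whose only matrix
  index is 0.\<close>

abbreviation chain_index :: "(nat \<Rightarrow> nat) \<Rightarrow> nat set \<Rightarrow> (nat \<Rightarrow> nat) \<Rightarrow> nat \<Rightarrow> nat \<times> nat" where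
 "chain_index lb J \<kappa> i \<equiv> (if lb i \<in> J then \<kappa> (lb i) else 0, if i \<in> J then \<kappa> i else 0)"

abbreviation chain_state where
 "chain_state N \<delta> J mm lb A \<equiv> vec_of {1..N} \<delta> (\<lambda>\<sigma>. \<Sum>\<kappa>\<in>PiE J (\<lambda>j. {..<mm j}). \<Prod>i\<in>{1..N}. A i (\<sigma> i) $$ chain_index lb J \<kappa> i)"

lemma mps_open:
 assumes N: "N \<ge> 1" and mm: "mm 0 = 1" "mm N = 1"
  and A: "\<And>i. i \<in> {1..N} \<Longrightarrow> A i (\<sigma> i) \<in> carrier_mat (mm (i - 1)) (mm i)"
 shows "mps_prod N (mm N) A \<sigma> $$ (0, 0) =
  (\<Sum>\<kappa>\<in>PiE {1..<N} (\<lambda>i. {..<mm i}). \<Prod>i\<in>{1..N}. A i (\<sigma> i) $$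
    chain_index (\<lambda>i. i - 1) {1..<N} \<kappa> i)"
proof -
 define B where "B i = A i (\<sigma> i)" for i
 have I: "{0..N} = insert 0 (insert N {1..<N})" using N by auto
 have "mps_prod N (mm N) A \<sigma> $$ (0, 0) =
   (\<Sum>\<kappa>\<in>PiE {0..N} (\<lambda>i. {..<mm i}). if \<kappa> 0 = 0 \<and> \<kappa> N = 0 then \<Prod>i\<in>{1..N}. B i $$ (\<kappa> (i - 1), \<kappa> i) else 0)"
 proof -
  have e: "mps_prod N (mm N) A \<sigma> = foldr (\<lambda>i M. B i * M) [Suc 0..<Suc N] (1\<^sub>m (mm N))"
   by (simp only: mps_prod_def B_def One_nat_def)
  have "B i \<in> carrier_mat (mm (i - 1)) (mm i)" if "i \<in> {1..N}" for i using A[OF that] by (simp add: B_def)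
  note seg0 = mps_segment[of N B mm 0, OF this le0, folded e]
  show ?thesis using conjunct2[OF seg0, rule_format, of 0 0] by (simp only: mm One_nat_def zero_less_one lessI)
 qed
 also have "\<dots> = (\<Sum>a\<in>{..<mm 0}. \<Sum>c\<in>{..<mm N}. \<Sum>\<kappa>\<in>PiE {1..<N} (\<lambda>i. {..<mm i}).
   if (\<kappa>(N := c, 0 := a)) 0 = 0 \<and> (\<kappa>(N := c, 0 := a)) N = 0 then \<Prod>i\<in>{1..N}. B i $$ ((\<kappa>(N := c, 0 := a)) (i - 1), (\<kappa>(N := c, 0 := a)) i) else 0)"
 proof -
  have n: "0 \<notin> insert N {1..<N}" "N \<notin> {1..<N}" using N by auto
  show ?thesis unfolding I sum_PiE_insert[OF n(1)] sum_PiE_insert[OF n(2)] by (rule refl)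
 qed
 also have "\<dots> = (\<Sum>\<kappa>\<in>PiE {1..<N} (\<lambda>i. {..<mm i}). \<Prod>i\<in>{1..N}. B i $$ ((\<kappa>(N := 0, 0 := 0)) (i - 1), (\<kappa>(N := 0, 0 := 0)) i))"
 proof -
  have z: "{..<mm 0} = {0}" "{..<mm N} = {0}" by (auto simp: mm)
  have sg: "(\<Sum>a\<in>{0::nat}. F a) = F 0" for F :: "nat \<Rightarrow> complex" by simp
  have c: "(\<kappa>(N := 0, 0 := 0)) 0 = (0::nat)" "(\<kappa>(N := 0, 0 := 0)) N = (0::nat)" for \<kappa> by simp_all
  show ?thesis unfolding z sg by (simp only: c if_True simp_thms)
 qed
 also have "\<dots> = (\<Sum>\<kappa>\<in>PiE {1..<N} (\<lambda>i. {..<mm i}). \<Prod>i\<in>{1..N}. B i $$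
    chain_index (\<lambda>i. i - 1) {1..<N} \<kappa> i)"
 proof (rule sum.cong[OF refl], rule prod.cong[OF refl])
  fix \<kappa> :: "nat \<Rightarrow> nat" and i assume i: "i \<in> {1..N}"
  have idx: "(\<kappa>(N := 0, 0 := 0)) j = (if j \<in> {1..<N} then \<kappa> j else 0)" if "j \<le> N" for j
   using that by (cases "j = 0"; cases "j = N") simp_all
  have "i - 1 \<le> N" "i \<le> N" using i by auto
  thus "B i $$ ((\<kappa>(N := 0, 0 := 0)) (i - 1), (\<kappa>(N := 0, 0 := 0)) i) =
    B i $$ chain_index (\<lambda>i. i - 1) {1..<N} \<kappa> i"
   by (simp only: idx)
 qed
 finally show ?thesis by (simp only: B_def)
qed

text \<open>A chain of matrices as a network: the bond to the right of site \<open>i\<close> is the edge \<open>ed i\<close> if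
 \<open>i \<in> J\<close>, and trivial otherwise; the bond to its left is the one to the right of \<open>lb i\<close>.\<close>

lemma chain_peps:
 fixes H :: "nat network"
 assumes inj: "inj_on ed J" and E: "edges H = ed ` J" and V: "verts H = {1..N}"
  and bd: "\<And>j. j \<in> J \<Longrightarrow> bdim H (ed j) = mm j" and triv: "\<And>j. j \<notin> J \<Longrightarrow> mm j = 1"
  and inc: "\<And>i. i \<in> {1..N} \<Longrightarrow> inc H i = ed ` ({lb i, i} \<inter> J)"
 shows "peps_cone H \<Psi> \<longleftrightarrow> (\<exists>A. (\<forall>i\<in>{1..N}. \<forall>s\<in>{1..sdim H i}. A i s \<in> carrier_mat (mm (lb i)) (mm i)) \<and>
   \<Psi> = chain_state N (sdim H) J mm lb A)"
proof -
 \<comment> \<open>Matrix indices start at 0 and bond labels at 1, hence the successor.\<close>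
 define NN where "NN \<kappa> = restrict (\<lambda>e. Suc (\<kappa> (the_inv_into J ed e))) (ed ` J)" for \<kappa> :: "nat \<Rightarrow> nat"
 have NN: "NN \<kappa> (ed j) = Suc (\<kappa> j)" if "j \<in> J" for \<kappa> j
  using that by (simp add: NN_def the_inv_into_f_f[OF inj])
 have sum_NN: "(\<Sum>n\<in>PiE (edges H) (\<lambda>e. {1..bdim H e}). g n) = (\<Sum>\<kappa>\<in>PiE J (\<lambda>j. {..<mm j}). g (NN \<kappa>))" for g :: "(nat set \<Rightarrow> nat) \<Rightarrow> complex"
 proof -
  have "(\<Sum>n\<in>PiE (edges H) (\<lambda>e. {1..bdim H e}). g n) =
    (\<Sum>k\<in>PiE J (\<lambda>j. {1..bdim H (ed j)}). g (restrict (\<lambda>e. k (the_inv_into J ed e)) (ed ` J)))"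
   unfolding E by (rule sum_PiE_reindex[OF inj])
  also have "\<dots> = (\<Sum>\<kappa>\<in>PiE J (\<lambda>j. {..<mm j}). g (NN \<kappa>))"
  proof (rule sum.reindex_bij_witness[of _ "\<lambda>\<kappa>. restrict (\<lambda>j. Suc (\<kappa> j)) J" "\<lambda>k. restrict (\<lambda>j. k j - 1) J"])
   fix k assume k: "k \<in> PiE J (\<lambda>j. {1..bdim H (ed j)})"
   show "restrict (\<lambda>j. Suc (restrict (\<lambda>j. k j - 1) J j)) J = k"
    using k by (auto simp: fun_eq_iff PiE_iff extensional_def restrict_def)
   show "restrict (\<lambda>j. k j - 1) J \<in> PiE J (\<lambda>j. {..<mm j})" using k bd by (fastforce simp: PiE_iff)
   have "NN (restrict (\<lambda>j. k j - 1) J) = restrict (\<lambda>e. k (the_inv_into J ed e)) (ed ` J)"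
    unfolding NN_def
   proof (rule restrict_ext)
    fix e assume "e \<in> ed ` J"
    then obtain j where j: "j \<in> J" "e = ed j" by blast
    thus "Suc (restrict (\<lambda>j. k j - 1) J (the_inv_into J ed e)) = k (the_inv_into J ed e)"
     using k by (auto simp: the_inv_into_f_f[OF inj] PiE_iff)
   qed
   thus "g (NN (restrict (\<lambda>j. k j - 1) J)) = g (restrict (\<lambda>e. k (the_inv_into J ed e)) (ed ` J))" by simp
  next
   fix \<kappa> assume \<kappa>: "\<kappa> \<in> PiE J (\<lambda>j. {..<mm j})"
   show "restrict (\<lambda>j. restrict (\<lambda>j. Suc (\<kappa> j)) J j - 1) J = \<kappa>"
    using \<kappa> by (auto simp: fun_eq_iff PiE_iff extensional_def restrict_def)
   show "restrict (\<lambda>j. Suc (\<kappa> j)) J \<in> PiE J (\<lambda>j. {1..bdim H (ed j)})" using \<kappa> bd by (auto simp: PiE_iff)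
  qed
  finally show ?thesis .
 qed
 show ?thesis
 proof
  assume "peps_cone H \<Psi>"
  then obtain B where B: "\<Psi> = peps_vec H B" by (auto simp: peps_cone_def)
  define A where "A i s = Matrix.mat (mm (lb i)) (mm i) (\<lambda>(a, b). B i s (restrict (\<lambda>e. if i \<in> J \<and> e = ed i then Suc b else Suc a) (inc H i)))" for i s
  have "A i s $$ chain_index lb J \<kappa> i = B i s (restrict (NN \<kappa>) (inc H i))"
   if i: "i \<in> {1..N}" and \<kappa>: "\<kappa> \<in> PiE J (\<lambda>j. {..<mm j})" for i s \<kappa>
  proof -
   have lt: "(if lb i \<in> J then \<kappa> (lb i) else 0) < mm (lb i)" "(if i \<in> J then \<kappa> i else 0) < mm i"
    using \<kappa> triv by (auto simp: PiE_iff)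
   have "restrict (\<lambda>e. if i \<in> J \<and> e = ed i then Suc (if i \<in> J then \<kappa> i else 0) else Suc (if lb i \<in> J then \<kappa> (lb i) else 0)) (inc H i) = restrict (NN \<kappa>) (inc H i)"
   proof (rule restrict_ext)
    fix e assume "e \<in> inc H i"
    then obtain j where j: "j \<in> J" "j = lb i \<or> j = i" "e = ed j" using inc[OF i] by blast
    show "(if i \<in> J \<and> e = ed i then Suc (if i \<in> J then \<kappa> i else 0) else Suc (if lb i \<in> J then \<kappa> (lb i) else 0)) = NN \<kappa> e"
     using j NN[OF j(1)] inj_onD[OF inj, of j i] by auto
   qed
   thus ?thesis using lt by (simp add: A_def)
  qed
  hence "\<Psi> = chain_state N (sdim H) J mm lb A"
   unfolding B peps_vec_def sum_NN V by (intro arg_cong[of _ _ "vec_of {1..N} (sdim H)"] ext sum.cong prod.cong refl) simp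
  moreover have "\<forall>i\<in>{1..N}. \<forall>s\<in>{1..sdim H i}. A i s \<in> carrier_mat (mm (lb i)) (mm i)" by (simp add: A_def)
  ultimately show "\<exists>A. (\<forall>i\<in>{1..N}. \<forall>s\<in>{1..sdim H i}. A i s \<in> carrier_mat (mm (lb i)) (mm i)) \<and>
   \<Psi> = chain_state N (sdim H) J mm lb A" by blast
 next
  assume "\<exists>A. (\<forall>i\<in>{1..N}. \<forall>s\<in>{1..sdim H i}. A i s \<in> carrier_mat (mm (lb i)) (mm i)) \<and>
   \<Psi> = chain_state N (sdim H) J mm lb A"
  then obtain A where A: "\<Psi> = chain_state N (sdim H) J mm lb A" by blast
  define B where "B i s n = A i s $$ (if lb i \<in> J then n (ed (lb i)) - 1 else 0, if i \<in> J then n (ed i) - 1 else 0)"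
   for i s and n :: "nat set \<Rightarrow> nat"
  have "B i s (restrict (NN \<kappa>) (inc H i)) = A i s $$ chain_index lb J \<kappa> i"
   if i: "i \<in> {1..N}" for i s \<kappa>
  proof -
   have "restrict (NN \<kappa>) (inc H i) (ed (lb i)) - 1 = \<kappa> (lb i)" if "lb i \<in> J"
    using NN[OF that] inc[OF i] that by simp
   moreover have "restrict (NN \<kappa>) (inc H i) (ed i) - 1 = \<kappa> i" if "i \<in> J"
    using NN[OF that] inc[OF i] that by simp
   ultimately show ?thesis unfolding B_def by (simp cong: if_cong)
  qed
  hence "\<Psi> = peps_vec H B"
   unfolding A peps_vec_def sum_NN V by (intro arg_cong[of _ _ "vec_of {1..N} (sdim H)"] ext sum.cong prod.cong refl) simp
  thus "peps_cone H \<Psi>" by (auto simp: peps_cone_def)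
 qed
qed

definition ring_edge :: "nat \<Rightarrow> nat \<Rightarrow> nat set" where
 "ring_edge N i = {i, Suc (i mod N)}"

definition ring_network :: "nat \<Rightarrow> nat \<Rightarrow> (nat \<Rightarrow> nat) \<Rightarrow> nat network" where
 "ring_network N m \<delta> = \<lparr>verts = {1..N}, edges = ring_edge N ` {1..N}, bdim = (\<lambda>_. m), sdim = \<delta>\<rparr>"

text \<open>\<open>Min e\<close> recovers \<open>i\<close> from the edge \<open>{i, Suc i}\<close>,
  so the bond dimension can be looked up by its position.\<close>

definition path_network :: "nat \<Rightarrow> (nat \<Rightarrow> nat) \<Rightarrow> (nat \<Rightarrow> nat) \<Rightarrow> nat network" where
 "path_network N mm \<delta> = \<lparr>verts = {1..N}, edges = (\<lambda>i. {i, Suc i}) ` {1..<N},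
   bdim = (\<lambda>e. mm (Min e)), sdim = \<delta>\<rparr>"

lemma mod_less_cases: "i \<in> {1..N} \<Longrightarrow> Suc (i mod N) = (if i = N then 1 else Suc i)" for i N :: nat
 by auto

text \<open>From three sites on the ring edges are pairwise distinct, so the periodic bonds are the
  edges of a simple graph.\<close>

lemma pMPSn_eq_PEPS:
 assumes N: "N \<ge> 3"
 shows "pMPSn N m \<delta> = PEPS (ring_network N m \<delta>)"
proof -
 let ?H = "ring_network N m \<delta>"
 define mm where "mm j = (if j \<in> {1..N} then m else 1)" for j
 have inj: "inj_on (ring_edge N) {1..N}"
 proof (rule inj_onI)
  fix i j assume ij: "i \<in> {1..N}" "j \<in> {1..N}" "ring_edge N i = ring_edge N j"
  thus "i = j" using N by (auto simp: ring_edge_def mod_less_cases doubleton_eq_iff split: if_splits)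
 qed
 have pr: "prev_site N i \<in> {1..N}" "prev_site N i \<noteq> i" "Suc (prev_site N i mod N) = i" if "i \<in> {1..N}" for i
  using that N by (auto simp: prev_site_def)
 have inc: "inc ?H i = ring_edge N ` ({prev_site N i, i} \<inter> {1..N})" if i: "i \<in> {1..N}" for i
 proof -
  have "j = prev_site N i" if "j \<in> {1..N}" "i = Suc (j mod N)" for j
   using that by (cases "j = N") (auto simp: prev_site_def)
  hence "inc ?H i \<subseteq> ring_edge N ` {prev_site N i, i}"
   by (auto simp: inc_def ring_network_def ring_edge_def)
  moreover have "ring_edge N ` {prev_site N i, i} \<subseteq> inc ?H i"
   using pr[OF i] i by (auto simp: inc_def ring_network_def ring_edge_def)
  moreover have "{prev_site N i, i} \<inter> {1..N} = {prev_site N i, i}" using pr[OF i] i by auto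
  ultimately show ?thesis by auto
 qed
 have cone: "peps_cone ?H \<Psi> \<longleftrightarrow> (\<exists>A. (\<forall>i\<in>{1..N}. \<forall>s\<in>{1..\<delta> i}. A i s \<in> carrier_mat m m) \<and>
   \<Psi> = vec_of {1..N} \<delta> (\<lambda>\<sigma>. mat_trace (mps_prod N m A \<sigma>)))" for \<Psi>
 proof -
  have "peps_cone ?H \<Psi> \<longleftrightarrow> (\<exists>A. (\<forall>i\<in>{1..N}. \<forall>s\<in>{1..sdim ?H i}. A i s \<in> carrier_mat (mm (prev_site N i)) (mm i)) \<and>
   \<Psi> = chain_state N (sdim ?H) {1..N} mm (prev_site N) A)"
   by (rule chain_peps[OF inj _ _ _ _ inc]) (auto simp: ring_network_def mm_def)
  also have "\<dots> \<longleftrightarrow> (\<exists>A. (\<forall>i\<in>{1..N}. \<forall>s\<in>{1..\<delta> i}. A i s \<in> carrier_mat m m) \<and>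
   \<Psi> = vec_of {1..N} \<delta> (\<lambda>\<sigma>. mat_trace (mps_prod N m A \<sigma>)))"
  proof (rule ex_cong1, rule conj_cong)
   fix A :: "nat \<Rightarrow> nat \<Rightarrow> complex mat"
   show "(\<forall>i\<in>{1..N}. \<forall>s\<in>{1..sdim ?H i}. A i s \<in> carrier_mat (mm (prev_site N i)) (mm i)) =
     (\<forall>i\<in>{1..N}. \<forall>s\<in>{1..\<delta> i}. A i s \<in> carrier_mat m m)"
    using pr(1) by (intro ball_cong refl) (simp_all add: ring_network_def mm_def del: atLeastAtMost_iff)
   assume A: "\<forall>i\<in>{1..N}. \<forall>s\<in>{1..\<delta> i}. A i s \<in> carrier_mat m m"
   have "chain_state N \<delta> {1..N} mm (prev_site N) A =
    vec_of {1..N} \<delta> (\<lambda>\<sigma>. mat_trace (mps_prod N m A \<sigma>))"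
    unfolding vec_of_def
   proof (rule ext, rule if_cong[OF refl _ refl])
    fix \<sigma> assume "\<sigma> \<in> configs {1..N} \<delta>"
    hence "A i (\<sigma> i) \<in> carrier_mat m m" if "i \<in> {1..N}" for i
     using A that unfolding configs_def by (meson PiE_mem)
    moreover have "PiE {1..N} (\<lambda>j. {..<mm j}) = PiE {1..N} (\<lambda>j. {..<m})" by (rule PiE_cong) (simp add: mm_def)
    ultimately show "(\<Sum>\<kappa>\<in>PiE {1..N} (\<lambda>j. {..<mm j}). \<Prod>i\<in>{1..N}. A i (\<sigma> i) $$
     chain_index (prev_site N) {1..N} \<kappa> i) = mat_trace (mps_prod N m A \<sigma>)"
     using pr(1) N by (subst mps_trace) (auto intro!: sum.cong prod.cong simp del: atLeastAtMost_iff)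
   qed
   thus "(\<Psi> = chain_state N (sdim ?H) {1..N} mm (prev_site N) A) \<longleftrightarrow>
    (\<Psi> = vec_of {1..N} \<delta> (\<lambda>\<sigma>. mat_trace (mps_prod N m A \<sigma>)))"
    by (simp add: ring_network_def)
  qed
  finally show ?thesis .
 qed
 have "verts ?H = {1..N}" "sdim ?H = \<delta>" by (simp_all add: ring_network_def)
 thus ?thesis unfolding pMPSn_def PEPS_cone cone by simp
qed

lemma oMPS_eq_PEPS:
 assumes N: "N \<ge> 1" and mm: "mm 0 = 1" "mm N = 1"
 shows "oMPS N mm d = PEPS (path_network N mm (\<lambda>_. d))"
proof -
 let ?H = "path_network N mm (\<lambda>_. d)"
 define mm' where "mm' j = (if j \<in> {1..<N} then mm j else 1)" for j
 have mme: "mm' j = mm j" if "j \<le> N" for j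
 proof -
  have "j = 0 \<or> j = N \<or> j \<in> {1..<N}" using that by auto
  thus ?thesis using mm by (auto simp: mm'_def)
 qed
 have inj: "inj_on (\<lambda>i. {i, Suc i}) {1..<N}"
  by (rule inj_onI) (auto simp: doubleton_eq_iff)
 have inc: "inc ?H i = (\<lambda>i. {i, Suc i}) ` ({i - 1, i} \<inter> {1..<N})" if i: "i \<in> {1..N}" for i
  using i by (auto simp: inc_def path_network_def)
 have cone: "peps_cone ?H \<Psi> \<longleftrightarrow> (\<exists>A. (\<forall>i\<in>{1..N}. \<forall>s\<in>{1..d}. A i s \<in> carrier_mat (mm (i - 1)) (mm i)) \<and>
   \<Psi> = vec_of {1..N} (\<lambda>_. d) (\<lambda>\<sigma>. mps_prod N (mm N) A \<sigma> $$ (0, 0)))" for \<Psi>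
 proof -
  have "peps_cone ?H \<Psi> \<longleftrightarrow> (\<exists>A. (\<forall>i\<in>{1..N}. \<forall>s\<in>{1..sdim ?H i}. A i s \<in> carrier_mat (mm' (i - 1)) (mm' i)) \<and>
   \<Psi> = chain_state N (sdim ?H) {1..<N} mm' (\<lambda>i. i - 1) A)"
  proof (rule chain_peps[OF inj _ _ _ _ inc])
   show "bdim ?H {j, Suc j} = mm' j" if "j \<in> {1..<N}" for j
    using that by (simp add: path_network_def mm'_def min_def)
  qed (auto simp: path_network_def mm'_def)
  also have "\<dots> \<longleftrightarrow> (\<exists>A. (\<forall>i\<in>{1..N}. \<forall>s\<in>{1..d}. A i s \<in> carrier_mat (mm (i - 1)) (mm i)) \<and>
   \<Psi> = vec_of {1..N} (\<lambda>_. d) (\<lambda>\<sigma>. mps_prod N (mm N) A \<sigma> $$ (0, 0)))"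
  proof (rule ex_cong1, rule conj_cong)
   fix A :: "nat \<Rightarrow> nat \<Rightarrow> complex mat"
   show "(\<forall>i\<in>{1..N}. \<forall>s\<in>{1..sdim ?H i}. A i s \<in> carrier_mat (mm' (i - 1)) (mm' i)) =
     (\<forall>i\<in>{1..N}. \<forall>s\<in>{1..d}. A i s \<in> carrier_mat (mm (i - 1)) (mm i))"
   proof (rule ball_cong[OF refl])
    fix i assume "i \<in> {1..N}"
    hence "mm' (i - 1) = mm (i - 1)" "mm' i = mm i" using mme[of "i - 1"] mme[of i] by auto
    thus "(\<forall>s\<in>{1..sdim ?H i}. A i s \<in> carrier_mat (mm' (i - 1)) (mm' i)) = (\<forall>s\<in>{1..d}. A i s \<in> carrier_mat (mm (i - 1)) (mm i))"
     by (simp only: path_network_def network.simps)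
   qed
   assume A: "\<forall>i\<in>{1..N}. \<forall>s\<in>{1..d}. A i s \<in> carrier_mat (mm (i - 1)) (mm i)"
   have "chain_state N (\<lambda>_. d) {1..<N} mm' (\<lambda>i. i - 1) A =
    vec_of {1..N} (\<lambda>_. d) (\<lambda>\<sigma>. mps_prod N (mm N) A \<sigma> $$ (0, 0))"
    unfolding vec_of_def
   proof (rule ext, rule if_cong[OF refl _ refl])
    fix \<sigma> assume "\<sigma> \<in> configs {1..N} (\<lambda>_. d)"
    hence c: "A i (\<sigma> i) \<in> carrier_mat (mm (i - 1)) (mm i)" if "i \<in> {1..N}" for i
     using A that unfolding configs_def by (meson PiE_mem)
    have P: "PiE {1..<N} (\<lambda>j. {..<mm' j}) = PiE {1..<N} (\<lambda>j. {..<mm j})" by (rule PiE_cong) (simp add: mm'_def)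
    show "(\<Sum>\<kappa>\<in>PiE {1..<N} (\<lambda>j. {..<mm' j}). \<Prod>i\<in>{1..N}. A i (\<sigma> i) $$
     chain_index (\<lambda>i. i - 1) {1..<N} \<kappa> i) = mps_prod N (mm N) A \<sigma> $$ (0, 0)"
     unfolding P by (rule mps_open[of N mm A \<sigma>, OF N mm c, symmetric])
   qed
   thus "(\<Psi> = chain_state N (sdim ?H) {1..<N} mm' (\<lambda>i. i - 1) A) \<longleftrightarrow>
    (\<Psi> = vec_of {1..N} (\<lambda>_. d) (\<lambda>\<sigma>. mps_prod N (mm N) A \<sigma> $$ (0, 0)))"
    by (simp add: path_network_def)
  qed
  finally show ?thesis .
 qed
 have "verts ?H = {1..N}" "sdim ?H = (\<lambda>_. d)" by (simp_all add: path_network_def)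
 thus ?thesis unfolding oMPS_def PEPS_cone cone by simp
qed

section \<open>Clustered rings and cubic lattices\<close>

text \<open>A divisor of \<open>a * b\<close> is a product of a divisor of \<open>a\<close> and one
  of \<open>b\<close>; splitting off the last factor gives the induction. With
  \<open>a = b = m\<close> it divides each site of a cluster into a step digit and a phase
  digit.\<close>

lemma prod_factorization:
 fixes d :: "nat \<Rightarrow> nat"
 assumes "(\<Prod>i<n. d i) = a * b" "\<And>i. i < n \<Longrightarrow> d i \<ge> 1"
 shows "\<exists>u w. (\<forall>i<n. d i = u i * w i) \<and> (\<Prod>i<n. u i) = a \<and> (\<Prod>i<n. w i) = b"
 using assms
proof (induction n arbitrary: a b)
 case 0 thus ?case by simp
next
 case (Suc n)
 have "d n dvd a * b" using Suc.prems(1) by (metis dvd_triv_right prod.lessThan_Suc)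
 then obtain b' c' where bc: "d n = b' * c'" "b' dvd a" "c' dvd b" using division_decomp by blast
 obtain a1 b1 where ab: "a = b' * a1" "b = c' * b1" using bc by (auto elim!: dvdE)
 have "d n \<ge> 1" using Suc.prems(2) by simp
 hence "(\<Prod>i<n. d i) = a1 * b1" using Suc.prems(1) bc(1) ab by simp
 then obtain u w where uw: "\<forall>i<n. d i = u i * w i" "(\<Prod>i<n. u i) = a1" "(\<Prod>i<n. w i) = b1"
  using Suc.IH[of a1 b1] Suc.prems(2) by auto
 have "(\<Prod>i<n. (u(n := b')) i) = a1" "(\<Prod>i<n. (w(n := c')) i) = b1" using uw by auto
 thus ?case using uw(1) bc(1) ab
  by (intro exI[of _ "u(n := b')"] exI[of _ "w(n := c')"]) (auto simp: less_Suc_eq)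
qed

lemma prod_shift: "(\<Prod>i\<in>{a..<a + n}. f i) = (\<Prod>i<n. f (a + i))" for f :: "nat \<Rightarrow> nat"
 by (rule prod.reindex_bij_witness[of _ "\<lambda>i. a + i" "\<lambda>i. i - a"]) auto

lemma cluster_index:
 fixes l :: "nat \<Rightarrow> nat"
 assumes "i < (\<Sum>c<K. l c)"
 shows "\<exists>c<K. \<exists>j<l c. i = (\<Sum>c'<c. l c') + j"
 using assms
proof (induction K)
 case 0 thus ?case by simp
next
 case (Suc K)
 show ?case
 proof (cases "i < (\<Sum>c<K. l c)")
  case True
  then obtain c j where "c < K" "j < l c" "i = (\<Sum>c'<c. l c') + j" using Suc.IH by blast
  thus ?thesis by (intro exI[of _ c]) auto
 next
  case False
  thus ?thesis using Suc.prems by (intro exI[of _ K] conjI exI[of _ "i - (\<Sum>c<K. l c)"]) auto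
 qed
qed

text \<open>Counted from the site after \<open>s\<close>, the ring becomes a single line. Three
  clusters serve as the corners of the triangle; \<open>pk\<close> gives digits of size 1 to all
  later sites.\<close>

theorem pMPSn_clusters_lacks_optimizers:
 fixes l :: "nat \<Rightarrow> nat" and d dt :: "nat \<Rightarrow> nat \<Rightarrow> nat"
 assumes m: "m > 1" and K: "K \<ge> 3" and l: "\<forall>c<K. l c \<ge> 1" and N: "N = (\<Sum>c<K. l c)"
  and d: "\<forall>c<K. \<forall>i<l c. d c i \<ge> 1 \<and> dt c i \<ge> d c i \<and> \<delta> (ring_site N s l c i) = dt c i"
  and pd: "\<forall>c<K. m\<^sup>2 = (\<Prod>i<l c. d c i)"
 shows "lacks_optimizers {1..N} \<delta> (pMPSn N m \<delta>)"
proof -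
 have off3: "(\<Sum>c<3. l c) \<le> N"
  unfolding N by (rule sum_mono2) (use K in auto)
 have s3: "(\<Sum>c<3. l c) = l 0 + l 1 + l 2" "(\<Sum>c<2. l c) = l 0 + l 1" "(\<Sum>c<1. l c) = l 0"
  by (simp_all add: numeral_3_eq_3 numeral_2_eq_2)
 have l1: "l 0 \<ge> 1" "l 1 \<ge> 1" "l 2 \<ge> 1" using l K by auto
 define p1 where "p1 = l 0"
 define p2 where "p2 = l 0 + l 1"
 define p3 where "p3 = l 0 + l 1 + l 2"
 have p: "0 < p1" "p1 < p2" "p2 < p3" "p3 \<le> N" using l1 off3 s3 by (auto simp: p1_def p2_def p3_def)
 have N3: "N \<ge> 3" using p by simp
 have "\<exists>u w. (\<forall>i<l c. d c i = u i * w i) \<and> (\<Prod>i<l c. u i) = m \<and> (\<Prod>i<l c. w i) = m" if "c < K" for c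
  by (rule prod_factorization) (use d pd that in \<open>auto simp: power2_eq_square\<close>)
 then obtain uu ww where uw: "\<And>c i. c < K \<Longrightarrow> i < l c \<Longrightarrow> d c i = uu c i * ww c i"
   "\<And>c. c < K \<Longrightarrow> (\<Prod>i<l c. uu c i) = m" "\<And>c. c < K \<Longrightarrow> (\<Prod>i<l c. ww c i) = m" by metis
 define pk where "pk f i = (if i < p1 then f 0 i else if i < p2 then f 1 (i - p1) else if i < p3 then f 2 (i - p2) else 1)"
  for f :: "nat \<Rightarrow> nat \<Rightarrow> nat" and i
 define loc where "loc r i = Suc ((s + i) mod N)" for r :: unit and i
 let ?G = "ring_network N m \<delta>"
 have site: "ring_site N s l c j = loc () ((\<Sum>c'<c. l c') + j)" for c j
  by (simp add: ring_site_def loc_def add.assoc)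
 have dpos: "d c j \<ge> 1" "d c j \<le> \<delta> (loc () ((\<Sum>c'<c. l c') + j))" if "c < K" "j < l c" for c j
  using d that unfolding site by (metis, metis)
 have pprod: "(\<Prod>i\<in>{0..<p1}. pk f i) = (\<Prod>i<l 0. f 0 i)" "(\<Prod>i\<in>{p1..<p2}. pk f i) = (\<Prod>i<l 1. f 1 i)"
  "(\<Prod>i\<in>{p2..<p3}. pk f i) = (\<Prod>i<l 2. f 2 i)" for f
 proof -
  show "(\<Prod>i\<in>{0..<p1}. pk f i) = (\<Prod>i<l 0. f 0 i)"
   by (rule prod.cong) (auto simp: pk_def p1_def)
  have "(\<Prod>i\<in>{p1..<p1 + l 1}. pk f i) = (\<Prod>i<l 1. f 1 i)"
   unfolding prod_shift by (rule prod.cong[OF refl]) (simp add: pk_def p1_def p2_def)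
  thus "(\<Prod>i\<in>{p1..<p2}. pk f i) = (\<Prod>i<l 1. f 1 i)" by (simp add: p1_def p2_def)
  have "(\<Prod>i\<in>{p2..<p2 + l 2}. pk f i) = (\<Prod>i<l 2. f 2 i)"
   unfolding prod_shift by (rule prod.cong[OF refl]) (simp add: pk_def p1_def p2_def p3_def)
  thus "(\<Prod>i\<in>{p2..<p3}. pk f i) = (\<Prod>i<l 2. f 2 i)" by (simp add: p2_def p3_def)
 qed
 have pkm: "pk uu i * pk ww i \<le> \<delta> (loc () i) \<and> 1 \<le> pk uu i \<and> 1 \<le> pk ww i" if i: "i < N" for i
 proof -
  obtain c j where cj: "c < K" "j < l c" "i = (\<Sum>c'<c. l c') + j" using cluster_index[of i l K] i N by blast
  have dle: "1 \<le> d c j" "d c j \<le> \<delta> (loc () i)" using dpos[OF cj(1,2)] cj(3) by simp_all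
  have le1: "1 \<le> uu c j \<and> 1 \<le> ww c j" using dle(1) uw(1)[OF cj(1,2)] by (metis One_nat_def Suc_leI mult_is_0 neq0_conv not_one_le_zero)
  consider "c = 0" | "c = 1" | "c = 2" | "3 \<le> c" by linarith
  thus ?thesis
  proof cases
   case 1
   hence "pk f i = f c j" for f using cj by (simp add: pk_def p1_def)
   thus ?thesis using uw(1)[OF cj(1,2)] dle le1 by simp
  next
   case 2
   hence "pk f i = f c j" for f using cj by (simp add: pk_def p1_def p2_def)
   thus ?thesis using uw(1)[OF cj(1,2)] dle le1 by simp
  next
   case 3
   hence "pk f i = f c j" for f using cj s3 by (simp add: pk_def p1_def p2_def p3_def)
   thus ?thesis using uw(1)[OF cj(1,2)] dle le1 by simp
  next
   case 4
   have "(\<Sum>c'<3. l c') \<le> (\<Sum>c'<c. l c')" by (rule sum_mono2) (use 4 in auto)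
   hence "i \<ge> p3" using cj(3) s3 by (simp add: p3_def)
   hence "pk f i = 1" for f using p by (simp add: pk_def)
   thus ?thesis using dle by simp
  qed
 qed
 have inj: "inj_on (loc ()) {..<N}"
 proof (rule inj_onI)
  fix i j assume ij: "i \<in> {..<N}" "j \<in> {..<N}" "loc () i = loc () j"
  hence "[s + i = s + j] (mod N)" by (simp add: loc_def cong_def)
  hence "[i = j] (mod N)" by (simp add: cong_add_lcancel_nat)
  thus "i = j" using ij by (simp add: cong_def)
 qed
 have img: "loc () ` {..<N} = {1..N}"
 proof (rule card_subset_eq)
  show "loc () ` {..<N} \<subseteq> {1..N}"
  proof
   fix x assume "x \<in> loc () ` {..<N}"
   then obtain i where "x = Suc ((s + i) mod N)" by (auto simp: loc_def)
   moreover have "(s + i) mod N < N" using N3 by simp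
   ultimately show "x \<in> {1..N}" by simp
  qed
  show "card (loc () ` {..<N}) = card {1..N}" using inj by (simp add: card_image)
 qed simp
 have edge: "ring_edge N (loc r i) = {loc r i, loc r (Suc i mod N)}" for r i
 proof -
  have "Suc (Suc ((s + i) mod N) mod N) = Suc ((s + Suc i mod N) mod N)"
   by (simp add: mod_Suc_eq mod_add_right_eq)
  thus ?thesis by (simp add: ring_edge_def loc_def)
 qed
 have lin: "loc () i \<in> {1..N}" if "i < N" for i using img that by blast
 interpret ring_lines ?G "{()}" "()" N m p1 p2 p3 loc "pk uu" "pk ww"
 proof unfold_locales
  show "graph_edges (verts ?G) (edges ?G)"
   unfolding graph_edges_def
  proof (intro conjI ballI)
   show "finite (verts ?G)" by (simp add: ring_network_def)
   fix e assume "e \<in> edges ?G"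
   then obtain j where j: "j \<in> {1..N}" "e = ring_edge N j" by (auto simp: ring_network_def)
   have "j mod N < N" "j \<noteq> Suc (j mod N)" using j N3 by (auto simp: le_less)
   thus "e \<subseteq> verts ?G" "card e = 2" using j by (auto simp: ring_network_def ring_edge_def Suc_le_eq)
  qed
  show "bij_betw (\<lambda>p. loc (fst p) (snd p)) ({()} \<times> {..<N}) (verts ?G)"
   unfolding bij_betw_def
  proof
   show "inj_on (\<lambda>p. loc (fst p) (snd p)) ({()} \<times> {..<N})"
    using inj by (auto simp: inj_on_def)
   have "(\<lambda>p. loc (fst p) (snd p)) ` ({()} \<times> {..<N}) = loc () ` {..<N}" by force
   thus "(\<lambda>p. loc (fst p) (snd p)) ` ({()} \<times> {..<N}) = verts ?G" by (simp add: img ring_network_def)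
  qed
  show "{loc r i, loc r (Suc i mod N)} \<in> edges ?G" if "r \<in> {()}" "i < N" for r i
   using lin[OF that(2)] by (auto simp: ring_network_def edge[symmetric])
  show "(\<exists>r\<in>{()}. \<exists>i<N. e = {loc r i, loc r (Suc i mod N)}) \<or>
    (\<exists>i<N. \<exists>r\<in>{()}. \<exists>r'\<in>{()}. e = {loc r i, loc r' i})" if "e \<in> edges ?G" for e
  proof -
   obtain j where j: "j \<in> {1..N}" "e = ring_edge N j" using \<open>e \<in> edges ?G\<close> by (auto simp: ring_network_def)
   then obtain i where "i < N" "j = loc () i" using img by (metis imageE lessThan_iff)
   thus ?thesis using j(2) edge by auto
  qed
  show "pk uu i * pk ww i \<le> sdim ?G (loc r i)" if "r \<in> {()}" "i < N" for r i
   using pkm[OF that(2)] by (simp add: ring_network_def)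
  show "1 \<le> pk uu i" "1 \<le> pk ww i" if "i < N" for i using pkm[OF that] by blast+
  show "bdim ?G {loc r i, loc r (Suc i mod N)} = m" for r i by (simp add: ring_network_def)
  show "1 \<le> bdim ?G e" for e using m by (simp add: ring_network_def)
  show "2 \<le> m" using m by simp
  show "(\<Prod>i\<in>{0..<p1}. pk uu i) = m" "(\<Prod>i\<in>{p1..<p2}. pk uu i) = m" "(\<Prod>i\<in>{p2..<p3}. pk uu i) = m"
   "(\<Prod>i\<in>{0..<p1}. pk ww i) = m" "(\<Prod>i\<in>{p1..<p2}. pk ww i) = m" "(\<Prod>i\<in>{p2..<p3}. pk ww i) = m"
   unfolding pprod using uw(2,3) K by simp_all
 qed (use p in auto)
 have "verts ?G = {1..N}" "sdim ?G = \<delta>" by (simp_all add: ring_network_def)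
 thus ?thesis using PEPS_lacks_optimizers unfolding pMPSn_eq_PEPS[OF N3] by simp
qed

text \<open>Every site is a cluster of its own.\<close>

lemma pMPSn_lacks_optimizers:
 assumes "m > 1" "N \<ge> 3" "d \<ge> m\<^sup>2"
 shows "lacks_optimizers {1..N} (\<lambda>_. d) (pMPSn N m (\<lambda>_. d))"
 by (rule pMPSn_clusters_lacks_optimizers[where K = N and l = "\<lambda>_. 1" and d = "\<lambda>_ _. m\<^sup>2" and dt = "\<lambda>_ _. d" and s = 0])
  (use assms in auto)

lemma pMPSn_equal_clusters_lacks_optimizers:
 assumes l: "l \<ge> 1" and d: "d > 1" "dt \<ge> d" and m: "real m = real d powr (real l / 2)" and N: "N \<ge> 3 * l" "l dvd N"
 shows "lacks_optimizers {1..N} (\<lambda>_. dt) (pMPSn N m (\<lambda>_. dt))"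
proof -
 have "real (m\<^sup>2) = (real d powr (real l / 2)) ^ 2" using m by simp
 also have "\<dots> = real d powr (real l / 2 + real l / 2)" by (simp only: power2_eq_square powr_add)
 also have "\<dots> = real (d ^ l)" using d by (simp add: powr_realpow)
 finally have m2: "m\<^sup>2 = d ^ l" by (simp only: of_nat_eq_iff)
 have "d ^ 1 \<le> d ^ l" using l d by (intro power_increasing) auto
 hence "m\<^sup>2 > 1" using d m2 by simp
 hence "m > 1" by (metis less_one linorder_neqE_nat not_less_iff_gr_or_eq one_power2 power_zero_numeral)
 obtain K where K: "N = l * K" using N(2) by (auto elim: dvdE)
 have "K \<ge> 3" using N(1) l K by simp
 thus ?thesis
  by (intro pMPSn_clusters_lacks_optimizers[where K = K and l = "\<lambda>_. l" and d = "\<lambda>_ _. d" and dt = "\<lambda>_ _. dt" and s = 0])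
   (use l d m2 \<open>m > 1\<close> K in auto)
qed

text \<open>The lines run in the x direction and are indexed by the sites with first coordinate 1;
  edges in other directions join equal positions. A site of dimension \<open>d\<close> holds a
  single digit of size \<open>d\<close>, so a cluster needs \<open>lx\<close> sites for its step and
  \<open>lx\<close> for its phase. This is why the length is counted in units of
  \<open>2 * lx\<close>, at least three of which are needed.\<close>

theorem cubic_lattice_lacks_optimizers:
 assumes D: "D \<ge> 1" and G: "cubic_lattice D L per m G" and d: "d \<ge> 2" "\<forall>i\<in>verts G. sdim G i \<ge> d"
  and x: "per 0" "lx \<ge> 1" "Nc \<ge> 3" "m 0 = d ^ lx" "L 0 = 2 * Nc * lx"
  and Lm: "\<forall>k. 1 \<le> k \<and> k < D \<longrightarrow> L k \<ge> 1 \<and> m k \<ge> 2"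
 shows "lacks_optimizers (verts G) (sdim G) (PEPS G)"
proof -
 define N where "N = L 0"
 have V: "verts G = lattice_sites D L" and E: "edges G = (\<Union>k<D. lattice_edges D L per k)"
  and bd: "\<And>k e. k < D \<Longrightarrow> e \<in> lattice_edges D L per k \<Longrightarrow> bdim G e = m k"
  using G by (auto simp: cubic_lattice_def)
 have N6: "N \<ge> 6 * lx"
 proof -
  have "6 * lx \<le> 2 * Nc * lx" using x(3) by (intro mult_le_mono1) simp
  thus ?thesis using x(5) by (simp add: N_def)
 qed
 hence N3: "N \<ge> 3" using x(2) by simp
 define R where "R = {v \<in> lattice_sites D L. v ! 0 = 1}"
 define loc where "loc r i = r[0 := Suc i]" for r :: "nat list" and i
 have L1: "L k \<ge> 1" if "k < D" for k using Lm N3 that by (cases "k = 0") (auto simp: N_def)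
 have finS: "finite (lattice_sites D L)"
 proof (rule finite_subset)
  show "lattice_sites D L \<subseteq> {xs. set xs \<subseteq> {0..(\<Sum>k<D. L k)} \<and> length xs = D}"
  proof
   fix v assume v: "v \<in> lattice_sites D L"
   have "v ! k \<le> (\<Sum>k<D. L k)" if "k < D" for k
   proof -
    have "v ! k \<le> L k" using v that by (auto simp: lattice_sites_def)
    also have "L k \<le> (\<Sum>k<D. L k)" by (rule member_le_sum) (use that in auto)
    finally show ?thesis .
   qed
   thus "v \<in> {xs. set xs \<subseteq> {0..(\<Sum>k<D. L k)} \<and> length xs = D}"
    using v by (auto simp: lattice_sites_def in_set_conv_nth)
  qed
  show "finite {xs. set xs \<subseteq> {0..(\<Sum>k<D. L k)} \<and> length xs = D}" by (rule finite_lists_length_eq) simp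
 qed
 have upd: "v[k := a] \<in> lattice_sites D L" if "v \<in> lattice_sites D L" "k < D" "a \<in> {1..L k}" for v k a
  using that by (auto simp: lattice_sites_def nth_list_update)
 have locV: "loc r i \<in> lattice_sites D L" if "r \<in> R" "i < N" for r i
  unfolding loc_def using that D by (intro upd) (auto simp: R_def N_def)
 have lenR: "length r = D" if "r \<in> R" for r using that by (simp add: R_def lattice_sites_def)
 have site_split: "v[0 := 1] \<in> R" "v ! 0 - 1 < N" "loc (v[0 := 1]) (v ! 0 - 1) = v" if v: "v \<in> lattice_sites D L" for v
 proof -
  have v0: "v ! 0 \<in> {1..L 0}" "length v = D" using v D by (auto simp: lattice_sites_def)
  show "v[0 := 1] \<in> R" using upd[OF v, of 0 1] D L1[of 0] v0(2) by (auto simp: R_def)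
  show "v ! 0 - 1 < N" using v0 by (auto simp: N_def)
  have "loc (v[0 := 1]) (v ! 0 - 1) = v[0 := v ! 0]" using v0 by (simp add: loc_def)
  thus "loc (v[0 := 1]) (v ! 0 - 1) = v" by simp
 qed
 have r0id: "r[0 := Suc 0] = r" if r: "r \<in> R" for r
 proof -
  have "r ! 0 = 1" using r by (simp add: R_def)
  thus ?thesis using list_update_id[of r 0] by (simp only: One_nat_def)
 qed
 have le0: "{loc r i, loc r (Suc i mod N)} \<in> lattice_edges D L per 0" if r: "r \<in> R" and i: "i < N" for r i
 proof (cases "Suc i < N")
  case True
  have "loc r i ! 0 = Suc i" "loc r (Suc i) = (loc r i)[0 := loc r i ! 0 + 1]"
   using lenR[OF r] D by (simp_all add: loc_def)
  thus ?thesis using True locV[OF r i] unfolding lattice_edges_def N_def by (intro UnI1 CollectI exI[of _ "loc r i"]) simp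
 next
  case False
  hence iN: "Suc i = N" using i by simp
  have "loc r i ! 0 = L 0" "loc r 0 = (loc r i)[0 := 1]"
   using lenR[OF r] D iN by (simp_all add: loc_def N_def)
  thus ?thesis using locV[OF r i] x(1) N3 iN unfolding lattice_edges_def
   by (intro UnI2 CollectI exI[of _ "loc r i"]) (simp add: N_def)
 qed
 \<comment> \<open>The first half of each block of \<open>2 * lx\<close> sites carries step digits
   and the second half phase digits, so \<open>u i * w i\<close> is \<open>d\<close> everywhere and
   both products over a block are \<open>d ^ lx\<close>.\<close>
 define u where "u i = (if i mod (2 * lx) < lx then d else 1)" for i
 define w where "w i = (if i mod (2 * lx) < lx then 1 else d)" for i
 have blk: "(\<Prod>i\<in>{2 * lx * c..<2 * lx * c + 2 * lx}. u i) = d ^ lx \<and> (\<Prod>i\<in>{2 * lx * c..<2 * lx * c + 2 * lx}. w i) = d ^ lx" for c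
 proof -
  have "(\<Prod>i\<in>{2 * lx * c..<2 * lx * c + 2 * lx}. f i) = (\<Prod>i<lx. f i) * (\<Prod>i<lx. f (lx + i))"
   if f: "\<And>i. f (2 * lx * c + i) = f i" for f :: "nat \<Rightarrow> nat"
  proof -
   have "(\<Prod>i\<in>{2 * lx * c..<2 * lx * c + 2 * lx}. f i) = (\<Prod>i<2 * lx. f i)"
    unfolding prod_shift f by (rule refl)
   also have "{..<2 * lx} = {..<lx} \<union> {lx..<lx + lx}" by auto
   also have "(\<Prod>i\<in>{..<lx} \<union> {lx..<lx + lx}. f i) = (\<Prod>i<lx. f i) * (\<Prod>i\<in>{lx..<lx + lx}. f i)"
    by (rule prod.union_disjoint) auto
   finally show ?thesis by (simp only: prod_shift)
  qed
  note * = this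
  have "u (2 * lx * c + i) = u i" "w (2 * lx * c + i) = w i" for i by (simp_all add: u_def w_def)
  note ** = *[of u, OF this(1)] *[of w, OF this(2)]
  have v: "u i = d" "w i = 1" "u (lx + i) = 1" "w (lx + i) = d" if "i \<in> {..<lx}" for i
   using that by (simp_all add: u_def w_def)
  have "(\<Prod>i<lx. u i) = d ^ lx" "(\<Prod>i<lx. u (lx + i)) = 1" "(\<Prod>i<lx. w i) = 1" "(\<Prod>i<lx. w (lx + i)) = d ^ lx"
  proof -
   have "prod u {..<lx} = prod (\<lambda>_. d) {..<lx}" by (rule prod.cong[OF refl v(1)])
   thus "(\<Prod>i<lx. u i) = d ^ lx" by simp
   have "(\<Prod>i<lx. w (lx + i)) = prod (\<lambda>_. d) {..<lx}" by (rule prod.cong[OF refl v(4)])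
   thus "(\<Prod>i<lx. w (lx + i)) = d ^ lx" by simp
   show "(\<Prod>i<lx. u (lx + i)) = 1" by (rule prod.neutral) (intro ballI v(3))
   show "(\<Prod>i<lx. w i) = 1" by (rule prod.neutral) (intro ballI v(2))
  qed
  thus ?thesis unfolding ** by simp
 qed
 have dims: "bdim G e \<ge> 1" if e: "e \<in> edges G" for e
 proof -
  obtain k where k: "k < D" "e \<in> lattice_edges D L per k" using e unfolding E by blast
  hence "bdim G e = m k" by (rule bd)
  moreover have "m k \<ge> 1"
  proof (cases "k = 0")
   case True thus ?thesis using x(4) d(1) by simp
  next
   case False
   hence "m k \<ge> 2" using Lm k(1) by auto
   thus ?thesis by simp
  qed
  ultimately show ?thesis by simp
 qed
 have edge_form: "\<exists>v a. v \<in> lattice_sites D L \<and> e = {v, v[k := a]} \<and> a \<in> {1..L k} \<and>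
   ((v ! k < L k \<and> a = v ! k + 1) \<or> (v ! k = L k \<and> a = 1 \<and> L k \<ge> 3))"
  if k: "k < D" and e: "e \<in> lattice_edges D L per k" for k e
  using e unfolding lattice_edges_def
 proof (elim UnE CollectE exE conjE)
  fix v assume "e = {v, v[k := v ! k + 1]}" "v \<in> lattice_sites D L" "v ! k < L k"
  thus ?thesis by (intro exI[of _ v] exI[of _ "v ! k + 1"]) auto
 next
  fix v assume "e = {v, v[k := 1]}" "v \<in> lattice_sites D L" "v ! k = L k" "3 \<le> L k"
  thus ?thesis by (intro exI[of _ v] exI[of _ 1]) auto
 qed
 interpret ring_lines G R "replicate D 1" N "m 0" "2 * lx" "4 * lx" "6 * lx" loc u w
 proof unfold_locales
  show "graph_edges (verts G) (edges G)"
   unfolding graph_edges_def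
  proof (intro conjI ballI)
   show "finite (verts G)" by (simp add: V finS)
   fix e assume "e \<in> edges G"
   then obtain k where k: "k < D" "e \<in> lattice_edges D L per k" using E by blast
   then obtain v a where va0: "v \<in> lattice_sites D L" "e = {v, v[k := a]}" "a \<in> {1..L k}"
     "(v ! k < L k \<and> a = v ! k + 1) \<or> (v ! k = L k \<and> a = 1 \<and> L k \<ge> 3)"
    using edge_form by blast
   hence va: "v \<in> lattice_sites D L" "e = {v, v[k := a]}" "a \<in> {1..L k}" "a \<noteq> v ! k" by auto
   have "k < length v" using va(1) k(1) by (simp add: lattice_sites_def)
   hence "v[k := a] ! k = a" by (rule nth_list_update_eq)
   hence "v \<noteq> v[k := a]" using va(4) by auto
   thus "card e = 2" using va(2) by simp
   show "e \<subseteq> verts G" using va upd[OF va(1) k(1) va(3)] by (simp add: V)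
  qed
  show "finite R" using finS by (simp add: R_def)
  show "replicate D 1 \<in> R" using D L1 by (auto simp: R_def lattice_sites_def)
  show "bij_betw (\<lambda>p. loc (fst p) (snd p)) (R \<times> {..<N}) (verts G)"
  proof (rule bij_betw_byWitness[where f' = "\<lambda>v. (v[0 := 1], v ! 0 - 1)"])
   show "\<forall>p\<in>R \<times> {..<N}. ((loc (fst p) (snd p))[0 := 1], loc (fst p) (snd p) ! 0 - 1) = p"
   proof
    fix p assume "p \<in> R \<times> {..<N}"
    then obtain r i where ri: "p = (r, i)" "r \<in> R" by auto
    thus "((loc (fst p) (snd p))[0 := 1], loc (fst p) (snd p) ! 0 - 1) = p"
     using lenR[OF ri(2)] D r0id[OF ri(2)] by (simp add: loc_def)
   qed
   show "\<forall>v\<in>verts G. loc (fst (v[0 := 1], v ! 0 - 1)) (snd (v[0 := 1], v ! 0 - 1)) = v"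
    using site_split(3) by (simp add: V)
   show "(\<lambda>p. loc (fst p) (snd p)) ` (R \<times> {..<N}) \<subseteq> verts G" using locV by (auto simp: V)
   show "(\<lambda>v. (v[0 := 1], v ! 0 - 1)) ` verts G \<subseteq> R \<times> {..<N}"
    using site_split(1,2) by (auto simp: V)
  qed
  show "{loc r i, loc r (Suc i mod N)} \<in> edges G" if "r \<in> R" "i < N" for r i
   using le0[OF that] D by (auto simp: E)
  show "bdim G {loc r i, loc r (Suc i mod N)} = m 0" if "r \<in> R" "i < N" for r i
   using bd[OF _ le0[OF that]] D by simp
  show "(\<exists>r\<in>R. \<exists>i<N. e = {loc r i, loc r (Suc i mod N)}) \<or> (\<exists>i<N. \<exists>r\<in>R. \<exists>r'\<in>R. e = {loc r i, loc r' i})"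
   if e: "e \<in> edges G" for e
  proof -
   obtain k where k: "k < D" "e \<in> lattice_edges D L per k" using e E by blast
   then obtain v a where va: "v \<in> lattice_sites D L" "e = {v, v[k := a]}" "a \<in> {1..L k}"
     "(v ! k < L k \<and> a = v ! k + 1) \<or> (v ! k = L k \<and> a = 1 \<and> L k \<ge> 3)"
    using edge_form by blast
   let ?r = "v[0 := 1]" and ?i = "v ! 0 - 1"
   note b = site_split[OF va(1)]
   have v0: "v ! 0 \<ge> 1" "length v = D" using va(1) D by (auto simp: lattice_sites_def)
   show ?thesis
   proof (cases "k = 0")
    case True
    have "loc ?r (Suc ?i mod N) = v[k := a]"
    proof (cases "v ! 0 < L 0")
     case True
     thus ?thesis using va(4) v0 \<open>k = 0\<close> by (simp add: loc_def N_def)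
    next
     case False
     thus ?thesis using va(4) v0 \<open>k = 0\<close> by (auto simp: loc_def N_def)
    qed
    hence "e = {loc ?r ?i, loc ?r (Suc ?i mod N)}" using va(2) b(3) by simp
    thus ?thesis using b(1,2) by blast
   next
    case False
    have "?r[k := a] \<in> R" using b(1) upd[of ?r k a] k(1) va(3) False by (simp add: R_def)
    moreover have "loc (?r[k := a]) ?i = (loc ?r ?i)[k := a]"
     unfolding loc_def by (rule list_update_swap) (use False in simp)
    hence "loc (?r[k := a]) ?i = v[k := a]" by (simp only: b(3))
    ultimately show ?thesis using va(2) b by (intro disjI2) (metis)
   qed
  qed
  show "u i * w i \<le> sdim G (loc r i)" if "r \<in> R" "i < N" for r i
   using d(2) locV[OF that] by (simp add: u_def w_def V)
  show "1 \<le> u i" "1 \<le> w i" for i using d(1) by (simp_all add: u_def w_def)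
  show "2 \<le> m 0" using x(2,4) d(1) by (metis One_nat_def le_trans one_le_numeral power_increasing power_one_right)
  show "(\<Prod>i\<in>{0..<2 * lx}. u i) = m 0" "(\<Prod>i\<in>{0..<2 * lx}. w i) = m 0" using blk[of 0] x(4) by simp_all
  show "(\<Prod>i\<in>{2 * lx..<4 * lx}. u i) = m 0" "(\<Prod>i\<in>{2 * lx..<4 * lx}. w i) = m 0" using blk[of 1] x(4) by simp_all
  show "(\<Prod>i\<in>{4 * lx..<6 * lx}. u i) = m 0" "(\<Prod>i\<in>{4 * lx..<6 * lx}. w i) = m 0" using blk[of 2] x(4) by simp_all
 qed (use dims N6 x(2) in auto)
 show ?thesis by (rule PEPS_lacks_optimizers)
qed

section \<open>Existence for trees and MERA\<close>

text \<open>A loop described by edges alone, so that its absence is inherited by any smaller set of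
  edges.\<close>

definition has_cycle :: "'v set set \<Rightarrow> bool" where
 "has_cycle E \<longleftrightarrow> (\<exists>vs. length vs \<ge> 3 \<and> distinct vs \<and> (\<forall>k<length vs. {vs ! k, vs ! (Suc k mod length vs)} \<in> E))"

lemma has_cycle_mono: "E' \<subseteq> E \<Longrightarrow> has_cycle E' \<Longrightarrow> has_cycle E"
 unfolding has_cycle_def by blast

text \<open>Take an end \<open>v\<close> of a longest path. A neighbour off the path would extend
  it, and one beyond the next vertex of the path would close a cycle.\<close>

lemma leaf_exists:
 assumes g: "graph_edges V E" and ne: "V \<noteq> {}" and ac: "\<not> has_cycle E"
 shows "\<exists>v\<in>V. \<forall>e\<in>E. \<forall>e'\<in>E. v \<in> e \<longrightarrow> v \<in> e' \<longrightarrow> e = e'"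
proof -
 define path where "path p \<longleftrightarrow> p \<noteq> [] \<and> distinct p \<and> set p \<subseteq> V \<and> (\<forall>k. Suc k < length p \<longrightarrow> {p ! k, p ! Suc k} \<in> E)" for p
 have fV: "finite V" using g by (simp add: graph_edges_def)
 obtain v0 where "v0 \<in> V" using ne by blast
 hence "path [v0]" by (simp add: path_def)
 moreover have "\<forall>p. path p \<longrightarrow> length p < Suc (card V)"
 proof (intro allI impI)
  fix p assume "path p"
  hence "length p = card (set p)" "set p \<subseteq> V" by (simp_all add: path_def distinct_card)
  thus "length p < Suc (card V)" using card_mono[OF fV] by (simp add: less_Suc_eq_le)
 qed
 ultimately obtain p where p: "path p" "\<forall>q. path q \<longrightarrow> length q \<le> length p"
  using ex_has_greatest_nat[of path "[v0]" length "Suc (card V)"] by (meson less_imp_le)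
 obtain v q where vq: "p = v # q" using p(1) by (cases p) (auto simp: path_def)
 have nb: "\<exists>i. 1 \<le> i \<and> i < length p \<and> p ! i = a" if e: "{v, a} \<in> E" "a \<noteq> v" for a
 proof -
  have "a \<in> set p"
  proof (rule ccontr)
   assume "a \<notin> set p"
   moreover have "a \<in> V" using g e(1) by (auto simp: graph_edges_def)
   moreover have "{(a # p) ! k, (a # p) ! Suc k} \<in> E" if "Suc k < length (a # p)" for k
    using that e(1) p(1) by (cases k) (auto simp: path_def vq insert_commute)
   ultimately have "path (a # p)" using p(1) by (simp add: path_def)
   thus False using p(2) by fastforce
  qed
  then obtain i where i: "i < length p" "p ! i = a" by (auto simp: in_set_conv_nth)
  have "i \<noteq> 0"
  proof
   assume "i = 0"
   thus False using i(2) e(2) by (simp add: vq)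
  qed
  hence "1 \<le> i" by simp
  thus ?thesis using i by blast
 qed
 have cyc: False if j: "2 \<le> j" "j < length p" "{v, p ! j} \<in> E" for j
 proof -
  let ?c = "take (Suc j) p"
  have len: "length ?c = Suc j" using j by simp
  have "{?c ! k, ?c ! (Suc k mod length ?c)} \<in> E" if "k < length ?c" for k
  proof (cases "k = j")
   case True
   thus ?thesis using j len vq by (simp add: insert_commute)
  next
   case False
   hence "k < j" using that len by simp
   thus ?thesis using p(1) j len by (simp add: path_def)
  qed
  moreover have "distinct ?c" using p(1) by (simp add: path_def)
  ultimately have "has_cycle E" unfolding has_cycle_def using len j(1) by (intro exI[of _ ?c]) simp
  thus False using ac by blast
 qed
 have other: "\<exists>a. e = {v, a} \<and> a \<noteq> v" if "e \<in> E" "v \<in> e" for e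
 proof -
  obtain x y where "e = {x, y}" "x \<noteq> y" using edge_two[OF g \<open>e \<in> E\<close>] by blast
  thus ?thesis using \<open>v \<in> e\<close> by (cases "v = x") auto
 qed
 have "e = e'" if ee: "e \<in> E" "e' \<in> E" "v \<in> e" "v \<in> e'" for e e'
 proof -
  obtain a where a: "e = {v, a}" "a \<noteq> v" using other[OF ee(1,3)] by blast
  obtain b where b: "e' = {v, b}" "b \<noteq> v" using other[OF ee(2,4)] by blast
  obtain i where i: "1 \<le> i" "i < length p" "p ! i = a" using nb[of a] a ee by blast
  obtain j where j: "1 \<le> j" "j < length p" "p ! j = b" using nb[of b] b ee by blast
  have "i < 2" using cyc[of i] i a ee by (meson not_le)
  moreover have "j < 2" using cyc[of j] j b ee by (meson not_le)
  ultimately have "i = j" using i j by simp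
  thus ?thesis using i j a b by simp
 qed
 moreover have "v \<in> V" using p(1) vq by (simp add: path_def)
 ultimately show ?thesis by blast
qed

text \<open>Having rank at most \<open>m\<close> is a closed condition, and rows can be chosen as the factors.\<close>

lemma limit_dependent:
 fixes r :: "nat \<Rightarrow> 's \<Rightarrow> 't \<Rightarrow> complex"
 assumes B: "finite B" "card B = Suc m"
  and r: "\<And>k s t. s \<in> B \<Longrightarrow> t \<in> T \<Longrightarrow> r k s t = (\<Sum>n\<in>{1..m}. a k s n * R k n t)"
  and lim: "\<And>s t. s \<in> B \<Longrightarrow> t \<in> T \<Longrightarrow> (\<lambda>k. r k s t) \<longlonglongrightarrow> r' s t"
 shows "\<exists>f. (\<exists>s\<in>B. f s \<noteq> 0) \<and> (\<forall>t\<in>T. (\<Sum>s\<in>B. f s * r' s t) = 0)"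
proof -
 \<comment> \<open>Any \<open>m + 1\<close> rows of a product with inner dimension \<open>m\<close>
   are dependent. Normalizing the coefficients prevents them from all tending to 0 along the
   subsequence chosen below.\<close>
 have "\<exists>g. (\<Sum>s\<in>B. cmod (g s)) = 1 \<and> (\<forall>n\<in>{1..m}. (\<Sum>s\<in>B. g s * a k s n) = 0)" for k
 proof -
  obtain f where f: "\<exists>s\<in>B. f s \<noteq> 0" "\<forall>n\<in>{1..m}. (\<Sum>s\<in>B. f s * a k s n) = 0"
   using underdetermined[of "{1..m}" B "a k"] B by auto
  define c where "c = (\<Sum>s\<in>B. cmod (f s))"
  have "c \<noteq> 0" using f(1) B(1) by (simp add: c_def sum_nonneg_eq_0_iff)
  have "c > 0" using \<open>c \<noteq> 0\<close> by (simp add: c_def order_less_le sum_nonneg)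
  have "cmod (f s / of_real c) = cmod (f s) / c" for s using \<open>c > 0\<close> by (simp add: norm_divide)
  hence "(\<Sum>s\<in>B. cmod (f s / of_real c)) = (\<Sum>s\<in>B. cmod (f s)) / c"
   by (simp only: sum_divide_distrib)
  also have "\<dots> = 1" unfolding c_def[symmetric] using \<open>c \<noteq> 0\<close> by simp
  finally have "(\<Sum>s\<in>B. cmod (f s / of_real c)) = 1" .
  moreover have "(\<Sum>s\<in>B. f s / of_real c * a k s n) = 0" if "n \<in> {1..m}" for n
  proof -
   have "(\<Sum>s\<in>B. f s / of_real c * a k s n) = (\<Sum>s\<in>B. f s * a k s n) / of_real c" by (simp add: sum_divide_distrib)
   thus ?thesis using f(2) that by simp
  qed
  ultimately show ?thesis by (intro exI[of _ "\<lambda>s. f s / of_real c"]) blast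
 qed
 then obtain g where g: "\<And>k. (\<Sum>s\<in>B. cmod (g k s)) = 1" "\<And>k n. n \<in> {1..m} \<Longrightarrow> (\<Sum>s\<in>B. g k s * a k s n) = 0" by metis
 have "cmod (g k s) \<le> 1" if "s \<in> B" for k s
  using member_le_sum[of s B "\<lambda>s. cmod (g k s)"] that B(1) g(1)[of k] by simp
 then obtain \<phi> h where \<phi>: "strict_mono (\<phi> :: nat \<Rightarrow> nat)" "\<forall>s\<in>B. (\<lambda>k. g (\<phi> k) s) \<longlonglongrightarrow> h s"
  using pointwise_convergent_subseq[OF B(1), of g "\<lambda>_. 1"] by blast
 have "(\<lambda>k. \<Sum>s\<in>B. cmod (g (\<phi> k) s)) \<longlonglongrightarrow> (\<Sum>s\<in>B. cmod (h s))" using \<phi>(2) by (intro tendsto_intros) blast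
 hence "(\<Sum>s\<in>B. cmod (h s)) = 1" by (simp add: g(1) LIMSEQ_const_iff)
 hence 1: "\<exists>s\<in>B. h s \<noteq> 0" by (rule contrapos_pp) simp
 have "(\<Sum>s\<in>B. h s * r' s t) = 0" if t: "t \<in> T" for t
 proof -
  have z: "(\<Sum>s\<in>B. g k s * r k s t) = 0" for k
  proof -
   have "(\<Sum>s\<in>B. g k s * r k s t) = (\<Sum>s\<in>B. \<Sum>n\<in>{1..m}. (g k s * a k s n) * R k n t)"
    by (intro sum.cong refl) (simp add: r t sum_distrib_left mult.assoc)
   also have "\<dots> = (\<Sum>n\<in>{1..m}. (\<Sum>s\<in>B. g k s * a k s n) * R k n t)"
    by (subst sum.swap) (simp only: sum_distrib_right)
   finally show ?thesis by (simp add: g(2))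
  qed
  have "(\<lambda>k. r (\<phi> k) s t) \<longlonglongrightarrow> r' s t" if "s \<in> B" for s
   using LIMSEQ_subseq_LIMSEQ[OF lim[OF that t] \<phi>(1)] by (simp add: o_def)
  hence "(\<lambda>k. \<Sum>s\<in>B. g (\<phi> k) s * r (\<phi> k) s t) \<longlonglongrightarrow> (\<Sum>s\<in>B. h s * r' s t)"
   using \<phi>(2) by (intro tendsto_sum tendsto_mult) blast+
  thus ?thesis unfolding z by (simp add: LIMSEQ_const_iff)
 qed
 thus ?thesis using 1 by blast
qed

text \<open>A maximal independent set of rows of the limit has at most \<open>m\<close> members and
  spans all rows. The factors \<open>a k\<close> and \<open>R k\<close> need not converge; taking
  actual rows of the limit as the second factor makes it a limit of states of the smaller network
  again.\<close>

lemma row_selection_limit: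
 fixes r :: "nat \<Rightarrow> 's \<Rightarrow> 't \<Rightarrow> complex"
 assumes S: "finite S" "S \<noteq> {}"
  and r: "\<And>k s t. s \<in> S \<Longrightarrow> t \<in> T \<Longrightarrow> r k s t = (\<Sum>n\<in>{1..m}. a k s n * R k n t)"
  and lim: "\<And>s t. s \<in> S \<Longrightarrow> t \<in> T \<Longrightarrow> (\<lambda>k. r k s t) \<longlonglongrightarrow> r' s t"
 shows "\<exists>sel L. (\<forall>n. sel n \<in> S) \<and> (\<forall>s\<in>S. \<forall>t\<in>T. r' s t = (\<Sum>n\<in>{1..m::nat}. L s n * r' (sel n) t))"
proof -
 define good where "good B \<longleftrightarrow> B \<subseteq> S \<and> indep B T r'" for B
 have "good {}" by (simp add: good_def indep_def)
 moreover have "\<forall>B. good B \<longrightarrow> card B < Suc (card S)"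
  using S(1) by (auto simp: good_def less_Suc_eq_le card_mono)
 ultimately obtain B where B: "good B" "\<forall>C. good C \<longrightarrow> card C \<le> card B"
  using ex_has_greatest_nat[of good "{}" card "Suc (card S)"] by (meson less_imp_le)
 have BS: "B \<subseteq> S" "indep B T r'" using B(1) by (auto simp: good_def)
 have fB: "finite B" using BS(1) S(1) by (rule finite_subset)
 have cB: "card B \<le> m"
 proof (rule ccontr)
  assume "\<not> card B \<le> m"
  hence "Suc m \<le> card B" by simp
  then obtain C where C: "C \<subseteq> B" "card C = Suc m" by (rule obtain_subset_with_card_n)
  have fC: "finite C" using C(1) fB by (rule finite_subset)
  have "\<exists>f. (\<exists>s\<in>C. f s \<noteq> 0) \<and> (\<forall>t\<in>T. (\<Sum>s\<in>C. f s * r' s t) = 0)"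
  proof (rule limit_dependent[OF fC C(2), where r = r and a = a and R = R])
   show "r k s t = (\<Sum>n\<in>{1..m}. a k s n * R k n t)" if "s \<in> C" "t \<in> T" for k s t
    using r[OF _ that(2)] C(1) BS(1) that(1) by blast
   show "(\<lambda>k. r k s t) \<longlonglongrightarrow> r' s t" if "s \<in> C" "t \<in> T" for s t
    using lim[OF _ that(2)] C(1) BS(1) that(1) by blast
  qed
  thus False using indep_subset[OF BS(2) C(1) fB] unfolding indep_def by blast
 qed
 have "\<exists>l. \<forall>t\<in>T. r' s t = (\<Sum>b\<in>B. l b * r' b t)" if s: "s \<in> S" for s
 proof (cases "s \<in> B")
  case True
  have "(\<Sum>b\<in>B. (if b = s then 1 else 0) * r' b t) = r' s t" for t
  proof -
   have "(\<Sum>b\<in>B. (if b = s then 1 else 0) * r' b t) = (\<Sum>b\<in>B. if b = s then r' b t else 0)"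
    by (rule sum.cong) auto
   thus ?thesis using True fB by simp
  qed
  thus ?thesis by (intro exI[of _ "\<lambda>b. if b = s then 1 else 0"]) simp
 next
  case False
  hence "card (insert s B) > card B" using fB by simp
  hence "\<not> good (insert s B)" using B(2) by (meson not_le)
  hence "\<not> indep (insert s B) T r'" using s BS(1) by (simp add: good_def)
  then obtain f where f: "\<forall>t\<in>T. (\<Sum>b\<in>insert s B. f b * r' b t) = 0" "\<not> (\<forall>b\<in>insert s B. f b = 0)"
   unfolding indep_def by blast
  hence f0: "\<forall>t\<in>T. f s * r' s t + (\<Sum>b\<in>B. f b * r' b t) = 0" using False fB by simp
  have fs: "f s \<noteq> 0"
  proof
   assume z: "f s = 0"
   hence "\<forall>t\<in>T. (\<Sum>b\<in>B. f b * r' b t) = 0" using f0 by simp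
   hence "\<forall>b\<in>B. f b = 0" using BS(2) unfolding indep_def by blast
   thus False using f(2) z by blast
  qed
  have "r' s t = (\<Sum>b\<in>B. (- f b / f s) * r' b t)" if "t \<in> T" for t
  proof -
   have "(\<Sum>b\<in>B. (- f b / f s) * r' b t) = - (\<Sum>b\<in>B. f b * r' b t) / f s"
    by (simp add: sum_divide_distrib sum_negf)
   moreover have "(\<Sum>b\<in>B. f b * r' b t) = - (f s * r' s t)"
    using f0 that by (simp add: add_eq_0_iff)
   ultimately show ?thesis using fs by simp
  qed
  thus ?thesis by (intro exI[of _ "\<lambda>b. - f b / f s"]) blast
 qed
 then obtain l where l: "\<And>s t. s \<in> S \<Longrightarrow> t \<in> T \<Longrightarrow> r' s t = (\<Sum>b\<in>B. l s b * r' b t)" by metis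
 obtain h where h: "bij_betw h {1..card B} B" using ex_bij_betw_nat_finite_1[OF fB] by blast
 obtain s0 where s0: "s0 \<in> S" using S(2) by blast
 \<comment> \<open>Surplus indices up to \<open>m\<close> point to some row \<open>s0\<close> and
   get coefficient 0.\<close>
 define sel where "sel n = (if n \<in> {1..card B} then h n else s0)" for n
 define L where "L s n = (if n \<in> {1..card B} then l s (h n) else 0)" for s n
 have "sel n \<in> S" for n using h s0 BS(1) unfolding sel_def bij_betw_def by auto
 moreover have "r' s t = (\<Sum>n\<in>{1..m}. L s n * r' (sel n) t)" if "s \<in> S" "t \<in> T" for s t
 proof -
  have "r' s t = (\<Sum>n\<in>{1..card B}. l s (h n) * r' (h n) t)"
   unfolding l[OF that] by (rule sum.reindex_bij_betw[OF h, symmetric])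
  also have "\<dots> = (\<Sum>n\<in>{1..m}. L s n * r' (sel n) t)"
   by (rule sum.mono_neutral_cong_left) (use cB in \<open>auto simp: L_def sel_def\<close>)
  finally show ?thesis .
 qed
 ultimately show ?thesis by blast
qed

text \<open>The contraction with vertices and edges as arguments, so that it can be applied after a
  leaf has been removed; site indices may range over any set.\<close>

definition gpeps :: "'v set \<Rightarrow> 'v set set \<Rightarrow> ('v set \<Rightarrow> nat) \<Rightarrow> ('v \<Rightarrow> nat \<Rightarrow> ('v set \<Rightarrow> nat) \<Rightarrow> complex) \<Rightarrow> ('v \<Rightarrow> nat) \<Rightarrow> complex" where
 "gpeps V E b A \<sigma> = (\<Sum>n\<in>PiE E (\<lambda>e. {1..b e}). \<Prod>i\<in>V. A i (\<sigma> i) (restrict n {e\<in>E. i \<in> e}))"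

lemma gpeps_cong:
 assumes "\<And>i n. i \<in> V \<Longrightarrow> A i (\<sigma> i) n = A' i (\<sigma>' i) n"
 shows "gpeps V E b A \<sigma> = gpeps V E b A' \<sigma>'"
 unfolding gpeps_def by (intro sum.cong prod.cong refl assms)

lemma gpeps_isolated:
 assumes "finite V" "v \<notin> V" "\<And>e. e \<in> E \<Longrightarrow> v \<notin> e"
 shows "gpeps (insert v V) E b A \<sigma> = A v (\<sigma> v) (\<lambda>_. undefined) * gpeps V E b A \<sigma>"
proof -
 have "{e\<in>E. v \<in> e} = {}" using assms(3) by blast
 moreover have "restrict n {} = (\<lambda>_. undefined)" for n :: "'a set \<Rightarrow> nat" by (simp add: restrict_def)
 ultimately show ?thesis unfolding gpeps_def prod.insert[OF assms(1,2)] sum_distrib_left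
  by (simp only:)
qed

text \<open>Cutting off the leaf turns its bond index \<open>x\<close> into a parameter of the
  tensor at its neighbour \<open>u\<close>; all other tensors keep their arguments.\<close>

lemma gpeps_leaf:
 assumes V: "finite V" "v \<notin> V" "u \<in> V" and E: "{v, u} \<notin> E" "\<And>e. e \<in> E \<Longrightarrow> v \<notin> e"
 shows "gpeps (insert v V) (insert {v, u} E) b A \<sigma> =
  (\<Sum>x\<in>{1..b {v, u}}. A v (\<sigma> v) (\<lambda>f\<in>{{v, u}}. x) *
   gpeps V E b (\<lambda>i s n. A i s (if i = u then (\<lambda>f\<in>insert {v, u} {f\<in>E. u \<in> f}. if f = {v, u} then x else n f) else n)) \<sigma>)"
proof -
 let ?e = "{v, u}"
 let ?r = "\<lambda>n x i. if i = u then (\<lambda>f\<in>insert ?e {f\<in>E. u \<in> f}. if f = ?e then x else restrict n {e\<in>E. i \<in> e} f) else restrict n {e\<in>E. i \<in> e}"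
 have "gpeps (insert v V) (insert ?e E) b A \<sigma> = (\<Sum>x\<in>{1..b ?e}. \<Sum>n\<in>PiE E (\<lambda>e. {1..b e}).
   \<Prod>i\<in>insert v V. A i (\<sigma> i) (restrict (n(?e := x)) {e\<in>insert ?e E. i \<in> e}))"
  unfolding gpeps_def by (rule sum_PiE_insert[OF E(1)])
 also have "\<dots> = (\<Sum>x\<in>{1..b ?e}. \<Sum>n\<in>PiE E (\<lambda>e. {1..b e}). A v (\<sigma> v) (\<lambda>f\<in>{?e}. x) *
   (\<Prod>i\<in>V. A i (\<sigma> i) (?r n x i)))"
 proof (intro sum.cong refl)
  fix x :: nat and n :: "'a set \<Rightarrow> nat"
  have iv: "{e\<in>insert ?e E. v \<in> e} = {?e}" using E(2) by blast
  have "restrict (n(?e := x)) {?e} = (\<lambda>f\<in>{?e}. x)" by (auto simp: restrict_def)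
  hence 1: "A v (\<sigma> v) (restrict (n(?e := x)) {e\<in>insert ?e E. v \<in> e}) = A v (\<sigma> v) (\<lambda>f\<in>{?e}. x)" unfolding iv by (simp only:)
  have 2: "restrict (n(?e := x)) {e\<in>insert ?e E. i \<in> e} =
    ?r n x i"
   if "i \<in> V" for i
  proof -
   have "i \<noteq> v" using that V(2) by blast
   show ?thesis
   proof (cases "i = u")
    case True
    thus ?thesis by (auto simp: fun_eq_iff restrict_def)
   next
    case False
    hence "{e\<in>insert ?e E. i \<in> e} = {e\<in>E. i \<in> e}" using \<open>i \<noteq> v\<close> by auto
    thus ?thesis using False E(1) by (auto simp: fun_eq_iff restrict_def)
   qed
  qed
  have "(\<Prod>i\<in>insert v V. A i (\<sigma> i) (restrict (n(?e := x)) {e\<in>insert ?e E. i \<in> e})) =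
   A v (\<sigma> v) (restrict (n(?e := x)) {e\<in>insert ?e E. v \<in> e}) * (\<Prod>i\<in>V. A i (\<sigma> i) (restrict (n(?e := x)) {e\<in>insert ?e E. i \<in> e}))"
   by (rule prod.insert[OF V(1,2)])
  also have "(\<Prod>i\<in>V. A i (\<sigma> i) (restrict (n(?e := x)) {e\<in>insert ?e E. i \<in> e})) =
   (\<Prod>i\<in>V. A i (\<sigma> i) (?r n x i))"
   by (rule prod.cong[OF refl]) (simp only: 2)
  finally show "(\<Prod>i\<in>insert v V. A i (\<sigma> i) (restrict (n(?e := x)) {e\<in>insert ?e E. i \<in> e})) =
   A v (\<sigma> v) (\<lambda>f\<in>{?e}. x) * (\<Prod>i\<in>V. A i (\<sigma> i) (?r n x i))"
   unfolding 1 .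
 qed
 finally show ?thesis unfolding gpeps_def by (simp only: sum_distrib_left)
qed

text \<open>Linearity of the contraction in the tensor at \<open>u\<close>. It turns the sum over
  the bond to a removed leaf into a single tensor at \<open>u\<close>.\<close>

lemma gpeps_site_linear:
 assumes V: "finite V" "u \<in> V" and X: "\<And>n. A u (\<sigma> u) n = (\<Sum>x\<in>X. w x * B x u (\<sigma> u) n)"
  and o: "\<And>i x n. i \<in> V \<Longrightarrow> i \<noteq> u \<Longrightarrow> A i (\<sigma> i) n = B x i (\<sigma> i) n"
 shows "gpeps V E b A \<sigma> = (\<Sum>x\<in>X. w x * gpeps V E b (B x) \<sigma>)"
proof -
 have rm: "(\<Prod>i\<in>V. t i) = t u * (\<Prod>i\<in>V - {u}. t i)" for t :: "'a \<Rightarrow> complex"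
  by (rule prod.remove[OF V])
 have "(\<Sum>x\<in>X. w x * gpeps V E b (B x) \<sigma>) = (\<Sum>x\<in>X. \<Sum>n\<in>PiE E (\<lambda>e. {1..b e}).
   (w x * B x u (\<sigma> u) (restrict n {e\<in>E. u \<in> e})) * (\<Prod>i\<in>V - {u}. A i (\<sigma> i) (restrict n {e\<in>E. i \<in> e})))"
  unfolding gpeps_def rm sum_distrib_left
 proof (intro sum.cong refl)
  fix x n
  have "(\<Prod>i\<in>V - {u}. B x i (\<sigma> i) (restrict n {e\<in>E. i \<in> e})) = (\<Prod>i\<in>V - {u}. A i (\<sigma> i) (restrict n {e\<in>E. i \<in> e}))"
   by (rule prod.cong[OF refl], rule o[symmetric]) auto
  thus "w x * (B x u (\<sigma> u) (restrict n {e\<in>E. u \<in> e}) * (\<Prod>i\<in>V - {u}. B x i (\<sigma> i) (restrict n {e\<in>E. i \<in> e}))) =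
   w x * B x u (\<sigma> u) (restrict n {e\<in>E. u \<in> e}) * (\<Prod>i\<in>V - {u}. A i (\<sigma> i) (restrict n {e\<in>E. i \<in> e}))"
   by (simp only: mult.assoc)
 qed
 also have "\<dots> = gpeps V E b A \<sigma>"
  unfolding gpeps_def rm X by (subst sum.swap) (simp only: sum_distrib_right)
 finally show ?thesis by simp
qed

text \<open>The rows selected at a leaf form a family of limits indexed by its bond. To make them
  one state of the smaller forest, the bond index is packed with the physical index of the neighbour
  by \<open>prod_encode\<close>, which is why the index ranges \<open>S v\<close> are arbitrary
  finite sets. The scalar \<open>c k\<close> keeps the empty forest and isolated vertices within the
  induction, where no remaining tensor has to absorb a factor.\<close>

theorem forest_closed:
 fixes V :: "'v set" and \<Psi> :: "nat \<Rightarrow> ('v \<Rightarrow> nat) \<Rightarrow> complex"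
 assumes "graph_edges V E" "\<not> has_cycle E" "\<And>v. v \<in> V \<Longrightarrow> finite (S v)"
  and "\<And>k \<sigma>. \<sigma> \<in> PiE V S \<Longrightarrow> \<Psi> k \<sigma> = c k * gpeps V E b (A k) \<sigma>"
  and "\<And>\<sigma>. \<sigma> \<in> PiE V S \<Longrightarrow> (\<lambda>k. \<Psi> k \<sigma>) \<longlonglongrightarrow> \<Psi>' \<sigma>"
 shows "\<exists>c A. \<forall>\<sigma>\<in>PiE V S. \<Psi>' \<sigma> = c * gpeps V E b A \<sigma>"
 using assms
proof (induction "card V" arbitrary: V E S \<Psi> c A \<Psi>')
 case 0
 hence V: "V = {}" by (auto simp: graph_edges_def)
 hence "E = {}" using 0(2) by (auto simp: graph_edges_def)
 thus ?case using V by (intro exI[of _ "\<Psi>' (\<lambda>_. undefined)"]) (simp add: gpeps_def)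
next
 case (Suc N)
 note g = Suc.prems(1) and ac = Suc.prems(2) and fS = Suc.prems(3) and eq = Suc.prems(4) and lim = Suc.prems(5)
 have fV: "finite V" using g by (simp add: graph_edges_def)
 have "V \<noteq> {}" using Suc.hyps(2) by auto
 then obtain v where v: "v \<in> V" "\<And>e e'. e \<in> E \<Longrightarrow> e' \<in> E \<Longrightarrow> v \<in> e \<Longrightarrow> v \<in> e' \<Longrightarrow> e = e'"
  using leaf_exists[OF g _ ac] by blast
 define V' where "V' = V - {v}"
 have V': "V = insert v V'" "v \<notin> V'" "finite V'" "N = card V'" using v(1) fV Suc.hyps(2) by (auto simp: V'_def)
 show ?case
 proof (cases "PiE V S = {}")
  case True thus ?thesis by simp
 next
  case False
  hence Sv: "finite (S v)" "S v \<noteq> {}" using v(1) fS by (auto simp: PiE_eq_empty_iff)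
  have upd: "\<tau>(v := s) \<in> PiE V S" if "\<tau> \<in> PiE V' S" "s \<in> S v" for \<tau> s
   using that unfolding V'(1) by (auto simp: PiE_iff extensional_def)
  have split: "\<exists>\<tau>\<in>PiE V' S. \<exists>s\<in>S v. \<sigma> = \<tau>(v := s)" if "\<sigma> \<in> PiE V S" for \<sigma>
  proof (intro bexI)
   show "\<sigma> = (restrict \<sigma> V')(v := \<sigma> v)" using that unfolding V'(1) by (auto simp: fun_eq_iff PiE_iff extensional_def restrict_def)
   show "\<sigma> v \<in> S v" "restrict \<sigma> V' \<in> PiE V' S" using that v(1) V'(1) by auto
  qed
  have eqv: "gpeps V' E'' b A'' (\<tau>(v := s)) = gpeps V' E'' b A'' \<tau>" for E'' A'' \<tau> s
   by (rule gpeps_cong) (use V'(2) in auto)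
  show ?thesis
  proof (cases "\<exists>e\<in>E. v \<in> e")
   case False
   hence iso: "\<And>e. e \<in> E \<Longrightarrow> v \<notin> e" by blast
   let ?u = "\<lambda>_. undefined"
   have dec: "gpeps V E b A'' (\<tau>(v := s)) = A'' v s ?u * gpeps V' E b A'' \<tau>" for A'' \<tau> s
   proof -
    have "gpeps (insert v V') E b A'' (\<tau>(v := s)) = A'' v ((\<tau>(v := s)) v) ?u * gpeps V' E b A'' (\<tau>(v := s))"
     by (rule gpeps_isolated[OF V'(3,2) iso])
    thus ?thesis by (simp only: V'(1)[symmetric] eqv fun_upd_same)
   qed
   have gV': "graph_edges V' E" using g iso unfolding graph_edges_def V'_def by blast
   have "\<exists>sel L. (\<forall>n. sel n \<in> S v) \<and> (\<forall>s\<in>S v. \<forall>t\<in>PiE V' S. \<Psi>' (t(v := s)) = (\<Sum>n\<in>{1..1::nat}. L s n * \<Psi>' (t(v := sel n))))"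
   proof (rule row_selection_limit[OF Sv, where r = "\<lambda>k s \<tau>. \<Psi> k (\<tau>(v := s))" and a = "\<lambda>k s n. A k v s ?u" and R = "\<lambda>k n \<tau>. c k * gpeps V' E b (A k) \<tau>"])
    show "\<Psi> k (t(v := s)) = (\<Sum>n\<in>{1..1::nat}. A k v s ?u * (c k * gpeps V' E b (A k) t))" if "s \<in> S v" "t \<in> PiE V' S" for k s t
     using eq[OF upd[OF that(2,1)]] by (simp add: dec)
    show "(\<lambda>k. \<Psi> k (t(v := s))) \<longlonglongrightarrow> \<Psi>' (t(v := s))" if "s \<in> S v" "t \<in> PiE V' S" for s t
     using lim[OF upd[OF that(2,1)]] .
   qed
   then obtain sel L where sel: "\<And>n. sel n \<in> S v" "\<And>s t. s \<in> S v \<Longrightarrow> t \<in> PiE V' S \<Longrightarrow> \<Psi>' (t(v := s)) = (\<Sum>n\<in>{1..1::nat}. L s n * \<Psi>' (t(v := sel n)))"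
    by blast
   have "\<exists>c' A'. \<forall>\<tau>\<in>PiE V' S. \<Psi>' (\<tau>(v := sel 1)) = c' * gpeps V' E b A' \<tau>"
   proof (rule Suc.hyps(1)[OF V'(4) gV' ac, where \<Psi> = "\<lambda>k \<tau>. \<Psi> k (\<tau>(v := sel 1))" and c = "\<lambda>k. c k * A k v (sel 1) ?u" and A = A])
    show "finite (S i)" if "i \<in> V'" for i using fS that V'(1) by blast
    show "\<Psi> k (\<tau>(v := sel 1)) = c k * A k v (sel 1) ?u * gpeps V' E b (A k) \<tau>" if "\<tau> \<in> PiE V' S" for k \<tau>
     using eq[OF upd[OF that sel(1)]] by (simp add: dec)
    show "(\<lambda>k. \<Psi> k (\<tau>(v := sel 1))) \<longlonglongrightarrow> \<Psi>' (\<tau>(v := sel 1))" if "\<tau> \<in> PiE V' S" for \<tau>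
     using lim[OF upd[OF that sel(1)]] .
   qed
   then obtain c' A' where A': "\<And>\<tau>. \<tau> \<in> PiE V' S \<Longrightarrow> \<Psi>' (\<tau>(v := sel 1)) = c' * gpeps V' E b A' \<tau>" by blast
   define A'' where "A'' = A'(v := \<lambda>s n. L s 1)"
   have "\<Psi>' \<sigma> = c' * gpeps V E b A'' \<sigma>" if \<sigma>: "\<sigma> \<in> PiE V S" for \<sigma>
   proof -
    obtain \<tau> s where ts: "\<tau> \<in> PiE V' S" "s \<in> S v" "\<sigma> = \<tau>(v := s)" using split[OF \<sigma>] by blast
    have "gpeps V' E b A'' \<tau> = gpeps V' E b A' \<tau>" by (rule gpeps_cong) (use V'(2) in \<open>auto simp: A''_def\<close>)
    hence "gpeps V E b A'' \<sigma> = L s 1 * gpeps V' E b A' \<tau>" unfolding ts(3) dec by (simp add: A''_def)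
    moreover have "\<Psi>' \<sigma> = L s 1 * (c' * gpeps V' E b A' \<tau>)" using sel(2)[OF ts(2,1)] A'[OF ts(1)] ts(3) by simp
    ultimately show ?thesis by simp
   qed
   thus ?thesis by blast
  next
   case True
   then obtain e where e: "e \<in> E" "v \<in> e" by blast
   obtain u where u: "e = {v, u}" "u \<noteq> v"
   proof -
    obtain x y where "e = {x, y}" "x \<noteq> y" using edge_two[OF g e(1)] by blast
    thus ?thesis using e(2) that[of y] that[of x] by (auto simp: insert_commute)
   qed
   have uV: "u \<in> V'" using g e(1) u by (auto simp: graph_edges_def V'_def)
   define E' where "E' = E - {e}"
   have E': "E = insert {v, u} E'" "{v, u} \<notin> E'" using e(1) u(1) by (auto simp: E'_def)
   have nv: "v \<notin> f" if "f \<in> E'" for f using v(2)[OF e(1), of f] e(2) that by (auto simp: E'_def)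
   have gV': "graph_edges V' E'" using g nv unfolding graph_edges_def V'_def E'_def by blast
   have ac': "\<not> has_cycle E'" using ac has_cycle_mono[of E' E] by (auto simp: E'_def)
   define m where "m = b {v, u}"
   define inj where "inj x n = (\<lambda>f\<in>insert {v, u} {f\<in>E'. u \<in> f}. if f = {v, u} then x else n f)" for x and n :: "'v set \<Rightarrow> nat"
   define AT where "AT A'' x = (\<lambda>i s n. A'' i s (if i = u then inj x n else n))" for A'' :: "'v \<Rightarrow> nat \<Rightarrow> ('v set \<Rightarrow> nat) \<Rightarrow> complex" and x
   have dec: "gpeps V E b A'' (\<tau>(v := s)) = (\<Sum>x\<in>{1..m}. A'' v s (\<lambda>f\<in>{{v, u}}. x) * gpeps V' E' b (AT A'' x) \<tau>)" for A'' \<tau> s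
   proof -
    have "gpeps (insert v V') (insert {v, u} E') b A'' (\<tau>(v := s)) = (\<Sum>x\<in>{1..m}. A'' v ((\<tau>(v := s)) v) (\<lambda>f\<in>{{v, u}}. x) * gpeps V' E' b (AT A'' x) (\<tau>(v := s)))"
     unfolding m_def AT_def inj_def by (rule gpeps_leaf[OF V'(3,2) uV E'(2) nv])
    thus ?thesis by (simp only: V'(1)[symmetric] E'(1)[symmetric] eqv fun_upd_same)
   qed
   have "\<exists>sel L. (\<forall>n. sel n \<in> S v) \<and> (\<forall>s\<in>S v. \<forall>t\<in>PiE V' S. \<Psi>' (t(v := s)) = (\<Sum>n\<in>{1..m}. L s n * \<Psi>' (t(v := sel n))))"
   proof (rule row_selection_limit[OF Sv, where r = "\<lambda>k s \<tau>. \<Psi> k (\<tau>(v := s))" and a = "\<lambda>k s x. A k v s (\<lambda>f\<in>{{v, u}}. x)" and R = "\<lambda>k x \<tau>. c k * gpeps V' E' b (AT (A k) x) \<tau>"])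
    show "\<Psi> k (t(v := s)) = (\<Sum>x\<in>{1..m}. A k v s (\<lambda>f\<in>{{v, u}}. x) * (c k * gpeps V' E' b (AT (A k) x) t))" if "s \<in> S v" "t \<in> PiE V' S" for k s t
     using eq[OF upd[OF that(2,1)]] by (simp add: dec sum_distrib_left mult_ac)
    show "(\<lambda>k. \<Psi> k (t(v := s))) \<longlonglongrightarrow> \<Psi>' (t(v := s))" if "s \<in> S v" "t \<in> PiE V' S" for s t
     using lim[OF upd[OF that(2,1)]] .
   qed
   then obtain sel L where sel: "\<And>n. sel n \<in> S v" "\<And>s t. s \<in> S v \<Longrightarrow> t \<in> PiE V' S \<Longrightarrow> \<Psi>' (t(v := s)) = (\<Sum>n\<in>{1..m}. L s n * \<Psi>' (t(v := sel n)))"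
    by blast
   define px where "px \<rho> = fst (prod_decode (\<rho> u))" for \<rho> :: "'v \<Rightarrow> nat"
   define ps where "ps \<rho> = \<rho>(u := snd (prod_decode (\<rho> u)))" for \<rho> :: "'v \<Rightarrow> nat"
   define S2 where "S2 = S(u := prod_encode ` ({1..m} \<times> S u))"
   have ps: "ps \<rho> \<in> PiE V' S" if \<rho>: "\<rho> \<in> PiE V' S2" for \<rho>
   proof (rule PiE_I)
    fix i assume i: "i \<in> V'"
    have "\<rho> i \<in> S2 i" using \<rho> i by (rule PiE_mem)
    thus "ps \<rho> i \<in> S i" by (cases "i = u") (auto simp: ps_def S2_def)
   next
    fix i assume "i \<notin> V'"
    thus "ps \<rho> i = undefined" using \<rho> uV by (auto simp: ps_def PiE_iff extensional_def)
   qed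
   \<comment> \<open>Fixing the leaf to the index \<open>sel x\<close> makes it a vector on the
     bond, which is contracted into the tensor at \<open>u\<close>; the code of \<open>u\<close>
     contains \<open>x\<close>.\<close>
   define A3 where "A3 k = (\<lambda>i s n. if i = u then \<Sum>y\<in>{1..m}. A k v (sel (fst (prod_decode s))) (\<lambda>f\<in>{{v, u}}. y) * A k u (snd (prod_decode s)) (inj y n)
     else A k i s n)" for k
   have "\<exists>c' A'. \<forall>\<rho>\<in>PiE V' S2. \<Psi>' ((ps \<rho>)(v := sel (px \<rho>))) = c' * gpeps V' E' b A' \<rho>"
   proof (rule Suc.hyps(1)[OF V'(4) gV' ac', where \<Psi> = "\<lambda>k \<rho>. \<Psi> k ((ps \<rho>)(v := sel (px \<rho>)))" and c = c and A = A3])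
    show "finite (S2 i)" if "i \<in> V'" for i using fS that V'(1) by (auto simp: S2_def)
    show "\<Psi> k ((ps \<rho>)(v := sel (px \<rho>))) = c k * gpeps V' E' b (A3 k) \<rho>" if "\<rho> \<in> PiE V' S2" for k \<rho>
    proof -
     have "gpeps V' E' b (A3 k) \<rho> = (\<Sum>y\<in>{1..m}. A k v (sel (px \<rho>)) (\<lambda>f\<in>{{v, u}}. y) * gpeps V' E' b (\<lambda>i s n. AT (A k) y i (if i = u then snd (prod_decode s) else s) n) \<rho>)"
      by (rule gpeps_site_linear[OF V'(3) uV]) (auto simp: A3_def AT_def px_def)
     also have "\<dots> = (\<Sum>y\<in>{1..m}. A k v (sel (px \<rho>)) (\<lambda>f\<in>{{v, u}}. y) * gpeps V' E' b (AT (A k) y) (ps \<rho>))"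
      by (intro sum.cong refl arg_cong2[of _ _ _ _ "(*)"] gpeps_cong) (auto simp: ps_def)
     finally show ?thesis using eq[OF upd[OF ps[OF that] sel(1)]] by (simp add: dec)
    qed
    show "(\<lambda>k. \<Psi> k ((ps \<rho>)(v := sel (px \<rho>)))) \<longlonglongrightarrow> \<Psi>' ((ps \<rho>)(v := sel (px \<rho>)))" if "\<rho> \<in> PiE V' S2" for \<rho>
     using lim[OF upd[OF ps[OF that] sel(1)]] .
   qed
   then obtain c' A' where A': "\<And>\<rho>. \<rho> \<in> PiE V' S2 \<Longrightarrow> \<Psi>' ((ps \<rho>)(v := sel (px \<rho>))) = c' * gpeps V' E' b A' \<rho>" by blast
   \<comment> \<open>The packing is undone: \<open>u\<close> reads the bond to \<open>v\<close> and
     hands it to \<open>A'\<close> as part of its index, while \<open>v\<close> carries the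
     coefficients \<open>L\<close> of the selected rows.\<close>
   define A'' where "A'' = (\<lambda>i s n. if i = v then L s (n {v, u}) else if i = u then A' u (prod_encode (n {v, u}, s)) (restrict n {f\<in>E'. u \<in> f}) else A' i s n)"
   have "\<Psi>' \<sigma> = c' * gpeps V E b A'' \<sigma>" if \<sigma>: "\<sigma> \<in> PiE V S" for \<sigma>
   proof -
    obtain \<tau> s where ts: "\<tau> \<in> PiE V' S" "s \<in> S v" "\<sigma> = \<tau>(v := s)" using split[OF \<sigma>] by blast
    define en where "en x = \<tau>(u := prod_encode (x, \<tau> u))" for x
    have en: "en x \<in> PiE V' S2" "ps (en x) = \<tau>" "px (en x) = x" if "x \<in> {1..m}" for x
    proof -
     show "ps (en x) = \<tau>" "px (en x) = x" by (simp_all add: ps_def px_def en_def)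
     show "en x \<in> PiE V' S2"
     proof (rule PiE_I)
      fix i assume i: "i \<in> V'"
      have "\<tau> i \<in> S i" using ts(1) i by (rule PiE_mem)
      thus "en x i \<in> S2 i" using that by (cases "i = u") (auto simp: en_def S2_def)
     next
      fix i assume "i \<notin> V'"
      thus "en x i = undefined" using ts(1) uV by (auto simp: en_def PiE_iff extensional_def)
     qed
    qed
    have "gpeps V' E' b (AT A'' x) \<tau> = gpeps V' E' b A' (en x)" for x
     unfolding gpeps_def
    proof (intro sum.cong prod.cong refl)
     fix n i assume n: "n \<in> PiE E' (\<lambda>e. {1..b e})" and i: "i \<in> V'"
     have "i \<noteq> v" using i V'(2) by blast
     moreover have "restrict (inj x (restrict n {e\<in>E'. u \<in> e})) {f\<in>E'. u \<in> f} = restrict n {e\<in>E'. u \<in> e}"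
      using E'(2) by (auto simp: inj_def restrict_def fun_eq_iff)
     moreover have "inj x (restrict n {e\<in>E'. u \<in> e}) {v, u} = x" by (simp add: inj_def)
     ultimately show "AT A'' x i (\<tau> i) (restrict n {e\<in>E'. i \<in> e}) = A' i (en x i) (restrict n {e\<in>E'. i \<in> e})"
      by (cases "i = u") (simp_all add: AT_def A''_def en_def)
    qed
    hence "gpeps V E b A'' \<sigma> = (\<Sum>x\<in>{1..m}. L s x * gpeps V' E' b A' (en x))"
     unfolding ts(3) dec by (simp add: A''_def)
    moreover have "\<Psi>' \<sigma> = (\<Sum>x\<in>{1..m}. L s x * (c' * gpeps V' E' b A' (en x)))"
     unfolding ts(3) sel(2)[OF ts(2,1)]
    proof (intro sum.cong refl arg_cong2[of _ _ _ _ "(*)"])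
     fix x assume x: "x \<in> {1..m}"
     show "\<Psi>' (\<tau>(v := sel x)) = c' * gpeps V' E' b A' (en x)" using A'[OF en(1)[OF x]] en(2,3)[OF x] by simp
    qed
    ultimately show ?thesis by (simp add: sum_distrib_left mult_ac)
   qed
   thus ?thesis by blast
  qed
 qed
qed

lemma peps_vec_gpeps:
 assumes "\<sigma> \<in> configs (verts G) (sdim G)"
 shows "peps_vec G A \<sigma> = gpeps (verts G) (edges G) (bdim G) A \<sigma>"
 using assms by (simp add: peps_vec_def vec_of_def gpeps_def inc_def)

theorem forest_PEPS_always_optimizers:
 assumes g: "graph_edges (verts G) (edges G)" and ne: "verts G \<noteq> {}" and ac: "\<not> has_cycle (edges G)"
  and b: "\<forall>e\<in>edges G. bdim G e \<ge> 1" and d: "\<forall>i\<in>verts G. sdim G i \<ge> 1"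
 shows "always_optimizers (verts G) (sdim G) (PEPS G)"
proof -
 have fV: "finite (verts G)" using g by (simp add: graph_edges_def)
 have fE: "finite (edges G)" using g by (rule graph_edges_finite)
 show ?thesis
 proof (rule always_optimizersI[OF fV])
  show "\<Psi> \<in> hilb (verts G) (sdim G)" "hnorm (verts G) (sdim G) \<Psi> = 1" if "\<Psi> \<in> PEPS G" for \<Psi>
   using that peps_cone_hilb unfolding PEPS_cone by blast+
  \<comment> \<open>The product basis vector with all site and bond indices 1 is a normalized
    element.\<close>
  show "PEPS G \<noteq> {}"
  proof -
   define one where "one = restrict (\<lambda>_::'a set. 1::nat) (edges G)"
   define A where "A i s n = (if s = 1 \<and> (\<forall>e\<in>inc G i. n e = 1) then 1 else 0 :: complex)" for i :: 'a and s :: nat and n :: "'a set \<Rightarrow> nat"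
   define \<sigma>1 where "\<sigma>1 = restrict (\<lambda>_::'a. 1::nat) (verts G)"
   have \<sigma>1: "\<sigma>1 \<in> configs (verts G) (sdim G)" using d by (auto simp: \<sigma>1_def configs_def)
   have one: "one \<in> PiE (edges G) (\<lambda>e. {1..bdim G e})" using b by (auto simp: one_def)
   have val: "peps_vec G A \<sigma> = (if \<sigma> = \<sigma>1 then 1 else 0)" if \<sigma>: "\<sigma> \<in> configs (verts G) (sdim G)" for \<sigma>
   proof -
    have pr: "(\<Prod>i\<in>verts G. A i (\<sigma> i) (restrict n (inc G i))) = (if n = one \<and> \<sigma> = \<sigma>1 then 1 else 0)"
     if n: "n \<in> PiE (edges G) (\<lambda>e. {1..bdim G e})" for n
    proof (cases "n = one \<and> \<sigma> = \<sigma>1")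
     case True
     thus ?thesis by (auto simp: A_def one_def \<sigma>1_def inc_def intro!: prod.neutral)
    next
     case False
     have "\<exists>i\<in>verts G. A i (\<sigma> i) (restrict n (inc G i)) = 0"
     proof (cases "\<sigma> = \<sigma>1")
      case True
      hence "n \<noteq> one" using False by blast
      then obtain e where e: "e \<in> edges G" "n e \<noteq> 1"
       using n unfolding one_def PiE_def extensional_def restrict_def by fastforce
      obtain i where "i \<in> e" "i \<in> verts G" using edge_two[OF g e(1)] by blast
      thus ?thesis using e by (intro bexI[of _ i]) (auto simp: A_def inc_def)
     next
      case False
      then obtain i where "i \<in> verts G" "\<sigma> i \<noteq> 1"
       using \<sigma> unfolding configs_def \<sigma>1_def PiE_def extensional_def restrict_def by fastforce
      thus ?thesis by (intro bexI[of _ i]) (auto simp: A_def)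
     qed
     thus ?thesis using False fV by (simp add: prod_zero)
    qed
    have "peps_vec G A \<sigma> = (\<Sum>n\<in>PiE (edges G) (\<lambda>e. {1..bdim G e}). if n = one then (if \<sigma> = \<sigma>1 then 1 else 0) else 0)"
    proof -
     have "peps_vec G A \<sigma> = (\<Sum>n\<in>PiE (edges G) (\<lambda>e. {1..bdim G e}). \<Prod>i\<in>verts G. A i (\<sigma> i) (restrict n (inc G i)))"
      using \<sigma> by (simp only: peps_vec_def vec_of_def if_True)
     also have "\<dots> = (\<Sum>n\<in>PiE (edges G) (\<lambda>e. {1..bdim G e}). if n = one then (if \<sigma> = \<sigma>1 then 1 else 0) else 0)"
      by (intro sum.cong refl) (simp add: pr)
     finally show ?thesis .
    qed
    thus ?thesis using one fE by (simp add: finite_PiE)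
   qed
   have "hnorm (verts G) (sdim G) (peps_vec G A) = 1"
   proof -
    have "(\<Sum>\<sigma>\<in>configs (verts G) (sdim G). (cmod (peps_vec G A \<sigma>))\<^sup>2) = (\<Sum>\<sigma>\<in>configs (verts G) (sdim G). if \<sigma> = \<sigma>1 then 1 else 0)"
     by (rule sum.cong) (simp_all add: val)
    thus ?thesis using \<sigma>1 finite_configs[OF fV] by (simp add: hnorm_def L2_set_def)
   qed
   thus ?thesis unfolding PEPS_def by blast
  qed
  fix f \<psi> assume f: "\<And>k::nat. f k \<in> PEPS G" and lim: "\<And>\<sigma>. (\<lambda>k. f k \<sigma>) \<longlonglongrightarrow> \<psi> \<sigma>"
  have "\<forall>k. \<exists>A. f k = peps_vec G A" using f unfolding PEPS_def by blast
  then obtain A where A: "\<And>k. f k = peps_vec G (A k)" by metis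
  have "\<exists>c A'. \<forall>\<sigma>\<in>PiE (verts G) (\<lambda>i. {1..sdim G i}). \<psi> \<sigma> = c * gpeps (verts G) (edges G) (bdim G) A' \<sigma>"
  proof (rule forest_closed[OF g ac, where \<Psi> = f and c = "\<lambda>_. 1" and A = A])
   show "f k \<sigma> = 1 * gpeps (verts G) (edges G) (bdim G) (A k) \<sigma>" if "\<sigma> \<in> PiE (verts G) (\<lambda>i. {1..sdim G i})" for k \<sigma>
    unfolding A using peps_vec_gpeps[of \<sigma> G "A k"] that by (simp add: configs_def)
  qed (use lim in auto)
  then obtain c A' where "\<forall>\<sigma>\<in>configs (verts G) (sdim G). \<psi> \<sigma> = c * gpeps (verts G) (edges G) (bdim G) A' \<sigma>"
   unfolding configs_def by (elim exE)
  hence cA: "\<And>\<sigma>. \<sigma> \<in> configs (verts G) (sdim G) \<Longrightarrow> \<psi> \<sigma> = c * peps_vec G A' \<sigma>"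
   by (simp only: peps_vec_gpeps)
  have "\<psi> \<sigma> = c * peps_vec G A' \<sigma>" for \<sigma>
  proof (cases "\<sigma> \<in> configs (verts G) (sdim G)")
   case False
   thus ?thesis using lim[of \<sigma>] by (simp add: A peps_vec_def vec_of_def LIMSEQ_const_iff)
  qed (rule cA)
  hence "\<psi> = (\<lambda>\<sigma>. c * peps_vec G A' \<sigma>)" by (rule ext)
  hence "peps_cone G \<psi>" using peps_cone_scale[OF fV ne, of "peps_vec G A'" c] by (auto simp: peps_cone_def)
  moreover have "hnorm (verts G) (sdim G) \<psi> = 1"
  proof -
   have "(\<lambda>k. hnorm (verts G) (sdim G) (f k)) \<longlonglongrightarrow> hnorm (verts G) (sdim G) \<psi>" by (rule hnorm_tendsto) (rule lim)
   moreover have "hnorm (verts G) (sdim G) (f k) = 1" for k using f[of k] unfolding PEPS_def by blast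
   ultimately show ?thesis by (simp only: LIMSEQ_const_iff)
  qed
  ultimately show "\<psi> \<in> PEPS G" unfolding PEPS_cone by blast
 qed
qed

lemma TTNS_always_optimizers:
 assumes "tree_network G"
 shows "always_optimizers (verts G) (sdim G) (TTNS G)"
proof -
 have n: "network G" and nl: "\<not> (\<exists>vs. is_loop G vs)" using assms by (auto simp: tree_network_def)
 have "\<not> has_cycle (edges G)"
 proof
  assume "has_cycle (edges G)"
  then obtain vs where vs: "length vs \<ge> 3" "distinct vs" "\<forall>k<length vs. {vs ! k, vs ! (Suc k mod length vs)} \<in> edges G"
   unfolding has_cycle_def by blast
  have "vs ! k \<in> verts G" if "k < length vs" for k
   using vs(3) that n unfolding network_def by blast
  hence "set vs \<subseteq> verts G" by (auto simp: in_set_conv_nth)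
  thus False using nl vs unfolding is_loop_def by blast
 qed
 thus ?thesis unfolding TTNS_def using network_graph[OF n] n
  by (intro forest_PEPS_always_optimizers) (auto simp: network_def)
qed

text \<open>Both cyclic neighbours of the largest vertex of a cycle would have to be its numerical
  predecessor.\<close>

lemma path_no_cycle: "\<not> has_cycle ((\<lambda>i::nat. {i, Suc i}) ` I)"
proof
 assume "has_cycle ((\<lambda>i::nat. {i, Suc i}) ` I)"
 then obtain vs :: "nat list" where vs: "length vs \<ge> 3" "distinct vs"
   "\<And>k. k < length vs \<Longrightarrow> {vs ! k, vs ! (Suc k mod length vs)} \<in> (\<lambda>i. {i, Suc i}) ` I"
  unfolding has_cycle_def by blast
 have ed: "Suc a = b \<or> Suc b = a" if "{a, b} \<in> (\<lambda>i. {i, Suc i}) ` I" for a b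
 proof -
  have "\<exists>i. {a, b} = {i, Suc i}" using that by blast
  thus ?thesis unfolding doubleton_eq_iff by auto
 qed
 let ?L = "length vs"
 have "set vs \<noteq> {}" using vs(1) by auto
 hence "Max (set vs) \<in> set vs" by simp
 then obtain k where k: "k < ?L" "vs ! k = Max (set vs)" by (auto simp: in_set_conv_nth)
 define k' where "k' = (if k = 0 then ?L - 1 else k - 1)"
 have k': "k' < ?L" "Suc k' mod ?L = k" using k(1) by (auto simp: k'_def)
 have s: "Suc k mod ?L < ?L" by (rule mod_less_divisor) (use k(1) in linarith)
 have le: "vs ! i \<le> vs ! k" if "i < ?L" for i unfolding k(2) using that by simp
 have "Suc (vs ! (Suc k mod ?L)) = vs ! k" using ed[OF vs(3)[OF k(1)]] le[OF s] by auto
 moreover have "Suc (vs ! k') = vs ! k" using ed[OF vs(3)[OF k'(1)]] le[OF k'(1)] k'(2) by auto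
 ultimately have "vs ! (Suc k mod ?L) = vs ! k'" by simp
 hence "Suc k mod ?L = k'" using nth_eq_iff_index_eq[OF vs(2) s k'(1)] by simp
 thus False using vs(1) k(1) by (cases "Suc k = ?L") (auto simp: k'_def split: if_splits)
qed

lemma oMPS_always_optimizers:
 assumes N: "N \<ge> 1" and d: "d \<ge> 1" and m: "\<forall>i\<le>N. m i \<ge> 1" "m 0 = 1" "m N = 1"
 shows "always_optimizers {1..N} (\<lambda>_. d) (oMPS N m d)"
proof -
 let ?G = "path_network N m (\<lambda>_. d)"
 have "always_optimizers (verts ?G) (sdim ?G) (PEPS ?G)"
 proof (rule forest_PEPS_always_optimizers)
  show "graph_edges (verts ?G) (edges ?G)" by (auto simp: graph_edges_def path_network_def)
  show "\<not> has_cycle (edges ?G)" using path_no_cycle by (simp add: path_network_def)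
  show "\<forall>e\<in>edges ?G. bdim ?G e \<ge> 1" using m(1) by (auto simp: path_network_def min_def)
 qed (use N d in \<open>auto simp: path_network_def\<close>)
 thus ?thesis unfolding oMPS_eq_PEPS[OF N m(2,3)] by (simp add: path_network_def)
qed

section \<open>MERA states\<close>

lemma bonds_restrict: "n \<in> bonds G X \<Longrightarrow> Y \<subseteq> X \<Longrightarrow> restrict n Y \<in> bonds G Y"
 unfolding bonds_def by auto

lemma arcs_subset: "arcs_out G i \<subseteq> marcs G" "arcs_in G i \<subseteq> marcs G"
 by (auto simp: arcs_out_def arcs_in_def)

text \<open>The dimension bound lets the outgoing indices of a vertex be embedded into pairs of a
  site index and incoming indices; the injection \<open>\<iota>\<close> is a valid tensor. As the
  graph is acyclic, exactly one assignment of bond indices is consistent with all these injections,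
  so the contraction is a product basis vector.\<close>

lemma mera_nonempty:
 assumes G: "mera_network G"
 shows "MERA G \<noteq> {}"
proof -
 have fV: "finite (mverts G)" and sub: "marcs G \<subseteq> mverts G \<times> mverts G" and ac: "acyclic (marcs G)"
  and bd: "\<And>i. i \<in> mverts G \<Longrightarrow> (\<Prod>e\<in>arcs_out G i. mbdim G e) \<le> msdim G i * (\<Prod>e\<in>arcs_in G i. mbdim G e)"
  using G unfolding mera_network_def by blast+
 have fE: "finite (marcs G)" using sub fV by (simp add: finite_subset)
 have fA: "finite (arcs_out G i)" "finite (arcs_in G i)" for i
  using arcs_subset[of G i] fE by (auto intro: finite_subset)
 have fb: "finite (bonds G X)" if "finite X" for X unfolding bonds_def using that by (simp add: finite_PiE)
 define P where "P i = {1..msdim G i} \<times> bonds G (arcs_in G i)" for i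
 have fP: "finite (P i)" for i using fb[OF fA(2)] by (simp add: P_def)
 have "\<exists>f. inj_on f (bonds G (arcs_out G i)) \<and> f ` bonds G (arcs_out G i) \<subseteq> P i" if "i \<in> mverts G" for i
 proof -
  have "card (bonds G (arcs_out G i)) \<le> card (P i)"
   using bd[OF that] fA by (simp add: P_def bonds_def card_cartesian_product card_PiE)
  thus ?thesis using inj_on_iff_card_le[OF fb[OF fA(1)] fP] by blast
 qed
 then obtain \<iota> where \<iota>: "\<And>i. i \<in> mverts G \<Longrightarrow> inj_on (\<iota> i) (bonds G (arcs_out G i))"
   "\<And>i. i \<in> mverts G \<Longrightarrow> \<iota> i ` bonds G (arcs_out G i) \<subseteq> P i" by metis
 have wf: "wf ((marcs G)\<inverse>)" using fE ac by (rule finite_acyclic_wf_converse)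
 \<comment> \<open>The incoming indices of \<open>i\<close> are computed from those at the heads of
   its outgoing arcs. The recursion runs against the arcs and starts at the sinks.\<close>
 define F where "F f i = snd (\<iota> i (\<lambda>e\<in>arcs_out G i. f (snd e) e))" for f i
 define N where "N = wfrec ((marcs G)\<inverse>) F"
 have N: "N i = snd (\<iota> i (\<lambda>e\<in>arcs_out G i. N (snd e) e))" for i
 proof -
  have "N i = F (cut N ((marcs G)\<inverse>) i) i" unfolding N_def by (rule wfrec[OF wf])
  moreover have "(\<lambda>e\<in>arcs_out G i. cut N ((marcs G)\<inverse>) i (snd e) e) = (\<lambda>e\<in>arcs_out G i. N (snd e) e)"
   by (rule restrict_ext) (auto simp: cut_def arcs_out_def)
  ultimately show ?thesis by (simp only: F_def)
 qed
 define n0 where "n0 = (\<lambda>e\<in>marcs G. N (snd e) e)"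
 have o0: "restrict n0 (arcs_out G i) = (\<lambda>e\<in>arcs_out G i. N (snd e) e)" for i
  by (auto simp: n0_def restrict_def fun_eq_iff arcs_out_def)
 have Nb: "i \<in> mverts G \<longrightarrow> N i \<in> bonds G (arcs_in G i)" for i
 proof (induction i rule: wf_induct[OF wf])
  case (1 i)
  show ?case
  proof
   assume i: "i \<in> mverts G"
   have "(\<lambda>e\<in>arcs_out G i. N (snd e) e) \<in> bonds G (arcs_out G i)"
    unfolding bonds_def
   proof (rule restrict_PiE_iff[THEN iffD2], intro ballI)
    fix e assume e: "e \<in> arcs_out G i"
    hence "(snd e, i) \<in> (marcs G)\<inverse>" "snd e \<in> mverts G" "e \<in> arcs_in G (snd e)"
     using sub by (auto simp: arcs_out_def arcs_in_def)
    thus "N (snd e) e \<in> {1..mbdim G e}" using 1 unfolding bonds_def by (meson PiE_mem)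
   qed
   hence "\<iota> i (\<lambda>e\<in>arcs_out G i. N (snd e) e) \<in> P i" using \<iota>(2)[OF i] by blast
   thus "N i \<in> bonds G (arcs_in G i)" unfolding N[of i] P_def by (simp add: mem_Times_iff)
  qed
 qed
 have n0: "n0 \<in> bonds G (marcs G)"
  unfolding n0_def bonds_def
 proof (rule restrict_PiE_iff[THEN iffD2], intro ballI)
  fix e assume e: "e \<in> marcs G"
  hence "snd e \<in> mverts G" "e \<in> arcs_in G (snd e)" using sub by (auto simp: arcs_in_def)
  thus "N (snd e) e \<in> {1..mbdim G e}" using Nb unfolding bonds_def by (meson PiE_mem)
 qed
 have i0: "restrict n0 (arcs_in G i) = N i" if i: "i \<in> mverts G" for i
 proof (rule ext)
  fix e
  have Ni: "N i \<in> bonds G (arcs_in G i)" using Nb i by blast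
  show "restrict n0 (arcs_in G i) e = N i e"
  proof (cases "e \<in> arcs_in G i")
   case True
   thus ?thesis by (simp add: n0_def arcs_in_def)
  next
   case False
   thus ?thesis using PiE_arb[OF Ni[unfolded bonds_def] False] by simp
  qed
 qed
 have cons0: "snd (\<iota> i (restrict n0 (arcs_out G i))) = restrict n0 (arcs_in G i)" if "i \<in> mverts G" for i
  unfolding o0 i0[OF that] by (rule N[symmetric])
 have uniq: "n = n0" if n: "n \<in> bonds G (marcs G)" and c: "\<And>i. i \<in> mverts G \<Longrightarrow> snd (\<iota> i (restrict n (arcs_out G i))) = restrict n (arcs_in G i)" for n
 proof -
  have eq: "i \<in> mverts G \<longrightarrow> restrict n (arcs_in G i) = N i" for i
  proof (induction i rule: wf_induct[OF wf])
   case (1 i)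
   show ?case
   proof
    assume i: "i \<in> mverts G"
    have "n e = N (snd e) e" if e: "e \<in> arcs_out G i" for e
    proof -
     have "(snd e, i) \<in> (marcs G)\<inverse>" "snd e \<in> mverts G" "e \<in> arcs_in G (snd e)"
      using e sub by (auto simp: arcs_out_def arcs_in_def)
     moreover from this have "restrict n (arcs_in G (snd e)) = N (snd e)" using 1 by blast
     ultimately show ?thesis by (metis restrict_apply')
    qed
    hence "restrict n (arcs_out G i) = (\<lambda>e\<in>arcs_out G i. N (snd e) e)" by (rule restrict_ext)
    thus "restrict n (arcs_in G i) = N i" using c[OF i] N[of i] by (simp only:)
   qed
  qed
  show "n = n0"
  proof (rule PiE_ext[of _ "marcs G" "\<lambda>e. {1..mbdim G e}"])
   fix e assume e: "e \<in> marcs G"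
   hence "snd e \<in> mverts G" "e \<in> arcs_in G (snd e)" using sub by (auto simp: arcs_in_def)
   moreover from this have "restrict n (arcs_in G (snd e)) = N (snd e)" using eq by blast
   ultimately have "n e = N (snd e) e" by (metis restrict_apply')
   thus "n e = n0 e" using e by (simp add: n0_def)
  qed (use n n0 in \<open>auto simp: bonds_def\<close>)
 qed
 define A where "A i s r c = (if \<iota> i r = (s, c) then 1 else 0 :: complex)" for i s r c
 have iso: "mera_isometric G A"
  unfolding mera_isometric_def
 proof (intro ballI)
  fix i r r' assume i: "i \<in> mverts G" and r: "r \<in> bonds G (arcs_out G i)" "r' \<in> bonds G (arcs_out G i)"
  have "(\<Sum>s\<in>{1..msdim G i}. \<Sum>c\<in>bonds G (arcs_in G i). A i s r c * cnj (A i s r' c)) =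
    (\<Sum>p\<in>P i. if p = \<iota> i r then (if \<iota> i r = \<iota> i r' then 1 else 0) else 0)"
   unfolding P_def sum.cartesian_product by (rule sum.cong) (auto simp: A_def)
  also have "\<dots> = (if \<iota> i r = \<iota> i r' then 1 else 0)"
   using \<iota>(2)[OF i] r(1) fP[of i] by (simp add: image_subset_iff)
  also have "\<dots> = (if r = r' then 1 else 0)" using inj_onD[OF \<iota>(1)[OF i] _ r] by auto
  finally show "(\<Sum>s\<in>{1..msdim G i}. \<Sum>c\<in>bonds G (arcs_in G i). A i s r c * cnj (A i s r' c)) = (if r = r' then 1 else 0)" .
 qed
 define \<sigma>0 where "\<sigma>0 = (\<lambda>i\<in>mverts G. fst (\<iota> i (restrict n0 (arcs_out G i))))"
 have \<sigma>0: "\<sigma>0 \<in> configs (mverts G) (msdim G)"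
  unfolding \<sigma>0_def configs_def
 proof (rule restrict_PiE_iff[THEN iffD2], intro ballI)
  fix i assume i: "i \<in> mverts G"
  have "\<iota> i (restrict n0 (arcs_out G i)) \<in> P i" using \<iota>(2)[OF i] bonds_restrict[OF n0 arcs_subset(1)] by blast
  thus "fst (\<iota> i (restrict n0 (arcs_out G i))) \<in> {1..msdim G i}" by (simp only: P_def mem_Times_iff)
 qed
 have val: "mera_vec G A \<sigma> = (if \<sigma> = \<sigma>0 then 1 else 0)" if \<sigma>: "\<sigma> \<in> configs (mverts G) (msdim G)" for \<sigma>
 proof -
  have "(\<Prod>i\<in>mverts G. A i (\<sigma> i) (restrict n (arcs_out G i)) (restrict n (arcs_in G i))) =
    (if n = n0 then (if \<sigma> = \<sigma>0 then 1 else 0) else 0)" if n: "n \<in> bonds G (marcs G)" for n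
  proof (cases "\<forall>i\<in>mverts G. \<iota> i (restrict n (arcs_out G i)) = (\<sigma> i, restrict n (arcs_in G i))")
   case True
   hence nn: "n = n0" by (intro uniq[OF n]) simp
   have "\<sigma> = \<sigma>0"
   proof (rule PiE_ext[of _ "mverts G" "\<lambda>i. {1..msdim G i}"])
    fix i assume "i \<in> mverts G"
    thus "\<sigma> i = \<sigma>0 i" using True nn by (simp add: \<sigma>0_def)
   qed (use \<sigma> \<sigma>0 in \<open>simp_all only: configs_def\<close>)
   moreover have "(\<Prod>i\<in>mverts G. A i (\<sigma> i) (restrict n (arcs_out G i)) (restrict n (arcs_in G i))) = 1"
   proof (rule prod.neutral, intro ballI)
    fix i assume "i \<in> mverts G"
    hence "\<iota> i (restrict n (arcs_out G i)) = (\<sigma> i, restrict n (arcs_in G i))" using True by blast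
    thus "A i (\<sigma> i) (restrict n (arcs_out G i)) (restrict n (arcs_in G i)) = 1" unfolding A_def by (rule if_P)
   qed
   ultimately show ?thesis using nn by simp
  next
   case False
   then obtain i where i: "i \<in> mverts G" "\<iota> i (restrict n (arcs_out G i)) \<noteq> (\<sigma> i, restrict n (arcs_in G i))" by blast
   hence "(\<Prod>i\<in>mverts G. A i (\<sigma> i) (restrict n (arcs_out G i)) (restrict n (arcs_in G i))) = 0"
    using fV by (intro prod_zero bexI[of _ i]) (simp_all only: A_def if_False)
   moreover have "\<not> (n = n0 \<and> \<sigma> = \<sigma>0)"
   proof
    assume a: "n = n0 \<and> \<sigma> = \<sigma>0"
    have "\<iota> i (restrict n (arcs_out G i)) = (\<sigma> i, restrict n (arcs_in G i))"
     using cons0[OF i(1)] i(1) a by (intro prod_eqI) (simp_all add: \<sigma>0_def)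
    thus False using i(2) by blast
   qed
   ultimately show ?thesis by auto
  qed
  hence "(\<Sum>n\<in>bonds G (marcs G). \<Prod>i\<in>mverts G. A i (\<sigma> i) (restrict n (arcs_out G i)) (restrict n (arcs_in G i))) =
    (\<Sum>n\<in>bonds G (marcs G). if n = n0 then (if \<sigma> = \<sigma>0 then 1 else 0) else 0)"
   by (rule sum.cong[OF refl])
  hence "mera_vec G A \<sigma> = (\<Sum>n\<in>bonds G (marcs G). if n = n0 then (if \<sigma> = \<sigma>0 then 1 else 0) else 0)"
   using \<sigma> by (simp only: mera_vec_def vec_of_def if_True)
  thus ?thesis using n0 fb[OF fE] by simp
 qed
 have "(\<Sum>\<sigma>\<in>configs (mverts G) (msdim G). (cmod (mera_vec G A \<sigma>))\<^sup>2) = (\<Sum>\<sigma>\<in>configs (mverts G) (msdim G). if \<sigma> = \<sigma>0 then 1 else 0)"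
  by (rule sum.cong) (simp_all add: val)
 hence "hnorm (mverts G) (msdim G) (mera_vec G A) = 1"
  using \<sigma>0 finite_configs[OF fV] by (simp add: hnorm_def L2_set_def)
 thus ?thesis using iso unfolding MERA_def by blast
qed

text \<open>The diagonal of the isometry condition bounds every entry of a tensor by 1. Tensors of a
  convergent sequence of states then have a convergent subsequence, and the condition as well as the
  contraction pass to the limit.\<close>

lemma MERA_always_optimizers:
 assumes G: "mera_network G"
 shows "always_optimizers (mverts G) (msdim G) (MERA G)"
proof -
 have fV: "finite (mverts G)" and sub: "marcs G \<subseteq> mverts G \<times> mverts G"
  using G unfolding mera_network_def by blast+
 have fE: "finite (marcs G)" using sub fV by (simp add: finite_subset)
 have fA: "finite (arcs_out G i)" "finite (arcs_in G i)" for i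
  using arcs_subset[of G i] fE by (auto intro: finite_subset)
 have fb: "finite (bonds G X)" if "finite X" for X unfolding bonds_def using that by (simp add: finite_PiE)
 show ?thesis
 proof (rule always_optimizersI[OF fV mera_nonempty[OF G]])
  show "\<Psi> \<in> hilb (mverts G) (msdim G)" "hnorm (mverts G) (msdim G) \<Psi> = 1" if "\<Psi> \<in> MERA G" for \<Psi>
   using that by (auto simp: MERA_def hilb_def mera_vec_def vec_of_def)
  fix f \<psi> assume f: "\<And>k::nat. f k \<in> MERA G" and lim: "\<And>\<sigma>. (\<lambda>k. f k \<sigma>) \<longlonglongrightarrow> \<psi> \<sigma>"
  have "\<forall>k. \<exists>A. mera_isometric G A \<and> f k = mera_vec G A" using f unfolding MERA_def by blast
  then obtain A where A: "\<And>k. mera_isometric G (A k)" "\<And>k. f k = mera_vec G (A k)" by metis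
  define J where "J = (SIGMA i:mverts G. {1..msdim G i} \<times> bonds G (arcs_out G i) \<times> bonds G (arcs_in G i))"
  have fJ: "finite J" unfolding J_def using fV fb fA by (intro finite_SigmaI finite_cartesian_product) auto
  define g where "g k = (\<lambda>(i, s, r, c). A k i s r c)" for k
  have "cmod (g k j) \<le> 1" if jJ: "j \<in> J" for k j
  proof -
   obtain i s r c where j: "j = (i, s, r, c)" "i \<in> mverts G" "s \<in> {1..msdim G i}" "r \<in> bonds G (arcs_out G i)" "c \<in> bonds G (arcs_in G i)"
    using jJ unfolding J_def by blast
   define h where "h s c = (cmod (A k i s r c))\<^sup>2" for s c
   have "(\<Sum>s\<in>{1..msdim G i}. \<Sum>c\<in>bonds G (arcs_in G i). A k i s r c * cnj (A k i s r c)) = 1"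
    using A(1)[of k] j(2,4) unfolding mera_isometric_def by simp
   moreover have "(\<Sum>s\<in>{1..msdim G i}. \<Sum>c\<in>bonds G (arcs_in G i). A k i s r c * cnj (A k i s r c)) =
     of_real (\<Sum>s\<in>{1..msdim G i}. \<Sum>c\<in>bonds G (arcs_in G i). h s c)"
    unfolding h_def by (simp only: complex_norm_square of_real_sum of_real_power[symmetric])
   ultimately have 1: "(\<Sum>s\<in>{1..msdim G i}. \<Sum>c\<in>bonds G (arcs_in G i). h s c) = 1"
    by (simp only: of_real_eq_1_iff)
   have "h s c \<le> (\<Sum>c\<in>bonds G (arcs_in G i). h s c)"
    by (rule member_le_sum[OF j(5) _ fb[OF fA(2)]]) (simp add: h_def)
   also have "\<dots> \<le> (\<Sum>s\<in>{1..msdim G i}. \<Sum>c\<in>bonds G (arcs_in G i). h s c)"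
    by (rule member_le_sum[OF j(3)]) (simp_all add: h_def sum_nonneg)
   finally have "h s c \<le> 1" using 1 by simp
   thus ?thesis by (simp add: j(1) g_def h_def abs_square_le_1)
  qed
  then obtain \<phi> h where \<phi>: "strict_mono (\<phi> :: nat \<Rightarrow> nat)" "\<forall>j\<in>J. (\<lambda>k. g (\<phi> k) j) \<longlonglongrightarrow> h j"
   using pointwise_convergent_subseq[OF fJ, of g "\<lambda>_. 1"] by blast
  define A' where "A' i s r c = h (i, s, r, c)" for i s r c
  have cv: "(\<lambda>k. A (\<phi> k) i s r c) \<longlonglongrightarrow> A' i s r c"
   if "i \<in> mverts G" "s \<in> {1..msdim G i}" "r \<in> bonds G (arcs_out G i)" "c \<in> bonds G (arcs_in G i)" for i s r c
  proof -
   have "(i, s, r, c) \<in> J" using that by (simp add: J_def)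
   thus ?thesis using \<phi>(2) unfolding A'_def g_def by fastforce
  qed
  have iso: "mera_isometric G A'"
   unfolding mera_isometric_def
  proof (intro ballI)
   fix i r r' assume i: "i \<in> mverts G" and r: "r \<in> bonds G (arcs_out G i)" "r' \<in> bonds G (arcs_out G i)"
   have "(\<lambda>k. \<Sum>s\<in>{1..msdim G i}. \<Sum>c\<in>bonds G (arcs_in G i). A (\<phi> k) i s r c * cnj (A (\<phi> k) i s r' c)) \<longlonglongrightarrow>
     (\<Sum>s\<in>{1..msdim G i}. \<Sum>c\<in>bonds G (arcs_in G i). A' i s r c * cnj (A' i s r' c))"
    by (intro tendsto_sum tendsto_mult tendsto_cnj cv i r)
   moreover have "(\<Sum>s\<in>{1..msdim G i}. \<Sum>c\<in>bonds G (arcs_in G i). A (\<phi> k) i s r c * cnj (A (\<phi> k) i s r' c)) = (if r = r' then 1 else 0)" for k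
    using A(1)[of "\<phi> k"] i r unfolding mera_isometric_def by blast
   ultimately show "(\<Sum>s\<in>{1..msdim G i}. \<Sum>c\<in>bonds G (arcs_in G i). A' i s r c * cnj (A' i s r' c)) = (if r = r' then 1 else 0)"
    by (simp only: LIMSEQ_const_iff)
  qed
  have "\<psi> \<sigma> = mera_vec G A' \<sigma>" for \<sigma>
  proof (cases "\<sigma> \<in> configs (mverts G) (msdim G)")
   case False
   thus ?thesis using lim[of \<sigma>] by (simp add: A(2) mera_vec_def vec_of_def LIMSEQ_const_iff)
  next
   case True
   have "(\<lambda>k. \<Sum>n\<in>bonds G (marcs G). \<Prod>i\<in>mverts G. A (\<phi> k) i (\<sigma> i) (restrict n (arcs_out G i)) (restrict n (arcs_in G i))) \<longlonglongrightarrow>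
    (\<Sum>n\<in>bonds G (marcs G). \<Prod>i\<in>mverts G. A' i (\<sigma> i) (restrict n (arcs_out G i)) (restrict n (arcs_in G i)))"
   proof (intro tendsto_sum tendsto_prod cv)
    fix i n assume n: "n \<in> bonds G (marcs G)" "i \<in> mverts G"
    show "restrict n (arcs_out G i) \<in> bonds G (arcs_out G i)" by (rule bonds_restrict[OF n(1) arcs_subset(1)])
    show "restrict n (arcs_in G i) \<in> bonds G (arcs_in G i)" by (rule bonds_restrict[OF n(1) arcs_subset(2)])
    show "\<sigma> i \<in> {1..msdim G i}" using True \<open>i \<in> mverts G\<close> unfolding configs_def by (rule PiE_mem)
   qed
   hence "(\<lambda>k. f (\<phi> k) \<sigma>) \<longlonglongrightarrow> mera_vec G A' \<sigma>"
    using True by (simp only: A(2) mera_vec_def vec_of_def if_True)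
   moreover have "(\<lambda>k. f (\<phi> k) \<sigma>) \<longlonglongrightarrow> \<psi> \<sigma>"
    using LIMSEQ_subseq_LIMSEQ[OF lim[of \<sigma>] \<phi>(1)] by (simp only: o_def)
   ultimately show ?thesis using LIMSEQ_unique by blast
  qed
  hence \<psi>: "\<psi> = mera_vec G A'" by (rule ext)
  have "(\<lambda>k. hnorm (mverts G) (msdim G) (f k)) \<longlonglongrightarrow> hnorm (mverts G) (msdim G) \<psi>" by (rule hnorm_tendsto) (rule lim)
  moreover have "hnorm (mverts G) (msdim G) (f k) = 1" for k using f[of k] unfolding MERA_def by blast
  ultimately have "hnorm (mverts G) (msdim G) \<psi> = 1" by (simp only: LIMSEQ_const_iff)
  thus "\<psi> \<in> MERA G" unfolding MERA_def using \<psi> iso by blast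
 qed
qed

section \<open>Translation-invariant matrix product states\<close>

text \<open>Matrix entries along a word over any commutative ring. Polynomial entries keep the
  powers of \<open>\<epsilon>\<close> apart, and evaluating them gives the matrices of the
  family.\<close>

fun word_entry :: "nat \<Rightarrow> (nat \<Rightarrow> nat \<Rightarrow> nat \<Rightarrow> 'a) \<Rightarrow> nat list \<Rightarrow> nat \<Rightarrow> nat \<Rightarrow> 'a::comm_ring_1" where
 "word_entry m B [] k l = (if k = l then 1 else 0)"
| "word_entry m B (s # w) k l = (\<Sum>j<m. B s k j * word_entry m B w j l)"

lemma word_entry_append:
 "k < m \<Longrightarrow> word_entry m B (u @ w) k l = (\<Sum>j<m. word_entry m B u k j * word_entry m B w j l)"
proof (induction u arbitrary: k)
 case Nil
 have "(\<Sum>j<m. (if k = j then 1 else 0) * word_entry m B w j l) = (\<Sum>j<m. if j = k then word_entry m B w k l else 0)"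
  by (rule sum.cong) auto
 thus ?case using Nil by simp
next
 case (Cons s u)
 have "word_entry m B ((s # u) @ w) k l = (\<Sum>j<m. \<Sum>i<m. B s k j * word_entry m B u j i * word_entry m B w i l)"
  using Cons.IH by (simp add: sum_distrib_left mult.assoc)
 also have "\<dots> = (\<Sum>i<m. \<Sum>j<m. B s k j * word_entry m B u j i * word_entry m B w i l)" by (rule sum.swap)
 finally show ?case by (simp add: sum_distrib_right)
qed

lemma word_entry_scale: "word_entry m (\<lambda>s k l. z * B s k l) w k l = z ^ length w * word_entry m B w k l"
 by (induction w arbitrary: k) (simp_all add: sum_distrib_left mult_ac)

lemma word_entry_poly: "poly (word_entry m B w k l) x = word_entry m (\<lambda>s k l. poly (B s k l) x) w k l"
 by (induction w arbitrary: k) (simp_all add: poly_sum)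

definition word_of :: "nat \<Rightarrow> (nat \<Rightarrow> nat) \<Rightarrow> nat list" where
 "word_of N \<sigma> = map \<sigma> [1..<Suc N]"

lemma length_word_of [simp]: "length (word_of N \<sigma>) = N"
 by (simp add: word_of_def)

definition trace_state :: "nat \<Rightarrow> nat \<Rightarrow> nat \<Rightarrow> (nat \<Rightarrow> nat \<Rightarrow> nat \<Rightarrow> complex) \<Rightarrow> nat state" where
 "trace_state N m d B = vec_of {1..N} (\<lambda>_. d) (\<lambda>\<sigma>. \<Sum>k<m. word_entry m B (word_of N \<sigma>) k k)"

lemma foldr_word_entry:
 assumes "\<And>s. s \<in> set w \<Longrightarrow> A s \<in> carrier_mat m m"
 shows "foldr (\<lambda>s M. A s * M) w (1\<^sub>m m) \<in> carrier_mat m m \<and>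
  (\<forall>k<m. \<forall>l<m. foldr (\<lambda>s M. A s * M) w (1\<^sub>m m) $$ (k, l) = word_entry m (\<lambda>s k l. A s $$ (k, l)) w k l)"
 using assms
proof (induction w)
 case Nil
 thus ?case by simp
next
 case (Cons s w)
 define M where "M = foldr (\<lambda>s M. A s * M) w (1\<^sub>m m)"
 have M: "M \<in> carrier_mat m m" "\<And>k l. k < m \<Longrightarrow> l < m \<Longrightarrow> M $$ (k, l) = word_entry m (\<lambda>s k l. A s $$ (k, l)) w k l"
  using Cons.IH Cons.prems unfolding M_def by auto
 have As: "A s \<in> carrier_mat m m" using Cons.prems by simp
 have "(A s * M) $$ (k, l) = word_entry m (\<lambda>s k l. A s $$ (k, l)) (s # w) k l" if "k < m" "l < m" for k l
  using that As M by (simp add: scalar_prod_def atLeast0LessThan)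
 moreover have "A s * M \<in> carrier_mat m m" using As M(1) by (rule mult_carrier_mat)
 ultimately show ?case by (simp add: M_def)
qed

lemma mps_word_trace:
 assumes "\<And>s. s \<in> {1..d} \<Longrightarrow> A s \<in> carrier_mat m m" and \<sigma>: "\<sigma> \<in> configs {1..N} (\<lambda>_. d)"
 shows "mat_trace (mps_prod N m (\<lambda>_. A) \<sigma>) = (\<Sum>k<m. word_entry m (\<lambda>s k l. A s $$ (k, l)) (word_of N \<sigma>) k k)"
proof -
 have "set (word_of N \<sigma>) \<subseteq> {1..d}"
 proof
  fix s assume "s \<in> set (word_of N \<sigma>)"
  moreover have "set (word_of N \<sigma>) = \<sigma> ` {1..N}"
   by (simp add: word_of_def atLeastLessThanSuc_atLeastAtMost del: upt_Suc)
  ultimately obtain i where "i \<in> {1..N}" "s = \<sigma> i" by blast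
  thus "s \<in> {1..d}" using \<sigma> unfolding configs_def by (auto dest: PiE_mem)
 qed
 hence "\<And>s. s \<in> set (word_of N \<sigma>) \<Longrightarrow> A s \<in> carrier_mat m m" using assms(1) by blast
 note f = foldr_word_entry[of "word_of N \<sigma>" A m, OF this]
 have "mps_prod N m (\<lambda>_. A) \<sigma> = foldr (\<lambda>s M. A s * M) (word_of N \<sigma>) (1\<^sub>m m)"
  by (simp add: mps_prod_def word_of_def foldr_map o_def del: upt_Suc)
 thus ?thesis using f by (auto simp: mat_trace_def)
qed

lemma tiMPS_trace_state: "tiMPS N m d = {\<Psi>. hnorm {1..N} (\<lambda>_. d) \<Psi> = 1 \<and> (\<exists>B. \<Psi> = trace_state N m d B)}"
proof -
 have 1: "vec_of {1..N} (\<lambda>_. d) (\<lambda>\<sigma>. mat_trace (mps_prod N m (\<lambda>_. A) \<sigma>)) = trace_state N m d (\<lambda>s k l. A s $$ (k, l))"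
  if "\<forall>s\<in>{1..d}. A s \<in> carrier_mat m m" for A
  using that mps_word_trace[of d A m _ N] by (auto simp: trace_state_def vec_of_def fun_eq_iff)
 have 2: "word_entry m (\<lambda>s k l. Matrix.mat m m (\<lambda>(k, l). B s k l) $$ (k, l)) w k l = word_entry m B w k l"
  if "k < m" "l < m" for w k l and B :: "nat \<Rightarrow> nat \<Rightarrow> nat \<Rightarrow> complex"
  using that by (induction w arbitrary: k) auto
 have "\<exists>A. (\<forall>s\<in>{1..d}. A s \<in> carrier_mat m m) \<and>
   trace_state N m d B = vec_of {1..N} (\<lambda>_. d) (\<lambda>\<sigma>. mat_trace (mps_prod N m (\<lambda>_. A) \<sigma>))" for B
 proof (intro exI[of _ "\<lambda>s. Matrix.mat m m (\<lambda>(k, l). B s k l)"] conjI ballI)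
  show "Matrix.mat m m (\<lambda>(k, l). B s k l) \<in> carrier_mat m m" for s by simp
  show "trace_state N m d B = vec_of {1..N} (\<lambda>_. d) (\<lambda>\<sigma>. mat_trace (mps_prod N m (\<lambda>_ s. Matrix.mat m m (\<lambda>(k, l). B s k l)) \<sigma>))"
   by (subst 1) (simp_all add: trace_state_def 2 cong: sum.cong_simp)
 qed
 thus ?thesis unfolding tiMPS_def using 1 by blast
qed

text \<open>All sites share one tensor, so a scalar is absorbed through an \<open>N\<close>-th
  root.\<close>

lemma trace_state_scale:
 assumes "N \<ge> 1"
 shows "\<exists>B'. (\<lambda>\<sigma>. c * trace_state N m d B \<sigma>) = trace_state N m d B'"
proof -
 define z where "z = rcis (root N (cmod c)) (Arg c / real N)"
 have z: "z ^ N = c"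
  using assms by (simp add: z_def DeMoivre2 rcis_cmod_Arg)
 have "(\<lambda>\<sigma>. c * trace_state N m d B \<sigma>) = trace_state N m d (\<lambda>s k l. z * B s k l)"
  by (simp add: fun_eq_iff trace_state_def vec_of_def word_entry_scale z sum_distrib_left)
 thus ?thesis by blast
qed

text \<open>The indeterminate is \<open>\<epsilon>\<close>. The weighted branch goes
  \<open>N\<close> further than an ordinary step, so a closed word of length \<open>N\<close> with
  \<open>j\<close> factors \<open>\<epsilon>\<close> requires \<open>N * (1 + j)\<close> to be
  divisible by \<open>m\<close>. This lets the length play the part of an offset at a distinguished
  site.\<close>

definition family_matrix :: "nat \<Rightarrow> nat \<Rightarrow> nat \<Rightarrow> nat \<Rightarrow> nat \<Rightarrow> complex poly" where
 "family_matrix N m s k l =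
   (if s = 1 then (if l = Suc k mod m then 1 else 0)
   else if s = 2 \<and> k = 0 then (if l = 1 then 1 else 0) + monom 1 1 * (if l = Suc N mod m then 1 else 0)
   else 0)"

lemma sum_pick: "(a::nat) < m \<Longrightarrow> (\<Sum>j<m. (if j = a then 1 else 0) * f j) = (f a :: 'a::comm_ring_1)"
proof -
 assume "a < m"
 moreover have "(\<Sum>j<m. (if j = a then 1 else 0) * f j) = (\<Sum>j<m. if j = a then f a else 0)" by (rule sum.cong) auto
 ultimately show ?thesis by simp
qed

text \<open>Below degree \<open>m\<close> both factors are monomials, and higher coefficients cannot
  contribute to degree \<open>n\<close>.\<close>

lemma coeff_mult_single_support:
 fixes p q :: "'a::comm_ring_1 poly"
 assumes p: "\<And>i. i < m \<Longrightarrow> i \<noteq> a \<Longrightarrow> coeff p i = 0" and q: "\<And>i. i < m \<Longrightarrow> i \<noteq> b \<Longrightarrow> coeff q i = 0" and n: "n < m"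
 shows "coeff (p * q) n = (if n = a + b then coeff p a * coeff q b else 0)"
proof -
 have "coeff p i * coeff q (n - i) = (if i = a then (if n = a + b then coeff p a * coeff q b else 0) else 0)" if "i \<le> n" for i
  using that n p[of i] q[of "n - i"] by (cases "i = a"; cases "n - i = b") auto
 hence "coeff (p * q) n = (\<Sum>i\<le>n. if i = a then (if n = a + b then coeff p a * coeff q b else 0) else 0)"
  unfolding coeff_mult by (intro sum.cong refl) simp
 thus ?thesis by simp
qed

text \<open>Dual functionals on the three segments pick one term of the sum over the positions
  between them; matching of adjacent positions remains as a condition.\<close>

lemma sum_product3_pick:
 fixes \<Phi> :: "'s \<Rightarrow> 't \<Rightarrow> 'u \<Rightarrow> complex" and x y z :: nat
 assumes \<Phi>: "\<And>s0 s1 s2. s0 \<in> S0 \<Longrightarrow> s1 \<in> S1 \<Longrightarrow> s2 \<in> S2 \<Longrightarrow>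
   \<Phi> s0 s1 s2 = (\<Sum>k<m. \<Sum>l<m. \<Sum>n<m. W k l n * (C0 s0 k l * C1 s1 l n * C2 s2 n k))"
  and f0: "\<And>k l. k < m \<Longrightarrow> l < m \<Longrightarrow> (\<Sum>s\<in>S0. f0 s * C0 s k l) = (if k = x \<and> l = y then 1 else 0)"
  and f1: "\<And>k l. k < m \<Longrightarrow> l < m \<Longrightarrow> (\<Sum>s\<in>S1. f1 s * C1 s k l) = (if k = y' \<and> l = z then 1 else 0)"
  and f2: "\<And>k l. k < m \<Longrightarrow> l < m \<Longrightarrow> (\<Sum>s\<in>S2. f2 s * C2 s k l) = (if k = z' \<and> l = x' then 1 else 0)"
  and lt: "x < m" "y < m" "z < m"
 shows "(\<Sum>s0\<in>S0. \<Sum>s1\<in>S1. \<Sum>s2\<in>S2. f0 s0 * f1 s1 * f2 s2 * \<Phi> s0 s1 s2) =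
   (if x = x' \<and> y = y' \<and> z = z' then W x y z else (0::complex))"
proof -
 let ?K = "{..<m} \<times> {..<m} \<times> {..<m}"
 let ?g = "\<lambda>s0 s1 s2 (k, l, n). W k l n * ((f0 s0 * C0 s0 k l) * (f1 s1 * C1 s1 l n) * (f2 s2 * C2 s2 n k))"
 have "(\<Sum>s0\<in>S0. \<Sum>s1\<in>S1. \<Sum>s2\<in>S2. f0 s0 * f1 s1 * f2 s2 * \<Phi> s0 s1 s2) = (\<Sum>s0\<in>S0. \<Sum>s1\<in>S1. \<Sum>s2\<in>S2. \<Sum>p\<in>?K. ?g s0 s1 s2 p)"
  by (intro sum.cong refl) (simp add: \<Phi> sum_distrib_left sum.cartesian_product split_def mult_ac)
 also have "\<dots> = (\<Sum>p\<in>?K. \<Sum>s0\<in>S0. \<Sum>s1\<in>S1. \<Sum>s2\<in>S2. ?g s0 s1 s2 p)" by (rule sum_swap_out3)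
 also have "\<dots> = (\<Sum>p\<in>?K. if p = (x, y, z) then (if x = x' \<and> y = y' \<and> z = z' then W x y z else 0) else 0)"
 proof (rule sum.cong[OF refl])
  fix p assume "p \<in> ?K"
  then obtain k l n where p: "p = (k, l, n)" "k < m" "l < m" "n < m" by auto
  have "(\<Sum>s0\<in>S0. \<Sum>s1\<in>S1. \<Sum>s2\<in>S2. ?g s0 s1 s2 p) =
    W k l n * ((\<Sum>s\<in>S0. f0 s * C0 s k l) * (\<Sum>s\<in>S1. f1 s * C1 s l n) * (\<Sum>s\<in>S2. f2 s * C2 s n k))"
   unfolding p(1) prod.case sum_product3[symmetric] by (simp only: sum_distrib_left)
  thus "(\<Sum>s0\<in>S0. \<Sum>s1\<in>S1. \<Sum>s2\<in>S2. ?g s0 s1 s2 p) = (if p = (x, y, z) then (if x = x' \<and> y = y' \<and> z = z' then W x y z else 0) else 0)"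
   using p by (auto simp: f0 f1 f2)
 qed
 finally show ?thesis using lt by simp
qed

section \<open>Graded walks and probe words\<close>

context
 fixes N m :: nat
 assumes m: "m \<ge> 2" and cop: "coprime N m"
begin

abbreviation "walk \<equiv> word_entry m (family_matrix N m)"

lemma walk_shift: "k < m \<Longrightarrow> walk (1 # w) k l = walk w (Suc k mod m) l"
 using m by (simp add: family_matrix_def sum_pick)

lemma walk_jump: "k < m \<Longrightarrow> walk (2 # w) k l = (if k = 0 then walk w 1 l + monom 1 1 * walk w (Suc N mod m) l else 0)"
 using m by (simp add: family_matrix_def sum_pick distrib_right sum.distrib mult.assoc flip: sum_distrib_left)

lemma walk_other: "s \<noteq> 1 \<Longrightarrow> s \<noteq> 2 \<Longrightarrow> walk (s # w) k l = 0"
 by (simp add: family_matrix_def)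

text \<open>Each letter advances the position by one, and each factor \<open>\<epsilon>\<close> by a
  further \<open>N\<close>, modulo \<open>m\<close>.\<close>

lemma walk_grading: "k < m \<Longrightarrow> coeff (walk w k l) j \<noteq> 0 \<Longrightarrow> [k + length w + N * j = l] (mod m)"
proof (induction w arbitrary: k j)
 case Nil
 thus ?case by (auto split: if_splits simp: coeff_eq_0 intro: ccontr)
next
 case (Cons s w)
 have m0: "0 < m" using m by simp
 consider "s = 1" | "s = 2" "k = 0" using Cons.prems walk_other[of s w k l] walk_jump[of k w l] by fastforce
 thus ?case
 proof cases
  case 1
  have "[Suc k mod m + length w + N * j = l] (mod m)"
   using Cons.IH[of "Suc k mod m" j] Cons.prems walk_shift[of k w l] 1 m0 by simp
  moreover have "(Suc k mod m + length w + N * j) mod m = (k + length (s # w) + N * j) mod m"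
   by (simp add: mod_simps add.assoc)
  ultimately show ?thesis by (simp add: cong_def)
 next
  case 2
  have "coeff (walk w 1 l) j \<noteq> 0 \<or> coeff (monom 1 1 * walk w (Suc N mod m) l) j \<noteq> 0"
   using Cons.prems walk_jump[of k w l] 2 by auto
  thus ?thesis
  proof
   assume "coeff (walk w 1 l) j \<noteq> 0"
   hence "[1 + length w + N * j = l] (mod m)" using Cons.IH[of 1 j] m by simp
   thus ?thesis using 2 by simp
  next
   assume "coeff (monom 1 1 * walk w (Suc N mod m) l) j \<noteq> 0"
   then obtain j' where j': "j = Suc j'" "coeff (walk w (Suc N mod m) l) j' \<noteq> 0"
    by (cases j) (auto simp: coeff_monom_mult split: if_splits)
   have "[Suc N mod m + length w + N * j' = l] (mod m)" using Cons.IH[OF _ j'(2)] m0 by simp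
   moreover have "(Suc N mod m + length w + N * j') mod m = (k + length (s # w) + N * j) mod m"
   proof -
    have "(Suc N mod m + (length w + N * j')) mod m = (Suc N + (length w + N * j')) mod m" by (rule mod_add_left_eq)
    moreover have "k + length (s # w) + N * j = Suc N + (length w + N * j')" using 2 j'(1) by simp
    ultimately show ?thesis by (simp only: add.assoc)
   qed
   ultimately show ?thesis by (simp add: cong_def)
  qed
 qed
qed

lemma walk_support:
 assumes "k < m" "i < m" "i \<noteq> wt m N (length w) k l"
 shows "coeff (walk w k l) i = 0"
 using walk_grading[OF assms(1), of w l i] wt_unique[OF m cop assms(2)] assms(3) by blast

lemma walk_shifts: "k < m \<Longrightarrow> walk (replicate t 1 @ w) k l = walk w ((k + t) mod m) l"
proof (induction t arbitrary: k)
 case (Suc t)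
 have "walk (replicate (Suc t) 1 @ w) k l = walk (1 # (replicate t 1 @ w)) k l" by simp
 also have "\<dots> = walk (replicate t 1 @ w) (Suc k mod m) l" by (rule walk_shift[OF Suc.prems])
 also have "\<dots> = walk w ((Suc k mod m + t) mod m) l" by (rule Suc.IH) (use m in simp)
 finally show ?case by (simp add: mod_simps)
qed simp

text \<open>The length of a block after which the weighted branch of letter 2 is back at 0. The
  other branch is then at \<open>stride\<close>, which is different from 0, so another letter 2 ends
  it.\<close>

definition stride :: nat where "stride = m - N mod m"

lemma stride: "1 \<le> stride" "stride < m" "m dvd N + stride"
proof -
 have "N mod m \<noteq> 0"
 proof
  assume "N mod m = 0"
  hence "m dvd N" by (simp add: dvd_eq_mod_eq_0)
  hence "is_unit m" using cop by (metis coprime_common_divisor dvd_refl)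
  thus False using m by simp
 qed
 moreover have lt: "N mod m < m" using m by simp
 ultimately show "1 \<le> stride" "stride < m" by (auto simp: stride_def)
 have "N + stride = m * (N div m) + m" using lt mult_div_mod_eq[of m N] unfolding stride_def by linarith
 thus "m dvd N + stride" by simp
qed

text \<open>A further block survives the weighted branch alone, so every block but the last
  contributes a factor \<open>\<epsilon>\<close>. For the last block both branches are kept, as the
  suffix \<open>w\<close> decides between them.\<close>

lemma walk_blocks:
 "k < m \<Longrightarrow> walk (concat (replicate i (2 # replicate (stride - 1) 1)) @ w) k l =
   (if i = 0 then walk w k l else if k = 0 then monom 1 (i - 1) * (walk w stride l + monom 1 1 * walk w 0 l) else 0)"
 if w: "\<And>k. k < m \<Longrightarrow> k \<noteq> 0 \<Longrightarrow> walk w k l = 0"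
proof (induction i arbitrary: k)
 case (Suc i)
 let ?W = "concat (replicate i (2 # replicate (stride - 1) 1)) @ w"
 have 1: "1 + (stride - 1) = stride" using stride(1) by simp
 have 2: "(Suc N mod m + (stride - 1)) mod m = 0"
 proof -
  have "(Suc N mod m + (stride - 1)) mod m = (Suc N + (stride - 1)) mod m" by (rule mod_add_left_eq)
  also have "Suc N + (stride - 1) = N + stride" using stride(1) by simp
  finally show ?thesis using stride(3) by simp
 qed
 have "walk (concat (replicate (Suc i) (2 # replicate (stride - 1) 1)) @ w) k l = walk (2 # (replicate (stride - 1) 1 @ ?W)) k l" by simp
 also have "\<dots> = (if k = 0 then walk ?W stride l + monom 1 1 * walk ?W 0 l else 0)"
  unfolding walk_jump[OF Suc.prems] using m stride(2) by (simp only: walk_shifts 1 2 mod_less mod_less_divisor)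
 also have "\<dots> = (if k = 0 then monom 1 i * (walk w stride l + monom 1 1 * walk w 0 l) else 0)"
 proof (cases "i = 0")
  case True
  thus ?thesis by simp
 next
  case False
  have "walk ?W stride l = 0" using Suc.IH[OF stride(2)] False stride(1) by simp
  moreover have "monom 1 1 * walk ?W 0 l = monom 1 i * (walk w stride l + monom 1 1 * walk w 0 l)"
   using Suc.IH[of 0] False m by (simp add: mult_monom flip: mult.assoc)
  ultimately show ?thesis by simp
 qed
 finally show ?case by simp
qed simp

text \<open>Letter \<open>1\<close> shifts the position by one; letter \<open>2\<close> jumps from \<open>0\<close> to \<open>1\<close> with weight \<open>1\<close> or to
 \<open>N + 1\<close> with weight \<open>\<epsilon>\<close>. After a block \<open>2 1 \<dots> 1\<close> the walk is back at \<open>0\<close> only if it took the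
 second branch, so a word with \<open>i\<close> blocks has coefficients exactly at \<open>\<epsilon>^i\<close> and \<open>\<epsilon>^(i + 1)\<close>, and an
 alternating sum of such words isolates a single power.\<close>

definition probe_word :: "nat \<Rightarrow> nat \<times> nat \<Rightarrow> nat list" where
 "probe_word c p = (case p of (x, i) \<Rightarrow> let t = (m - x) mod m in
   replicate t 1 @ concat (replicate i (2 # replicate (stride - 1) 1)) @ 2 # replicate (c - t - i * stride - 1) 1)"

lemma probe_set: "set (probe_word c p) \<subseteq> {1, 2}"
 by (auto simp: probe_word_def Let_def split: prod.splits)

text \<open>The worst case is \<open>(m - 1) + (m - 1)^2 + 1\<close>, which is at most
  \<open>m^2\<close>; this is where the segment length \<open>m^2\<close> comes from.\<close>

lemma probe_room:
 assumes "x < m" "i < m" "m\<^sup>2 \<le> c"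
 shows "(m - x) mod m + i * stride + 1 \<le> c"
proof -
 have "(m - x) mod m \<le> m - 1" using m by (simp add: less_Suc_eq_le[symmetric])
 moreover have "i * stride \<le> (m - 1) * (m - 1)" using assms(2) stride(2) by (intro mult_le_mono) auto
 moreover have "(m - 1) + (m - 1) * (m - 1) + 1 \<le> m * m" using m by (cases m) simp_all
 ultimately show ?thesis using assms(3) by (simp add: power2_eq_square)
qed

lemma probe_length: "x < m \<Longrightarrow> i < m \<Longrightarrow> m\<^sup>2 \<le> c \<Longrightarrow> length (probe_word c (x, i)) = c"
proof -
 assume a: "x < m" "i < m" "m\<^sup>2 \<le> c"
 have "length (concat (replicate i (2 # replicate (stride - 1) (1::nat)))) = i * stride"
  using stride(1) by (induction i) simp_all
 thus ?thesis using probe_room[OF a] by (simp add: probe_word_def Let_def)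
qed

text \<open>The shifts bring the start \<open>x\<close> to 0 and any other start elsewhere, where
  letter 2 ends the walk. The blocks give \<open>\<epsilon> ^ i\<close>, and the final letter 2
  gives 1 or \<open>\<epsilon>\<close>; which of the two occurs is decided by the end
  \<open>l\<close>, that is, by the weight \<open>w\<close>.\<close>

lemma walk_probe:
 assumes a: "x < m" "i < m" "m\<^sup>2 \<le> c" and kl: "k < m" "l < m"
 defines "w \<equiv> wt m N c k l"
 shows "coeff (walk (probe_word c (x, i)) k l) w = (if k = x \<and> (w = i \<or> w = Suc i) then 1 else 0)"
proof -
 define t where "t = (m - x) mod m"
 define r where "r = c - t - i * stride - 1"
 have c: "c = t + i * stride + 1 + r" using probe_room[OF a] by (simp add: r_def t_def)
 have kx: "(k + t) mod m = 0 \<longleftrightarrow> k = x"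
 proof -
  have "(k + t) mod m = (k + (m - x)) mod m" by (simp add: t_def mod_simps)
  also have "\<dots> = 0 \<longleftrightarrow> k = x"
  proof (cases "x \<le> k")
   case True
   hence "k + (m - x) = m + (k - x)" using a(1) by simp
   hence "(k + (m - x)) mod m = (k - x) mod m" by (simp only: mod_add_self1)
   hence "(k + (m - x)) mod m = k - x" using kl(1) by simp
   thus ?thesis using True by auto
  next
   case False
   hence "k + (m - x) < m" "k + (m - x) > 0" using a(1) by auto
   thus ?thesis using False by auto
  qed
  finally show ?thesis .
 qed
 have e: "walk (2 # replicate r 1) k' l = (if k' = 0 then (if l = Suc r mod m then 1 else 0) + monom 1 1 * (if l = (Suc N + r) mod m then 1 else 0) else 0)"
  if "k' < m" for k'
 proof -
  have "walk (replicate r 1 @ []) k'' l = (if l = (k'' + r) mod m then 1 else 0)" if "k'' < m" for k''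
   unfolding walk_shifts[OF that] by auto
  from this[of 1] this[of "Suc N mod m"] show ?thesis
   unfolding walk_jump[OF that] using m by (simp add: mod_simps)
 qed
 define E where "E = (if l = Suc r mod m then 1 else 0) + monom 1 1 * (if l = (Suc N + r) mod m then 1 else (0::complex poly))"
 have "walk (probe_word c (x, i)) k l = walk (concat (replicate i (2 # replicate (stride - 1) 1)) @ 2 # replicate r 1) ((k + t) mod m) l"
  using walk_shifts[OF kl(1)] by (simp add: probe_word_def Let_def t_def r_def)
 also have "\<dots> = (if k = x then monom 1 i * E else 0)"
 proof (cases "k = x")
  case True
  thus ?thesis using walk_blocks[of "2 # replicate r 1" l 0 i] e stride m kx
   by (cases i) (simp_all add: E_def mult_monom flip: mult.assoc)
 next
  case False
  thus ?thesis using walk_blocks[of "2 # replicate r 1" l "(k + t) mod m" i] e m kx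
   by simp
 qed
 finally have walk: "coeff (walk (probe_word c (x, i)) k l) w = (if k = x \<and> i \<le> w then coeff E (w - i) else 0)"
  by (simp add: coeff_monom_mult)
 have E: "coeff E n = (if n = 0 \<and> l = Suc r mod m \<or> n = 1 \<and> l = (Suc N + r) mod m then 1 else 0)" for n
  by (cases n) (auto simp: E_def coeff_monom_mult)
 have cg: "(k + c + N * w) mod m = l" using wt_cong[OF m cop, of k c l] kl(2) by (simp add: w_def cong_def)
 show ?thesis
 proof (cases "k = x \<and> i \<le> w")
  case True
  have gi: "m dvd i * stride + N * i" using stride(3) by (metis add.commute dvd_mult distrib_right mult.commute)
  have kt: "m dvd k + t" using kx True by (simp add: dvd_eq_mod_eq_0)
  have "k + c + N * w = (k + t) + (i * stride + N * i) + (1 + r + N * (w - i))"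
  proof -
   have "N * w = N * i + N * (w - i)" using True by (simp flip: distrib_left)
   thus ?thesis unfolding c by simp
  qed
  \<comment> \<open>Shifts and blocks contribute a multiple of \<open>m\<close>, so the end is
    determined by the last letter 2 and the padding.\<close>
  hence l: "l = (1 + r + N * (w - i)) mod m"
  proof -
   assume e: "k + c + N * w = (k + t) + (i * stride + N * i) + (1 + r + N * (w - i))"
   obtain q where "(k + t) + (i * stride + N * i) = m * q" using dvd_add[OF kt gi] by (rule dvdE)
   thus ?thesis using cg unfolding e by simp
  qed
  show ?thesis unfolding walk E using True l by (auto simp: le_Suc_eq algebra_simps)
 next
  case False
  thus ?thesis unfolding walk by auto
 qed
qed

text \<open>A weight above \<open>j\<close> is met by \<open>i = w\<close> and
  \<open>i = w - 1\<close> with opposite signs, the weight \<open>j\<close> by \<open>i = j\<close>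
  alone. The range of \<open>i\<close> suffices because \<open>w < m\<close>.\<close>

lemma alternating_telescope:
 assumes "j < m" "w < m"
 shows "(\<Sum>i<m. (if j \<le> i then (- 1) ^ (i - j) else 0) * (if w = i \<or> w = Suc i then 1 else 0)) = (if w = j then 1 else (0::complex))"
proof -
 let ?f = "\<lambda>i. (if j \<le> i then (- 1) ^ (i - j) else 0) * (if w = i \<or> w = Suc i then 1 else (0::complex))"
 have "sum ?f {..<m} = sum ?f {w - 1, w}"
  by (rule sum.mono_neutral_right) (use assms in auto)
 also have "\<dots> = (if w = j then 1 else 0)"
 proof (cases w)
  case (Suc v)
  consider "v < j" "Suc v \<noteq> j" | "Suc v = j" | "j \<le> v" by linarith
  thus ?thesis by cases (simp_all add: Suc Suc_diff_le)
 qed auto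
 finally show ?thesis .
qed

definition probe_coeff :: "nat \<Rightarrow> nat \<Rightarrow> nat \<Rightarrow> nat \<times> nat \<Rightarrow> complex" where
 "probe_coeff c x y p = (if fst p = x \<and> wt m N c x y \<le> snd p then (- 1) ^ (snd p - wt m N c x y) else 0)"

text \<open>At fixed length the start and the weight of a walk determine its end. Isolating the
  start \<open>x\<close> and the weight belonging to \<open>(x, y)\<close> therefore isolates the
  pair.\<close>

lemma probe_dual:
 assumes c: "m\<^sup>2 \<le> c" and xy: "x < m" "y < m" and kl: "k < m" "l < m"
 shows "(\<Sum>p\<in>{..<m} \<times> {..<m}. probe_coeff c x y p * coeff (walk (probe_word c p) k l) (wt m N c k l)) =
   (if k = x \<and> l = y then 1 else 0)"
proof -
 let ?w = "wt m N c k l" and ?j = "wt m N c x y"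
 have "(\<Sum>p\<in>{..<m} \<times> {..<m}. probe_coeff c x y p * coeff (walk (probe_word c p) k l) ?w) =
   (\<Sum>a<m. \<Sum>i<m. probe_coeff c x y (a, i) * coeff (walk (probe_word c (a, i)) k l) ?w)"
  by (simp only: sum.cartesian_product split_def prod.collapse)
 also have "\<dots> = (\<Sum>a<m. if a = x then (\<Sum>i<m. (if ?j \<le> i then (- 1) ^ (i - ?j) else 0) * (if k = x \<and> (?w = i \<or> ?w = Suc i) then 1 else 0)) else 0)"
 proof (rule sum.cong[OF refl])
  fix a assume a: "a \<in> {..<m}"
  show "(\<Sum>i<m. probe_coeff c x y (a, i) * coeff (walk (probe_word c (a, i)) k l) ?w) =
   (if a = x then (\<Sum>i<m. (if ?j \<le> i then (- 1) ^ (i - ?j) else 0) * (if k = x \<and> (?w = i \<or> ?w = Suc i) then 1 else 0)) else 0)"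
  proof (cases "a = x")
   case True
   have "probe_coeff c x y (a, i) * coeff (walk (probe_word c (a, i)) k l) ?w =
     (if ?j \<le> i then (- 1) ^ (i - ?j) else 0) * (if k = x \<and> (?w = i \<or> ?w = Suc i) then 1 else 0)" if i: "i \<in> {..<m}" for i
   proof -
    have "probe_coeff c x y (a, i) = (if ?j \<le> i then (- 1) ^ (i - ?j) else 0)" using True by (simp add: probe_coeff_def)
    moreover have "coeff (walk (probe_word c (a, i)) k l) ?w = (if k = x \<and> (?w = i \<or> ?w = Suc i) then 1 else 0)"
     unfolding True using walk_probe[OF xy(1) _ c kl] i by blast
    ultimately show ?thesis by (simp only:)
   qed
   thus ?thesis using True by simp
  next
   case False
   thus ?thesis by (simp add: probe_coeff_def)
  qed
 qed
 also have "\<dots> = (\<Sum>i<m. (if ?j \<le> i then (- 1) ^ (i - ?j) else 0) * (if k = x \<and> (?w = i \<or> ?w = Suc i) then 1 else 0))"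
  using xy(1) by simp
 also have "\<dots> = (if k = x \<and> ?w = ?j then 1 else 0)"
 proof (cases "k = x")
  case True
  thus ?thesis using alternating_telescope[of ?j ?w] wt_less[OF m cop] by simp
 next
  case False
  thus ?thesis by simp
 qed
 also have "k = x \<and> ?w = ?j \<longleftrightarrow> k = x \<and> l = y"
 proof -
  have "l = y" if "k = x" "?w = ?j"
  proof -
   have "k + c + N * ?w = x + c + N * ?j" using that by (simp only:)
   hence "[l = y] (mod m)"
    using wt_cong[OF m cop, of k c l] wt_cong[OF m cop, of x c y] by (metis cong_sym cong_trans)
   thus ?thesis using kl(2) xy(2) by (simp add: cong_def)
  qed
  thus ?thesis by blast
 qed
 finally show ?thesis .
qed

text \<open>Each entry is a monomial below degree \<open>m\<close>, so a choice of positions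
  contributes to degree \<open>m - 1\<close> only if its three weights add up to
  \<open>m - 1\<close>.\<close>

lemma word_trace_coeff:
 "coeff (\<Sum>k<m. walk (u @ v @ w) k k) (m - 1) = (\<Sum>k<m. \<Sum>l<m. \<Sum>n<m.
   (if wt m N (length u) k l + wt m N (length v) l n + wt m N (length w) n k = m - 1 then 1 else 0) *
   (coeff (walk u k l) (wt m N (length u) k l) * coeff (walk v l n) (wt m N (length v) l n) * coeff (walk w n k) (wt m N (length w) n k)))"
proof -
 have e: "coeff (walk u k l * (walk v l n * walk w n k)) (m - 1) =
   (if wt m N (length u) k l + wt m N (length v) l n + wt m N (length w) n k = m - 1 then 1 else 0) *
   (coeff (walk u k l) (wt m N (length u) k l) * coeff (walk v l n) (wt m N (length v) l n) * coeff (walk w n k) (wt m N (length w) n k))"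
  if k: "k < m" "l < m" "n < m" for k l n
 proof -
  define a b c where "a = wt m N (length u) k l" and "b = wt m N (length v) l n" and "c = wt m N (length w) n k"
  have vw: "coeff (walk v l n * walk w n k) i = (if i = b + c then coeff (walk v l n) b * coeff (walk w n k) c else 0)" if "i < m" for i
   unfolding b_def c_def by (rule coeff_mult_single_support[OF walk_support walk_support]) (use k that in simp_all)
  have "coeff (walk u k l * (walk v l n * walk w n k)) (m - 1) =
   (if m - 1 = a + (b + c) then coeff (walk u k l) a * coeff (walk v l n * walk w n k) (b + c) else 0)"
  proof (rule coeff_mult_single_support[where m = m])
   show "coeff (walk u k l) i = 0" if "i < m" "i \<noteq> a" for i
    by (rule walk_support) (use k that in \<open>simp_all add: a_def\<close>)
   show "coeff (walk v l n * walk w n k) i = 0" if "i < m" "i \<noteq> b + c" for i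
    using vw[OF that(1)] that(2) by simp
  qed (use m in simp)
  thus ?thesis using vw[of "b + c"] m unfolding a_def[symmetric] b_def[symmetric] c_def[symmetric]
   by (auto simp: add.assoc mult.assoc)
 qed
 have "walk (u @ v @ w) k k = (\<Sum>l<m. \<Sum>n<m. walk u k l * (walk v l n * walk w n k))" if "k < m" for k
  using that by (simp add: word_entry_append sum_distrib_left)
 hence "coeff (\<Sum>k<m. walk (u @ v @ w) k k) (m - 1) =
   (\<Sum>k<m. \<Sum>l<m. \<Sum>n<m. coeff (walk u k l * (walk v l n * walk w n k)) (m - 1))"
  by (simp add: coeff_sum)
 also have "\<dots> = (\<Sum>k<m. \<Sum>l<m. \<Sum>n<m.
   (if wt m N (length u) k l + wt m N (length v) l n + wt m N (length w) n k = m - 1 then 1 else 0) *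
   (coeff (walk u k l) (wt m N (length u) k l) * coeff (walk v l n) (wt m N (length v) l n) * coeff (walk w n k) (wt m N (length w) n k)))"
  by (intro sum.cong refl e) (simp_all only: lessThan_iff)
 finally show ?thesis .
qed

text \<open>Closing a word of length \<open>N\<close> with \<open>i\<close> factors
  \<open>\<epsilon>\<close> requires \<open>m\<close> to divide \<open>N * (i + 1)\<close>, and
  hence \<open>i + 1\<close> by coprimality.\<close>

lemma word_trace_order:
 assumes "length w = N" "i < m - 1"
 shows "coeff (\<Sum>k<m. walk w k k) i = 0"
proof -
 have "coeff (walk w k k) i = 0" if k: "k < m" for k
 proof (rule ccontr)
  assume "coeff (walk w k k) i \<noteq> 0"
  hence "[k + (N + N * i) = k + 0] (mod m)" using walk_grading[OF k, of w k i] assms(1) by (simp add: add.assoc)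
  hence "[N * Suc i = 0] (mod m)" by (simp only: cong_add_lcancel_nat mult_Suc_right)
  hence "m dvd N * Suc i" by (simp add: cong_0_iff)
  moreover have "coprime m N" using cop by (simp only: coprime_commute)
  ultimately have "m dvd Suc i" by (simp only: coprime_dvd_mult_right_iff)
  thus False using assms(2) by (auto dest: dvd_imp_le)
 qed
 thus ?thesis by (simp add: coeff_sum)
qed

lemma word_of_config:
 assumes "length w = N'" "set w \<subseteq> {1..d}"
 shows "\<exists>\<sigma>\<in>configs {1..N'} (\<lambda>_. d). word_of N' \<sigma> = w"
proof
 define \<sigma> where "\<sigma> = (\<lambda>i\<in>{1..N'}. w ! (i - 1))"
 have "\<sigma> i \<in> {1..d}" if "i \<in> {1..N'}" for i
 proof -
  have "w ! (i - 1) \<in> set w" using that assms(1) by (intro nth_mem) auto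
  thus ?thesis using that assms(2) by (auto simp: \<sigma>_def)
 qed
 thus "\<sigma> \<in> configs {1..N'} (\<lambda>_. d)" by (auto simp: configs_def \<sigma>_def)
 show "word_of N' \<sigma> = w" by (rule nth_equalityI) (use assms(1) in \<open>auto simp: word_of_def \<sigma>_def simp del: upt_Suc\<close>)
qed

definition limit_state :: "nat \<Rightarrow> nat state" where
 "limit_state d = vec_of {1..N} (\<lambda>_. d) (\<lambda>\<sigma>. coeff (\<Sum>k<m. walk (word_of N \<sigma>) k k) (m - 1))"

text \<open>The trace is divisible by \<open>\<epsilon> ^ (m - 1)\<close> as a polynomial; the limit
  is the value of the quotient at 0.\<close>

lemma limit_state_tendsto:
 "(\<lambda>n. (1 / (1 / of_nat (Suc n)) ^ (m - 1)) * trace_state N m d (\<lambda>s k l. poly (family_matrix N m s k l) (1 / of_nat (Suc n))) \<sigma>)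
   \<longlonglongrightarrow> limit_state d \<sigma>"
proof (cases "\<sigma> \<in> configs {1..N} (\<lambda>_. d)")
 case False
 thus ?thesis by (simp add: limit_state_def trace_state_def vec_of_def)
next
 case True
 define p where "p = (\<Sum>k<m. walk (word_of N \<sigma>) k k)"
 have "monom 1 (m - 1) dvd p"
  unfolding monom_1_dvd_iff' p_def using word_trace_order[of "word_of N \<sigma>"] by simp
 then obtain q where q: "p = monom 1 (m - 1) * q" by (rule dvdE)
 have "(1 / x ^ (m - 1)) * trace_state N m d (\<lambda>s k l. poly (family_matrix N m s k l) x) \<sigma> = poly q x" if "x \<noteq> 0" for x
 proof -
  have "trace_state N m d (\<lambda>s k l. poly (family_matrix N m s k l) x) \<sigma> = poly p x"
   using True by (simp add: trace_state_def vec_of_def p_def poly_sum word_entry_poly)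
  thus ?thesis using that by (simp add: q poly_monom)
 qed
 hence eq: "(1 / (1 / of_nat (Suc n)) ^ (m - 1)) * trace_state N m d (\<lambda>s k l. poly (family_matrix N m s k l) (1 / of_nat (Suc n))) \<sigma> =
   poly q (1 / of_nat (Suc n))" for n
  by (metis of_nat_neq_0 zero_neq_one divide_eq_0_iff)
 have "(\<lambda>n. 1 / of_nat (Suc n)) \<longlonglongrightarrow> (0::complex)" by (rule lim_1_over_n[THEN LIMSEQ_Suc])
 hence "(\<lambda>n. poly q (1 / of_nat (Suc n))) \<longlonglongrightarrow> poly q 0" by (rule tendsto_poly)
 moreover have "poly q 0 = limit_state d \<sigma>"
  using True by (simp add: limit_state_def vec_of_def p_def[symmetric] q coeff_monom_mult poly_0_coeff_0)
 ultimately show ?thesis unfolding eq by simp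
qed

text \<open>Words are cut into two segments of length \<open>m^2\<close> and the rest, all long
  enough for probe words, which use two letters. The three lengths add up to \<open>N\<close>, which
  is the congruence required with \<open>q = N\<close>; each bond index is its own label.\<close>

theorem tiMPS_lacks_optimizers:
 assumes N: "3 * m\<^sup>2 \<le> N" and d: "d \<ge> 2"
 shows "lacks_optimizers {1..N} (\<lambda>_. d) (tiMPS N m d)"
proof -
 define c where "c = N - 2 * m\<^sup>2"
 have c: "m\<^sup>2 \<le> m\<^sup>2" "m\<^sup>2 \<le> c" "m\<^sup>2 + m\<^sup>2 + c = N" using N by (simp_all add: c_def)
 have N1: "N \<ge> 1" using N m by (cases N) auto
 let ?S = "{..<m} \<times> {..<m}"
 define cfg where "cfg w = (SOME \<sigma>. \<sigma> \<in> configs {1..N} (\<lambda>_. d) \<and> word_of N \<sigma> = w)" for w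
 define word where "word s0 s1 s2 = probe_word (m\<^sup>2) s0 @ probe_word (m\<^sup>2) s1 @ probe_word c s2" for s0 s1 s2
 have len: "length (probe_word c' s) = c'" if "s \<in> ?S" "m\<^sup>2 \<le> c'" for s c' using probe_length[of "fst s" "snd s" c'] that by auto
 have cfg: "cfg (word s0 s1 s2) \<in> configs {1..N} (\<lambda>_. d) \<and> word_of N (cfg (word s0 s1 s2)) = word s0 s1 s2"
  if "s0 \<in> ?S" "s1 \<in> ?S" "s2 \<in> ?S" for s0 s1 s2
 proof -
  have "length (word s0 s1 s2) = N" using len[OF that(1) c(1)] len[OF that(2) c(1)] len[OF that(3) c(2)] c(3) by (simp add: word_def)
  moreover have "set (word s0 s1 s2) \<subseteq> {1..d}" using probe_set[of "m\<^sup>2" s0] probe_set[of "m\<^sup>2" s1] probe_set[of c s2] d by (auto simp: word_def)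
  ultimately have "\<exists>\<sigma>. \<sigma> \<in> configs {1..N} (\<lambda>_. d) \<and> word_of N \<sigma> = word s0 s1 s2" using word_of_config by blast
  thus ?thesis unfolding cfg_def by (rule someI_ex)
 qed
 define \<Phi> where "\<Phi> s0 s1 s2 = limit_state d (cfg (word s0 s1 s2))" for s0 s1 s2
 define C where "C c' s k l = coeff (walk (probe_word c' s) k l) (wt m N c' k l)" for c' s k l
 define W where "W k l n = (if wt m N (m\<^sup>2) k l + wt m N (m\<^sup>2) l n + wt m N c n k = m - 1 then 1 else (0::complex))" for k l n
 have \<Phi>: "\<Phi> s0 s1 s2 = (\<Sum>k<m. \<Sum>l<m. \<Sum>n<m. W k l n * (C (m\<^sup>2) s0 k l * C (m\<^sup>2) s1 l n * C c s2 n k))"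
  if s: "s0 \<in> ?S" "s1 \<in> ?S" "s2 \<in> ?S" for s0 s1 s2
 proof -
  have "\<Phi> s0 s1 s2 = coeff (\<Sum>k<m. walk (word s0 s1 s2) k k) (m - 1)"
   using cfg[OF s] by (simp add: \<Phi>_def limit_state_def vec_of_def)
  thus ?thesis unfolding word_def word_trace_coeff len[OF s(1) c(1)] len[OF s(2) c(1)] len[OF s(3) c(2)] W_def C_def .
 qed
 have pull: "(\<Sum>s0\<in>?S. \<Sum>s1\<in>?S. \<Sum>s2\<in>?S. probe_coeff (m\<^sup>2) x y s0 * probe_coeff (m\<^sup>2) y' z s1 * probe_coeff c z' x' s2 * \<Phi> s0 s1 s2) =
   (if x = x' \<and> y = y' \<and> z = z' then W x y z else 0)"
  if "x < m" "y < m" "y' < m" "z < m" "z' < m" "x' < m" for x y y' z z' x'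
  by (rule sum_product3_pick[where m = m and W = W, OF \<Phi>])
   (simp_all only: C_def probe_dual[OF c(1)] probe_dual[OF c(2)] that)
 have notin: "\<not> (\<exists>B. limit_state d = trace_state N m d B)"
 proof
  assume "\<exists>B. limit_state d = trace_state N m d B"
  then obtain B where B: "limit_state d = trace_state N m d B" by blast
  define T where "T c' s = word_entry m B (probe_word c' s)" for c' s
  have tri: "\<Phi> s0 s1 s2 = (\<Sum>a<m. \<Sum>b<m. \<Sum>n<m. T (m\<^sup>2) s0 a b * T (m\<^sup>2) s1 b n * T c s2 n a)"
   if s: "s0 \<in> ?S" "s1 \<in> ?S" "s2 \<in> ?S" for s0 s1 s2
  proof -
   have "\<Phi> s0 s1 s2 = (\<Sum>k<m. word_entry m B (word s0 s1 s2) k k)"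
    using cfg[OF s] by (simp add: \<Phi>_def B trace_state_def vec_of_def)
   thus ?thesis by (simp add: word_def word_entry_append T_def sum_distrib_left mult.assoc)
  qed
  have fib: "m * card {x\<in>{..<m}. x = i} = card {..<m}" if "i < m" for i
  proof -
   have "{x\<in>{..<m}. x = i} = {i}" using that by auto
   thus ?thesis by simp
  qed
  show False
  proof (rule cyclic_triangle_obstruction[OF m cop, where ?c1.0 = "m\<^sup>2" and ?c2.0 = "m\<^sup>2" and ?c3.0 = c and X = "{..<m}" and X' = "{..<m}"
    and Y' = "{..<m}" and Z' = "{..<m}" and g = "\<lambda>x. x" and \<Phi> = \<Phi> and ?S0.0 = ?S and ?S1.0 = ?S and ?S2.0 = ?S
    and ?f0.0 = "probe_coeff (m\<^sup>2)" and ?f1.0 = "probe_coeff (m\<^sup>2)" and ?f2.0 = "probe_coeff c"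
    and ?T0.0 = "T (m\<^sup>2)" and ?T1.0 = "T (m\<^sup>2)" and ?T2.0 = "T c"])
   show "[m\<^sup>2 + m\<^sup>2 + c = N] (mod m)" unfolding c(3) by (rule cong_refl)
   show "\<Phi> s0 s1 s2 = (\<Sum>a<m. \<Sum>b<m. \<Sum>n<m. T (m\<^sup>2) s0 a b * T (m\<^sup>2) s1 b n * T c s2 n a)"
    if "s0 \<in> ?S" "s1 \<in> ?S" "s2 \<in> ?S" for s0 s1 s2 by (rule tri[OF that])
   show "(\<Sum>s0\<in>?S. \<Sum>s1\<in>?S. \<Sum>s2\<in>?S. probe_coeff (m\<^sup>2) x y s0 * probe_coeff (m\<^sup>2) y' z s1 * probe_coeff c z' x' s2 * \<Phi> s0 s1 s2) =
    (if x = x' \<and> y = y' \<and> z = z' \<and> wt m N (m\<^sup>2) x y + wt m N (m\<^sup>2) y z + wt m N c z x = m - 1 then 1 else 0)"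
    if "x \<in> {..<m}" "y \<in> {..<m}" "y' \<in> {..<m}" "z \<in> {..<m}" "z' \<in> {..<m}" "x' \<in> {..<m}" for x y y' z z' x'
    using pull[of x y y' z z' x'] that unfolding W_def by (simp only: lessThan_iff) (simp cong: if_cong)
   show "m * card {x\<in>{..<m}. x = i} = card {..<m}" if "i < m" for i by (rule fib[OF that])
   have "0 \<in> {..<m}" using m by simp
   thus "{..<m} \<noteq> {}" by blast
  qed simp_all
 qed
 obtain z where z: "z < m" "W 0 0 z = 1"
  using wt_extend[OF m cop, of "m\<^sup>2" "m\<^sup>2" c 0 0] c(3) by (auto simp: W_def)
 have nz: "\<exists>\<rho>. limit_state d \<rho> \<noteq> 0"
 proof (rule ccontr)
  assume "\<not> (\<exists>\<rho>. limit_state d \<rho> \<noteq> 0)"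
  hence "\<Phi> s0 s1 s2 = 0" for s0 s1 s2 by (simp add: \<Phi>_def)
  thus False using pull[of 0 0 0 z z 0] z m by simp
 qed
 then obtain \<rho> where \<rho>: "limit_state d \<rho> \<noteq> 0" by blast
 show ?thesis
 proof (rule lacks_optimizers_cone[where C = "\<lambda>\<Psi>. \<exists>B. \<Psi> = trace_state N m d B", OF _ tiMPS_trace_state _ _ _ limit_state_tendsto \<rho> notin])
  show "finite {1..N}" by simp
  show "\<Psi> \<in> hilb {1..N} (\<lambda>_. d)" if "\<exists>B. \<Psi> = trace_state N m d B" for \<Psi>
   using that by (auto simp: trace_state_def hilb_def vec_of_def)
  show "\<exists>B. (\<lambda>\<sigma>. c * \<Psi> \<sigma>) = trace_state N m d B" if "\<exists>B. \<Psi> = trace_state N m d B" for \<Psi> c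
   using that trace_state_scale[OF N1] by blast
  show "\<exists>B. (\<lambda>\<sigma>. (1 / (1 / of_nat (Suc n)) ^ (m - 1)) * trace_state N m d (\<lambda>s k l. poly (family_matrix N m s k l) (1 / of_nat (Suc n))) \<sigma>) = trace_state N m d B" for n
   by (rule trace_state_scale[OF N1])
 qed
qed

end

section \<open>Two-domain loop states and fine-graining\<close>

lemma card_PiE_fix:
 assumes "finite R" "r0 \<in> R" "a \<in> F r0"
 shows "card (F r0) * card {x\<in>PiE R F. x r0 = a} = card (PiE R F)"
proof -
 have "{x\<in>PiE R F. x r0 = a} = PiE R (F(r0 := {a}))"
 proof (intro Set.set_eqI iffI)
  fix x assume "x \<in> {x\<in>PiE R F. x r0 = a}"
  hence x: "x \<in> PiE R F" "x r0 = a" by simp_all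
  show "x \<in> PiE R (F(r0 := {a}))"
  proof (rule PiE_I)
   show "x i \<in> (F(r0 := {a})) i" if "i \<in> R" for i using PiE_mem[OF x(1) that] x(2) by simp
   show "x i = undefined" if "i \<notin> R" for i using PiE_arb[OF x(1) that] .
  qed
 next
  fix x assume x: "x \<in> PiE R (F(r0 := {a}))"
  hence "x r0 = a" using PiE_mem[OF x assms(2)] by simp
  moreover have "x \<in> PiE R F"
  proof (rule PiE_I)
   show "x i \<in> F i" if "i \<in> R" for i using PiE_mem[OF x that] assms(3) by (cases "i = r0") simp_all
   show "x i = undefined" if "i \<notin> R" for i using PiE_arb[OF x that] .
  qed
  ultimately show "x \<in> {x\<in>PiE R F. x r0 = a}" by simp
 qed
 hence "card {x\<in>PiE R F. x r0 = a} = (\<Prod>r\<in>R. card ((F(r0 := {a})) r))"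
  using assms(1) by (simp only: card_PiE)
 also have "\<dots> = (\<Prod>r\<in>R - {r0}. card (F r))"
 proof -
  have "(\<Prod>r\<in>R - {r0}. card ((F(r0 := {a})) r)) = (\<Prod>r\<in>R - {r0}. card (F r))" by (rule prod.cong) auto
  thus ?thesis unfolding prod.remove[OF assms(1,2)] by simp
 qed
 finally show ?thesis using assms(1) by (simp add: card_PiE prod.remove[OF assms(1,2)])
qed

locale loop_states =
 fixes G :: "'v network" and m :: nat and vs :: "'v list" and W :: "'v \<Rightarrow> nat \<Rightarrow> ('v set \<Rightarrow> nat) \<Rightarrow> complex"
 assumes g: "graph_edges (verts G) (edges G)" and m: "m \<ge> 2" and loop: "is_loop G vs" and emb: "site_embedding G m W"
begin

abbreviation L :: nat where "L \<equiv> length vs"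

definition le :: "nat \<Rightarrow> 'v set" where "le k = {vs ! k, vs ! (Suc k mod L)}"

definition pe :: "nat \<Rightarrow> 'v set" where "pe k = {vs ! ((k + L - 1) mod L), vs ! k}"

lemma L3: "L \<ge> 3" and dist: "distinct vs" and vsV: "k < L \<Longrightarrow> vs ! k \<in> verts G" and le_edge: "k < L \<Longrightarrow> le k \<in> edges G"
 using loop by (auto simp: is_loop_def le_def)

lemma L_facts: "0 < L" "1 < L" "Suc 0 < L" "L - 1 < L" "L - Suc 0 < L" "vs \<noteq> []"
 using L3 by auto

lemma pe_le: "k < L \<Longrightarrow> pe k = le (if k = 0 then L - 1 else k - 1)"
 using L3 by (cases k) (auto simp: pe_def le_def mod_simps)

lemma pe_edge: "k < L \<Longrightarrow> pe k \<in> edges G"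
 using le_edge[of "if k = 0 then L - 1 else k - 1"] pe_le[of k] L3 by auto

lemma loop_inc: "k < L \<Longrightarrow> le k \<in> inc G (vs ! k)" "k < L \<Longrightarrow> pe k \<in> inc G (vs ! k)"
 using le_edge pe_edge by (auto simp: inc_def le_def pe_def)

lemma fV: "finite (verts G)" and fE: "finite (edges G)"
 using g graph_edges_finite[OF g] by (auto simp: graph_edges_def)

lemma fhalf: "finite (half_edges G)"
 unfolding half_edges_def inc_def using fV fE by auto

text \<open>The operators at the loop vertices are diagonal. A domain wall at the
  \<open>k\<close>-th vertex, where the labels of its two loop bonds differ, costs
  \<open>\<epsilon>\<close>, and at the last vertex it is refunded.\<close>

definition lw :: "real \<Rightarrow> nat \<Rightarrow> nat \<Rightarrow> nat \<Rightarrow> complex" where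
 "lw \<epsilon> k a b = (if a = b then 1 else if Suc k < L then of_real \<epsilon> else 1 / of_real \<epsilon>)"

lemma op_lw: "\<epsilon> \<noteq> 0 \<Longrightarrow> (if Suc k < L then op_A \<epsilon> else op_B \<epsilon>) x y = (if x = y then lw \<epsilon> k (fst x) (snd x) else 0)"
 by (auto simp: op_A_def op_B_def op_Po_def op_Pd_def lw_def)

lemma apply_pair_diagonal:
 assumes T: "\<And>x y. T x y = (if x = y then w (fst x) (snd x) else 0)" and \<nu>: "\<nu> \<in> configs S (\<lambda>_. m)" and pq: "p \<in> S" "q \<in> S"
 shows "apply_pair S m T p q \<phi> \<nu> = w (\<nu> p) (\<nu> q) * \<phi> \<nu>"
proof -
 have "(\<nu> p, \<nu> q) \<in> {1..m} \<times> {1..m}"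
  using PiE_mem[OF \<nu>[unfolded configs_def] pq(1)] PiE_mem[OF \<nu>[unfolded configs_def] pq(2)] by (rule SigmaI)
 moreover have "(\<Sum>y\<in>{1..m} \<times> {1..m}. T (\<nu> p, \<nu> q) y * \<phi> (\<nu>(p := fst y, q := snd y))) =
   (\<Sum>y\<in>{1..m} \<times> {1..m}. if y = (\<nu> p, \<nu> q) then w (\<nu> p) (\<nu> q) * \<phi> \<nu> else 0)"
  by (rule sum.cong) (auto simp: T)
 ultimately show ?thesis using \<nu> by (simp add: apply_pair_def vec_of_def)
qed

lemma loop_vec_eq:
 assumes \<nu>: "\<nu> \<in> configs (half_edges G) (\<lambda>_. m)" and \<epsilon>: "\<epsilon> \<noteq> 0"
 shows "loop_vec G m vs \<epsilon> \<nu> = (\<Prod>k<L. lw \<epsilon> k (\<nu> (vs ! k, pe k)) (\<nu> (vs ! k, le k))) * mu_vec G m \<nu>"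
proof -
 define T where "T k = (if Suc k < L then op_A \<epsilon> else op_B \<epsilon>)" for k
 have fold: "foldr (\<lambda>k. apply_pair (half_edges G) m (T k) (vs ! k, pe k) (vs ! k, le k)) ks (mu_vec G m) \<nu> =
   (\<Prod>k\<leftarrow>ks. lw \<epsilon> k (\<nu> (vs ! k, pe k)) (\<nu> (vs ! k, le k))) * mu_vec G m \<nu>" if "set ks \<subseteq> {..<L}" for ks
  using that
 proof (induction ks)
  case (Cons k ks)
  hence k: "k < L" by simp
  have "(vs ! k, pe k) \<in> half_edges G" "(vs ! k, le k) \<in> half_edges G"
   using vsV[OF k] loop_inc[OF k] by (auto simp: half_edges_def)
  note a = apply_pair_diagonal[of "T k" "lw \<epsilon> k", OF op_lw[OF \<epsilon>, folded T_def] \<nu> this]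
  show ?case using Cons by (simp add: a mult.assoc)
 qed simp
 have "loop_vec G m vs \<epsilon> \<nu> = foldr (\<lambda>k. apply_pair (half_edges G) m (T k) (vs ! k, pe k) (vs ! k, le k)) [0..<L] (mu_vec G m) \<nu>"
  by (simp only: loop_vec_def Let_def T_def pe_def le_def)
 also have "\<dots> = (\<Prod>k\<leftarrow>[0..<L]. lw \<epsilon> k (\<nu> (vs ! k, pe k)) (\<nu> (vs ! k, le k))) * mu_vec G m \<nu>"
  by (rule fold) auto
 also have "(\<Prod>k\<leftarrow>[0..<L]. lw \<epsilon> k (\<nu> (vs ! k, pe k)) (\<nu> (vs ! k, le k))) = (\<Prod>k<L. lw \<epsilon> k (\<nu> (vs ! k, pe k)) (\<nu> (vs ! k, le k)))"
  by (simp add: prod.distinct_set_conv_list[symmetric] atLeast0LessThan)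
 finally show ?thesis .
qed

text \<open>A bond configuration copied to both ends of every edge. These are the labels in the
  support of \<open>mu_vec\<close>, so sums over half edges reduce to sums over bonds.\<close>

definition lift :: "('v set \<Rightarrow> nat) \<Rightarrow> 'v \<times> 'v set \<Rightarrow> nat" where
 "lift n = (\<lambda>p\<in>half_edges G. n (snd p))"

lemma mu_vec_eq:
 assumes \<nu>: "\<nu> \<in> configs (half_edges G) (\<lambda>_. m)"
 shows "mu_vec G m \<nu> = (if \<nu> \<in> lift ` PiE (edges G) (\<lambda>_. {1..m}) then 1 else 0)"
proof -
 have e: "(\<Sum>n\<in>{1..m}. \<Prod>i\<in>e. if \<nu> (i, e) = n then 1 else 0) = (if \<forall>i\<in>e. \<forall>j\<in>e. \<nu> (i, e) = \<nu> (j, e) then 1 else (0::complex))"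
  if "e \<in> edges G" for e
 proof -
  obtain u v where uv: "e = {u, v}" "u \<noteq> v" "u \<in> verts G" "v \<in> verts G" using edge_two[OF g \<open>e \<in> edges G\<close>] by blast
  have "(u, e) \<in> half_edges G" using uv \<open>e \<in> edges G\<close> by (auto simp: half_edges_def inc_def)
  hence u: "\<nu> (u, e) \<in> {1..m}" using \<nu> unfolding configs_def by (rule PiE_mem[rotated])
  have "(\<Sum>n\<in>{1..m}. \<Prod>i\<in>e. if \<nu> (i, e) = n then 1 else 0) = (\<Sum>n\<in>{1..m}. if n = \<nu> (u, e) then (if \<nu> (v, e) = \<nu> (u, e) then 1 else 0) else (0::complex))"
   unfolding uv(1) by (rule sum.cong) (use uv(2) in auto)
  also have "\<dots> = (if \<nu> (v, e) = \<nu> (u, e) then 1 else 0)" using u by simp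
  also have "\<dots> = (if \<forall>i\<in>e. \<forall>j\<in>e. \<nu> (i, e) = \<nu> (j, e) then 1 else 0)"
   by (rule if_cong) (use uv(1) in auto)
  finally show ?thesis .
 qed
 have "mu_vec G m \<nu> = (\<Prod>e\<in>edges G. if \<forall>i\<in>e. \<forall>j\<in>e. \<nu> (i, e) = \<nu> (j, e) then 1 else 0)"
  unfolding mu_vec_def vec_of_def if_P[OF \<nu>] by (rule prod.cong[OF refl e])
 also have "\<dots> = (if \<forall>e\<in>edges G. \<forall>i\<in>e. \<forall>j\<in>e. \<nu> (i, e) = \<nu> (j, e) then 1 else 0)"
  by (rule prod_indicator[OF fE])
 also have "(\<forall>e\<in>edges G. \<forall>i\<in>e. \<forall>j\<in>e. \<nu> (i, e) = \<nu> (j, e)) \<longleftrightarrow> \<nu> \<in> lift ` PiE (edges G) (\<lambda>_. {1..m})"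
 proof
  assume c: "\<forall>e\<in>edges G. \<forall>i\<in>e. \<forall>j\<in>e. \<nu> (i, e) = \<nu> (j, e)"
  define n where "n = (\<lambda>e\<in>edges G. \<nu> (SOME i. i \<in> e, e))"
  have some: "(SOME i. i \<in> e) \<in> e" if "e \<in> edges G" for e
  proof -
   have "\<exists>i. i \<in> e" using edge_two[OF g \<open>e \<in> edges G\<close>] by blast
   thus ?thesis by (rule someI_ex)
  qed
  have "n e \<in> {1..m}" if e': "e \<in> edges G" for e
  proof -
   have "(SOME i. i \<in> e, e) \<in> half_edges G"
    using some[OF e'] e' g unfolding half_edges_def inc_def graph_edges_def by blast
   hence "\<nu> (SOME i. i \<in> e, e) \<in> {1..m}" using \<nu> unfolding configs_def by (rule PiE_mem[rotated])
   thus ?thesis using e' by (simp add: n_def)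
  qed
  hence "n \<in> PiE (edges G) (\<lambda>_. {1..m})" by (auto simp: n_def)
  moreover have "\<nu> = lift n"
  proof
   fix p :: "'v \<times> 'v set"
   show "\<nu> p = lift n p"
   proof (cases "p \<in> half_edges G")
    case True
    then obtain i e where p: "p = (i, e)" "e \<in> edges G" "i \<in> e" by (auto simp: half_edges_def inc_def)
    have "\<nu> (i, e) = \<nu> (SOME i. i \<in> e, e)" using c p(2,3) some[OF p(2)] by blast
    hence "\<nu> p = n e" unfolding p(1) n_def using p(2) by (simp only: restrict_apply')
    thus ?thesis using True p(1) by (simp add: lift_def)
   next
    case False
    thus ?thesis using PiE_arb[OF \<nu>[unfolded configs_def] False] by (simp add: lift_def)
   qed
  qed
  ultimately show "\<nu> \<in> lift ` PiE (edges G) (\<lambda>_. {1..m})" by blast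
 next
  assume "\<nu> \<in> lift ` PiE (edges G) (\<lambda>_. {1..m})"
  then obtain n where n: "\<nu> = lift n" by blast
  have "\<nu> (i, e) = n e" if "e \<in> edges G" "i \<in> e" for e i
  proof -
   have "(i, e) \<in> half_edges G" using that g unfolding half_edges_def inc_def graph_edges_def by blast
   thus ?thesis by (simp add: n lift_def)
  qed
  thus "\<forall>e\<in>edges G. \<forall>i\<in>e. \<forall>j\<in>e. \<nu> (i, e) = \<nu> (j, e)" by simp
 qed
 finally show ?thesis .
qed

lemma lift_inj: "inj_on lift (PiE (edges G) (\<lambda>_. {1..m}))"
proof (rule inj_onI)
 fix n n' assume n: "n \<in> PiE (edges G) (\<lambda>_. {1..m})" "n' \<in> PiE (edges G) (\<lambda>_. {1..m})" and e: "lift n = lift n'"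
 show "n = n'"
 proof (rule PiE_ext[OF n])
  fix e' assume e': "e' \<in> edges G"
  obtain u where "u \<in> e'" "u \<in> verts G" using edge_two[OF g e'] by blast
  hence "(u, e') \<in> half_edges G" using e' by (auto simp: half_edges_def inc_def)
  thus "n e' = n' e'" using fun_cong[OF e, of "(u, e')"] by (simp add: lift_def)
 qed
qed

lemma lift_config: "n \<in> PiE (edges G) (\<lambda>_. {1..m}) \<Longrightarrow> lift n \<in> configs (half_edges G) (\<lambda>_. m)"
 unfolding lift_def configs_def
proof (rule restrict_PiE_iff[THEN iffD2], intro ballI)
 fix p assume n: "n \<in> PiE (edges G) (\<lambda>_. {1..m})" and "p \<in> half_edges G"
 hence "snd p \<in> edges G" by (auto simp: half_edges_def inc_def)
 thus "n (snd p) \<in> {1..m}" using n by (rule PiE_mem[rotated])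
qed

definition weight :: "real \<Rightarrow> ('v set \<Rightarrow> nat) \<Rightarrow> complex" where
 "weight \<epsilon> n = (\<Prod>k<L. lw \<epsilon> k (n (pe k)) (n (le k)))"

text \<open>The common form, before normalization, of the loop states and of their limit.\<close>

definition weighted :: "(('v set \<Rightarrow> nat) \<Rightarrow> complex) \<Rightarrow> 'v state" where
 "weighted w = vec_of (verts G) (sdim G) (\<lambda>\<sigma>. \<Sum>n\<in>PiE (edges G) (\<lambda>_. {1..m}).
   (\<Prod>i\<in>verts G. W i (\<sigma> i) (restrict n (inc G i))) * w n)"

lemma psi_T_weighted:
 assumes "\<epsilon> \<noteq> 0"
 shows "psi_T G m W vs \<epsilon> = normalized (verts G) (sdim G) (weighted (weight \<epsilon>))"
proof -
 have "(\<Sum>\<nu>\<in>configs (half_edges G) (\<lambda>_. m). (\<Prod>i\<in>verts G. W i (\<sigma> i) (\<lambda>e\<in>inc G i. \<nu> (i, e))) * loop_vec G m vs \<epsilon> \<nu>) =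
   (\<Sum>n\<in>PiE (edges G) (\<lambda>_. {1..m}). (\<Prod>i\<in>verts G. W i (\<sigma> i) (restrict n (inc G i))) * weight \<epsilon> n)" for \<sigma>
 proof -
  define h where "h \<nu> = (\<Prod>i\<in>verts G. W i (\<sigma> i) (\<lambda>e\<in>inc G i. \<nu> (i, e))) * (\<Prod>k<L. lw \<epsilon> k (\<nu> (vs ! k, pe k)) (\<nu> (vs ! k, le k)))" for \<nu>
  let ?P = "PiE (edges G) (\<lambda>_. {1..m})"
  have "(\<Sum>\<nu>\<in>configs (half_edges G) (\<lambda>_. m). (\<Prod>i\<in>verts G. W i (\<sigma> i) (\<lambda>e\<in>inc G i. \<nu> (i, e))) * loop_vec G m vs \<epsilon> \<nu>) =
    (\<Sum>\<nu>\<in>configs (half_edges G) (\<lambda>_. m). if \<nu> \<in> lift ` ?P then h \<nu> else 0)"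
   by (rule sum.cong[OF refl]) (simp add: loop_vec_eq[OF _ assms] mu_vec_eq h_def)
  also have "\<dots> = sum h (configs (half_edges G) (\<lambda>_. m) \<inter> lift ` ?P)"
   by (rule sum.inter_restrict[symmetric, OF finite_configs[OF fhalf]])
  also have "configs (half_edges G) (\<lambda>_. m) \<inter> lift ` ?P = lift ` ?P" using lift_config by blast
  also have "sum h (lift ` ?P) = (\<Sum>n\<in>?P. h (lift n))" by (simp only: sum.reindex[OF lift_inj] o_def)
  also have "\<dots> = (\<Sum>n\<in>?P. (\<Prod>i\<in>verts G. W i (\<sigma> i) (restrict n (inc G i))) * weight \<epsilon> n)"
  proof (intro sum.cong refl)
   fix n
   have "(\<lambda>e\<in>inc G i. lift n (i, e)) = restrict n (inc G i)" if "i \<in> verts G" for i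
    using that by (auto simp: lift_def half_edges_def restrict_def fun_eq_iff)
   hence 1: "(\<Prod>i\<in>verts G. W i (\<sigma> i) (\<lambda>e\<in>inc G i. lift n (i, e))) = (\<Prod>i\<in>verts G. W i (\<sigma> i) (restrict n (inc G i)))"
    by (intro prod.cong refl) (simp only:)
   have "lift n (vs ! k, pe k) = n (pe k)" "lift n (vs ! k, le k) = n (le k)" if "k < L" for k
    using vsV[OF that] loop_inc[OF that] by (simp_all add: lift_def half_edges_def)
   hence 2: "(\<Prod>k<L. lw \<epsilon> k (lift n (vs ! k, pe k)) (lift n (vs ! k, le k))) = weight \<epsilon> n"
    unfolding weight_def by (intro prod.cong refl) (simp only: lessThan_iff)
   show "h (lift n) = (\<Prod>i\<in>verts G. W i (\<sigma> i) (restrict n (inc G i))) * weight \<epsilon> n"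
    by (simp only: h_def 1 2)
  qed
  finally show ?thesis .
 qed
 thus ?thesis by (simp only: psi_T_def weighted_def)
qed

text \<open>The weight at a loop vertex depends on two bonds incident to it and is absorbed into its
  tensor.\<close>

lemma weighted_peps_cone:
 assumes b: "\<And>e. e \<in> edges G \<Longrightarrow> bdim G e = m"
 shows "peps_cone G (weighted (weight \<epsilon>))"
proof -
 define A where "A i s n = W i s n * (\<Prod>k<L. if vs ! k = i then lw \<epsilon> k (n (pe k)) (n (le k)) else 1)" for i s n
 have "(\<Prod>i\<in>verts G. A i (\<sigma> i) (restrict n (inc G i))) = (\<Prod>i\<in>verts G. W i (\<sigma> i) (restrict n (inc G i))) * weight \<epsilon> n" for \<sigma> n
 proof -
  have "(\<Prod>i\<in>verts G. \<Prod>k<L. if vs ! k = i then lw \<epsilon> k (restrict n (inc G i) (pe k)) (restrict n (inc G i) (le k)) else 1) =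
    (\<Prod>k<L. \<Prod>i\<in>verts G. if i = vs ! k then lw \<epsilon> k (n (pe k)) (n (le k)) else 1)"
   by (subst prod.swap, intro prod.cong refl) (use loop_inc in auto)
  also have "\<dots> = weight \<epsilon> n" unfolding weight_def
   by (intro prod.cong refl) (use fV vsV in simp)
  finally show ?thesis by (simp add: A_def prod.distrib)
 qed
 moreover have "PiE (edges G) (\<lambda>e. {1..bdim G e}) = PiE (edges G) (\<lambda>_. {1..m})" by (rule PiE_cong) (simp add: b)
 ultimately have "weighted (weight \<epsilon>) = peps_vec G A" by (simp only: weighted_def peps_vec_def)
 thus ?thesis unfolding peps_cone_def by blast
qed

section \<open>Domain walls and the limit of the loop states\<close>

definition jumps :: "('v set \<Rightarrow> nat) \<Rightarrow> nat set" where
 "jumps n = {k\<in>{..<L - 1}. n (pe k) \<noteq> n (le k)}"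

text \<open>The value at \<open>\<epsilon> = 0\<close>: the walls before the last vertex must be
  exactly compensated there.\<close>

definition limit_weight :: "('v set \<Rightarrow> nat) \<Rightarrow> complex" where
 "limit_weight n = (if card (jumps n) = (if n (pe (L - 1)) \<noteq> n (le (L - 1)) then 1 else 0) then 1 else 0)"

abbreviation limit_vec :: "'v state" where "limit_vec \<equiv> weighted limit_weight"

abbreviation cfgs :: "('v \<Rightarrow> nat) set" where "cfgs \<equiv> configs (verts G) (sdim G)"

abbreviation vbonds :: "('v set \<Rightarrow> nat) set" where "vbonds \<equiv> PiE (edges G) (\<lambda>_. {1..m})"

text \<open>A label that is constant up to the last vertex has nothing to change there: a closed
  loop cannot have a single wall. This keeps the exponent of \<open>\<epsilon>\<close>
  nonnegative.\<close>

lemma jumps_closed: "n (pe (L - 1)) \<noteq> n (le (L - 1)) \<Longrightarrow> jumps n \<noteq> {}"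
proof
 assume a: "n (pe (L - 1)) \<noteq> n (le (L - 1))" and "jumps n = {}"
 hence e: "n (pe k) = n (le k)" if "k < L - 1" for k using that by (auto simp: jumps_def)
 have "k < L - 1 \<longrightarrow> n (le k) = n (le (L - 1))" for k
 proof (induction k)
  case 0
  thus ?case using e[of 0] pe_le[OF L_facts(1)] by simp
 next
  case (Suc k)
  thus ?case using e[of "Suc k"] pe_le[of "Suc k"] by auto
 qed
 hence "n (le (L - 2)) = n (le (L - 1))" using L3 by simp
 moreover have "pe (L - 1) = le (L - 2)" using pe_le[of "L - 1"] L3 by (simp add: numeral_2_eq_2)
 ultimately show False using a by simp
qed

lemma weight_power:
 assumes "\<epsilon> \<noteq> 0"
 shows "weight \<epsilon> n = of_real \<epsilon> ^ (card (jumps n) - (if n (pe (L - 1)) \<noteq> n (le (L - 1)) then 1 else 0))"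
proof -
 have i: "{..<L} = insert (L - 1) {..<L - 1}" using L3 by auto
 have "(\<Prod>k<L - 1. lw \<epsilon> k (n (pe k)) (n (le k))) = (\<Prod>k<L - 1. if n (pe k) \<noteq> n (le k) then of_real \<epsilon> else 1)"
  by (rule prod.cong) (auto simp: lw_def)
 also have "\<dots> = of_real \<epsilon> ^ card (jumps n)"
  unfolding jumps_def by (subst prod.inter_filter[symmetric]) simp_all
 finally have w: "weight \<epsilon> n = lw \<epsilon> (L - 1) (n (pe (L - 1))) (n (le (L - 1))) * of_real \<epsilon> ^ card (jumps n)"
  unfolding weight_def i by (subst prod.insert) simp_all
 show ?thesis
 proof (cases "n (pe (L - 1)) = n (le (L - 1))")
  case True
  thus ?thesis by (simp add: w lw_def)
 next
  case False
  have "finite (jumps n)" by (simp add: jumps_def)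
  hence "card (jumps n) > 0" using jumps_closed[OF False] by (simp add: card_gt_0_iff)
  then obtain c where "card (jumps n) = Suc c" by (cases "card (jumps n)") auto
  thus ?thesis using False assms L3 by (simp add: w lw_def)
 qed
qed

lemma weighted_tendsto:
 assumes "\<And>k. \<epsilon> k \<noteq> 0" "\<epsilon> \<longlonglongrightarrow> 0"
 shows "(\<lambda>k::nat. weighted (weight (\<epsilon> k)) \<sigma>) \<longlonglongrightarrow> limit_vec \<sigma>"
proof (cases "\<sigma> \<in> cfgs")
 case True
 have w: "(\<lambda>k. weight (\<epsilon> k) n) \<longlonglongrightarrow> limit_weight n" for n
 proof -
  define d where "d = card (jumps n) - (if n (pe (L - 1)) \<noteq> n (le (L - 1)) then 1 else 0)"
  have fj: "finite (jumps n)" by (simp add: jumps_def)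
  have lim: "limit_weight n = 0 ^ d"
  proof (cases "n (pe (L - 1)) = n (le (L - 1))")
   case True
   thus ?thesis by (simp add: limit_weight_def d_def power_0_left)
  next
   case False
   hence "card (jumps n) > 0" using jumps_closed[OF False] fj by (simp add: card_gt_0_iff)
   then obtain c where "card (jumps n) = Suc c" by (cases "card (jumps n)") auto
   thus ?thesis using False by (simp add: limit_weight_def d_def power_0_left)
  qed
  have "(\<lambda>k. complex_of_real (\<epsilon> k)) \<longlonglongrightarrow> of_real 0" using assms(2) by (rule tendsto_of_real)
  hence "(\<lambda>k. complex_of_real (\<epsilon> k) ^ d) \<longlonglongrightarrow> of_real 0 ^ d" by (rule tendsto_power)
  thus ?thesis unfolding lim weight_power[OF assms(1)] d_def by simp
 qed
 have "(\<lambda>k. \<Sum>n\<in>vbonds. (\<Prod>i\<in>verts G. W i (\<sigma> i) (restrict n (inc G i))) * weight (\<epsilon> k) n) \<longlonglongrightarrow>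
   (\<Sum>n\<in>vbonds. (\<Prod>i\<in>verts G. W i (\<sigma> i) (restrict n (inc G i))) * limit_weight n)"
  by (intro tendsto_sum tendsto_mult tendsto_const w)
 thus ?thesis using True by (simp only: weighted_def vec_of_def if_True)
next
 case False
 thus ?thesis by (simp add: weighted_def vec_of_def)
qed

text \<open>Two neighbouring loop vertices form classes of their own. The rest of the network,
  including the last loop vertex with its inverse weight, is the third class.\<close>

definition cl :: "'v \<Rightarrow> nat" where
 "cl i = (if i = vs ! 0 then 0 else if i = vs ! 1 then 1 else 2)"

abbreviation ce :: "nat \<Rightarrow> nat \<Rightarrow> 'v set set" where "ce i j \<equiv> class_edges G cl i j"
abbreviation cv :: "nat \<Rightarrow> 'v set" where "cv i \<equiv> class_verts G cl i"
abbreviation bc :: "nat \<Rightarrow> nat \<Rightarrow> ('v set \<Rightarrow> nat) set" where "bc i j \<equiv> PiE (ce i j) (\<lambda>_. {1..m})"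

lemma cl_less: "cl v < 3" by (simp add: cl_def)

lemma cl_vs: "k < L \<Longrightarrow> cl (vs ! k) = (if k = 0 then 0 else if k = 1 then 1 else 2)"
 using nth_eq_iff_index_eq[OF dist _ L_facts(1), of k] nth_eq_iff_index_eq[OF dist _ L_facts(2), of k] by (simp add: cl_def)

lemma cl_le: "k < L \<Longrightarrow> cl ` le k = (if k = 0 then {0, 1} else if k = 1 then {1, 2} else if Suc k = L then {2, 0} else {2})"
proof -
 assume k: "k < L"
 have "cl ` le k = {cl (vs ! k), cl (vs ! (Suc k mod L))}" by (simp add: le_def)
 moreover have "cl (vs ! (Suc k mod L)) = (if Suc k = L then 0 else if k = 0 then 1 else 2)"
 proof (cases "Suc k = L")
  case True
  thus ?thesis using cl_vs[OF L_facts(1)] by auto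
 next
  case False
  hence "Suc k < L" using k by simp
  thus ?thesis using cl_vs[of "Suc k"] by auto
 qed
 moreover have "Suc k = L \<Longrightarrow> k \<noteq> 0 \<and> k \<noteq> 1" using L3 by auto
 ultimately show ?thesis unfolding cl_vs[OF k] by (cases "Suc k = L"; cases "k = 0"; cases "k = 1") (simp_all add: insert_commute)
qed

lemma ce_disj: "ce 2 0 \<inter> ce 0 1 = {}" "ce 2 0 \<inter> ce 1 2 = {}" "ce 0 1 \<inter> ce 1 2 = {}"
proof -
 have d: "ce i j \<inter> ce k l = {}" if ne: "{i, j} \<noteq> {k, l}" for i j k l
 proof (rule equals0I)
  fix e assume "e \<in> ce i j \<inter> ce k l"
  hence e: "cl ` e = {i, j}" "cl ` e = {k, l}" unfolding class_edges_def by blast+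
  show False using ne unfolding e(1)[symmetric] e(2)[symmetric] by simp
 qed
 show "ce 2 0 \<inter> ce 0 1 = {}" by (rule d) (simp add: doubleton_eq_iff)
 show "ce 2 0 \<inter> ce 1 2 = {}" by (rule d) (simp add: doubleton_eq_iff)
 show "ce 0 1 \<inter> ce 1 2 = {}" by (rule d) (simp add: doubleton_eq_iff)
qed

lemma le_ce: "le 0 \<in> ce 0 1" "le 1 \<in> ce 1 2" "le (L - 1) \<in> ce 2 0"
proof -
 have "L - 1 \<noteq> 0" "L - 1 \<noteq> 1" "Suc (L - 1) = L" using L3 by auto
 hence "cl ` le (L - 1) = {2, 0}" using cl_le[OF L_facts(4)] by (simp only: if_False if_True simp_thms)
 moreover have "cl ` le 0 = {0, 1}" using cl_le[OF L_facts(1)] by (simp only: if_True simp_thms)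
 moreover have "cl ` le 1 = {1, 2}" using cl_le[OF L_facts(2)] by (simp only: if_True if_False one_neq_zero simp_thms)
 ultimately show "le 0 \<in> ce 0 1" "le 1 \<in> ce 1 2" "le (L - 1) \<in> ce 2 0"
  unfolding class_edges_def using le_edge[OF L_facts(1)] le_edge[OF L_facts(2)] le_edge[OF L_facts(4)] by blast+
qed

lemma le_inner: "2 \<le> k \<Longrightarrow> k < L - 1 \<Longrightarrow> le k \<notin> ce 2 0 \<and> le k \<notin> ce 0 1 \<and> le k \<notin> ce 1 2"
proof -
 assume k: "2 \<le> k" "k < L - 1"
 hence "k < L" "k \<noteq> 0" "k \<noteq> 1" "Suc k \<noteq> L" by auto
 hence "cl ` le k = {2}" using cl_le[of k] by (simp only: if_False)
 moreover have "{2} \<noteq> {2, 0::nat}" "{2} \<noteq> {0, 1::nat}" "{2} \<noteq> {1, 2::nat}" by auto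
 ultimately show ?thesis unfolding class_edges_def by (simp only: mem_Collect_eq simp_thms)
qed

lemma ce_sub: "ce i j \<subseteq> edges G" by (auto simp: class_edges_def)

text \<open>Extends labels of the bonds between classes to all bonds. On the part of the loop inside
  class 2 the label of \<open>le 1\<close> is continued, so walls can occur at
  \<open>vs ! 0\<close>, \<open>vs ! 1\<close> and the last vertex; any other bond inside a class
  gets label 1.\<close>

definition merge :: "('v set \<Rightarrow> nat) \<Rightarrow> ('v set \<Rightarrow> nat) \<Rightarrow> ('v set \<Rightarrow> nat) \<Rightarrow> 'v set \<Rightarrow> nat" where
 "merge x y z = (\<lambda>e\<in>edges G. if e \<in> ce 2 0 then x e else if e \<in> ce 0 1 then y e else if e \<in> ce 1 2 then z e
   else if \<exists>k. 2 \<le> k \<and> k < L - 1 \<and> e = le k then z (le 1) else 1)"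

lemma merge_simps:
 "e \<in> ce 2 0 \<Longrightarrow> merge x y z e = x e" "e \<in> ce 0 1 \<Longrightarrow> merge x y z e = y e" "e \<in> ce 1 2 \<Longrightarrow> merge x y z e = z e"
 "2 \<le> k \<Longrightarrow> k < L - 1 \<Longrightarrow> merge x y z (le k) = z (le 1)"
proof -
 show "merge x y z e = x e" if "e \<in> ce 2 0" using that ce_sub[of 2 0] by (auto simp: merge_def)
 show "merge x y z e = y e" if "e \<in> ce 0 1" using that ce_sub[of 0 1] ce_disj by (auto simp: merge_def)
 show "merge x y z e = z e" if "e \<in> ce 1 2" using that ce_sub[of 1 2] ce_disj by (auto simp: merge_def)
 show "merge x y z (le k) = z (le 1)" if "2 \<le> k" "k < L - 1"
  using that le_inner[OF that] le_edge[of k] by (auto simp: merge_def)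
qed

lemma merge_PiE:
 assumes "\<And>e. e \<in> ce 2 0 \<Longrightarrow> x e \<in> {1..m}" "\<And>e. e \<in> ce 0 1 \<Longrightarrow> y e \<in> {1..m}" "\<And>e. e \<in> ce 1 2 \<Longrightarrow> z e \<in> {1..m}"
 shows "merge x y z \<in> vbonds"
proof -
 have "1 \<in> {1..m}" using m by simp
 thus ?thesis using assms le_ce(2) unfolding merge_def by (intro restrict_PiE_iff[THEN iffD2] ballI) (simp split: if_split)
qed

definition compatible :: "nat \<Rightarrow> nat \<Rightarrow> nat \<Rightarrow> bool" where
 "compatible i j l \<longleftrightarrow> (if i \<noteq> j then 1 else 0) + (if j \<noteq> l then 1 else 0) = (if l \<noteq> i then 1 else (0::nat))"

text \<open>Walls can separate \<open>x\<close> from \<open>y\<close> at vertex 0, \<open>y\<close>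
  from \<open>z\<close> at vertex 1, and \<open>z\<close> from \<open>x\<close> at the last
  vertex.\<close>

lemma limit_weight_merge:
 "limit_weight (merge x y z) = (if compatible (x (le (L - 1))) (y (le 0)) (z (le 1)) then 1 else 0)"
proof -
 let ?n = "merge x y z" and ?x = "x (le (L - 1))" and ?y = "y (le 0)" and ?z = "z (le 1)"
 have n: "?n (le 0) = ?y" "?n (le 1) = ?z" "?n (le (L - 1)) = ?x"
  using le_ce by (simp_all only: merge_simps)
 have inner: "?n (le k) = ?z" if "1 \<le> k" "k < L - 1" for k
  using that n(2) merge_simps(4)[of k x y z] by (cases "k = 1") auto
 have p: "pe 0 = le (L - 1)" "pe 1 = le 0" using pe_le[OF L_facts(1)] pe_le[OF L_facts(2)] by simp_all
 have pk: "pe k = le (k - 1)" if "1 \<le> k" "k < L" for k using pe_le[of k] that by auto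
 have last: "?n (pe (L - 1)) = ?z"
  using pk[of "L - 1"] inner[of "L - 1 - 1"] L3 by simp
 have "jumps ?n = (if ?x \<noteq> ?y then {0} else {}) \<union> (if ?y \<noteq> ?z then {1} else {})" (is "_ = ?R")
 proof (rule Set.set_eqI)
  fix k
  consider "k = 0" | "k = 1" | "2 \<le> k" "k < L - 1" | "2 \<le> k" "\<not> k < L - 1" by linarith
  thus "k \<in> jumps ?n \<longleftrightarrow> k \<in> ?R"
  proof cases
   case 1
   thus ?thesis using n p L3 by (simp add: jumps_def)
  next
   case 2
   have "1 < L - 1" using L3 by linarith
   hence "k \<in> jumps ?n \<longleftrightarrow> ?n (pe 1) \<noteq> ?n (le 1)" using 2 by (simp add: jumps_def)
   thus ?thesis unfolding n p using 2 by auto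
  next
   case 3
   hence "?n (pe k) = ?z" "?n (le k) = ?z" using inner[of k] inner[of "k - 1"] pk[of k] by auto
   thus ?thesis using 3 by (simp add: jumps_def)
  next
   case 4
   thus ?thesis by (simp add: jumps_def)
  qed
 qed
 hence "card (jumps ?n) = (if ?x \<noteq> ?y then 1 else 0) + (if ?y \<noteq> ?z then 1 else 0)" by simp
 thus ?thesis unfolding limit_weight_def last n compatible_def by simp
qed

lemma edge_class:
 assumes "e \<in> edges G" "i \<in> e"
 shows "cl i = 0 \<Longrightarrow> e \<in> ce 2 0 \<union> ce 0 1" "cl i = 1 \<Longrightarrow> e \<in> ce 0 1 \<union> ce 1 2"
proof -
 obtain j where j: "e = {i, j}" "i \<noteq> j"
 proof -
  obtain u v where "e = {u, v}" "u \<noteq> v" using edge_two[OF g assms(1)] by blast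
  thus thesis using assms(2) that[of u] that[of v] by (auto simp: insert_commute)
 qed
 have ce: "e \<in> ce a b" if "{cl i, cl j} = {a, b}" for a b
  using assms(1) that by (simp add: class_edges_def j(1))
 show "e \<in> ce 2 0 \<union> ce 0 1" if i: "cl i = 0"
 proof -
  have "i = vs ! 0"
  proof (rule ccontr)
   assume "i \<noteq> vs ! 0"
   hence "cl i \<noteq> 0" by (simp add: cl_def)
   thus False using i by simp
  qed
  hence "cl j = 1 \<or> cl j = 2" using j(2) by (simp add: cl_def)
  thus ?thesis
  proof
   assume "cl j = 1"
   hence "{cl i, cl j} = {0, 1}" by (simp only: i)
   thus ?thesis by (intro UnI2 ce)
  next
   assume "cl j = 2"
   hence "{cl i, cl j} = {2, 0}" by (simp only: i insert_commute)
   thus ?thesis by (intro UnI1 ce)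
  qed
 qed
 show "e \<in> ce 0 1 \<union> ce 1 2" if i: "cl i = 1"
 proof -
  have "i = vs ! 1"
  proof (rule ccontr)
   assume "i \<noteq> vs ! 1"
   hence "cl i \<noteq> 1" by (simp add: cl_def)
   thus False using i by simp
  qed
  hence "j \<noteq> vs ! 1" using j(2) by simp
  hence "cl j = 0 \<or> cl j = 2" by (simp add: cl_def)
  thus ?thesis
  proof
   assume "cl j = 0"
   hence "{cl i, cl j} = {0, 1}" by (simp only: i insert_commute)
   thus ?thesis by (intro UnI1 ce)
  next
   assume "cl j = 2"
   hence "{cl i, cl j} = {1, 2}" by (simp only: i)
   thus ?thesis by (intro UnI2 ce)
  qed
 qed
qed

text \<open>What each class sees of its own copies of the boundary labels. The boundary not
  belonging to the class is filled with 1, which none of its vertices reads.\<close>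

definition local_merge where
 "local_merge x y y' z z' x' i = (if cl i = 0 then merge x y (\<lambda>_. 1) else if cl i = 1 then merge (\<lambda>_. 1) y' z else merge x' (\<lambda>_. 1) z')"

lemma ce_ends:
 assumes e: "e \<in> ce a b" shows "\<exists>i\<in>e. i \<in> verts G \<and> cl i = a" "\<exists>i\<in>e. i \<in> verts G \<and> cl i = b"
proof -
 have "a \<in> cl ` e" "b \<in> cl ` e" "e \<subseteq> verts G" using e g by (auto simp: class_edges_def graph_edges_def)
 thus "\<exists>i\<in>e. i \<in> verts G \<and> cl i = a" "\<exists>i\<in>e. i \<in> verts G \<and> cl i = b" by blast+
qed

text \<open>A bond between two classes is read from both ends, which forces the two copies of its
  label to agree. A bond inside class 2 is read by that class alone, and there \<open>merge\<close>
  prescribes its label.\<close>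

lemma local_merge_match:
 assumes x: "x \<in> bc 2 0" "x' \<in> bc 2 0" and y: "y \<in> bc 0 1" "y' \<in> bc 0 1" and z: "z \<in> bc 1 2" "z' \<in> bc 1 2"
  and n: "n \<in> vbonds"
 shows "(\<forall>i\<in>verts G. restrict n (inc G i) = restrict (local_merge x y y' z z' x' i) (inc G i)) \<longleftrightarrow>
   x = x' \<and> y = y' \<and> z = z' \<and> n = merge x y z"
proof
 assume a: "\<forall>i\<in>verts G. restrict n (inc G i) = restrict (local_merge x y y' z z' x' i) (inc G i)"
 have ne: "n e = local_merge x y y' z z' x' i e" if "e \<in> edges G" "i \<in> e" "i \<in> verts G" for e i
 proof -
  have "e \<in> inc G i" using that by (simp add: inc_def)
  moreover have "restrict n (inc G i) e = restrict (local_merge x y y' z z' x' i) (inc G i) e"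
   using bspec[OF a that(3)] by (rule fun_cong)
  ultimately show ?thesis by (simp only: restrict_apply')
 qed
 have 20: "n e = x e \<and> n e = x' e" if e: "e \<in> ce 2 0" for e
 proof -
  obtain i j where "i \<in> e" "i \<in> verts G" "cl i = 2" "j \<in> e" "j \<in> verts G" "cl j = 0" using ce_ends[OF e] by blast
  thus ?thesis using ne[of e i] ne[of e j] e ce_sub[of 2 0] by (auto simp: local_merge_def merge_simps)
 qed
 have 01: "n e = y e \<and> n e = y' e" if e: "e \<in> ce 0 1" for e
 proof -
  obtain i j where "i \<in> e" "i \<in> verts G" "cl i = 0" "j \<in> e" "j \<in> verts G" "cl j = 1" using ce_ends[OF e] by blast
  thus ?thesis using ne[of e i] ne[of e j] e ce_sub[of 0 1] by (auto simp: local_merge_def merge_simps)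
 qed
 have 12: "n e = z e \<and> n e = z' e" if e: "e \<in> ce 1 2" for e
 proof -
  obtain i j where "i \<in> e" "i \<in> verts G" "cl i = 1" "j \<in> e" "j \<in> verts G" "cl j = 2" using ce_ends[OF e] by blast
  thus ?thesis using ne[of e i] ne[of e j] e ce_sub[of 1 2] by (auto simp: local_merge_def merge_simps)
 qed
 have xx: "x = x'" by (rule PiE_ext[OF x]) (use 20 in force)
 have yy: "y = y'" by (rule PiE_ext[OF y]) (use 01 in force)
 have zz: "z = z'" by (rule PiE_ext[OF z]) (use 12 in force)
 have "merge x y z \<in> vbonds" by (rule merge_PiE) (use x y z in \<open>auto dest: PiE_mem\<close>)
 from n this have "n = merge x y z"
 proof (rule PiE_ext)
  fix e assume e: "e \<in> edges G"
  show "n e = merge x y z e"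
  proof (cases "e \<in> ce 2 0 \<union> ce 0 1 \<union> ce 1 2")
   case True
   thus ?thesis using 20 01 12 merge_simps(1,2,3) by auto
  next
   case False
   obtain i where i: "i \<in> e" "i \<in> verts G" using edge_two[OF g e] by blast
   hence "cl i \<noteq> 0" "cl i \<noteq> 1" using edge_class[OF e i(1)] False by auto
   hence "n e = merge x' (\<lambda>_. 1) z' e" using ne[OF e i] by (simp add: local_merge_def)
   thus ?thesis using False e by (simp add: merge_def zz)
  qed
 qed
 thus "x = x' \<and> y = y' \<and> z = z' \<and> n = merge x y z" using xx yy zz by blast
next
 assume a: "x = x' \<and> y = y' \<and> z = z' \<and> n = merge x y z"
 show "\<forall>i\<in>verts G. restrict n (inc G i) = restrict (local_merge x y y' z z' x' i) (inc G i)"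
 proof (intro ballI restrict_ext)
  fix i e assume i: "i \<in> verts G" and e: "e \<in> inc G i"
  have e': "e \<in> edges G" "i \<in> e" using e by (auto simp: inc_def)
  consider "cl i = 0" | "cl i = 1" | "cl i = 2" using cl_less[of i] by linarith
  thus "n e = local_merge x y y' z z' x' i e"
  proof cases
   case 1
   thus ?thesis using edge_class(1)[OF e' 1] a by (auto simp: local_merge_def merge_simps)
  next
   case 2
   thus ?thesis using edge_class(2)[OF e' 2] a by (auto simp: local_merge_def merge_simps)
  next
   case 3
   have "e \<notin> ce 0 1"
   proof
    assume "e \<in> ce 0 1"
    hence "cl i \<in> {0, 1}" using e'(2) by (auto simp: class_edges_def)
    thus False using 3 by simp
   qed
   hence "merge x y z e = merge x (\<lambda>_. 1) z e" unfolding merge_def restrict_apply'[OF e'(1)] by (simp only: if_False)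
   thus ?thesis using 3 a by (simp add: local_merge_def)
  qed
 qed
qed

definition glue :: "('v \<Rightarrow> nat) \<Rightarrow> ('v \<Rightarrow> nat) \<Rightarrow> ('v \<Rightarrow> nat) \<Rightarrow> 'v \<Rightarrow> nat" where
 "glue s0 s1 s2 = (\<lambda>i. if i \<in> cv 0 \<union> cv 1 then (if i \<in> cv 0 then s0 i else s1 i) else s2 i)"

abbreviation sites :: "nat \<Rightarrow> ('v \<Rightarrow> nat) set" where "sites c \<equiv> configs (cv c) (sdim G)"

lemma cv_Un: "cv 0 \<union> cv 1 \<union> cv 2 = verts G" and cv_disj: "cv 0 \<inter> cv 1 = {}" "(cv 0 \<union> cv 1) \<inter> cv 2 = {}"
proof -
 have "v \<in> cv 0 \<union> cv 1 \<union> cv 2" if "v \<in> verts G" for v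
  using that by (auto simp: class_verts_def cl_def)
 thus "cv 0 \<union> cv 1 \<union> cv 2 = verts G" by (auto simp: class_verts_def)
qed (auto simp: class_verts_def)

lemma sum_glue: "(\<Sum>\<sigma>\<in>cfgs. f \<sigma>) = (\<Sum>s0\<in>sites 0. \<Sum>s1\<in>sites 1. \<Sum>s2\<in>sites 2. f (glue s0 s1 s2))"
 unfolding configs_def glue_def by (subst cv_Un[symmetric]) (simp only: sum_PiE_Un[OF cv_disj(2)] sum_PiE_Un[OF cv_disj(1)])

lemma glue_config: "s0 \<in> sites 0 \<Longrightarrow> s1 \<in> sites 1 \<Longrightarrow> s2 \<in> sites 2 \<Longrightarrow> glue s0 s1 s2 \<in> cfgs"
 unfolding configs_def glue_def using cv_Un cv_disj by (auto simp: PiE_iff extensional_def)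

lemma glue_restrict:
 assumes "s0 \<in> sites 0" "s1 \<in> sites 1" "s2 \<in> sites 2"
 shows "restrict (glue s0 s1 s2) (cv 0) = s0" "restrict (glue s0 s1 s2) (cv 1) = s1" "restrict (glue s0 s1 s2) (cv 2) = s2"
 using assms cv_disj unfolding configs_def glue_def
 by (auto simp: fun_eq_iff PiE_iff extensional_def restrict_def)

text \<open>The conjugated embeddings. As these are isometric, they act as functionals dual to the
  bond labels around the sites of class \<open>c\<close>.\<close>

definition site_probe where
 "site_probe c n s = (\<Prod>i\<in>cv c. cnj (W i (s i) (restrict n (inc G i))))"

lemma probe_glue:
 "site_probe 0 (merge x y (\<lambda>_. 1)) s0 * site_probe 1 (merge (\<lambda>_. 1) y' z) s1 * site_probe 2 (merge x' (\<lambda>_. 1) z') s2 =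
  (\<Prod>i\<in>verts G. cnj (W i (glue s0 s1 s2 i) (restrict (local_merge x y y' z z' x' i) (inc G i))))"
proof -
 have f: "finite (cv c)" for c using fV by (simp add: class_verts_def)
 let ?h = "\<lambda>i. cnj (W i (glue s0 s1 s2 i) (restrict (local_merge x y y' z z' x' i) (inc G i)))"
 have "(\<Prod>i\<in>verts G. ?h i) = (\<Prod>i\<in>cv 0. ?h i) * (\<Prod>i\<in>cv 1. ?h i) * (\<Prod>i\<in>cv 2. ?h i)"
  unfolding cv_Un[symmetric] using f cv_disj by (simp add: prod.union_disjoint)
 moreover have "(\<Prod>i\<in>cv 0. ?h i) = site_probe 0 (merge x y (\<lambda>_. 1)) s0"
  unfolding site_probe_def by (rule prod.cong) (auto simp: glue_def local_merge_def class_verts_def)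
 moreover have "(\<Prod>i\<in>cv 1. ?h i) = site_probe 1 (merge (\<lambda>_. 1) y' z) s1"
  unfolding site_probe_def by (rule prod.cong) (auto simp: glue_def local_merge_def class_verts_def)
 moreover have "(\<Prod>i\<in>cv 2. ?h i) = site_probe 2 (merge x' (\<lambda>_. 1) z') s2"
  unfolding site_probe_def by (rule prod.cong) (auto simp: glue_def local_merge_def class_verts_def)
 ultimately show ?thesis by simp
qed

text \<open>Isometry of the embeddings annihilates every bond configuration that differs from the
  probed labels at some vertex. By \<open>local_merge_match\<close> at most one survives, and its
  limit weight is the result.\<close>

lemma loop_pullback:
 assumes x: "x \<in> bc 2 0" "x' \<in> bc 2 0" and y: "y \<in> bc 0 1" "y' \<in> bc 0 1" and z: "z \<in> bc 1 2" "z' \<in> bc 1 2"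
 shows "(\<Sum>s0\<in>sites 0. \<Sum>s1\<in>sites 1. \<Sum>s2\<in>sites 2. site_probe 0 (merge x y (\<lambda>_. 1)) s0 * site_probe 1 (merge (\<lambda>_. 1) y' z) s1 *
    site_probe 2 (merge x' (\<lambda>_. 1) z') s2 * limit_vec (glue s0 s1 s2)) =
   (if x = x' \<and> y = y' \<and> z = z' \<and> compatible (x (le (L - 1))) (y (le 0)) (z (le 1)) then 1 else 0)"
proof -
 define M where "M = local_merge x y y' z z' x'"
 let ?P = "vbonds"
 have r: "restrict n (inc G i) \<in> PiE (inc G i) (\<lambda>_. {1..m})" if "n \<in> ?P" for n i
  using that by (auto simp: inc_def)
 have M: "M i \<in> ?P" for i
 proof -
  have 1: "1 \<in> {1..m}" using m by simp
  have "merge x y (\<lambda>_. 1) \<in> ?P" "merge (\<lambda>_. 1) y' z \<in> ?P" "merge x' (\<lambda>_. 1) z' \<in> ?P"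
   by (rule merge_PiE[OF PiE_mem[OF x(1)] PiE_mem[OF y(1)] 1], assumption+)
    (rule merge_PiE[OF 1 PiE_mem[OF y(2)] PiE_mem[OF z(1)]], assumption+,
     rule merge_PiE[OF PiE_mem[OF x(2)] 1 PiE_mem[OF z(2)]], assumption+)
  thus ?thesis by (simp add: M_def local_merge_def)
 qed
 have orth: "(\<Sum>s\<in>{1..sdim G i}. cnj (W i s (restrict (M i) (inc G i))) * W i s (restrict n (inc G i))) =
   (if restrict n (inc G i) = restrict (M i) (inc G i) then 1 else 0)" if "i \<in> verts G" "n \<in> ?P" for i n
  by (rule trans[OF emb[unfolded site_embedding_def, rule_format, OF that(1) r[OF M] r[OF that(2)]] if_cong[OF eq_commute refl refl]])
 have "(\<Sum>s0\<in>sites 0. \<Sum>s1\<in>sites 1. \<Sum>s2\<in>sites 2. site_probe 0 (merge x y (\<lambda>_. 1)) s0 * site_probe 1 (merge (\<lambda>_. 1) y' z) s1 *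
    site_probe 2 (merge x' (\<lambda>_. 1) z') s2 * limit_vec (glue s0 s1 s2)) =
   (\<Sum>\<sigma>\<in>cfgs. (\<Prod>i\<in>verts G. cnj (W i (\<sigma> i) (restrict (M i) (inc G i)))) * limit_vec \<sigma>)"
  unfolding sum_glue probe_glue M_def by (rule refl)
 also have "\<dots> = (\<Sum>\<sigma>\<in>cfgs. \<Sum>n\<in>?P. limit_weight n *
   (\<Prod>i\<in>verts G. cnj (W i (\<sigma> i) (restrict (M i) (inc G i))) * W i (\<sigma> i) (restrict n (inc G i))))"
  by (rule sum.cong[OF refl]) (simp add: weighted_def vec_of_def sum_distrib_left prod.distrib mult_ac)
 also have "\<dots> = (\<Sum>n\<in>?P. limit_weight n * (\<Sum>\<sigma>\<in>cfgs.
   \<Prod>i\<in>verts G. cnj (W i (\<sigma> i) (restrict (M i) (inc G i))) * W i (\<sigma> i) (restrict n (inc G i))))"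
  by (subst sum.swap) (simp only: sum_distrib_left)
 also have "\<dots> = (\<Sum>n\<in>?P. limit_weight n * (\<Prod>i\<in>verts G. \<Sum>s\<in>{1..sdim G i}. cnj (W i s (restrict (M i) (inc G i))) * W i s (restrict n (inc G i))))"
  unfolding configs_def by (subst prod_sum_PiE) (use fV in simp_all)
 also have "\<dots> = (\<Sum>n\<in>?P. limit_weight n * (if \<forall>i\<in>verts G. restrict n (inc G i) = restrict (M i) (inc G i) then 1 else 0))"
 proof (intro sum.cong refl arg_cong2[of _ _ _ _ "(*)"])
  fix n assume n: "n \<in> ?P"
  have "(\<Prod>i\<in>verts G. \<Sum>s\<in>{1..sdim G i}. cnj (W i s (restrict (M i) (inc G i))) * W i s (restrict n (inc G i))) =
    (\<Prod>i\<in>verts G. if restrict n (inc G i) = restrict (M i) (inc G i) then 1 else 0)"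
   by (rule prod.cong[OF refl orth[OF _ n]])
  thus "(\<Prod>i\<in>verts G. \<Sum>s\<in>{1..sdim G i}. cnj (W i s (restrict (M i) (inc G i))) * W i s (restrict n (inc G i))) =
    (if \<forall>i\<in>verts G. restrict n (inc G i) = restrict (M i) (inc G i) then 1 else 0)"
   by (simp only: prod_indicator[OF fV])
 qed
 also have "\<dots> = (\<Sum>n\<in>?P. if n = merge x y z then (if x = x' \<and> y = y' \<and> z = z' then limit_weight (merge x y z) else 0) else 0)"
  by (intro sum.cong refl) (auto simp: M_def local_merge_match[OF x y z])
 also have "\<dots> = (if x = x' \<and> y = y' \<and> z = z' then limit_weight (merge x y z) else 0)"
 proof -
  have "merge x y z \<in> ?P" by (rule merge_PiE) (use x y z in \<open>auto dest: PiE_mem\<close>)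
  thus ?thesis using fE by (simp add: finite_PiE)
 qed
 finally show ?thesis by (simp add: limit_weight_merge)
qed

text \<open>The bond sets are abstract and only their sizes are prescribed, so that the same
  statement applies to fine-grained networks. Forbidden are \<open>i \<noteq> j\<close> with
  \<open>j \<noteq> l\<close>, which would need two walls at the last vertex, and
  \<open>i \<noteq> j\<close> with \<open>l = i\<close>, which would need a wall there although none
  is possible. There are \<open>m * (m - 1)\<close> unequal and \<open>m\<close> equal
  pairs.\<close>

theorem weighted_no_triangle:
 fixes T0 :: "('v \<Rightarrow> nat) \<Rightarrow> 'a \<Rightarrow> 'b \<Rightarrow> complex" and T1 :: "('v \<Rightarrow> nat) \<Rightarrow> 'b \<Rightarrow> 'c \<Rightarrow> complex" and T2 :: "('v \<Rightarrow> nat) \<Rightarrow> 'c \<Rightarrow> 'a \<Rightarrow> complex"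
 assumes tri: "\<And>\<sigma>. \<sigma> \<in> cfgs \<Longrightarrow> limit_vec \<sigma> = (\<Sum>a\<in>X'. \<Sum>b\<in>Y'. \<Sum>c\<in>Z'.
   T0 (restrict \<sigma> (cv 0)) a b * T1 (restrict \<sigma> (cv 1)) b c * T2 (restrict \<sigma> (cv 2)) c a)"
  and fin: "finite X'" "finite Y'" "finite Z'"
  and card: "card X' = m ^ card (ce 2 0)" "card Y' = m ^ card (ce 0 1)" "card Z' = m ^ card (ce 1 2)"
 shows False
proof -
 have fce: "finite (ce i j)" for i j using fE ce_sub by (rule finite_subset[rotated])
 have fbc: "finite (bc i j)" for i j by (simp add: finite_PiE fce)
 have cbc: "card (bc i j) = m ^ card (ce i j)" for i j by (simp add: card_PiE fce)
 have ne: "bc i j \<noteq> {}" for i j using m by (auto simp: PiE_eq_empty_iff)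
 have lt: "x e - 1 < m" if "x \<in> bc i j" "e \<in> ce i j" for x e i j
 proof -
  have "x e \<in> {1..m}" using that by (rule PiE_mem)
  thus ?thesis by auto
 qed
 have fib: "m * card {x\<in>bc i j. x e - 1 = k} = card (bc i j)" if "e \<in> ce i j" "k < m" for e i j k
 proof -
  have "{x\<in>bc i j. x e - 1 = k} = {x\<in>bc i j. x e = Suc k}"
  proof (intro Collect_cong conj_cong refl)
   fix x assume "x \<in> bc i j"
   hence "x e \<in> {1..m}" using that(1) by (rule PiE_mem)
   thus "x e - 1 = k \<longleftrightarrow> x e = Suc k" by auto
  qed
  thus ?thesis using card_PiE_fix[OF fce that(1), of "Suc k" "\<lambda>_. {1..m}"] that(2) by simp
 qed
 define Q where "Q i j l = compatible i j l" for i j l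
 have Qs: "Q (a - 1) (b - 1) (c - 1) = compatible a b c" if "a \<in> {1..m}" "b \<in> {1..m}" "c \<in> {1..m}" for a b c
 proof -
  have "a - 1 = b - 1 \<longleftrightarrow> a = b" "b - 1 = c - 1 \<longleftrightarrow> b = c" "c - 1 = a - 1 \<longleftrightarrow> c = a" using that by auto
  thus ?thesis unfolding Q_def compatible_def by (simp only:)
 qed
 define n1 where "n1 = {p\<in>{..<m} \<times> {..<m}. fst p \<noteq> snd p}"
 define n3 where "n3 = {p\<in>{..<m} \<times> {..<m}. fst p = snd p}"
 have c3: "card n3 = m"
 proof -
  have "n3 = (\<lambda>i. (i, i)) ` {..<m}" by (auto simp: n3_def)
  thus ?thesis by (simp add: card_image inj_on_def)
 qed
 have f3: "finite n3" "n3 \<subseteq> {..<m} \<times> {..<m}" by (auto simp: n3_def)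
 have "n1 = {..<m} \<times> {..<m} - n3" by (auto simp: n1_def n3_def)
 hence "card n1 = m * m - m" using f3 c3 by (simp add: card_Diff_subset card_cartesian_product)
 hence c1: "card n1 \<ge> m * (m - 1)" by (simp add: diff_mult_distrib2)
 have c2: "card n1 \<ge> m"
 proof -
  have "1 \<le> m - 1" using m by simp
  hence "m * 1 \<le> m * (m - 1)" by (rule mult_le_mono2)
  thus ?thesis using c1 unfolding mult_1_right by (rule order_trans)
 qed
 show False
 proof (rule triangle_pullback_obstruction[where P = Q and \<Phi> = "\<lambda>s0 s1 s2. limit_vec (glue s0 s1 s2)"
   and ?S0.0 = "sites 0" and ?S1.0 = "sites 1" and ?S2.0 = "sites 2" and X' = X' and Y' = Y' and Z' = Z'
   and ?T0.0 = T0 and ?T1.0 = T1 and ?T2.0 = T2 and X = "bc 2 0" and Y = "bc 0 1" and Z = "bc 1 2"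
   and ?f0.0 = "\<lambda>x y. site_probe 0 (merge x y (\<lambda>_. 1))" and ?f1.0 = "\<lambda>y z. site_probe 1 (merge (\<lambda>_. 1) y z)" and ?f2.0 = "\<lambda>z x. site_probe 2 (merge x (\<lambda>_. 1) z)"
   and gX = "\<lambda>x. x (le (L - 1)) - 1" and gY = "\<lambda>y. y (le 0) - 1" and gZ = "\<lambda>z. z (le 1) - 1"
   and m = m and ?n1.0 = n1 and ?n2.0 = n1 and ?n3.0 = n3])
  show "limit_vec (glue s0 s1 s2) = (\<Sum>a\<in>X'. \<Sum>b\<in>Y'. \<Sum>c\<in>Z'. T0 s0 a b * T1 s1 b c * T2 s2 c a)"
   if s: "s0 \<in> sites 0" "s1 \<in> sites 1" "s2 \<in> sites 2" for s0 s1 s2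
   using tri[OF glue_config[OF s]] unfolding glue_restrict[OF s] .
  show "(\<Sum>s0\<in>sites 0. \<Sum>s1\<in>sites 1. \<Sum>s2\<in>sites 2. site_probe 0 (merge x y (\<lambda>_. 1)) s0 * site_probe 1 (merge (\<lambda>_. 1) y' z) s1 *
    site_probe 2 (merge x' (\<lambda>_. 1) z') s2 * limit_vec (glue s0 s1 s2)) =
   (if x = x' \<and> y = y' \<and> z = z' \<and> Q (x (le (L - 1)) - 1) (y (le 0) - 1) (z (le 1) - 1) then 1 else 0)"
   if h: "x \<in> bc 2 0" "y \<in> bc 0 1" "y' \<in> bc 0 1" "z \<in> bc 1 2" "z' \<in> bc 1 2" "x' \<in> bc 2 0" for x y y' z z' x'
  proof -
   have "x (le (L - 1)) \<in> {1..m}" "y (le 0) \<in> {1..m}" "z (le 1) \<in> {1..m}"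
    using PiE_mem[OF h(1) le_ce(3)] PiE_mem[OF h(2) le_ce(1)] PiE_mem[OF h(4) le_ce(2)] by blast+
   note q = Qs[OF this]
   show ?thesis unfolding q by (rule loop_pullback[OF h(1,6,2,3,4,5)])
  qed
  show "x (le (L - 1)) - 1 < m" if "x \<in> bc 2 0" for x by (rule lt[OF that le_ce(3)])
  show "y (le 0) - 1 < m" if "y \<in> bc 0 1" for y by (rule lt[OF that le_ce(1)])
  show "z (le 1) - 1 < m" if "z \<in> bc 1 2" for z by (rule lt[OF that le_ce(2)])
  show "m * card {x\<in>bc 2 0. x (le (L - 1)) - 1 = i} = card (bc 2 0)" if "i < m" for i by (rule fib[OF le_ce(3) that])
  show "m * card {x\<in>bc 0 1. x (le 0) - 1 = i} = card (bc 0 1)" if "i < m" for i by (rule fib[OF le_ce(1) that])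
  show "m * card {x\<in>bc 1 2. x (le 1) - 1 = i} = card (bc 1 2)" if "i < m" for i by (rule fib[OF le_ce(2) that])
  show "\<exists>l<m. Q i j l" if "i < m" "j < m" for i j using that by (intro exI[of _ j]) (auto simp: Q_def compatible_def)
  show "\<exists>i<m. Q i j l" if "j < m" "l < m" for j l using that by (intro exI[of _ j]) (auto simp: Q_def compatible_def)
  show "\<exists>j<m. Q i j l" if "l < m" "i < m" for l i using that by (intro exI[of _ i]) (auto simp: Q_def compatible_def)
  show "\<not> Q i j l" if "(i, j) \<in> n1" "(j, l) \<in> n1" for i j l using that by (auto simp: Q_def compatible_def n1_def)
  show "\<not> Q i j l" if "(i, j) \<in> n1" "(l, i) \<in> n3" for i j l using that by (auto simp: Q_def compatible_def n1_def n3_def)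
  show "n1 \<subseteq> {..<m} \<times> {..<m}" by (auto simp: n1_def)
  thus "n1 \<subseteq> {..<m} \<times> {..<m}" .
 qed (simp_all only: fbc fin card cbc ne m f3 c1 c2 c3 order_refl not_False_eq_True)
qed

lemma weighted_nonzero: "\<exists>\<rho>. limit_vec \<rho> \<noteq> 0"
proof (rule ccontr)
 assume "\<not> (\<exists>\<rho>. limit_vec \<rho> \<noteq> 0)"
 hence z: "limit_vec \<rho> = 0" for \<rho> by blast
 define o1 where "o1 i j = restrict (\<lambda>_::'v set. 1::nat) (ce i j)" for i j
 have o: "o1 i j \<in> bc i j" for i j using m by (auto simp: o1_def)
 have "compatible (o1 2 0 (le (L - 1))) (o1 0 1 (le 0)) (o1 1 2 (le 1))"
  using le_ce by (simp add: o1_def compatible_def)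
 thus False using loop_pullback[OF o o o o o o] by (simp add: z)
qed

end

text \<open>The site dimensions leave room for an embedding that sends basis vectors to basis
  vectors, given by injections \<open>h i\<close>; the loop states built from it furnish the
  escaping sequence.\<close>

theorem loop_network_lacks_optimizers:
 assumes G: "loop_network G m"
 shows "lacks_optimizers (verts G) (sdim G) (PEPS G)"
proof -
 have n: "network G" and m: "m \<ge> 2" and b: "\<And>e. e \<in> edges G \<Longrightarrow> bdim G e = m"
  and s: "\<And>i. i \<in> verts G \<Longrightarrow> sdim G i \<ge> m ^ card (inc G i)"
  using G unfolding loop_network_def by blast+
 obtain vs where vs: "is_loop G vs" using G unfolding loop_network_def by blast
 note g = network_graph[OF n]
 have fV: "finite (verts G)" and fE: "finite (edges G)" using g graph_edges_finite[OF g] by (auto simp: graph_edges_def)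
 have fi: "finite (inc G i)" for i using fE by (simp add: inc_def)
 have "\<exists>h. inj_on h (PiE (inc G i) (\<lambda>_. {1..m})) \<and> h ` PiE (inc G i) (\<lambda>_. {1..m}) \<subseteq> {1..sdim G i}" if i: "i \<in> verts G" for i
 proof -
  have "card (PiE (inc G i) (\<lambda>_. {1..m})) \<le> card {1..sdim G i}" using s[OF i] fi by (simp add: card_PiE)
  thus ?thesis using inj_on_iff_card_le[of "PiE (inc G i) (\<lambda>_. {1..m})" "{1..sdim G i}"] fi by (simp add: finite_PiE)
 qed
 then obtain h where h: "\<And>i. i \<in> verts G \<Longrightarrow> inj_on (h i) (PiE (inc G i) (\<lambda>_. {1..m}))"
   "\<And>i. i \<in> verts G \<Longrightarrow> h i ` PiE (inc G i) (\<lambda>_. {1..m}) \<subseteq> {1..sdim G i}" by metis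
 define W where "W i s n = (if h i n = s then 1 else 0 :: complex)" for i s n
 have "site_embedding G m W"
  unfolding site_embedding_def
 proof (intro ballI)
  fix i n n' assume i: "i \<in> verts G" and n: "n \<in> PiE (inc G i) (\<lambda>_. {1..m})" "n' \<in> PiE (inc G i) (\<lambda>_. {1..m})"
  have hn: "h i n \<in> {1..sdim G i}" using h(2)[OF i] n(1) by blast
  have "(\<Sum>s\<in>{1..sdim G i}. cnj (W i s n) * W i s n') = (\<Sum>s\<in>{1..sdim G i}. if s = h i n then (if h i n' = h i n then 1 else 0) else 0)"
   by (rule sum.cong) (auto simp: W_def)
  also have "\<dots> = (if h i n' = h i n then 1 else 0)" using hn by simp
  also have "\<dots> = (if n = n' then 1 else 0)" using inj_onD[OF h(1)[OF i] _ n] by auto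
  finally show "(\<Sum>s\<in>{1..sdim G i}. cnj (W i s n) * W i s n') = (if n = n' then 1 else 0)" .
 qed
 then interpret loop_states G m vs W using g m vs by unfold_locales
 define \<epsilon> where "\<epsilon> k = 1 / real (Suc k)" for k
 have \<epsilon>: "\<epsilon> k \<noteq> 0" for k by (simp add: \<epsilon>_def)
 have \<epsilon>0: "\<epsilon> \<longlonglongrightarrow> 0" unfolding \<epsilon>_def by (rule lim_1_over_n[THEN LIMSEQ_Suc])
 have ne: "verts G \<noteq> {}" using n by (simp add: network_def)
 obtain \<rho> where \<rho>: "limit_vec \<rho> \<noteq> 0" using weighted_nonzero by blast
 have notin: "\<not> peps_cone G (limit_vec)"
 proof
  assume "peps_cone G (limit_vec)"
  then obtain A where A: "limit_vec = peps_vec G A" unfolding peps_cone_def by blast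
  obtain T0 T1 T2 where T: "\<forall>\<sigma>\<in>configs (verts G) (sdim G). peps_vec G A \<sigma> =
   (\<Sum>x\<in>bond_configs G (ce 2 0). \<Sum>y\<in>bond_configs G (ce 0 1). \<Sum>z\<in>bond_configs G (ce 1 2).
    T0 (restrict \<sigma> (cv 0)) x y * T1 (restrict \<sigma> (cv 1)) y z * (T2 (restrict \<sigma> (cv 2)) z x :: complex))"
   using peps_triangle[OF g, where cl = cl and A = A, OF cl_less] by blast
  have f: "finite (ce i j)" for i j using fE ce_sub by (rule finite_subset[rotated])
  have c: "card (bond_configs G (ce i j)) = m ^ card (ce i j)" for i j
  proof -
   have "(\<Prod>e\<in>ce i j. bdim G e) = (\<Prod>e\<in>ce i j. m)" by (rule prod.cong) (use b ce_sub in auto)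
   thus ?thesis by (simp add: card_bond_configs[OF f])
  qed
  show False
  proof (rule weighted_no_triangle)
   show "limit_vec \<sigma> = (\<Sum>x\<in>bond_configs G (ce 2 0). \<Sum>y\<in>bond_configs G (ce 0 1). \<Sum>z\<in>bond_configs G (ce 1 2).
    T0 (restrict \<sigma> (cv 0)) x y * T1 (restrict \<sigma> (cv 1)) y z * T2 (restrict \<sigma> (cv 2)) z x)" if "\<sigma> \<in> configs (verts G) (sdim G)" for \<sigma>
    unfolding A by (rule bspec[OF T that])
  qed (rule c finite_bond_configs[OF f])+
 qed
 show ?thesis
  by (rule lacks_optimizers_cone[where C = "peps_cone G", OF fV PEPS_cone peps_cone_hilb peps_cone_scale[OF fV ne]
   weighted_peps_cone[OF b] weighted_tendsto[OF \<epsilon> \<epsilon>0] \<rho> notin])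
qed

text \<open>Contracting cluster by cluster reorders the sum: bonds inside clusters are summed within
  \<open>contract_cluster\<close>, and bonds between clusters are in bijection, through
  \<open>\<gamma>\<close>, with bond configurations of \<open>G\<close>.\<close>

lemma fine_grained_value:
 fixes G :: "'v network" and G' :: "'w network"
 assumes g': "graph_edges (verts G') (edges G')"
  and bs: "blocking_scheme G G' p"
  and \<beta>: "\<And>i. i \<in> verts G \<Longrightarrow> bij_betw (\<beta> i) {1..sdim G i} (configs (cluster G' p i) (sdim G'))"
  and \<gamma>: "\<And>e. e \<in> edges G \<Longrightarrow> bij_betw (\<gamma> e) {1..bdim G e} (PiE (edges_over G' p e) (\<lambda>e'. {1..bdim G' e'}))"
  and A: "\<And>i s n. i \<in> verts G \<Longrightarrow> s \<in> {1..sdim G i} \<Longrightarrow> n \<in> PiE (inc G i) (\<lambda>e. {1..bdim G e}) \<Longrightarrow>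
    A i s n = contract_cluster G' p \<beta> \<gamma> A' i s n"
  and g: "graph_edges (verts G) (edges G)"
  and \<sigma>': "\<sigma>' \<in> configs (verts G') (sdim G')" and \<sigma>: "\<sigma> \<in> configs (verts G) (sdim G)"
  and match: "\<And>i j. i \<in> verts G \<Longrightarrow> j \<in> cluster G' p i \<Longrightarrow> \<sigma>' j = \<beta> i (\<sigma> i) j"
 shows "peps_vec G' A' \<sigma>' = peps_vec G A \<sigma>"
proof -
 have fV: "finite (verts G)" "finite (verts G')" using g g' by (simp_all add: graph_edges_def)
 have pV: "p j \<in> verts G" if "j \<in> verts G'" for j using bs that unfolding blocking_scheme_def by blast
 have over: "p ` e' \<in> edges G \<or> (\<exists>i\<in>verts G. p ` e' = {i})" if e': "e' \<in> edges G'" for e'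
 proof -
  obtain u v where uv: "e' = {u, v}" "u \<in> verts G'" using edge_two[OF g' e'] by blast
  show ?thesis
  proof (cases "p u = p v")
   case True
   thus ?thesis using pV[OF uv(2)] uv(1) by auto
  next
   case False
   hence "card (p ` e') = 2" using uv(1) by simp
   thus ?thesis using bs e' unfolding blocking_scheme_def by blast
  qed
 qed
 have card2: "e \<noteq> {i}" if "e \<in> edges G" for e i using edge_two[OF g that] by auto
 define I where "I = (\<Union>e\<in>edges G. edges_over G' p e)"
 define J where "J = (\<Union>i\<in>verts G. edges_over G' p {i})"
 have IJ: "edges G' = I \<union> J"
 proof (intro Set.equalityI subsetI)
  fix e' assume e': "e' \<in> edges G'"
  show "e' \<in> I \<union> J" using over[OF e'] e' by (auto simp: I_def J_def edges_over_def)
 qed (auto simp: I_def J_def edges_over_def)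
 have Ip: "p ` e' \<in> edges G" "e' \<in> edges_over G' p (p ` e')" if "e' \<in> I" for e'
  using that unfolding I_def edges_over_def by blast+
 have dIJ: "I \<inter> J = {}"
 proof (rule equals0I)
  fix e' assume a: "e' \<in> I \<inter> J"
  hence "e' \<in> J" by blast
  then obtain i where "p ` e' = {i}" unfolding J_def edges_over_def by blast
  thus False using card2[OF Ip(1)[of e'], of i] a by blast
 qed
 define B where "B = (\<lambda>e'. {1..bdim G' e'})"
 define \<Gamma> where "\<Gamma> n = (\<lambda>e'\<in>I. \<gamma> (p ` e') (n (p ` e')) e')" for n
 let ?N = "PiE (edges G) (\<lambda>e. {1..bdim G e})"
 have \<gamma>m: "\<gamma> e (n e) \<in> PiE (edges_over G' p e) B" if "n \<in> ?N" "e \<in> edges G" for n e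
  using bij_betwE[OF \<gamma>[OF that(2)]] PiE_mem[OF that] unfolding B_def by blast
 have bij: "bij_betw \<Gamma> ?N (PiE I B)"
  unfolding bij_betw_def
 proof
  show "inj_on \<Gamma> ?N"
  proof (rule inj_onI)
   fix n n' assume n: "n \<in> ?N" "n' \<in> ?N" and eq: "\<Gamma> n = \<Gamma> n'"
   show "n = n'"
   proof (rule PiE_ext[OF n])
    fix e assume e: "e \<in> edges G"
    have "\<gamma> e (n e) = \<gamma> e (n' e)"
    proof (rule PiE_ext[OF \<gamma>m[OF n(1) e] \<gamma>m[OF n(2) e]])
     fix e' assume e': "e' \<in> edges_over G' p e"
     hence "e' \<in> I" "p ` e' = e" using e by (auto simp: I_def edges_over_def)
     thus "\<gamma> e (n e) e' = \<gamma> e (n' e) e'" using fun_cong[OF eq, of e'] by (simp add: \<Gamma>_def)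
    qed
    thus "n e = n' e"
     using inj_onD[OF bij_betw_imp_inj_on[OF \<gamma>[OF e]]] PiE_mem[OF n(1) e] PiE_mem[OF n(2) e] by blast
   qed
  qed
  show "\<Gamma> ` ?N = PiE I B"
  proof
   show "\<Gamma> ` ?N \<subseteq> PiE I B"
   proof
    fix a assume "a \<in> \<Gamma> ` ?N"
    then obtain n where n: "n \<in> ?N" "a = \<Gamma> n" by blast
    show "a \<in> PiE I B" unfolding n(2) \<Gamma>_def
    proof (rule restrict_PiE_iff[THEN iffD2], intro ballI)
     fix e' assume e': "e' \<in> I"
     show "\<gamma> (p ` e') (n (p ` e')) e' \<in> B e'" using PiE_mem[OF \<gamma>m[OF n(1) Ip(1)[OF e']] Ip(2)[OF e']] .
    qed
   qed
   show "PiE I B \<subseteq> \<Gamma> ` ?N"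
   proof
    fix a assume a: "a \<in> PiE I B"
    have ra: "restrict a (edges_over G' p e) \<in> PiE (edges_over G' p e) B" if "e \<in> edges G" for e
    proof (rule restrict_PiE_iff[THEN iffD2], intro ballI)
     fix e' assume "e' \<in> edges_over G' p e"
     hence "e' \<in> I" using that by (auto simp: I_def)
     thus "a e' \<in> B e'" by (rule PiE_mem[OF a])
    qed
    have "\<exists>k\<in>{1..bdim G e}. \<gamma> e k = restrict a (edges_over G' p e)" if "e \<in> edges G" for e
     using ra[OF that] bij_betw_imp_surj_on[OF \<gamma>[OF that]] unfolding B_def by (metis imageE)
    then obtain k where k: "\<And>e. e \<in> edges G \<Longrightarrow> k e \<in> {1..bdim G e}" "\<And>e. e \<in> edges G \<Longrightarrow> \<gamma> e (k e) = restrict a (edges_over G' p e)" by metis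
    define n where "n = restrict k (edges G)"
    have "n \<in> ?N" using k(1) by (simp add: n_def)
    moreover have "a = \<Gamma> n"
    proof
     fix e'
     show "a e' = \<Gamma> n e'"
     proof (cases "e' \<in> I")
      case True
      have "\<Gamma> n e' = \<gamma> (p ` e') (k (p ` e')) e'" using True Ip(1)[OF True] by (simp add: \<Gamma>_def n_def)
      also have "\<dots> = a e'" unfolding k(2)[OF Ip(1)[OF True]] using Ip(2)[OF True] by simp
      finally show ?thesis by simp
     next
      case False
      thus ?thesis using PiE_arb[OF a False] by (simp add: \<Gamma>_def)
     qed
    qed
    ultimately show "a \<in> \<Gamma> ` ?N" by blast
   qed
  qed
 qed
 define F where "F i a k = (\<Prod>j\<in>cluster G' p i. A' j (\<sigma>' j) (\<lambda>e'\<in>inc G' j. if p ` e' = {i} then k e' else a e'))" for i and a k :: "'w set \<Rightarrow> nat"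
 have vert: "(\<Prod>j\<in>verts G'. h j) = (\<Prod>i\<in>verts G. \<Prod>j\<in>cluster G' p i. h j)" for h :: "'w \<Rightarrow> complex"
 proof -
  have "(\<Prod>i\<in>verts G. \<Prod>j\<in>cluster G' p i. h j) = prod h (\<Union>i\<in>verts G. cluster G' p i)"
   by (rule prod.UNION_disjoint[symmetric]) (use fV in \<open>auto simp: cluster_def\<close>)
  also have "(\<Union>i\<in>verts G. cluster G' p i) = verts G'" using pV by (auto simp: cluster_def)
  finally show ?thesis by simp
 qed
 have "peps_vec G' A' \<sigma>' = (\<Sum>n'\<in>PiE (edges G') B. \<Prod>j\<in>verts G'. A' j (\<sigma>' j) (restrict n' (inc G' j)))"
  using \<sigma>' by (simp add: peps_vec_def vec_of_def B_def)
 also have "\<dots> = (\<Sum>a\<in>PiE I B. \<Sum>b\<in>PiE J B. \<Prod>j\<in>verts G'. A' j (\<sigma>' j) (restrict (\<lambda>e'. if e' \<in> I then a e' else b e') (inc G' j)))"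
  unfolding IJ by (rule sum_PiE_Un[OF dIJ])
 also have "\<dots> = (\<Sum>a\<in>PiE I B. \<Sum>b\<in>PiE J B. \<Prod>i\<in>verts G. F i a (restrict b (edges_over G' p {i})))"
 proof (intro sum.cong refl)
  fix a b :: "'w set \<Rightarrow> nat"
  have "restrict (\<lambda>e'. if e' \<in> I then a e' else b e') (inc G' j) = (\<lambda>e'\<in>inc G' j. if p ` e' = {i} then restrict b (edges_over G' p {i}) e' else a e')"
   if "j \<in> cluster G' p i" "i \<in> verts G" for i j
  proof (rule restrict_ext)
   fix e' assume e': "e' \<in> inc G' j"
   hence ee: "e' \<in> edges G'" "j \<in> e'" by (auto simp: inc_def)
   have pj: "i \<in> p ` e'" using that(1) ee(2) by (auto simp: cluster_def)
   show "(if e' \<in> I then a e' else b e') = (if p ` e' = {i} then restrict b (edges_over G' p {i}) e' else a e')"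
   proof (cases "p ` e' = {i}")
    case True
    hence "e' \<notin> I" using card2 Ip(1)[of e'] by auto
    moreover have "e' \<in> edges_over G' p {i}" using True ee(1) by (simp add: edges_over_def)
    ultimately show ?thesis using True by simp
   next
    case False
    hence "p ` e' \<in> edges G" using over[OF ee(1)] pj False by (metis singletonD)
    hence "e' \<in> I" using ee(1) by (auto simp: I_def edges_over_def)
    thus ?thesis using False by simp
   qed
  qed
  thus "(\<Prod>j\<in>verts G'. A' j (\<sigma>' j) (restrict (\<lambda>e'. if e' \<in> I then a e' else b e') (inc G' j))) =
   (\<Prod>i\<in>verts G. F i a (restrict b (edges_over G' p {i})))"
   unfolding vert F_def by (intro prod.cong refl) (simp only:)
 qed
 also have "\<dots> = (\<Sum>a\<in>PiE I B. \<Prod>i\<in>verts G. \<Sum>k\<in>PiE (edges_over G' p {i}) B. F i a k)"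
  unfolding J_def
 proof (rule sum.cong[OF refl], rule prod_sum_PiE_UN[OF fV(1)])
  show "edges_over G' p {i} \<inter> edges_over G' p {j} = {}" if "i \<noteq> j" for i j
   using that by (auto simp: edges_over_def)
 qed
 also have "\<dots> = (\<Sum>n\<in>?N. \<Prod>i\<in>verts G. \<Sum>k\<in>PiE (edges_over G' p {i}) B. F i (\<Gamma> n) k)"
  by (rule sum.reindex_bij_betw[OF bij, symmetric])
 also have "\<dots> = (\<Sum>n\<in>?N. \<Prod>i\<in>verts G. A i (\<sigma> i) (restrict n (inc G i)))"
 proof (intro sum.cong prod.cong refl)
  fix n i assume n: "n \<in> ?N" and i: "i \<in> verts G"
  have ri: "restrict n (inc G i) \<in> PiE (inc G i) (\<lambda>e. {1..bdim G e})"
  proof (rule restrict_PiE_iff[THEN iffD2], intro ballI)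
   fix e assume "e \<in> inc G i"
   thus "n e \<in> {1..bdim G e}" by (intro PiE_mem[OF n]) (simp add: inc_def)
  qed
  have si: "\<sigma> i \<in> {1..sdim G i}" using \<sigma> i unfolding configs_def by (rule PiE_mem)
  have "F i (\<Gamma> n) k = (\<Prod>j\<in>cluster G' p i. A' j (\<beta> i (\<sigma> i) j)
    (\<lambda>e'\<in>inc G' j. if p ` e' = {i} then k e' else \<gamma> (p ` e') (restrict n (inc G i) (p ` e')) e'))" for k
   unfolding F_def
  proof (rule prod.cong[OF refl])
   fix j assume j: "j \<in> cluster G' p i"
   have "(\<lambda>e'\<in>inc G' j. if p ` e' = {i} then k e' else \<Gamma> n e') = (\<lambda>e'\<in>inc G' j. if p ` e' = {i} then k e' else \<gamma> (p ` e') (restrict n (inc G i) (p ` e')) e')"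
   proof (rule restrict_ext)
    fix e' assume e': "e' \<in> inc G' j"
    hence ee: "e' \<in> edges G'" "j \<in> e'" by (auto simp: inc_def)
    have pj: "i \<in> p ` e'" using j ee(2) by (auto simp: cluster_def)
    show "(if p ` e' = {i} then k e' else \<Gamma> n e') = (if p ` e' = {i} then k e' else \<gamma> (p ` e') (restrict n (inc G i) (p ` e')) e')"
    proof (cases "p ` e' = {i}")
     case False
     hence pe: "p ` e' \<in> edges G" using over[OF ee(1)] pj False by (metis singletonD)
     hence "e' \<in> I" using ee(1) by (auto simp: I_def edges_over_def)
     moreover have "p ` e' \<in> inc G i" using pe pj by (simp add: inc_def)
     ultimately show ?thesis using False by (simp add: \<Gamma>_def)
    qed simp
   qed
   thus "A' j (\<sigma>' j) (\<lambda>e'\<in>inc G' j. if p ` e' = {i} then k e' else \<Gamma> n e') =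
     A' j (\<beta> i (\<sigma> i) j) (\<lambda>e'\<in>inc G' j. if p ` e' = {i} then k e' else \<gamma> (p ` e') (restrict n (inc G i) (p ` e')) e')"
    by (simp only: match[OF i j])
  qed
  thus "(\<Sum>k\<in>PiE (edges_over G' p {i}) B. F i (\<Gamma> n) k) = A i (\<sigma> i) (restrict n (inc G i))"
   unfolding A[OF i si ri] contract_cluster_def B_def by (simp only:)
 qed
 also have "\<dots> = peps_vec G A \<sigma>" using \<sigma> by (simp add: peps_vec_def vec_of_def)
 finally show ?thesis .
qed

text \<open>The blocking scheme is fixed, but the identifications \<open>\<beta>\<close> of bases
  may vary with \<open>\<epsilon>\<close>. On the relevant arguments there are finitely many of
  them, so a subsequence shares one; along it the fine-grained states converge to the limit vector
  read in the basis of \<open>G'\<close>. A network state there would be a triangle for the limit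
  vector with bonds of the excluded size.\<close>

theorem fine_grained_lacks_optimizers:
 fixes G :: "'v network" and G' :: "'w network"
 assumes G: "loop_network G m" and G': "network G'" and bs: "blocking_scheme G G' p" and vs: "is_loop G vs"
  and emb: "site_embedding G m W"
  and fine: "\<And>\<epsilon>. \<epsilon> > 0 \<Longrightarrow> \<exists>\<Psi>'. fine_grained_state G G' p (psi_T G m W vs \<epsilon>) \<Psi>'"
 shows "lacks_optimizers (verts G') (sdim G') (PEPS G')"
proof -
 have n: "network G" and m: "m \<ge> 2" and b: "\<And>e. e \<in> edges G \<Longrightarrow> bdim G e = m"
  using G unfolding loop_network_def by blast+
 note g = network_graph[OF n] and g' = network_graph[OF G']
 have finV: "finite (verts G)" "finite (verts G')" and finE: "finite (edges G)" "finite (edges G')"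
  using g g' graph_edges_finite[OF g] graph_edges_finite[OF g'] by (auto simp: graph_edges_def)
 have pV: "p j \<in> verts G" if "j \<in> verts G'" for j using bs that unfolding blocking_scheme_def by blast
 have fcl: "finite (cluster G' p i)" for i using finV(2) by (simp add: cluster_def)
 have ne': "verts G' \<noteq> {}" using G' by (simp add: network_def)
 interpret loop_states G m vs W using g m vs emb by unfold_locales
 define \<epsilon> where "\<epsilon> k = 1 / real (Suc k)" for k
 have \<epsilon>: "\<epsilon> k > 0" "\<epsilon> k \<noteq> 0" for k by (simp_all add: \<epsilon>_def)
 have \<epsilon>0: "\<epsilon> \<longlonglongrightarrow> 0" unfolding \<epsilon>_def by (rule lim_1_over_n[THEN LIMSEQ_Suc])
 define U where "U k = weighted (weight (\<epsilon> k))" for k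
 define c where "c k = complex_of_real (hnorm (verts G) (sdim G) (U k))" for k
 \<comment> \<open>All that is retained of a fine-grained state is how its coefficients are read off
   from the unnormalized loop state \<open>U k\<close>; its tensors and \<open>\<gamma>\<close> are
   left behind.\<close>
 define cb where "cb k \<beta> \<Psi>' \<longleftrightarrow> peps_cone G' \<Psi>' \<and>
   (\<forall>i\<in>verts G. bij_betw (\<beta> i) {1..sdim G i} (configs (cluster G' p i) (sdim G'))) \<and>
   (\<forall>\<sigma>'\<in>configs (verts G') (sdim G'). \<forall>\<sigma>\<in>configs (verts G) (sdim G).
     (\<forall>i\<in>verts G. \<forall>j\<in>cluster G' p i. \<sigma>' j = \<beta> i (\<sigma> i) j) \<longrightarrow> \<Psi>' \<sigma>' = U k \<sigma>)" for k \<beta> \<Psi>'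
 have "\<exists>\<beta> \<Psi>'. cb k \<beta> \<Psi>'" for k
 proof -
  obtain \<Psi>' where "fine_grained_state G G' p (psi_T G m W vs (\<epsilon> k)) \<Psi>'" using fine[OF \<epsilon>(1)] by blast
  then obtain A A' \<beta> \<gamma> where P: "psi_T G m W vs (\<epsilon> k) \<in> PEPS G" "psi_T G m W vs (\<epsilon> k) = peps_vec G A" "\<Psi>' = peps_vec G' A'"
   and \<beta>: "\<forall>i\<in>verts G. bij_betw (\<beta> i) {1..sdim G i} (configs (cluster G' p i) (sdim G'))"
   and \<gamma>: "\<forall>e\<in>edges G. bij_betw (\<gamma> e) {1..bdim G e} (PiE (edges_over G' p e) (\<lambda>e'. {1..bdim G' e'}))"
   and A: "\<forall>i\<in>verts G. \<forall>s\<in>{1..sdim G i}. \<forall>n\<in>PiE (inc G i) (\<lambda>e. {1..bdim G e}). A i s n = contract_cluster G' p \<beta> \<gamma> A' i s n"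
   unfolding fine_grained_state_def by (elim conjE exE)
  have psi: "psi_T G m W vs (\<epsilon> k) \<sigma> = U k \<sigma> / c k" for \<sigma>
   unfolding psi_T_weighted[OF \<epsilon>(2)] normalized_def U_def c_def by (rule refl)
  have "c k \<noteq> 0"
  proof
   assume "c k = 0"
   hence "psi_T G m W vs (\<epsilon> k) = (\<lambda>_. 0)" using psi by (simp add: fun_eq_iff)
   hence "hnorm (verts G) (sdim G) (\<lambda>_. 0) = 1" using P(1) by (simp add: PEPS_def)
   thus False by (simp add: hnorm_def L2_set_def)
  qed
  hence U: "U k \<sigma> = c k * peps_vec G A \<sigma>" for \<sigma> using psi[of \<sigma>] P(2) by (simp add: field_simps)
  have "cb k \<beta> (\<lambda>\<sigma>'. c k * peps_vec G' A' \<sigma>')"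
   unfolding cb_def
  proof (intro conjI ballI impI)
   show "peps_cone G' (\<lambda>\<sigma>'. c k * peps_vec G' A' \<sigma>')"
    by (rule peps_cone_scale[OF finV(2) ne']) (auto simp: peps_cone_def)
   show "bij_betw (\<beta> i) {1..sdim G i} (configs (cluster G' p i) (sdim G'))" if "i \<in> verts G" for i
    using \<beta> that by blast
   fix \<sigma>' \<sigma> assume \<sigma>: "\<sigma>' \<in> configs (verts G') (sdim G')" "\<sigma> \<in> configs (verts G) (sdim G)"
    and match: "\<forall>i\<in>verts G. \<forall>j\<in>cluster G' p i. \<sigma>' j = \<beta> i (\<sigma> i) j"
   have "peps_vec G' A' \<sigma>' = peps_vec G A \<sigma>"
    by (rule fine_grained_value[OF g' bs bspec[OF \<beta>] bspec[OF \<gamma>] bspec[OF bspec[OF bspec[OF A]]] g \<sigma> bspec[OF bspec[OF match]]])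
   thus "c k * peps_vec G' A' \<sigma>' = U k \<sigma>" by (simp only: U)
  qed
  thus ?thesis by blast
 qed
 then obtain \<beta> \<Psi>' where cb: "\<And>k. cb k (\<beta> k) (\<Psi>' k)" by metis
 \<comment> \<open>Restriction to sites and indices in range puts all identifications into one
   finite set, as the pigeonhole principle requires.\<close>
 define \<beta>r where "\<beta>r k = (\<lambda>i\<in>verts G. restrict (\<beta> k i) {1..sdim G i})" for k
 have bij: "bij_betw (\<beta> k i) {1..sdim G i} (configs (cluster G' p i) (sdim G'))" if "i \<in> verts G" for k i
  using cb[of k] that unfolding cb_def by blast
 have "finite (range \<beta>r)"
 proof (rule finite_subset)
  show "range \<beta>r \<subseteq> PiE (verts G) (\<lambda>i. PiE {1..sdim G i} (\<lambda>_. configs (cluster G' p i) (sdim G')))"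
  proof
   fix b assume "b \<in> range \<beta>r"
   then obtain k where k: "b = \<beta>r k" by blast
   show "b \<in> PiE (verts G) (\<lambda>i. PiE {1..sdim G i} (\<lambda>_. configs (cluster G' p i) (sdim G')))"
    unfolding k \<beta>r_def
    by (rule restrict_PiE_iff[THEN iffD2], rule ballI, rule restrict_PiE_iff[THEN iffD2], rule ballI)
     (rule bij_betwE[OF bij, rule_format])
  qed
  show "finite (PiE (verts G) (\<lambda>i. PiE {1..sdim G i} (\<lambda>_. configs (cluster G' p i) (sdim G'))))"
   by (intro finite_PiE finV finite_configs fcl) simp_all
 qed
 then obtain k0 where k0: "infinite {k\<in>UNIV. \<beta>r k = \<beta>r k0}"
  using pigeonhole_infinite[of "UNIV :: nat set" \<beta>r] by auto
 then obtain \<phi> :: "nat \<Rightarrow> nat" where \<phi>: "strict_mono \<phi>" "\<And>k. \<beta>r (\<phi> k) = \<beta>r k0"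
  using infinite_enumerate[OF k0] by auto
 define \<beta>0 where "\<beta>0 = \<beta> k0"
 have \<beta>0: "\<beta> (\<phi> k) i s = \<beta>0 i s" if "i \<in> verts G" "s \<in> {1..sdim G i}" for k i s
  using fun_cong[OF fun_cong[OF \<phi>(2)[of k], of i], of s] that by (simp add: \<beta>r_def \<beta>0_def)
 have bij0: "bij_betw (\<beta>0 i) {1..sdim G i} (configs (cluster G' p i) (sdim G'))" if "i \<in> verts G" for i
  unfolding \<beta>0_def by (rule bij[OF that])
 define coarse where "coarse \<sigma>' = (\<lambda>i\<in>verts G. inv_into {1..sdim G i} (\<beta>0 i) (restrict \<sigma>' (cluster G' p i)))" for \<sigma>'
 define finer where "finer \<sigma> = (\<lambda>j\<in>verts G'. \<beta>0 (p j) (\<sigma> (p j)) j)" for \<sigma>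
 have rc: "restrict \<sigma>' (cluster G' p i) \<in> configs (cluster G' p i) (sdim G')" if "\<sigma>' \<in> configs (verts G') (sdim G')" for \<sigma>' i
  unfolding configs_def
 proof (rule restrict_PiE_iff[THEN iffD2], rule ballI)
  fix j assume "j \<in> cluster G' p i"
  thus "\<sigma>' j \<in> {1..sdim G' j}" using that unfolding configs_def cluster_def by (auto dest: PiE_mem)
 qed
 have coarse: "coarse \<sigma>' \<in> configs (verts G) (sdim G)" "\<And>i. i \<in> verts G \<Longrightarrow> \<beta>0 i (coarse \<sigma>' i) = restrict \<sigma>' (cluster G' p i)"
  if \<sigma>': "\<sigma>' \<in> configs (verts G') (sdim G')" for \<sigma>'
 proof -
  have im: "restrict \<sigma>' (cluster G' p i) \<in> \<beta>0 i ` {1..sdim G i}" if "i \<in> verts G" for i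
   using rc[OF \<sigma>'] bij_betw_imp_surj_on[OF bij0[OF that]] by simp
  show "coarse \<sigma>' \<in> configs (verts G) (sdim G)"
   unfolding configs_def coarse_def
   by (rule restrict_PiE_iff[THEN iffD2], rule ballI) (rule inv_into_into[OF im])
  show "\<beta>0 i (coarse \<sigma>' i) = restrict \<sigma>' (cluster G' p i)" if "i \<in> verts G" for i
   using f_inv_into_f[OF im[OF that]] that by (simp add: coarse_def)
 qed
 define \<Phi>0 where "\<Phi>0 \<sigma>' = (if \<sigma>' \<in> configs (verts G') (sdim G') then limit_vec (coarse \<sigma>') else 0)" for \<sigma>'
 have cone: "peps_cone G' (\<Psi>' (\<phi> k))" for k using cb[of "\<phi> k"] unfolding cb_def by blast
 have lim: "(\<lambda>k. \<Psi>' (\<phi> k) \<sigma>') \<longlonglongrightarrow> \<Phi>0 \<sigma>'" for \<sigma>'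
 proof (cases "\<sigma>' \<in> configs (verts G') (sdim G')")
  case True
  have "\<Psi>' (\<phi> k) \<sigma>' = U (\<phi> k) (coarse \<sigma>')" for k
  proof -
   have "\<forall>i\<in>verts G. \<forall>j\<in>cluster G' p i. \<sigma>' j = \<beta> (\<phi> k) i (coarse \<sigma>' i) j"
   proof (intro ballI)
    fix i j assume i: "i \<in> verts G" and j: "j \<in> cluster G' p i"
    have "coarse \<sigma>' i \<in> {1..sdim G i}" using coarse(1)[OF True] i unfolding configs_def by (rule PiE_mem)
    hence "\<beta> (\<phi> k) i (coarse \<sigma>' i) j = restrict \<sigma>' (cluster G' p i) j"
     by (simp only: \<beta>0[OF i] coarse(2)[OF True i])
    thus "\<sigma>' j = \<beta> (\<phi> k) i (coarse \<sigma>' i) j" using j by simp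
   qed
   thus ?thesis using cb[of "\<phi> k"] True coarse(1)[OF True] unfolding cb_def by blast
  qed
  moreover have "(\<lambda>k. U (\<phi> k) (coarse \<sigma>')) \<longlonglongrightarrow> limit_vec (coarse \<sigma>')"
   using LIMSEQ_subseq_LIMSEQ[OF weighted_tendsto[of \<epsilon> "coarse \<sigma>'", OF \<epsilon>(2) \<epsilon>0] \<phi>(1)] unfolding o_def U_def .
  ultimately show ?thesis using True by (simp add: \<Phi>0_def)
 next
  case False
  have "\<Psi>' (\<phi> k) \<sigma>' = 0" for k using peps_cone_hilb[OF cone[of k]] False by (simp add: hilb_def)
  thus ?thesis using False by (simp add: \<Phi>0_def)
 qed
 have finer: "finer \<sigma> \<in> configs (verts G') (sdim G')" "coarse (finer \<sigma>) = \<sigma>" if \<sigma>: "\<sigma> \<in> configs (verts G) (sdim G)" for \<sigma>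
 proof -
  have mem: "\<beta>0 i (\<sigma> i) \<in> configs (cluster G' p i) (sdim G')" if "i \<in> verts G" for i
   using bij_betwE[OF bij0[OF that]] PiE_mem[OF \<sigma>[unfolded configs_def] that] by blast
  show f: "finer \<sigma> \<in> configs (verts G') (sdim G')"
   unfolding finer_def configs_def
  proof (rule restrict_PiE_iff[THEN iffD2], rule ballI)
   fix j assume j: "j \<in> verts G'"
   hence "j \<in> cluster G' p (p j)" by (simp add: cluster_def)
   thus "\<beta>0 (p j) (\<sigma> (p j)) j \<in> {1..sdim G' j}"
    using mem[OF pV[OF j]] unfolding configs_def by (rule PiE_mem[rotated])
  qed
  have r: "restrict (finer \<sigma>) (cluster G' p i) = \<beta>0 i (\<sigma> i)" if i: "i \<in> verts G" for i
  proof
   fix j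
   show "restrict (finer \<sigma>) (cluster G' p i) j = \<beta>0 i (\<sigma> i) j"
   proof (cases "j \<in> cluster G' p i")
    case True
    hence "j \<in> verts G'" "p j = i" by (simp_all add: cluster_def)
    thus ?thesis using True by (simp add: finer_def)
   next
    case False
    thus ?thesis using PiE_arb[OF mem[OF i, unfolded configs_def] False] by simp
   qed
  qed
  show "coarse (finer \<sigma>) = \<sigma>"
  proof (rule PiE_ext[OF coarse(1)[OF f, unfolded configs_def] \<sigma>[unfolded configs_def]])
   fix i assume i: "i \<in> verts G"
   have "\<sigma> i \<in> {1..sdim G i}" using PiE_mem[OF \<sigma>[unfolded configs_def] i] .
   thus "coarse (finer \<sigma>) i = \<sigma> i"
    using inv_into_f_f[OF bij_betw_imp_inj_on[OF bij0[OF i]]] i by (simp add: coarse_def r)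
  qed
 qed
 obtain \<rho> where \<rho>: "limit_vec \<rho> \<noteq> 0" using weighted_nonzero by blast
 have "\<rho> \<in> configs (verts G) (sdim G)" using \<rho> by (auto simp: weighted_def vec_of_def split: if_splits)
 hence nz: "\<Phi>0 (finer \<rho>) \<noteq> 0" using finer \<rho> by (simp add: \<Phi>0_def)
 have notin: "\<not> peps_cone G' \<Phi>0"
 proof
  assume "peps_cone G' \<Phi>0"
  then obtain A where A: "\<Phi>0 = peps_vec G' A" unfolding peps_cone_def by blast
  define cl' where "cl' j = cl (p j)" for j
  have cl': "cl' j < 3" for j by (simp only: cl'_def cl_less)
  let ?ce = "class_edges G' cl'" and ?cv = "class_verts G' cl'"
  obtain T0 T1 T2 where T: "\<forall>\<sigma>\<in>configs (verts G') (sdim G'). peps_vec G' A \<sigma> =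
   (\<Sum>x\<in>bond_configs G' (?ce 2 0). \<Sum>y\<in>bond_configs G' (?ce 0 1). \<Sum>z\<in>bond_configs G' (?ce 1 2).
    T0 (restrict \<sigma> (?cv 0)) x y * T1 (restrict \<sigma> (?cv 1)) y z * (T2 (restrict \<sigma> (?cv 2)) z x :: complex))"
   using peps_triangle[OF g', where cl = cl' and A = A, OF cl'] by blast
  have f: "finite (?ce i j)" for i j using finE(2) by (rule finite_subset[rotated]) (auto simp: class_edges_def)
  \<comment> \<open>The bonds of \<open>G'\<close> over one edge of \<open>G\<close> have dimensions
    with product \<open>m\<close>, so the bond sets between classes are as large as those of
    \<open>G\<close>.\<close>
  have card: "card (bond_configs G' (?ce i j)) = m ^ card (ce i j)" if ij: "i \<noteq> j" for i j
  proof -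
   have ce': "?ce i j = (\<Union>e\<in>ce i j. edges_over G' p e)"
   proof (intro Set.set_eqI iffI)
    fix e' assume e': "e' \<in> ?ce i j"
    hence e: "e' \<in> edges G'" "cl' ` e' = {i, j}" by (simp_all add: class_edges_def)
    have cli: "cl ` (p ` e') = {i, j}" using e(2) by (simp add: image_image cl'_def)
    obtain u v where uv: "e' = {u, v}" using edge_two[OF g' e(1)] by blast
    have "p u \<noteq> p v" using cli ij unfolding uv by auto
    hence "card (p ` e') = 2" unfolding uv by simp
    hence "p ` e' \<in> edges G" using bs e(1) unfolding blocking_scheme_def by blast
    hence "p ` e' \<in> ce i j" using cli by (simp add: class_edges_def)
    thus "e' \<in> (\<Union>e\<in>ce i j. edges_over G' p e)" using e(1) by (auto simp: edges_over_def)
   next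
    fix e' assume "e' \<in> (\<Union>e\<in>ce i j. edges_over G' p e)"
    then obtain e where e: "cl ` e = {i, j}" "e' \<in> edges G'" "p ` e' = e" by (auto simp: class_edges_def edges_over_def)
    hence "cl' ` e' = {i, j}" by (auto simp: cl'_def image_image)
    thus "e' \<in> ?ce i j" using e(2) by (simp add: class_edges_def)
   qed
   have fce: "finite (ce i j)" using finE(1) ce_sub by (rule finite_subset[rotated])
   have "(\<Prod>e'\<in>?ce i j. bdim G' e') = (\<Prod>e\<in>ce i j. \<Prod>e'\<in>edges_over G' p e. bdim G' e')"
    unfolding ce'
   proof (rule prod.UNION_disjoint[OF fce])
    show "\<forall>e\<in>ce i j. finite (edges_over G' p e)" using finE(2) by (simp add: edges_over_def)
    show "\<forall>e\<in>ce i j. \<forall>e2\<in>ce i j. e \<noteq> e2 \<longrightarrow> edges_over G' p e \<inter> edges_over G' p e2 = {}"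
     by (auto simp: edges_over_def)
   qed
   also have "\<dots> = (\<Prod>e\<in>ce i j. m)"
   proof (rule prod.cong[OF refl])
    fix e assume "e \<in> ce i j"
    hence "e \<in> edges G" using ce_sub by blast
    thus "(\<Prod>e'\<in>edges_over G' p e. bdim G' e') = m" using bs b unfolding blocking_scheme_def by simp
   qed
   finally show ?thesis by (simp add: card_bond_configs[OF f])
  qed
  define ref where "ref k s = (\<lambda>j\<in>?cv k. \<beta>0 (p j) (s (p j)) j)" for k s
  have ref: "restrict (finer \<sigma>) (?cv k) = ref k (restrict \<sigma> (cv k))" for \<sigma> k
  proof -
   have "finer \<sigma> j = \<beta>0 (p j) (restrict \<sigma> (cv k) (p j)) j" if j: "j \<in> ?cv k" for j
   proof -
    have "j \<in> verts G'" "cl (p j) = k" using j by (simp_all add: class_verts_def cl'_def)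
    moreover from this have "p j \<in> cv k" using pV by (simp add: class_verts_def)
    ultimately show ?thesis by (simp add: finer_def)
   qed
   thus ?thesis unfolding ref_def by (rule restrict_ext)
  qed
  show False
  proof (rule weighted_no_triangle)
   show "limit_vec \<sigma> = (\<Sum>x\<in>bond_configs G' (?ce 2 0). \<Sum>y\<in>bond_configs G' (?ce 0 1). \<Sum>z\<in>bond_configs G' (?ce 1 2).
    (\<lambda>s. T0 (ref 0 s)) (restrict \<sigma> (cv 0)) x y * (\<lambda>s. T1 (ref 1 s)) (restrict \<sigma> (cv 1)) y z * (\<lambda>s. T2 (ref 2 s)) (restrict \<sigma> (cv 2)) z x)"
    if \<sigma>: "\<sigma> \<in> configs (verts G) (sdim G)" for \<sigma>
   proof -
    have "limit_vec \<sigma> = \<Phi>0 (finer \<sigma>)" using finer[OF \<sigma>] by (simp add: \<Phi>0_def)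
    also have "\<dots> = (\<Sum>x\<in>bond_configs G' (?ce 2 0). \<Sum>y\<in>bond_configs G' (?ce 0 1). \<Sum>z\<in>bond_configs G' (?ce 1 2).
     T0 (ref 0 (restrict \<sigma> (cv 0))) x y * T1 (ref 1 (restrict \<sigma> (cv 1))) y z * T2 (ref 2 (restrict \<sigma> (cv 2))) z x)"
     unfolding A ref[symmetric] by (rule bspec[OF T finer(1)[OF \<sigma>]])
    finally show ?thesis .
   qed
   show "finite (bond_configs G' (?ce 2 0))" "finite (bond_configs G' (?ce 0 1))" "finite (bond_configs G' (?ce 1 2))"
    by (rule finite_bond_configs[OF f])+
   show "card (bond_configs G' (?ce 2 0)) = m ^ card (ce 2 0)" "card (bond_configs G' (?ce 0 1)) = m ^ card (ce 0 1)"
    "card (bond_configs G' (?ce 1 2)) = m ^ card (ce 1 2)" by (rule card, simp)+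
  qed
 qed
 show ?thesis
  by (rule lacks_optimizers_cone[where C = "peps_cone G'", OF finV(2) PEPS_cone peps_cone_hilb peps_cone_scale[OF finV(2) ne'] cone lim nz notin])
qed

text \<open>\<open>84 * m ^ 3\<close> is the admissible upper bound
  \<open>12 * m ^ 3 * (7 + log 2 m)\<close> without its logarithm, and it does not depend on
  \<open>d\<close>. A prime above it exceeds \<open>m\<close>, hence is coprime to it, and also
  exceeds \<open>3 * m^2\<close>.\<close>

lemma prime_tiMPS_threshold:
 assumes m: "m \<ge> 2"
 shows "\<exists>Nc::nat. \<forall>d::nat. d \<ge> 2 \<longrightarrow>
    2 * log (real d) (real m) < real Nc \<and>
    real Nc \<le> 12 * real m ^ 3 * (7 + log 2 (real m)) \<and>
    (\<forall>N::nat. prime N \<and> N > Nc \<longrightarrow> lacks_optimizers {1..N} (\<lambda>_. d) (tiMPS N m d))"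
proof (intro exI[of _ "84 * m ^ 3"] allI impI conjI)
 fix d :: nat assume d: "d \<ge> 2"
 have "log (real d) (real m) \<le> log 2 (real m)"
 proof -
  have "ln 2 \<le> ln (real d)" using d by simp
  moreover have "ln (real m) \<ge> 0" "ln (2::real) > 0" using m by simp_all
  ultimately show ?thesis unfolding log_def by (intro divide_left_mono) (use d in auto)
 qed
 also have "\<dots> < real m"
 proof -
  have "real m < 2 ^ m" using less_exp[of m] by (metis of_nat_less_iff of_nat_numeral of_nat_power)
  thus ?thesis using m by (simp add: log_less_iff powr_realpow)
 qed
 finally have "2 * log (real d) (real m) < 2 * real m" by simp
 also have "\<dots> \<le> 84 * real m ^ 3"
 proof -
  have "real m * 1 \<le> real m * real m ^ 2" using m by (intro mult_left_mono one_le_power) auto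
  thus ?thesis using m by (simp add: power3_eq_cube power2_eq_square)
 qed
 finally show "2 * log (real d) (real m) < real (84 * m ^ 3)" by simp
 have "log 2 (real m) \<ge> 0" using m by simp
 hence "12 * real m ^ 3 * 7 \<le> 12 * real m ^ 3 * (7 + log 2 (real m))" by (intro mult_left_mono) auto
 thus "real (84 * m ^ 3) \<le> 12 * real m ^ 3 * (7 + log 2 (real m))" by simp
 fix N :: nat assume N: "prime N \<and> N > 84 * m ^ 3"
 have m23: "m\<^sup>2 \<le> m ^ 3" "m \<le> m ^ 3" using m by (auto intro: power_increasing self_le_power)
 have "\<not> N dvd m"
 proof
  assume "N dvd m"
  hence "N \<le> m" using m by (intro dvd_imp_le) auto
  thus False using N m23(2) by simp
 qed
 hence "coprime N m" using N by (intro prime_imp_coprime) auto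
 moreover have "3 * m\<^sup>2 \<le> N" using N m23(1) by simp
 ultimately show "lacks_optimizers {1..N} (\<lambda>_. d) (tiMPS N m d)" using tiMPS_lacks_optimizers[OF m] d by blast
qed


theorem mainTheorem10:
  shows
    "(\<forall>(N::nat) (m::nat \<Rightarrow> nat) (d::nat).
        N \<ge> 1 \<and> d \<ge> 1 \<and> (\<forall>i\<le>N. m i \<ge> 1) \<and> m 0 = 1 \<and> m N = 1 \<longrightarrow>
        always_optimizers {1..N} (\<lambda>_. d) (oMPS N m d)) \<and>
     (\<forall>(G::nat network) (N::nat).
        tree_network G \<and> verts G = {1..N} \<longrightarrow>
        always_optimizers (verts G) (sdim G) (TTNS G)) \<and>
     (\<forall>(G::nat mera_network) (N::nat).
        mera_network G \<and> mverts G = {1..N} \<longrightarrow>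
        always_optimizers (mverts G) (msdim G) (MERA G)) \<and>
     (\<forall>m::nat. m \<ge> 2 \<longrightarrow> (\<exists>Nc::nat. \<forall>d::nat. d \<ge> 2 \<longrightarrow>
        2 * log (real d) (real m) < real Nc \<and>
        real Nc \<le> 12 * real m ^ 3 * (7 + log 2 (real m)) \<and>
        (\<forall>N::nat. prime N \<and> N > Nc \<longrightarrow>
           lacks_optimizers {1..N} (\<lambda>_. d) (tiMPS N m d)))) \<and>
     (\<forall>(N::nat) (m::nat) (d::nat).
        m > 1 \<and> N \<ge> 3 \<and> d \<ge> m\<^sup>2 \<longrightarrow>
        lacks_optimizers {1..N} (\<lambda>_. d) (pMPSn N m (\<lambda>_. d))) \<and>
     (\<forall>(l::nat) (d::nat) (dt::nat) (m::nat) (N::nat).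
        l \<ge> 1 \<and> d > 1 \<and> dt \<ge> d \<and> real m = real d powr (real l / 2) \<and> N \<ge> 3 * l \<and> l dvd N \<longrightarrow>
        lacks_optimizers {1..N} (\<lambda>_. dt) (pMPSn N m (\<lambda>_. dt))) \<and>
     (\<forall>(K::nat) (l::nat \<Rightarrow> nat) (N::nat) (s::nat) (m::nat)
        (d::nat \<Rightarrow> nat \<Rightarrow> nat) (dt::nat \<Rightarrow> nat \<Rightarrow> nat) (\<delta>::nat \<Rightarrow> nat).
        m > 1 \<and> K \<ge> 3 \<and> (\<forall>c<K. l c \<ge> 1) \<and> N = (\<Sum>c<K. l c) \<and>
        (\<forall>c<K. \<forall>i<l c. d c i \<ge> 1 \<and> dt c i \<ge> d c i \<and> \<delta> (ring_site N s l c i) = dt c i) \<and>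
        (\<forall>c<K. m\<^sup>2 = (\<Prod>i<l c. d c i)) \<longrightarrow>
        lacks_optimizers {1..N} \<delta> (pMPSn N m \<delta>)) \<and>
     (\<forall>(G::nat network) (N::nat) (m::nat).
        loop_network G m \<and> verts G = {1..N} \<longrightarrow>
        lacks_optimizers (verts G) (sdim G) (PEPS G)) \<and>
     (\<forall>(D::nat) (L::nat \<Rightarrow> nat) (per::nat \<Rightarrow> bool) (m::nat \<Rightarrow> nat)
        (d::nat) (lx::nat) (Nc::nat) (G::nat list network).
        D \<ge> 1 \<and> cubic_lattice D L per m G \<and>
        d \<ge> 2 \<and> (\<forall>i\<in>verts G. sdim G i \<ge> d) \<and>
        per 0 \<and> lx \<ge> 1 \<and> Nc \<ge> 3 \<and> m 0 = d ^ lx \<and> L 0 = 2 * Nc * lx \<and>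
        (\<forall>k. 1 \<le> k \<and> k < D \<longrightarrow> L k \<ge> 1 \<and> m k \<ge> 2) \<longrightarrow>
        lacks_optimizers (verts G) (sdim G) (PEPS G)) \<and>
     (\<forall>(G::nat network) (N::nat) (m::nat) (G'::nat network) (N'::nat) (p::nat \<Rightarrow> nat)
        (W::nat \<Rightarrow> nat \<Rightarrow> (nat set \<Rightarrow> nat) \<Rightarrow> complex) (vs::nat list).
        loop_network G m \<and> verts G = {1..N} \<and> network G' \<and> verts G' = {1..N'} \<and>
        blocking_scheme G G' p \<and> is_loop G vs \<and> site_embedding G m W \<and>
        (\<forall>\<epsilon>>0. \<exists>\<Psi>'\<in>PEPS G'. fine_grained_state G G' p (psi_T G m W vs \<epsilon>) \<Psi>') \<longrightarrow>
        lacks_optimizers (verts G') (sdim G') (PEPS G'))"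
proof (intro conjI allI impI)
 show "always_optimizers {1..N} (\<lambda>_. d) (oMPS N m d)"
  if "N \<ge> 1 \<and> d \<ge> 1 \<and> (\<forall>i\<le>N. m i \<ge> 1) \<and> m 0 = 1 \<and> m N = 1" for N d :: nat and m
  using that oMPS_always_optimizers[of N d m] by blast
 show "always_optimizers (verts G) (sdim G) (TTNS G)"
  if "tree_network G \<and> verts G = {1..N}" for G :: "nat network" and N
  using TTNS_always_optimizers[OF conjunct1[OF that]] .
 show "always_optimizers (mverts G) (msdim G) (MERA G)"
  if "mera_network G \<and> mverts G = {1..N}" for G :: "nat mera_network" and N
  using MERA_always_optimizers[OF conjunct1[OF that]] .
 show "\<exists>Nc::nat. \<forall>d::nat. d \<ge> 2 \<longrightarrow>
    2 * log (real d) (real m) < real Nc \<and>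
    real Nc \<le> 12 * real m ^ 3 * (7 + log 2 (real m)) \<and>
    (\<forall>N::nat. prime N \<and> N > Nc \<longrightarrow> lacks_optimizers {1..N} (\<lambda>_. d) (tiMPS N m d))"
  if "m \<ge> 2" for m :: nat
  by (rule prime_tiMPS_threshold[OF that])
 show "lacks_optimizers {1..N} (\<lambda>_. d) (pMPSn N m (\<lambda>_. d))"
  if "m > 1 \<and> N \<ge> 3 \<and> d \<ge> m\<^sup>2" for N m d :: nat
  using that pMPSn_lacks_optimizers by blast
 show "lacks_optimizers {1..N} (\<lambda>_. dt) (pMPSn N m (\<lambda>_. dt))"
  if "l \<ge> 1 \<and> d > 1 \<and> dt \<ge> d \<and> real m = real d powr (real l / 2) \<and> N \<ge> 3 * l \<and> l dvd N" for l d dt m N :: nat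
  using that pMPSn_equal_clusters_lacks_optimizers by blast
 show "lacks_optimizers {1..N} \<delta> (pMPSn N m \<delta>)"
  if "m > 1 \<and> K \<ge> 3 \<and> (\<forall>c<K. l c \<ge> 1) \<and> N = (\<Sum>c<K. l c) \<and>
    (\<forall>c<K. \<forall>i<l c. d c i \<ge> 1 \<and> dt c i \<ge> d c i \<and> \<delta> (ring_site N s l c i) = dt c i) \<and>
    (\<forall>c<K. m\<^sup>2 = (\<Prod>i<l c. d c i))"
  for K N s m :: nat and l and d dt :: "nat \<Rightarrow> nat \<Rightarrow> nat" and \<delta>
  using that by (elim conjE) (rule pMPSn_clusters_lacks_optimizers)
 show "lacks_optimizers (verts G) (sdim G) (PEPS G)"
  if "loop_network G m \<and> verts G = {1..N}" for G :: "nat network" and N m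
  using loop_network_lacks_optimizers[OF conjunct1[OF that]] .
 show "lacks_optimizers (verts G) (sdim G) (PEPS G)"
  if "D \<ge> 1 \<and> cubic_lattice D L per m G \<and> d \<ge> 2 \<and> (\<forall>i\<in>verts G. sdim G i \<ge> d) \<and>
    per 0 \<and> lx \<ge> 1 \<and> Nc \<ge> 3 \<and> m 0 = d ^ lx \<and> L 0 = 2 * Nc * lx \<and>
    (\<forall>k. 1 \<le> k \<and> k < D \<longrightarrow> L k \<ge> 1 \<and> m k \<ge> 2)"
  for D and L :: "nat \<Rightarrow> nat" and per m and d lx Nc :: nat and G
  using that by (elim conjE) (rule cubic_lattice_lacks_optimizers)
 show "lacks_optimizers (verts G') (sdim G') (PEPS G')"
  if "loop_network G m \<and> verts G = {1..N} \<and> network G' \<and> verts G' = {1..N'} \<and>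
    blocking_scheme G G' p \<and> is_loop G vs \<and> site_embedding G m W \<and>
    (\<forall>\<epsilon>>0. \<exists>\<Psi>'\<in>PEPS G'. fine_grained_state G G' p (psi_T G m W vs \<epsilon>) \<Psi>')"
  for G G' :: "nat network" and N N' m and p :: "nat \<Rightarrow> nat" and vs W
  by (rule fine_grained_lacks_optimizers[of G m G' p vs W]) (use that in blast)+
qed

end
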